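(* Let $\mathcal{U}_{\mathcal{P}}$ be a finite-dimensional subspace of $\mathcal{U}\cap(L^\infty(Q)\times L^\infty(Q)^d\times L^\infty(Q))$ and let $\mathcal{K}_{\mathcal{P}}\subset\mathcal{U}_{\mathcal{P}}$ be a non-empty, closed and convex subset (not necessarily a subset of $\mathcal{K}$). For any $f\in L^2(Q)$, any $u_0\in L^2(\Omega)$, and any obstacle $g\in\widetilde{\mathcal{W}}\cap C^0(\overline{Q})$ satisfying $g|_{(0,T)\times\partial\Omega}\le 0$, $g(0)\le u_0$, and such that $\psi:=\partial_t g+\mathcal{L}g-f\in\mathcal{V}^*$ admits a decomposition $\psi=\psi^+-\psi^-$ with $0\le\psi^\pm\in\mathcal{V}^*$, the discrete problem $$\text{find }\boldsymbol{u}_{\mathcal{P}}\in\mathcal{K}_{\mathcal{P}}:\qquad a(\boldsymbol{u}_{\mathcal{P}},\boldsymbol{v}-\boldsymbol{u}_{\mathcal{P}})\ge F(\boldsymbol{v}-\boldsymbol{u}_{\mathcal{P}})\quad\text{for all }\boldsymbol{v}\in\mathcal{K}_{\mathcal{P}}$$ admits a unique solution.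
   Context: Setting: $d\in\{1,2,3\}$, $\Omega\subset\mathbb{R}^d$ is a bounded Lipschitz domain, $T>0$, $Q=(0,T)\times\Omega$. Let $\mathcal{V}=L^2((0,T);H_0^1(\Omega))$ with norm $\|v\|_{\mathcal{V}}=\|\nabla_{\boldsymbol{x}}v\|_{L^2(Q)}$, $\mathcal{V}^*=L^2((0,T);H^{-1}(\Omega))$ its dual, with duality pairing $\langle\cdot,\cdot\rangle_{\mathcal{V}^*\times\mathcal{V}}$ extending the $L^2(Q)$ inner product, $\mathcal{W}=\mathcal{V}\cap H^1((0,T);H^{-1}(\Omega))$ (continuously embedded in $C^0([0,T];L^2(\Omega))$), and $\widetilde{\mathcal{W}}=L^2((0,T);H^1(\Omega))\cap H^1((0,T);H^{-1}(\Omega))$. For $(v,\boldsymbol{\tau})\in L^2(Q)^{1+d}$ set $\operatorname{div}_{t,\boldsymbol{x}}(v,\boldsymbol{\tau})=\partial_t v+\operatorname{div}_{\boldsymbol{x}}\boldsymbol{\tau}$ (distributional). For $v\in L^2(Q)$, $v\ge 0$ means a.e. in $Q$; for $\mu\in\mathcal{V}^*$, $\mu\ge 0$ means $\langle\mu,v\rangle_{\mathcal{V}^*\times\mathcal{V}}\ge 0$ for all $v\in\mathcal{V}$ with $v\ge 0$. Operator: $\mathcal{L}u=-\operatorname{div}_{\boldsymbol{x}}(\boldsymbol{A}\nabla_{\boldsymbol{x}}u)+\boldsymbol{b}\cdot\nabla_{\boldsymbol{x}}u+cu$, where $\boldsymbol{A}=\boldsymbol{A}^\top\in L^\infty(Q)^{d\times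 d}$, $\boldsymbol{b}\in L^\infty(Q)^d$, $c\in L^\infty(Q)$, $-\tfrac12\operatorname{div}_{\boldsymbol{x}}\boldsymbol{b}+c\in L^\infty(Q)$ with $-\tfrac12\operatorname{div}_{\boldsymbol{x}}\boldsymbol{b}+c\ge 0$, and there is $\alpha>0$ with $\boldsymbol{y}\cdot\boldsymbol{A}\boldsymbol{y}\ge\alpha|\boldsymbol{y}|^2$ for all $\boldsymbol{y}\in\mathbb{R}^d$, a.e. in $Q$. Let $c_F>0$ be the smallest constant with $\|v\|_{L^2(Q)}\le c_F\|\nabla_{\boldsymbol{x}}v\|_{L^2(Q)}$ for all $v\in\mathcal{V}$, and fix some $\Lambda\ge c_F^2$. Spaces and sets: $$\mathcal{U}=\{(v,\boldsymbol{\tau},\mu)\in\mathcal{V}\times L^2(Q)^d\times\mathcal{V}^*:\operatorname{div}_{t,\boldsymbol{x}}(v,\boldsymbol{\tau})-\mu\in L^2(Q)\},\qquad \mathcal{K}=\{(v,\boldsymbol{\tau},\mu)\in\mathcal{U}: v\ge g,\ \mu\ge 0\}.$$ For $(v,\boldsymbol{\tau},\mu)\in\mathcal{U}$ one has $v\in\mathcal{W}$, so $v(0),v(T)\in L^2(\Omega)$ are defined. $\mathcal{U}$ is normed by $$|(u,\boldsymbol{\sigma},\lambda)|_{\mathcal{U}}^2=\|u\|_{\mathcal{V}}^2+\|u(0)\|_{L^2(\Omega)}^2+\|u(T)\|_{L^2(\Omega)}^2+\|\boldsymbol{\sigma}\|_{L^2(Q)}^2+\|\operatorname{div}_{t,\boldsymbol{x}}(u,\boldsymbol{\sigma})-\lambda\|_{L^2(Q)}^2.$$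 The subscript $\mathcal{P}$ refers to a partition of $Q$ underlying the discrete space. Forms: for $\boldsymbol{u}=(u,\boldsymbol{\sigma},\lambda)$, $\boldsymbol{v}=(v,\boldsymbol{\tau},\mu)\in\mathcal{U}$, $$\begin{aligned}a(\boldsymbol{u},\boldsymbol{v})&=\alpha^{-1}\Lambda\,(\operatorname{div}_{t,\boldsymbol{x}}(u,\boldsymbol{\sigma})+\boldsymbol{b}\cdot\nabla_{\boldsymbol{x}}u+cu-\lambda,\ \operatorname{div}_{t,\boldsymbol{x}}(v,\boldsymbol{\tau})+\boldsymbol{b}\cdot\nabla_{\boldsymbol{x}}v+cv-\mu)_{L^2(Q)}\\&\quad+(\boldsymbol{A}^{-1/2}\boldsymbol{\sigma}+\boldsymbol{A}^{1/2}\nabla_{\boldsymbol{x}}u,\ \boldsymbol{A}^{-1/2}\boldsymbol{\tau}+\boldsymbol{A}^{1/2}\nabla_{\boldsymbol{x}}v)_{L^2(Q)}+(u(0),v(0))_{L^2(\Omega)}\\&\quad+\tfrac12\langle\lambda,v\rangle_{\mathcal{V}^*\times\mathcal{V}}+\tfrac12\langle\mu,u\rangle_{\mathcal{V}^*\times\mathcal{V}},\end{aligned}$$ and for $\boldsymbol{v}=(v,\boldsymbol{\tau},\mu)\in\mathcal{U}_{\mathcal{P}}$ (so $\mu\in L^\infty(Q)$), $$F(\boldsymbol{v})=\alpha^{-1}\Lambda\,(f,\operatorname{div}_{t,\boldsymbol{x}}(v,\boldsymbol{\tau})+\boldsymbol{b}\cdot\nabla_{\boldsymbol{x}}v+cv-\mu)_{L^2(Q)}+(u_0,v(0))_{L^2(\Omega)}+\tfrac12\int_Q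 g\,\mu\,\mathrm{d}(t,\boldsymbol{x}).$$ *)

theory Defs
  imports "HOL-Analysis.Analysis" "HOL-Library.Function_Algebras"
begin

text \<open>
  Elements of \<open>V\<^sup>*\<close> are HOL functions; this instance makes triples \<open>(v, \<tau>, \<mu>)\<close> a real vector
  space, so that \<open>span\<close>, \<open>subspace\<close> and \<open>convex\<close> apply to sets of triples.
\<close>

instantiation "fun" :: (type, real_vector) real_vector
begin

definition scaleR_fun :: "real \<Rightarrow> ('a \<Rightarrow> 'b) \<Rightarrow> 'a \<Rightarrow> 'b"
  where "scaleR_fun r f = (\<lambda>x. r *\<^sub>R f x)"

instance
  by standard (simp_all add: scaleR_fun_def fun_eq_iff algebra_simps)

end

definition square_integrable :: "('a::euclidean_space \<Rightarrow> 'b::euclidean_space) \<Rightarrow> bool"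
  where "square_integrable f \<longleftrightarrow>
    f \<in> borel_measurable lborel \<and> integrable lborel (\<lambda>x. (norm (f x))\<^sup>2)"

definition L2_rel :: "('a::euclidean_space \<Rightarrow> 'b::euclidean_space) \<Rightarrow> ('a \<Rightarrow> 'b) \<Rightarrow> bool"
  where "L2_rel f g \<longleftrightarrow>
    square_integrable f \<and> square_integrable g \<and> (AE x in lborel. f x = g x)"

lemma square_integrable_zero: "square_integrable (\<lambda>_. 0)"
  by (simp add: square_integrable_def)

lemma square_integrable_scaleR:
  assumes "square_integrable f"
  shows "square_integrable (\<lambda>x. r *\<^sub>R f x)"
  using assms by (auto simp: square_integrable_def power_mult_distrib)

lemma square_integrable_add:
  fixes f g :: "'a::euclidean_space \<Rightarrow> 'b::euclidean_space"
  assumes f: "square_integrable f" and g: "square_integrable g"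
  shows "square_integrable (\<lambda>x. f x + g x)"
proof -
  have [measurable]: "f \<in> borel_measurable lborel" "g \<in> borel_measurable lborel"
    using f g by (auto simp: square_integrable_def)
  have bound: "(norm (f x + g x))\<^sup>2 \<le> 2 * (norm (f x))\<^sup>2 + 2 * (norm (g x))\<^sup>2" for x
  proof -
    have "(norm (f x + g x))\<^sup>2 \<le> (norm (f x) + norm (g x))\<^sup>2"
      by (intro power_mono norm_triangle_ineq) auto
    also have "\<dots> \<le> 2 * (norm (f x))\<^sup>2 + 2 * (norm (g x))\<^sup>2"
      using sum_squares_bound[of "norm (f x)" "norm (g x)"] by (simp add: power2_sum)
    finally show ?thesis .
  qed
  have "integrable lborel (\<lambda>x. (norm (f x + g x))\<^sup>2)"
  proof (rule Bochner_Integration.integrable_bound)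
    show "integrable lborel (\<lambda>x. 2 * (norm (f x))\<^sup>2 + 2 * (norm (g x))\<^sup>2)"
      using f g by (auto simp: square_integrable_def)
    show "AE x in lborel. norm ((norm (f x + g x))\<^sup>2)
        \<le> norm (2 * (norm (f x))\<^sup>2 + 2 * (norm (g x))\<^sup>2)"
      using bound by (auto intro!: AE_I2)
  qed measurable
  then show ?thesis
    by (simp add: square_integrable_def)
qed

lemma square_integrable_diff:
  assumes "square_integrable f" "square_integrable g"
  shows "square_integrable (\<lambda>x. f x - g x)"
  using square_integrable_add[OF assms(1) square_integrable_scaleR[OF assms(2), of "-1"]] by simp

lemma square_integrable_inner:
  fixes f g :: "'a::euclidean_space \<Rightarrow> 'b::euclidean_space"
  assumes f: "square_integrable f" and g: "square_integrable g"
  shows "integrable lborel (\<lambda>x. f x \<bullet> g x)"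
proof (rule Bochner_Integration.integrable_bound)
  have [measurable]: "f \<in> borel_measurable lborel" "g \<in> borel_measurable lborel"
    using f g by (auto simp: square_integrable_def)
  show "integrable lborel (\<lambda>x. (norm (f x))\<^sup>2 + (norm (g x))\<^sup>2)"
    using f g by (auto simp: square_integrable_def)
  show "(\<lambda>x. f x \<bullet> g x) \<in> borel_measurable lborel"
    by measurable
  have "\<bar>f x \<bullet> g x\<bar> \<le> (norm (f x))\<^sup>2 + (norm (g x))\<^sup>2" for x
  proof -
    have "\<bar>f x \<bullet> g x\<bar> \<le> norm (f x) * norm (g x)"
      by (rule Cauchy_Schwarz_ineq2)
    also have "\<dots> \<le> 2 * norm (f x) * norm (g x)"
      by simp
    also have "\<dots> \<le> (norm (f x))\<^sup>2 + (norm (g x))\<^sup>2"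
      by (rule sum_squares_bound)
    finally show ?thesis .
  qed
  then show "AE x in lborel. norm (f x \<bullet> g x) \<le> norm ((norm (f x))\<^sup>2 + (norm (g x))\<^sup>2)"
    by (auto intro!: AE_I2)
qed

quotient_type (overloaded) ('a, 'b) L2 =
  "'a::euclidean_space \<Rightarrow> 'b::euclidean_space" / partial: L2_rel
proof (rule part_equivpI)
  show "\<exists>f. L2_rel f f"
    using square_integrable_zero by (auto simp: L2_rel_def)
  show "symp L2_rel"
    by (auto simp: symp_def L2_rel_def)
  show "transp L2_rel"
    by (auto simp: transp_def L2_rel_def)
qed

instantiation L2 :: (euclidean_space, euclidean_space) real_vector
begin

lift_definition zero_L2 :: "('a, 'b) L2" is "\<lambda>_. 0"
  by (simp add: L2_rel_def square_integrable_zero)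

lift_definition plus_L2 :: "('a, 'b) L2 \<Rightarrow> ('a, 'b) L2 \<Rightarrow> ('a, 'b) L2"
  is "\<lambda>f g x. f x + g x"
  by (auto simp: L2_rel_def intro: square_integrable_add)

lift_definition minus_L2 :: "('a, 'b) L2 \<Rightarrow> ('a, 'b) L2 \<Rightarrow> ('a, 'b) L2"
  is "\<lambda>f g x. f x - g x"
  by (auto simp: L2_rel_def intro: square_integrable_diff)

lift_definition scaleR_L2 :: "real \<Rightarrow> ('a, 'b) L2 \<Rightarrow> ('a, 'b) L2"
  is "\<lambda>r f x. r *\<^sub>R f x"
  by (auto simp: L2_rel_def intro: square_integrable_scaleR)

definition uminus_L2 :: "('a, 'b) L2 \<Rightarrow> ('a, 'b) L2"
  where "uminus_L2 f = (-1) *\<^sub>R f"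

instance
proof
  fix f g h :: "('a, 'b) L2" and r s :: real
  show "f + g + h = f + (g + h)"
    by transfer (auto simp: L2_rel_def add.assoc intro!: square_integrable_add)
  show "f + g = g + f"
    by transfer (auto simp: L2_rel_def add.commute intro!: square_integrable_add)
  show "0 + f = f"
    by transfer (auto simp: L2_rel_def)
  show "- f + f = 0"
    unfolding uminus_L2_def by transfer (auto simp: L2_rel_def square_integrable_zero)
  show "f - g = f + - g"
    unfolding uminus_L2_def by transfer (auto simp: L2_rel_def intro!: square_integrable_diff)
  show "r *\<^sub>R (f + g) = r *\<^sub>R f + r *\<^sub>R g"
    by transfer (auto simp: L2_rel_def scaleR_add_right
        intro!: square_integrable_add square_integrable_scaleR)
  show "(r + s) *\<^sub>R f = r *\<^sub>R f + s *\<^sub>R f"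
    by transfer (auto simp: L2_rel_def scaleR_add_left
        intro!: square_integrable_add square_integrable_scaleR)
  show "r *\<^sub>R s *\<^sub>R f = (r * s) *\<^sub>R f"
    by transfer (auto simp: L2_rel_def intro!: square_integrable_scaleR)
  show "1 *\<^sub>R f = f"
    by transfer (auto simp: L2_rel_def)
qed

end

instantiation L2 :: (euclidean_space, euclidean_space) real_inner
begin

lift_definition inner_L2 :: "('a, 'b) L2 \<Rightarrow> ('a, 'b) L2 \<Rightarrow> real"
  is "\<lambda>f g. LINT x|lborel. f x \<bullet> g x"
proof -
  fix f f' g g' :: "'a \<Rightarrow> 'b"
  assume ff': "L2_rel f f'" and gg': "L2_rel g g'"
  have [measurable]: "f \<in> borel_measurable lborel" "f' \<in> borel_measurable lborel"
      "g \<in> borel_measurable lborel" "g' \<in> borel_measurable lborel"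
    using ff' gg' by (auto simp: L2_rel_def square_integrable_def)
  have "AE x in lborel. f x = f' x" "AE x in lborel. g x = g' x"
    using ff' gg' by (auto simp: L2_rel_def)
  then have "AE x in lborel. f x \<bullet> g x = f' x \<bullet> g' x"
    by eventually_elim simp
  then show "(LINT x|lborel. f x \<bullet> g x) = (LINT x|lborel. f' x \<bullet> g' x)"
    by (intro integral_cong_AE) measurable
qed

definition norm_L2 :: "('a, 'b) L2 \<Rightarrow> real"
  where "norm_L2 f = sqrt (f \<bullet> f)"

definition dist_L2 :: "('a, 'b) L2 \<Rightarrow> ('a, 'b) L2 \<Rightarrow> real"
  where "dist_L2 f g = norm (f - g)"

definition sgn_L2 :: "('a, 'b) L2 \<Rightarrow> ('a, 'b) L2"
  where "sgn_L2 f = f /\<^sub>R norm f"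

definition uniformity_L2 :: "(('a, 'b) L2 \<times> ('a, 'b) L2) filter"
  where "uniformity_L2 = (INF e\<in>{0 <..}. principal {(f, g). dist f g < e})"

definition open_L2 :: "('a, 'b) L2 set \<Rightarrow> bool"
  where "open_L2 S = (\<forall>f\<in>S. \<forall>\<^sub>F (f', g) in uniformity. f' = f \<longrightarrow> g \<in> S)"

instance
proof
  fix f g h :: "('a, 'b) L2" and r :: real and S :: "('a, 'b) L2 set"
  show "dist f g = norm (f - g)"
    by (rule dist_L2_def)
  show "sgn f = f /\<^sub>R norm f"
    by (rule sgn_L2_def)
  show "(uniformity :: (('a, 'b) L2 \<times> ('a, 'b) L2) filter) =
      (INF e\<in>{0 <..}. principal {(f, g). dist f g < e})"
    by (rule uniformity_L2_def)
  show "open S = (\<forall>f\<in>S. \<forall>\<^sub>F (f', g) in uniformity. f' = f \<longrightarrow> g \<in> S)"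
    by (rule open_L2_def)
  show "norm f = sqrt (f \<bullet> f)"
    by (rule norm_L2_def)
  show "f \<bullet> g = g \<bullet> f"
    by transfer (simp add: inner_commute)
  show "(f + g) \<bullet> h = f \<bullet> h + g \<bullet> h"
    by transfer (simp add: L2_rel_def inner_add_left square_integrable_inner)
  show "(r *\<^sub>R f) \<bullet> g = r * (f \<bullet> g)"
    by transfer simp
  show "0 \<le> f \<bullet> f"
    by transfer simp
  show "f \<bullet> f = 0 \<longleftrightarrow> f = 0"
  proof transfer
    fix f :: "'a \<Rightarrow> 'b"
    assume "L2_rel f f"
    then have f: "square_integrable f"
      by (simp add: L2_rel_def)
    have "(LINT x|lborel. f x \<bullet> f x) = 0 \<longleftrightarrow> (AE x in lborel. f x \<bullet> f x = 0)"
      by (rule integral_nonneg_eq_0_iff_AE[OF square_integrable_inner[OF f f]]) simp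
    also have "\<dots> \<longleftrightarrow> L2_rel f (\<lambda>_. 0)"
      using f by (simp add: L2_rel_def square_integrable_zero)
    finally show "(LINT x|lborel. f x \<bullet> f x) = 0 \<longleftrightarrow> L2_rel f (\<lambda>_. 0)" .
  qed
qed

end

text \<open>
  \<open>L\<^sup>2(S)\<close> is realised inside \<open>L\<^sup>2\<close> of the whole space by extension by zero.
  \<open>rep_L2 u\<close> is an arbitrary representative of the class \<open>u\<close>, and \<open>L2_of S f\<close> is the class of
  the function \<open>f\<close> restricted to \<open>S\<close> (the value \<open>0\<close> for functions that are not square-integrable
  on \<open>S\<close> is a dummy).
\<close>

definition L2_on :: "'a::euclidean_space set \<Rightarrow> ('a, 'b::euclidean_space) L2 set"
  where "L2_on S = {u. AE x in lborel. x \<notin> S \<longrightarrow> rep_L2 u x = 0}"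

definition L2_of :: "'a::euclidean_space set \<Rightarrow> ('a \<Rightarrow> 'b::euclidean_space) \<Rightarrow> ('a, 'b) L2"
  where "L2_of S f =
    (if square_integrable (\<lambda>x. indicator S x *\<^sub>R f x)
     then abs_L2 (\<lambda>x. indicator S x *\<^sub>R f x) else 0)"

definition Linf_on :: "'a::euclidean_space set \<Rightarrow> ('a \<Rightarrow> 'b::euclidean_space) \<Rightarrow> bool"
  where "Linf_on S f \<longleftrightarrow> set_borel_measurable lborel S f \<and>
    (\<exists>C. AE x in lborel. x \<in> S \<longrightarrow> norm (f x) \<le> C)"

text \<open>
  Near each of its points, the boundary is the graph of a Lipschitz function over the hyperplane
  orthogonal to some unit vector \<open>\<nu>\<close>, with the domain lying strictly above the graph.
\<close>

definition bounded_lipschitz_domain :: "('a::euclidean_space) set \<Rightarrow> bool"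
  where "bounded_lipschitz_domain \<Omega> \<longleftrightarrow>
    \<Omega> \<noteq> {} \<and> open \<Omega> \<and> connected \<Omega> \<and> bounded \<Omega> \<and>
    (\<forall>p\<in>frontier \<Omega>. \<exists>\<nu> \<gamma> L N. norm \<nu> = 1 \<and> L-lipschitz_on {y. \<nu> \<bullet> y = 0} \<gamma> \<and>
       open N \<and> p \<in> N \<and>
       (\<forall>x\<in>N. x \<in> \<Omega> \<longleftrightarrow> \<gamma> (x - (\<nu> \<bullet> x) *\<^sub>R \<nu>) < \<nu> \<bullet> x))"

primrec Ck :: "nat \<Rightarrow> ('a::euclidean_space \<Rightarrow> real) \<Rightarrow> bool" where
  "Ck 0 f \<longleftrightarrow> continuous_on UNIV f"
| "Ck (Suc k) f \<longleftrightarrow>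
    (\<exists>f'. (\<forall>x. (f has_derivative f' x) (at x)) \<and> (\<forall>h. Ck k (\<lambda>x. f' x h)))"

definition test_functions :: "'a::euclidean_space set \<Rightarrow> ('a \<Rightarrow> real) set"
  where "test_functions S = {\<phi>. (\<forall>k. Ck k \<phi>) \<and>
    compact (closure {x. \<phi> x \<noteq> 0}) \<and> closure {x. \<phi> x \<noteq> 0} \<subseteq> S}"

type_synonym 'n st = "real \<times> (real^'n)"

definition grad :: "(real^'n \<Rightarrow> real) \<Rightarrow> real^'n \<Rightarrow> real^'n"
  where "grad \<phi> x = (\<chi> i. frechet_derivative \<phi> (at x) (axis i 1))"

definition dt :: "('n::finite st \<Rightarrow> real) \<Rightarrow> 'n st \<Rightarrow> real"
  where "dt \<phi> z = frechet_derivative \<phi> (at z) (1, 0)"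

definition dx :: "('n st \<Rightarrow> real) \<Rightarrow> 'n st \<Rightarrow> real^'n"
  where "dx \<phi> z = (\<chi> i. frechet_derivative \<phi> (at z) (0, axis i 1))"

text \<open>
  \<open>H\<^sup>1(\<Omega>)\<close> and \<open>H\<^sub>0\<^sup>1(\<Omega>)\<close> are given by the graphs of their weak gradients; the closure in the
  second definition is the one in \<open>L\<^sup>2 \<times> L\<^sup>2\<close>, i.e. with respect to the \<open>H\<^sup>1\<close> norm.
\<close>

definition H1_graph :: "(real^'n) set \<Rightarrow> ((real^'n, real) L2 \<times> (real^'n, real^'n) L2) set"
  where "H1_graph \<Omega> = {(w, G). w \<in> L2_on \<Omega> \<and> G \<in> L2_on \<Omega> \<and>
    (\<forall>\<phi>\<in>test_functions \<Omega>.
       (LINT x|lborel. rep_L2 w x *\<^sub>R grad \<phi> x) = - (LINT x|lborel. \<phi> x *\<^sub>R rep_L2 G x))}"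

definition H10_graph :: "(real^'n) set \<Rightarrow> ((real^'n, real) L2 \<times> (real^'n, real^'n) L2) set"
  where "H10_graph \<Omega> = closure {(L2_of \<Omega> \<phi>, L2_of \<Omega> (grad \<phi>)) | \<phi>. \<phi> \<in> test_functions \<Omega>}"

definition Qcyl :: "real \<Rightarrow> (real^'n) set \<Rightarrow> ('n st) set"
  where "Qcyl T \<Omega> = {0<..<T} \<times> \<Omega>"

text \<open>
  With \<open>X\<close> the graph of the gradient of \<open>H\<^sup>1(\<Omega>)\<close> or \<open>H\<^sub>0\<^sup>1(\<Omega>)\<close>, this says that \<open>v\<close> belongs to
  \<open>L\<^sup>2((0,T);H\<^sup>1(\<Omega>))\<close> or \<open>L\<^sup>2((0,T);H\<^sub>0\<^sup>1(\<Omega>))\<close> and that \<open>G\<close> is its spatial gradient: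
  functions of time with values in \<open>L\<^sup>2(\<Omega>)\<close> are identified with functions on the cylinder.
\<close>

definition L2_time ::
  "real \<Rightarrow> (real^'n) set \<Rightarrow> ((real^'n, real) L2 \<times> (real^'n, real^'n) L2) set \<Rightarrow>
   ('n st, real) L2 \<Rightarrow> ('n st, real^'n) L2 \<Rightarrow> bool"
  where "L2_time T \<Omega> X v G \<longleftrightarrow> v \<in> L2_on (Qcyl T \<Omega>) \<and> G \<in> L2_on (Qcyl T \<Omega>) \<and>
    (AE t in lborel. t \<in> {0<..<T} \<longrightarrow> (\<exists>(w, H)\<in>X.
       (AE x in lborel. rep_L2 v (t, x) = rep_L2 w x) \<and>
       (AE x in lborel. rep_L2 G (t, x) = rep_L2 H x)))"

definition V_space :: "real \<Rightarrow> (real^'n) set \<Rightarrow> ('n st, real) L2 set"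
  where "V_space T \<Omega> = {v. \<exists>G. L2_time T \<Omega> (H10_graph \<Omega>) v G}"

definition xgrad ::
  "real \<Rightarrow> (real^'n) set \<Rightarrow> ('n st, real) L2 \<Rightarrow> ('n st, real^'n) L2"
  where "xgrad T \<Omega> v = (THE G. L2_time T \<Omega> (H1_graph \<Omega>) v G)"

text \<open>Functionals are extended by zero off \<open>V\<close>, so that equality in \<open>V\<^sup>*\<close> is equality in HOL.\<close>

definition V_dual :: "real \<Rightarrow> (real^'n) set \<Rightarrow> (('n st, real) L2 \<Rightarrow> real) set"
  where "V_dual T \<Omega> = {\<mu>.
    (\<forall>v\<in>V_space T \<Omega>. \<forall>w\<in>V_space T \<Omega>. \<mu> (v + w) = \<mu> v + \<mu> w) \<and>
    (\<forall>r. \<forall>v\<in>V_space T \<Omega>. \<mu> (r *\<^sub>R v) = r * \<mu> v) \<and>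
    (\<exists>C. \<forall>v\<in>V_space T \<Omega>. \<bar>\<mu> v\<bar> \<le> C * norm (xgrad T \<Omega> v)) \<and>
    (\<forall>v. v \<notin> V_space T \<Omega> \<longrightarrow> \<mu> v = 0)}"

definition V_dual_nonneg ::
  "real \<Rightarrow> (real^'n) set \<Rightarrow> (('n st, real) L2 \<Rightarrow> real) \<Rightarrow> bool"
  where "V_dual_nonneg T \<Omega> \<mu> \<longleftrightarrow>
    (\<forall>v\<in>V_space T \<Omega>. (AE z in lborel. z \<in> Qcyl T \<Omega> \<longrightarrow> 0 \<le> rep_L2 v z) \<longrightarrow> 0 \<le> \<mu> v)"

definition L2_embed ::
  "real \<Rightarrow> (real^'n) set \<Rightarrow> ('n st, real) L2 \<Rightarrow> ('n st, real) L2 \<Rightarrow> real"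
  where "L2_embed T \<Omega> m = (\<lambda>v. if v \<in> V_space T \<Omega> then m \<bullet> v else 0)"

text \<open>The function \<open>m\<close> through which a functional \<open>\<mu>\<close> in the image of \<open>L\<^sup>2(Q)\<close> acts.\<close>

definition L2_density ::
  "real \<Rightarrow> (real^'n) set \<Rightarrow> (('n st, real) L2 \<Rightarrow> real) \<Rightarrow> ('n st, real) L2"
  where "L2_density T \<Omega> \<mu> = (THE m. m \<in> L2_on (Qcyl T \<Omega>) \<and> \<mu> = L2_embed T \<Omega> m)"

definition is_time_deriv ::
  "real \<Rightarrow> (real^'n) set \<Rightarrow> ('n st, real) L2 \<Rightarrow>
   (('n st, real) L2 \<Rightarrow> real) \<Rightarrow> bool"
  where "is_time_deriv T \<Omega> v \<mu> \<longleftrightarrow> \<mu> \<in> V_dual T \<Omega> \<and>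
    (\<forall>\<phi>\<in>test_functions (Qcyl T \<Omega>).
       \<mu> (L2_of (Qcyl T \<Omega>) \<phi>) = - (LINT z|lborel. rep_L2 v z * dt \<phi> z))"

definition time_deriv ::
  "real \<Rightarrow> (real^'n) set \<Rightarrow> ('n st, real) L2 \<Rightarrow> ('n st, real) L2 \<Rightarrow> real"
  where "time_deriv T \<Omega> v = (THE \<mu>. is_time_deriv T \<Omega> v \<mu>)"

definition W_tilde :: "real \<Rightarrow> (real^'n) set \<Rightarrow> ('n st, real) L2 set"
  where "W_tilde T \<Omega> =
    {v. (\<exists>G. L2_time T \<Omega> (H1_graph \<Omega>) v G) \<and> (\<exists>\<mu>. is_time_deriv T \<Omega> v \<mu>)}"

text \<open>The value at time \<open>t\<close> of the representative in \<open>C\<^sup>0([0,T];L\<^sup>2(\<Omega>))\<close>.\<close>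

definition time_trace ::
  "real \<Rightarrow> ('n st, real) L2 \<Rightarrow> real \<Rightarrow> (real^'n, real) L2"
  where "time_trace T v = (SOME w. continuous_on {0..T} w \<and>
    (AE t in lborel. t \<in> {0<..<T} \<longrightarrow>
       (AE x in lborel. rep_L2 v (t, x) = rep_L2 (w t) x)))"

definition friedrichs_const :: "real \<Rightarrow> (real^'n) set \<Rightarrow> real"
  where "friedrichs_const T \<Omega> =
    (LEAST C. 0 \<le> C \<and> (\<forall>v\<in>V_space T \<Omega>. norm v \<le> C * norm (xgrad T \<Omega> v)))"

type_synonym 'n triple =
  "('n st, real) L2 \<times> ('n st, real^'n) L2 \<times>
   (('n st, real) L2 \<Rightarrow> real)"

definition div_tx ::
  "('n::finite st, real) L2 \<Rightarrow> ('n st, real^'n) L2 \<Rightarrow>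
   ('n st \<Rightarrow> real) \<Rightarrow> real"
  where "div_tx v \<tau> \<phi> =
    - (LINT z|lborel. rep_L2 v z * dt \<phi> z + rep_L2 \<tau> z \<bullet> dx \<phi> z)"

text \<open>\<open>div\<^sub>t\<^sub>,\<^sub>x(v, \<tau>) - \<mu> = w\<close> as distributions, with \<open>w\<close> in \<open>L\<^sup>2(Q)\<close>.\<close>

definition is_div_minus ::
  "real \<Rightarrow> (real^'n) set \<Rightarrow> 'n triple \<Rightarrow> ('n st, real) L2 \<Rightarrow> bool"
  where "is_div_minus T \<Omega> = (\<lambda>(v, \<tau>, \<mu>) w. w \<in> L2_on (Qcyl T \<Omega>) \<and>
    (\<forall>\<phi>\<in>test_functions (Qcyl T \<Omega>).
       div_tx v \<tau> \<phi> - \<mu> (L2_of (Qcyl T \<Omega>) \<phi>) = (LINT z|lborel. rep_L2 w z * \<phi> z)))"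

definition U_space :: "real \<Rightarrow> (real^'n) set \<Rightarrow> 'n triple set"
  where "U_space T \<Omega> = {(v, \<tau>, \<mu>). v \<in> V_space T \<Omega> \<and> \<tau> \<in> L2_on (Qcyl T \<Omega>) \<and>
    \<mu> \<in> V_dual T \<Omega> \<and> (\<exists>w. is_div_minus T \<Omega> (v, \<tau>, \<mu>) w)}"

definition div_minus :: "real \<Rightarrow> (real^'n) set \<Rightarrow> 'n triple \<Rightarrow> ('n st, real) L2"
  where "div_minus T \<Omega> u = (THE w. is_div_minus T \<Omega> u w)"

definition U_norm :: "real \<Rightarrow> (real^'n) set \<Rightarrow> 'n triple \<Rightarrow> real"
  where "U_norm T \<Omega> = (\<lambda>(u, \<sigma>, l).
    sqrt ((norm (xgrad T \<Omega> u))\<^sup>2 + (norm (time_trace T u 0))\<^sup>2 + (norm (time_trace T u T))\<^sup>2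
      + (norm \<sigma>)\<^sup>2 + (norm (div_minus T \<Omega> (u, \<sigma>, l)))\<^sup>2))"

text \<open>Closedness in \<open>U\<close> with respect to the norm \<open>U_norm\<close>.\<close>

definition U_closed :: "real \<Rightarrow> (real^'n) set \<Rightarrow> 'n triple set \<Rightarrow> bool"
  where "U_closed T \<Omega> K \<longleftrightarrow> (\<forall>s u. (\<forall>k::nat. s k \<in> K) \<and> u \<in> U_space T \<Omega> \<and>
    (\<lambda>k. U_norm T \<Omega> (s k - u)) \<longlonglongrightarrow> 0 \<longrightarrow> u \<in> K)"

definition Linf_triples :: "real \<Rightarrow> (real^'n) set \<Rightarrow> 'n triple set"
  where "Linf_triples T \<Omega> = {(v, \<tau>, \<mu>).
    Linf_on (Qcyl T \<Omega>) (rep_L2 v) \<and> Linf_on (Qcyl T \<Omega>) (rep_L2 \<tau>) \<and>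
    (\<exists>m\<in>L2_on (Qcyl T \<Omega>). Linf_on (Qcyl T \<Omega>) (rep_L2 m) \<and> \<mu> = L2_embed T \<Omega> m)}"

text \<open>\<open>q\<close> equals \<open>- \<onehalf> div\<^sub>x b + c\<close> in the sense of distributions on the cylinder.\<close>

definition is_half_div_plus ::
  "real \<Rightarrow> (real^'n) set \<Rightarrow> ('n st \<Rightarrow> real^'n) \<Rightarrow> ('n st \<Rightarrow> real) \<Rightarrow>
   ('n st \<Rightarrow> real) \<Rightarrow> bool"
  where "is_half_div_plus T \<Omega> b c q \<longleftrightarrow> (\<forall>\<phi>\<in>test_functions (Qcyl T \<Omega>).
    (LINT z:Qcyl T \<Omega>|lborel. q z * \<phi> z)
      = 1/2 * (LINT z:Qcyl T \<Omega>|lborel. b z \<bullet> dx \<phi> z)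
        + (LINT z:Qcyl T \<Omega>|lborel. c z * \<phi> z))"

definition mat_sqrt :: "real^'n^'n \<Rightarrow> real^'n^'n"
  where "mat_sqrt M =
    (THE B. transpose B = B \<and> (\<forall>y. 0 \<le> y \<bullet> (B *v y)) \<and> B ** B = M)"

text \<open>
  The functional \<open>\<partial>\<^sub>t g + \<L> g - f\<close>, where the second-order part of \<open>\<L>\<close> acts weakly,
  \<open>\<langle>- div\<^sub>x (A \<nabla>\<^sub>x g), v\<rangle> = (A \<nabla>\<^sub>x g, \<nabla>\<^sub>x v)\<close>.
\<close>

definition obstacle_residual ::
  "real \<Rightarrow> (real^'n) set \<Rightarrow> ('n st \<Rightarrow> real^'n^'n) \<Rightarrow> ('n st \<Rightarrow> real^'n) \<Rightarrow>
   ('n st \<Rightarrow> real) \<Rightarrow> ('n st, real) L2 \<Rightarrow> ('n st, real) L2 \<Rightarrow>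
   ('n st, real) L2 \<Rightarrow> real"
  where "obstacle_residual T \<Omega> A b c f g = (\<lambda>v. if v \<in> V_space T \<Omega> then
      time_deriv T \<Omega> g v
      + (LINT z:Qcyl T \<Omega>|lborel.
          (A z *v rep_L2 (xgrad T \<Omega> g) z) \<bullet> rep_L2 (xgrad T \<Omega> v) z)
      + (LINT z:Qcyl T \<Omega>|lborel.
          (b z \<bullet> rep_L2 (xgrad T \<Omega> g) z + c z * rep_L2 g z - rep_L2 f z) * rep_L2 v z)
    else 0)"

definition first_order_residual ::
  "real \<Rightarrow> (real^'n) set \<Rightarrow> ('n st \<Rightarrow> real^'n) \<Rightarrow> ('n st \<Rightarrow> real) \<Rightarrow>
   'n triple \<Rightarrow> 'n st \<Rightarrow> real"
  where "first_order_residual T \<Omega> b c = (\<lambda>(v, \<tau>, \<mu>) z.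
    rep_L2 (div_minus T \<Omega> (v, \<tau>, \<mu>)) z + b z \<bullet> rep_L2 (xgrad T \<Omega> v) z + c z * rep_L2 v z)"

definition flux_residual ::
  "real \<Rightarrow> (real^'n) set \<Rightarrow> ('n st \<Rightarrow> real^'n^'n) \<Rightarrow>
   'n triple \<Rightarrow> 'n st \<Rightarrow> real^'n"
  where "flux_residual T \<Omega> A = (\<lambda>(v, \<tau>, \<mu>) z.
    matrix_inv (mat_sqrt (A z)) *v rep_L2 \<tau> z + mat_sqrt (A z) *v rep_L2 (xgrad T \<Omega> v) z)"

definition a_form ::
  "real \<Rightarrow> (real^'n) set \<Rightarrow> ('n st \<Rightarrow> real^'n^'n) \<Rightarrow> ('n st \<Rightarrow> real^'n) \<Rightarrow>
   ('n st \<Rightarrow> real) \<Rightarrow> real \<Rightarrow> real \<Rightarrow> 'n triple \<Rightarrow> 'n triple \<Rightarrow> real"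
  where "a_form T \<Omega> A b c \<alpha> \<Lambda> = (\<lambda>(u, \<sigma>, l) (v, \<tau>, \<mu>).
    \<Lambda> / \<alpha> * (LINT z:Qcyl T \<Omega>|lborel.
        first_order_residual T \<Omega> b c (u, \<sigma>, l) z * first_order_residual T \<Omega> b c (v, \<tau>, \<mu>) z)
    + (LINT z:Qcyl T \<Omega>|lborel.
        flux_residual T \<Omega> A (u, \<sigma>, l) z \<bullet> flux_residual T \<Omega> A (v, \<tau>, \<mu>) z)
    + time_trace T u 0 \<bullet> time_trace T v 0
    + 1/2 * l v + 1/2 * \<mu> u)"

definition F_form ::
  "real \<Rightarrow> (real^'n) set \<Rightarrow> ('n st \<Rightarrow> real^'n) \<Rightarrow> ('n st \<Rightarrow> real) \<Rightarrow>
   real \<Rightarrow> real \<Rightarrow> ('n st, real) L2 \<Rightarrow> (real^'n, real) L2 \<Rightarrow>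
   ('n st \<Rightarrow> real) \<Rightarrow> 'n triple \<Rightarrow> real"
  where "F_form T \<Omega> b c \<alpha> \<Lambda> f u\<^sub>0 g = (\<lambda>(v, \<tau>, \<mu>).
    \<Lambda> / \<alpha> * (LINT z:Qcyl T \<Omega>|lborel.
        rep_L2 f z * first_order_residual T \<Omega> b c (v, \<tau>, \<mu>) z)
    + u\<^sub>0 \<bullet> time_trace T v 0
    + 1/2 * (LINT z:Qcyl T \<Omega>|lborel. g z * rep_L2 (L2_density T \<Omega> \<mu>) z))"

end

theory Submission
  imports Defs
begin

text \<open>
  On the finite-dimensional space \<open>U\<^sub>P\<close> the form \<open>a\<close> is symmetric, and it is positive definite: testing with
  \<open>(u, \<sigma>, \<lambda>)\<close> itself, the energy identity
  \<open>\<parallel>u(T)\<parallel>\<^sup>2 - \<parallel>u(0)\<parallel>\<^sup>2 = 2 \<langle>\<partial>\<^sub>t u, u\<rangle>\<close> for functions in \<open>W\<close> expresses \<open>\<langle>\<lambda>, u\<rangle>\<close> through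
  traces, the flux and the first-order residual, and the Friedrichs inequality absorbs the
  indefinite terms because \<open>\<Lambda> \<ge> c\<^sub>F\<^sup>2\<close>. Hence the discrete problem characterises the
  \<open>a\<close>-projection onto \<open>K\<^sub>P\<close>. Closedness of \<open>K\<^sub>P\<close> in the norm of \<open>U\<close> suffices, since in finite
  dimensions that norm is bounded by the one induced by \<open>a\<close>.

  The properties of \<open>W\<close> (continuous representatives, energy identity) follow from the weak equation
  alone: a function with values in \<open>H\<^sub>0\<^sup>1\<close> is a limit of test functions on the cylinder together with
  its gradient, so time increments of \<open>u\<close> may be tested with \<open>u\<close>.
\<close>

subsection \<open>Square-integrable classes\<close>

text \<open>On \<open>UP\<close> the functional \<lambda> has a density \<open>m\<close> in L2(Q).
  With \<open>w\<close> = div(u, \<sigma>) - \<lambda>, a triple amounts to the weak equation d_t u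
  + div \<sigma> = w + m, whose flux and source both lie in L2, so dual-valued time derivatives need
  not be handled. The obstacle is that \<open>u\<close> has no L2 derivative in time and is no test
  function. The energy identity is therefore read off from time shifts: u(t+h) - u(t) tested with
  u(t+h) + u(t) telescopes, and by the mean value theorem the increment is h times flux and source
  terms. The same estimate, applied to time differences of \<open>u\<close>, yields the continuous
  representative.

  Constants in the coercivity: let P be the flux residual, N = A^(1/2) grad u and \<rho> the
  first-order residual. Then a(u,u) contains |P|^2 - P.N + |N|^2 = |P - N/2|^2 + (3/4)|N|^2. Young's
  inequality spends half of the weight \<Lambda>/\<alpha> of |\<rho>|^2 and (\<alpha>/2)|grad u|^2,
  which leaves \<alpha>/4. This controls \<open>u\<close> and \<sigma>; \<lambda> is recovered from
  the equation.\<close>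

lemma L2_rel_refl_iff: "L2_rel f f \<longleftrightarrow> square_integrable f"
  by (auto simp: L2_rel_def)

lemma square_integrable_rep [simp]: "square_integrable (rep_L2 u)"
  using Quotient_rep_reflp[OF Quotient_L2] L2_rel_refl_iff by blast

lemma abs_rep_L2 [simp]: "abs_L2 (rep_L2 u) = u"
  by (rule Quotient_abs_rep[OF Quotient_L2])

lemma rep_abs_L2:
  assumes "square_integrable f"
  shows "AE x in lborel. rep_L2 (abs_L2 f) x = f x"
proof -
  have "L2_rel (rep_L2 (abs_L2 f)) f"
    using assms Quotient_rep_abs[OF Quotient_L2] L2_rel_refl_iff by blast
  then show ?thesis by (simp add: L2_rel_def)
qed

lemma abs_L2_cong:
  assumes "square_integrable f" "square_integrable g" "AE x in lborel. f x = g x"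
  shows "abs_L2 f = abs_L2 g"
  using assms Quotient_rel_abs[OF Quotient_L2, of f g] by (simp add: L2_rel_def)

lemma L2_eqI:
  assumes "AE x in lborel. rep_L2 u x = rep_L2 v x"
  shows "u = v"
  using abs_L2_cong[OF square_integrable_rep square_integrable_rep assms] by simp

lemma L2_eq_iff: "u = v \<longleftrightarrow> (AE x in lborel. rep_L2 u x = rep_L2 v x)"
  using L2_eqI by auto

lemma measurable_rep_L2 [measurable]: "rep_L2 u \<in> borel_measurable borel"
  using square_integrable_rep[of u] by (simp add: square_integrable_def)

lemma square_integrable_measurable:
  "square_integrable f \<Longrightarrow> f \<in> borel_measurable borel"
  by (simp add: square_integrable_def)

lemma abs_L2_add:
  assumes "square_integrable f" "square_integrable g"
  shows "abs_L2 f + abs_L2 g = abs_L2 (\<lambda>x. f x + g x)"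
  using assms by (simp add: plus_L2.abs_eq L2_rel_refl_iff)

lemma abs_L2_diff:
  assumes "square_integrable f" "square_integrable g"
  shows "abs_L2 f - abs_L2 g = abs_L2 (\<lambda>x. f x - g x)"
  using assms by (simp add: minus_L2.abs_eq L2_rel_refl_iff)

lemma abs_L2_scaleR:
  assumes "square_integrable f"
  shows "r *\<^sub>R abs_L2 f = abs_L2 (\<lambda>x. r *\<^sub>R f x)"
  using assms by (simp add: scaleR_L2.abs_eq L2_rel_refl_iff)

lemma inner_abs_L2:
  assumes "square_integrable f" "square_integrable g"
  shows "abs_L2 f \<bullet> abs_L2 g = (LINT x|lborel. f x \<bullet> g x)"
  using assms by (simp add: inner_L2.abs_eq L2_rel_refl_iff)

lemma inner_L2_rep: "u \<bullet> v = (LINT x|lborel. rep_L2 u x \<bullet> rep_L2 v x)"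
  using inner_abs_L2[of "rep_L2 u" "rep_L2 v"] by simp

lemma rep_L2_zero: "AE x in lborel. rep_L2 0 x = 0"
  unfolding zero_L2_def by (rule rep_abs_L2[OF square_integrable_zero])

lemma rep_L2_add: "AE x in lborel. rep_L2 (u + v) x = rep_L2 u x + rep_L2 v x"
  using rep_abs_L2[OF square_integrable_add, of "rep_L2 u" "rep_L2 v"]
    abs_L2_add[of "rep_L2 u" "rep_L2 v"] by simp

lemma rep_L2_diff: "AE x in lborel. rep_L2 (u - v) x = rep_L2 u x - rep_L2 v x"
  using rep_abs_L2[OF square_integrable_diff, of "rep_L2 u" "rep_L2 v"]
    abs_L2_diff[of "rep_L2 u" "rep_L2 v"] by simp

lemma rep_L2_scaleR: "AE x in lborel. rep_L2 (r *\<^sub>R u) x = r *\<^sub>R rep_L2 u x"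
  using rep_abs_L2[OF square_integrable_scaleR, of "rep_L2 u" r]
    abs_L2_scaleR[of "rep_L2 u" r] by simp

lemma integrable_rep_inner [simp]: "integrable lborel (\<lambda>x. rep_L2 u x \<bullet> rep_L2 v x)"
  by (rule square_integrable_inner) simp_all

lemma power2_norm_L2: "(norm u)\<^sup>2 = (LINT x|lborel. (norm (rep_L2 u x))\<^sup>2)"
  by (simp add: power2_norm_eq_inner inner_L2_rep)

lemma nn_integral_rep_L2: "(\<integral>\<^sup>+x. ennreal ((norm (rep_L2 u x))\<^sup>2) \<partial>lborel) = ennreal ((norm u)\<^sup>2)"
  unfolding power2_norm_L2
  by (rule nn_integral_eq_integral) (use square_integrable_rep[of u] in \<open>auto simp: square_integrable_def\<close>)

lemma square_integrable_iff_nn_integral: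
  fixes f :: "'a::euclidean_space \<Rightarrow> 'b::euclidean_space"
  shows "square_integrable f \<longleftrightarrow> f \<in> borel_measurable borel \<and>
    (\<integral>\<^sup>+x. ennreal ((norm (f x))\<^sup>2) \<partial>lborel) < \<infinity>"
  by (auto simp: square_integrable_def integrable_iff_bounded)

text \<open>A comparison test. The two codomains may differ, so that it also covers components of
  vectors and products with bounded coefficients.\<close>

lemma square_integrable_AE_cong:
  fixes f :: "'a::euclidean_space \<Rightarrow> 'b::euclidean_space" and g :: "'a \<Rightarrow> 'c::euclidean_space"
  assumes "square_integrable f" "g \<in> borel_measurable borel" "AE x in lborel. norm (g x) \<le> C * norm (f x)"
  shows "square_integrable g"
proof -
  have [measurable]: "f \<in> borel_measurable borel" "g \<in> borel_measurable borel"
    using assms by (auto simp: square_integrable_def)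
  have "integrable lborel (\<lambda>x. (norm (g x))\<^sup>2)"
  proof (rule Bochner_Integration.integrable_bound)
    show "integrable lborel (\<lambda>x. C\<^sup>2 * (norm (f x))\<^sup>2)"
      using assms by (simp add: square_integrable_def)
    have "AE x in lborel. (norm (g x))\<^sup>2 \<le> (C * norm (f x))\<^sup>2"
      using assms(3) by eventually_elim (simp add: power_mono)
    then show "AE x in lborel. norm ((norm (g x))\<^sup>2) \<le> norm (C\<^sup>2 * (norm (f x))\<^sup>2)"
      by eventually_elim (simp add: power_mult_distrib)
  qed measurable
  then show ?thesis using assms(2) by (simp add: square_integrable_def)
qed

lemma norm_abs_L2_le:
  fixes f :: "'a::euclidean_space \<Rightarrow> 'b::euclidean_space" and g :: "'a \<Rightarrow> 'c::euclidean_space"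
  assumes "square_integrable f" "square_integrable g" "AE x in lborel. norm (f x) \<le> norm (g x)"
  shows "norm (abs_L2 f) \<le> norm (abs_L2 g)"
proof -
  have "(norm (abs_L2 f))\<^sup>2 \<le> (norm (abs_L2 g))\<^sup>2"
    unfolding power2_norm_eq_inner inner_abs_L2[OF assms(1) assms(1)] inner_abs_L2[OF assms(2) assms(2)]
  proof (intro integral_mono_AE square_integrable_inner assms(1) assms(2))
    show "AE x in lborel. f x \<bullet> f x \<le> g x \<bullet> g x"
      using assms(3) by eventually_elim (simp add: dot_square_norm power_mono)
  qed
  then show ?thesis by simp
qed

text \<open>Riesz-Fischer. Along a subsequence with increments below (1/4)^n the series of 4^n |d
  n|^2 has finite integral, so its terms are bounded at almost every point and |d n| decays like
  2^(-n) there. Completeness is what later allows an L2-valued function of time to be extended to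
  the closure of its domain.\<close>

instance L2 :: (euclidean_space, euclidean_space) complete_space
proof
  fix X :: "nat \<Rightarrow> ('a, 'b) L2"
  assume X: "Cauchy X"
  have "\<exists>r. strict_mono r \<and> (\<forall>n. norm (X (r (Suc n)) - X (r n)) < (1/4)^n)"
  proof -
    have "\<exists>r. \<forall>n. (\<forall>m\<ge>r n. norm (X m - X (r n)) < (1/4)^n) \<and> r n < r (Suc n)"
    proof (rule dependent_nat_choice)
      show "\<exists>x. \<forall>m\<ge>x. norm (X m - X x) < (1/4)^0"
        using CauchyD[OF X, of 1] by force
      fix x n
      assume "\<forall>m\<ge>x. norm (X m - X x) < (1/4)^n"
      obtain M where M: "\<And>m k. m \<ge> M \<Longrightarrow> k \<ge> M \<Longrightarrow> norm (X m - X k) < (1/4)^Suc n"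
        using CauchyD[OF X, of "(1/4)^Suc n"] by auto
      show "\<exists>y. (\<forall>m\<ge>y. norm (X m - X y) < (1/4)^Suc n) \<and> x < y"
        by (rule exI[of _ "max M (Suc x)"]) (use M in \<open>auto simp del: power_Suc\<close>)
    qed
    then obtain r where r: "\<And>n m. m \<ge> r n \<Longrightarrow> norm (X m - X (r n)) < (1/4)^n" "\<And>n. r n < r (Suc n)"
      by blast
    have "norm (X (r (Suc n)) - X (r n)) < (1/4)^n" for n
      using r(1)[of n "r (Suc n)"] r(2)[of n] by simp
    then show ?thesis
      using r(2) by (intro exI[of _ r]) (simp add: strict_mono_Suc_iff)
  qed
  then obtain r where r: "strict_mono r" "\<And>n. norm (X (r (Suc n)) - X (r n)) < (1/4)^n"
    by blast
  define d where "d n x = rep_L2 (X (r (Suc n))) x - rep_L2 (X (r n)) x" for n x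
  have [measurable]: "d n \<in> borel_measurable borel" for n
    unfolding d_def by measurable
  have dn: "(\<integral>\<^sup>+x. ennreal ((norm (d n x))\<^sup>2) \<partial>lborel) \<le> ennreal ((1/16)^n)" for n
  proof -
    have "(\<integral>\<^sup>+x. ennreal ((norm (d n x))\<^sup>2) \<partial>lborel)
        = (\<integral>\<^sup>+x. ennreal ((norm (rep_L2 (X (r (Suc n)) - X (r n)) x))\<^sup>2) \<partial>lborel)"
      by (intro nn_integral_cong_AE) (use rep_L2_diff[of "X (r (Suc n))" "X (r n)"] in \<open>auto simp: d_def\<close>)
    also have "\<dots> = ennreal ((norm (X (r (Suc n)) - X (r n)))\<^sup>2)"
      by (rule nn_integral_rep_L2)
    also have "\<dots> \<le> ennreal (((1/4)^n)\<^sup>2)"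
      using r(2)[of n] by (intro ennreal_leI power_mono) auto
    finally show ?thesis by (simp add: power2_eq_square flip: power_mult_distrib)
  qed
  have "(\<integral>\<^sup>+x. (\<Sum>n. ennreal (4^n * (norm (d n x))\<^sup>2)) \<partial>lborel)
      = (\<Sum>n. \<integral>\<^sup>+x. ennreal (4^n * (norm (d n x))\<^sup>2) \<partial>lborel)"
    by (intro nn_integral_suminf) measurable
  also have "\<dots> \<le> (\<Sum>n. ennreal ((1/4)^n))"
  proof (intro suminf_le summableI)
    fix n
    have "(\<integral>\<^sup>+x. ennreal (4^n * (norm (d n x))\<^sup>2) \<partial>lborel) = ennreal (4^n) * (\<integral>\<^sup>+x. ennreal ((norm (d n x))\<^sup>2) \<partial>lborel)"
      by (subst nn_integral_cmult[symmetric]) (auto simp: ennreal_mult)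
    also have "\<dots> \<le> ennreal (4^n) * ennreal ((1/16)^n)"
      by (intro mult_left_mono dn) auto
    also have "\<dots> = ennreal ((1/4)^n)"
      by (simp flip: ennreal_mult power_mult_distrib)
    finally show "(\<integral>\<^sup>+x. ennreal (4^n * (norm (d n x))\<^sup>2) \<partial>lborel) \<le> ennreal ((1/4)^n)" .
  qed
  also have "\<dots> < \<infinity>"
  proof -
    have "(\<Sum>n. ennreal ((1/4)^n)) = ennreal (\<Sum>n. (1/4)^n)"
      by (intro suminf_ennreal2) (auto intro: summable_geometric)
    then show ?thesis by simp
  qed
  finally have "AE x in lborel. (\<Sum>n. ennreal (4^n * (norm (d n x))\<^sup>2)) \<noteq> \<infinity>"
    by (intro nn_integral_PInf_AE) auto
  then have conv: "AE x in lborel. convergent (\<lambda>n. rep_L2 (X (r n)) x)"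
  proof eventually_elim
    case (elim x)
    then have "summable (\<lambda>n. 4^n * (norm (d n x))\<^sup>2)"
      by (intro summable_suminf_not_top) (auto simp: top_unique)
    then have "Bseq (\<lambda>n. 4^n * (norm (d n x))\<^sup>2)"
      by (intro convergent_imp_Bseq) (auto intro: summable_LIMSEQ_zero simp: convergent_def)
    then obtain K where K: "K > 0" "\<And>n. 4^n * (norm (d n x))\<^sup>2 \<le> K"
      by (auto simp: Bseq_def)
    have "norm (d n x) \<le> sqrt K * (1/2)^n" for n
    proof (rule power2_le_imp_le)
      show "(norm (d n x))\<^sup>2 \<le> (sqrt K * (1/2)^n)\<^sup>2"
        using K(2)[of n] K(1)
        by (simp add: power_mult_distrib field_simps)
          (simp add: power2_eq_square mult.commute flip: power_mult_distrib)
    qed (use K in auto)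
    then have "summable (\<lambda>n. d n x)"
      by (intro summable_comparison_test'[OF summable_mult[OF summable_geometric, of "1/2" "sqrt K"]])
        auto
    then have "summable (\<lambda>n. rep_L2 (X (r (Suc n))) x - rep_L2 (X (r n)) x)"
      by (simp add: d_def)
    then show ?case
      unfolding summable_iff_convergent sum_lessThan_telescope[of "\<lambda>n. rep_L2 (X (r n)) x"]
      by (simp add: convergent_diff_const_right_iff)
  qed
  define F where "F x = lim (\<lambda>n. rep_L2 (X (r n)) x)" for x
  have [measurable]: "F \<in> borel_measurable borel"
    unfolding F_def by measurable
  \<comment> \<open>Fatou's lemma bounds the distance from \<open>X n\<close> to the pointwise limit
    by the distances from \<open>X n\<close> to the members of the subsequence, and those are
    controlled by the Cauchy property.\<close>
  have est: "\<exists>N. \<forall>n\<ge>N. (\<integral>\<^sup>+x. ennreal ((norm (F x - rep_L2 (X n) x))\<^sup>2) \<partial>lborel) \<le> ennreal (e\<^sup>2)"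
    if e: "e > 0" for e
  proof -
    obtain N where N: "\<And>m k. m \<ge> N \<Longrightarrow> k \<ge> N \<Longrightarrow> norm (X m - X k) < e"
      using CauchyD[OF X e] by auto
    have "(\<integral>\<^sup>+x. ennreal ((norm (F x - rep_L2 (X n) x))\<^sup>2) \<partial>lborel) \<le> ennreal (e\<^sup>2)" if n: "n \<ge> N" for n
    proof -
      have "(\<integral>\<^sup>+x. ennreal ((norm (F x - rep_L2 (X n) x))\<^sup>2) \<partial>lborel)
        \<le> (\<integral>\<^sup>+x. liminf (\<lambda>k. ennreal ((norm (rep_L2 (X (r k)) x - rep_L2 (X n) x))\<^sup>2)) \<partial>lborel)"
      proof (intro nn_integral_mono_AE)
        show "AE x in lborel. ennreal ((norm (F x - rep_L2 (X n) x))\<^sup>2)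
            \<le> liminf (\<lambda>k. ennreal ((norm (rep_L2 (X (r k)) x - rep_L2 (X n) x))\<^sup>2))"
          using conv
        proof eventually_elim
          case (elim x)
          then have "(\<lambda>k. rep_L2 (X (r k)) x) \<longlonglongrightarrow> F x"
            by (simp add: F_def convergent_LIMSEQ_iff)
          then have "(\<lambda>k. ennreal ((norm (rep_L2 (X (r k)) x - rep_L2 (X n) x))\<^sup>2)) \<longlonglongrightarrow>
              ennreal ((norm (F x - rep_L2 (X n) x))\<^sup>2)"
            by (intro tendsto_intros)
          then show ?case
            by (intro eq_refl lim_imp_Liminf[symmetric]) simp_all
        qed
      qed
      also have "\<dots> \<le> liminf (\<lambda>k. \<integral>\<^sup>+x. ennreal ((norm (rep_L2 (X (r k)) x - rep_L2 (X n) x))\<^sup>2) \<partial>lborel)"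
        by (intro nn_integral_liminf) measurable
      also have "\<dots> \<le> ennreal (e\<^sup>2)"
      proof -
        have "\<forall>\<^sub>F k in sequentially. (\<integral>\<^sup>+x. ennreal ((norm (rep_L2 (X (r k)) x - rep_L2 (X n) x))\<^sup>2) \<partial>lborel) \<le> ennreal (e\<^sup>2)"
          using eventually_ge_at_top[of N]
        proof eventually_elim
          case (elim k)
          have "(\<integral>\<^sup>+x. ennreal ((norm (rep_L2 (X (r k)) x - rep_L2 (X n) x))\<^sup>2) \<partial>lborel)
              = (\<integral>\<^sup>+x. ennreal ((norm (rep_L2 (X (r k) - X n) x))\<^sup>2) \<partial>lborel)"
            by (intro nn_integral_cong_AE) (use rep_L2_diff[of "X (r k)" "X n"] in auto)
          also have "\<dots> = ennreal ((norm (X (r k) - X n))\<^sup>2)"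
            by (rule nn_integral_rep_L2)
          also have "\<dots> \<le> ennreal (e\<^sup>2)"
            using N[of "r k" n] n elim seq_suble[OF r(1), of k]
            by (intro ennreal_leI power_mono) auto
          finally show ?case .
        qed
        then show ?thesis
          by (intro order_trans[OF Liminf_le_Limsup Limsup_bounded]) auto
      qed
      finally show ?thesis .
    qed
    then show ?thesis by blast
  qed
  obtain N where N: "(\<integral>\<^sup>+x. ennreal ((norm (F x - rep_L2 (X N) x))\<^sup>2) \<partial>lborel) \<le> ennreal (1\<^sup>2)"
    using est[of 1] by auto
  have "square_integrable (\<lambda>x. F x - rep_L2 (X N) x)"
    unfolding square_integrable_iff_nn_integral using N by (auto simp: less_top top_unique intro: le_less_trans)
  from square_integrable_add[OF this square_integrable_rep[of "X N"]]
  have F: "square_integrable F" by simp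
  have "X \<longlonglongrightarrow> abs_L2 F"
  proof (rule LIMSEQ_I)
    fix e :: real assume e: "0 < e"
    obtain N where N: "\<And>n. n \<ge> N \<Longrightarrow> (\<integral>\<^sup>+x. ennreal ((norm (F x - rep_L2 (X n) x))\<^sup>2) \<partial>lborel) \<le> ennreal ((e/2)\<^sup>2)"
      using est[of "e/2"] e by auto
    have "norm (X n - abs_L2 F) < e" if "n \<ge> N" for n
    proof -
      have "ennreal ((norm (abs_L2 F - X n))\<^sup>2) = (\<integral>\<^sup>+x. ennreal ((norm (rep_L2 (abs_L2 F - X n) x))\<^sup>2) \<partial>lborel)"
        by (rule nn_integral_rep_L2[symmetric])
      also have "\<dots> = (\<integral>\<^sup>+x. ennreal ((norm (F x - rep_L2 (X n) x))\<^sup>2) \<partial>lborel)"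
        by (intro nn_integral_cong_AE)
          (use rep_L2_diff[of "abs_L2 F" "X n"] rep_abs_L2[OF F] in \<open>eventually_elim, simp\<close>)
      also have "\<dots> \<le> ennreal ((e/2)\<^sup>2)"
        by (rule N[OF that])
      finally have "norm (abs_L2 F - X n) \<le> e/2"
        using e by (simp add: power2_le_iff_abs_le)
      then show ?thesis using e by (simp add: norm_minus_commute)
    qed
    then show "\<exists>no. \<forall>n\<ge>no. norm (X n - abs_L2 F) < e" by blast
  qed
  then show "convergent X" by (auto simp: convergent_def)
qed

section \<open>Analytic tools: translations, smooth functions, localisation by test
  functions\<close>

subsection \<open>Continuity of translations\<close>

lemma real_squeeze_zero:
  fixes f g :: "'a \<Rightarrow> real"
  assumes "\<And>x. 0 \<le> f x" "\<And>x. f x \<le> g x" "(g \<longlongrightarrow> 0) F"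
  shows "(f \<longlongrightarrow> 0) F"
  by (rule tendsto_sandwich[OF _ _ tendsto_const assms(3)]) (use assms(1,2) in \<open>auto intro: always_eventually\<close>)

lemma distr_lborel_shift: "distr lborel borel (\<lambda>x. x + s) = (lborel :: 'a::euclidean_space measure)"
proof -
  have "(\<lambda>x. x + s) = (+) s" by (auto simp: add.commute)
  then show ?thesis by (simp only: lborel_distr_plus)
qed

lemma AE_lborel_shift:
  fixes s :: "'a::euclidean_space"
  assumes "AE x in lborel. P x"
  shows "AE x in lborel. P (x + s)"
proof -
  from assms obtain N where N: "{x. \<not> P x} \<subseteq> N" "N \<in> sets lborel" "emeasure lborel N = 0"
    by (auto elim!: AE_E)
  have [measurable]: "N \<in> sets borel" using N(2) by simp
  have "AE x in lborel. x \<notin> N"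
    using N by (intro AE_not_in) (auto simp: null_sets_def)
  then have "AE x in distr lborel borel (\<lambda>x. x + s). x \<notin> N"
    by (simp only: distr_lborel_shift)
  then have "AE x in lborel. x + s \<notin> N"
    by (subst (asm) AE_distr_iff) auto
  then show ?thesis
    by eventually_elim (use N in auto)
qed

lemma nn_integral_shift:
  fixes f :: "'a::euclidean_space \<Rightarrow> ennreal"
  assumes [measurable]: "f \<in> borel_measurable borel"
  shows "(\<integral>\<^sup>+x. f (x + s) \<partial>lborel) = (\<integral>\<^sup>+x. f x \<partial>lborel)"
  by (subst (2) distr_lborel_shift[of s, symmetric]) (simp add: nn_integral_distr)

lemma integrable_shift:
  fixes f :: "'a::euclidean_space \<Rightarrow> 'b::{banach, second_countable_topology}"
  assumes "integrable lborel f"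
  shows "integrable lborel (\<lambda>x. f (x + s))"
proof -
  have [measurable]: "f \<in> borel_measurable borel"
    using borel_measurable_integrable[OF assms] by simp
  have "integrable (distr lborel borel (\<lambda>x. x + s)) f"
    by (simp add: distr_lborel_shift assms)
  then show ?thesis
    by (subst (asm) integrable_distr_eq) auto
qed

lemma integral_shift:
  fixes f :: "'a::euclidean_space \<Rightarrow> 'b::{banach, second_countable_topology}"
  assumes [measurable]: "f \<in> borel_measurable borel"
  shows "(LINT x|lborel. f (x + s)) = (LINT x|lborel. f x)"
  by (subst (2) distr_lborel_shift[of s, symmetric]) (simp add: integral_distr)

text \<open>A set and its translate have equal measure, so the integral of the absolute difference
  is twice that of the positive part. The positive part is dominated by the indicator of
  \<open>U\<close> and is eventually zero at every point because \<open>U\<close> is open.\<close>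

lemma open_indicator_translation:
  fixes U :: "'a::euclidean_space set" and S :: "nat \<Rightarrow> 'a"
  assumes U: "open U" "emeasure lborel U < \<infinity>" and S: "S \<longlonglongrightarrow> 0"
  shows "(\<lambda>n. LINT x|lborel. \<bar>indicator U (x + S n) - indicator U x\<bar>) \<longlonglongrightarrow> (0::real)"
proof -
  have [measurable]: "U \<in> sets borel" using U by simp
  let ?i = "indicator U :: 'a \<Rightarrow> real"
  have iU: "integrable lborel ?i"
    using U by (simp add: integrable_indicator_iff)
  have iUs: "integrable lborel (\<lambda>x. ?i (x + s))" for s
    by (rule integrable_shift[OF iU])
  have pos: "(\<lambda>n. LINT x|lborel. max 0 (?i x - ?i (x + S n))) \<longlonglongrightarrow> (LINT x::'a|lborel. (0::real))"
  proof (rule Bochner_Integration.integral_dominated_convergence[where w="?i"])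
    show "AE x in lborel. (\<lambda>n. max 0 (?i x - ?i (x + S n))) \<longlonglongrightarrow> 0"
    proof (rule AE_I2)
      fix x :: 'a
      show "(\<lambda>n. max 0 (?i x - ?i (x + S n))) \<longlonglongrightarrow> 0"
      proof (cases "x \<in> U")
        case True
        have "(\<lambda>n. x + S n) \<longlonglongrightarrow> x + 0"
          by (intro tendsto_intros S)
        then have "\<forall>\<^sub>F n in sequentially. x + S n \<in> U"
          using U(1) True by (simp add: topological_tendstoD)
        then have "\<forall>\<^sub>F n in sequentially. max 0 (?i x - ?i (x + S n)) = 0"
          by eventually_elim simp
        then show ?thesis by (rule tendsto_eventually)
      next
        case False
        then have "max 0 (?i x - ?i (x + S n)) = 0" for n
          by (auto simp: indicator_def)
        then show ?thesis by simp
      qed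
    qed
    show "AE x in lborel. norm (max 0 (?i x - ?i (x + S n))) \<le> ?i x" for n
      by (auto simp: indicator_def)
  qed (use iU in measurable)
  have "(LINT x|lborel. \<bar>?i (x + s) - ?i x\<bar>) = 2 * (LINT x|lborel. max 0 (?i x - ?i (x + s)))" for s
  proof -
    have "(LINT x|lborel. \<bar>?i (x + s) - ?i x\<bar>)
        = (LINT x|lborel. 2 * max 0 (?i x - ?i (x + s)) + (?i (x + s) - ?i x))"
      by (intro Bochner_Integration.integral_cong) (auto simp: indicator_def)
    also have "\<dots> = (LINT x|lborel. 2 * max 0 (?i x - ?i (x + s))) + ((LINT x|lborel. ?i (x + s)) - (LINT x|lborel. ?i x))"
      using iU iUs[of s]
      by (subst Bochner_Integration.integral_add)
        (auto intro!: Bochner_Integration.integrable_max)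
    also have "(LINT x|lborel. ?i (x + s)) = (LINT x|lborel. ?i x)"
      by (rule integral_shift) measurable
    finally show ?thesis by simp
  qed
  then show ?thesis
    using tendsto_mult_left[OF pos, of 2] by simp
qed

text \<open>Outer regularity encloses \<open>A\<close> in an open set with excess below e/4. The
  error for \<open>A\<close> is at most that for the open set plus the excess and its translate,
  three quarters of e in total.\<close>

lemma indicator_translation:
  fixes A :: "'a::euclidean_space set" and S :: "nat \<Rightarrow> 'a"
  assumes A[measurable]: "A \<in> sets borel" and fin: "emeasure lborel A < \<infinity>" and S: "S \<longlonglongrightarrow> 0"
  shows "(\<lambda>n. LINT x|lborel. \<bar>indicator A (x + S n) - indicator A x\<bar>) \<longlonglongrightarrow> (0::real)"
proof (rule LIMSEQ_I)
  fix e :: real assume e: "0 < e"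
  obtain U where U: "open U" "A \<subseteq> U" and UA: "emeasure lborel (U - A) < ennreal (e/4)"
    using outer_regular_lborel[OF A, of "e/4"] e by auto
  have [measurable]: "U \<in> sets borel" using U by simp
  have "emeasure lborel U \<le> emeasure lborel A + emeasure lborel (U - A)"
    using U(2) by (subst plus_emeasure) (auto simp: Un_absorb1 intro!: emeasure_mono)
  also have "\<dots> < \<infinity>"
    using fin UA by (auto simp: less_top[symmetric] intro: less_trans)
  finally have Ufin: "emeasure lborel U < \<infinity>" .
  have iD: "integrable lborel (indicator (U - A) :: 'a \<Rightarrow> real)"
    using UA by (auto simp: integrable_indicator_iff intro: less_trans)
  have iU: "integrable lborel (indicator U :: 'a \<Rightarrow> real)"
    using Ufin by (auto simp: integrable_indicator_iff)
  have D: "(LINT x|lborel. indicator (U - A) x) \<le> e/4"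
    using UA e enn2real_leI[of "e/4" "emeasure lborel (U - A)"] by (simp add: measure_def less_imp_le)
  obtain N where N: "\<And>n. n \<ge> N \<Longrightarrow> \<bar>LINT x|lborel. \<bar>indicator U (x + S n) - indicator U x\<bar>\<bar> < e/4"
    using LIMSEQ_D[OF open_indicator_translation[OF U(1) Ufin S], of "e/4"] e by auto
  have "norm ((LINT x|lborel. \<bar>indicator A (x + S n) - indicator A x\<bar> :: real) - 0) < e" if "n \<ge> N" for n
  proof -
    have "(LINT x|lborel. \<bar>indicator A (x + S n) - indicator A x\<bar>)
      \<le> (LINT x|lborel. \<bar>indicator U (x + S n) - indicator U x\<bar> +
           (indicator (U - A) (x + S n) + indicator (U - A) x) :: real)"
      using U(2) by (intro integral_mono' Bochner_Integration.integrable_add integrable_abs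
        Bochner_Integration.integrable_diff integrable_shift iD iU) (auto simp: indicator_def)
    also have "\<dots> = (LINT x|lborel. \<bar>indicator U (x + S n) - indicator U x\<bar>) +
        ((LINT x|lborel. indicator (U - A) (x + S n)) + (LINT x|lborel. indicator (U - A) x))"
      by (simp add: integrable_shift iD iU integrable_abs)
    also have "(LINT x|lborel. indicator (U - A) (x + S n)) = (LINT x|lborel. indicator (U - A) x :: real)"
      by (rule integral_shift) measurable
    finally have "(LINT x|lborel. \<bar>indicator A (x + S n) - indicator A x\<bar> :: real) \<le> e/4 + (e/4 + e/4)"
      using N[OF that] D by linarith
    then have "(LINT x|lborel. \<bar>indicator A (x + S n) - indicator A x\<bar> :: real) < e"
      using e by simp
    then show ?thesis
      by (simp add: Bochner_Integration.integral_nonneg)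
  qed
  then show "\<exists>no. \<forall>n\<ge>no. norm ((LINT x|lborel. \<bar>indicator A (x + S n) - indicator A x\<bar> :: real) - 0) < e"
    by blast
qed

lemma integrable_translation_continuous:
  fixes f :: "'a::euclidean_space \<Rightarrow> 'b::{banach, second_countable_topology}"
  assumes "integrable lborel f" "S \<longlonglongrightarrow> (0::'a)"
  shows "(\<lambda>n. LINT x|lborel. norm (f (x + S n) - f x)) \<longlonglongrightarrow> 0"
  using assms
proof (induction f rule: integrable_induct)
  case (base A c)
  have "(LINT x|lborel. norm (indicator A (x + S n) *\<^sub>R c - indicator A x *\<^sub>R c))
      = (LINT x|lborel. \<bar>indicator A (x + S n) - indicator A x\<bar>) * norm c" for n
    by (simp flip: scaleR_diff_left)
  then show ?case
    using tendsto_mult_right[OF indicator_translation[of A S], of "norm c"] base by simp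
next
  case (add f g)
  have "norm ((f (x + S n) + g (x + S n)) - (f x + g x)) \<le> norm (f (x + S n) - f x) + norm (g (x + S n) - g x)" for x n
    by (metis add_diff_add norm_triangle_ineq)
  then have "(LINT x|lborel. norm ((f (x + S n) + g (x + S n)) - (f x + g x)))
    \<le> (LINT x|lborel. norm (f (x + S n) - f x) + norm (g (x + S n) - g x))" for n
    using add.hyps by (intro integral_mono Bochner_Integration.integrable_add integrable_norm
        Bochner_Integration.integrable_diff integrable_shift) auto
  then have le: "(LINT x|lborel. norm ((f (x + S n) + g (x + S n)) - (f x + g x)))
    \<le> (LINT x|lborel. norm (f (x + S n) - f x)) + (LINT x|lborel. norm (g (x + S n) - g x))" for n
    using add.hyps by (simp add: integrable_shift)
  have "(\<lambda>n. (LINT x|lborel. norm (f (x + S n) - f x)) + (LINT x|lborel. norm (g (x + S n) - g x))) \<longlonglongrightarrow> 0"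
    using tendsto_add[OF add.IH(1)[OF add.prems] add.IH(2)[OF add.prems]] by simp
  then show ?case
    by (rule real_squeeze_zero[rotated 2]) (use le in \<open>auto intro!: Bochner_Integration.integral_nonneg\<close>)
next
  case (lim f s)
  have [measurable]: "f \<in> borel_measurable borel" "\<And>i. s i \<in> borel_measurable borel"
    using borel_measurable_integrable[OF lim.hyps(4)] borel_measurable_integrable[OF lim.hyps(1)] by auto
  \<comment> \<open>The approximants of \<open>integrable_induct\<close> satisfy norm (s i x) \<le>
    2 * norm (f x), which gives the dominating function 3 * norm (f x).\<close>
  have lim0: "(\<lambda>i. LINT x|lborel. norm (s i x - f x)) \<longlonglongrightarrow> (LINT x::'a|lborel. (0::real))"
  proof (rule Bochner_Integration.integral_dominated_convergence[where w="\<lambda>x. 3 * norm (f x)"])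
    show "AE x in lborel. (\<lambda>i. norm (s i x - f x)) \<longlonglongrightarrow> 0"
      using lim.hyps(2) by (auto intro!: tendsto_norm_zero LIM_zero)
    show "AE x in lborel. norm (norm (s i x - f x)) \<le> 3 * norm (f x)" for i
    proof (rule AE_I2)
      fix x :: 'a
      show "norm (norm (s i x - f x)) \<le> 3 * norm (f x)"
        using lim.hyps(3)[of x i] norm_triangle_ineq4[of "s i x" "f x"] by simp
    qed
  qed (use lim.hyps(4) in auto)
  show ?case
  proof (rule LIMSEQ_I)
    fix e :: real assume e: "e > 0"
    obtain i where i: "(LINT x|lborel. norm (s i x - f x)) < e/4"
      using LIMSEQ_D[OF lim0, of "e/4"] e by force
    obtain N where N: "\<And>n. n \<ge> N \<Longrightarrow> (LINT x|lborel. norm (s i (x + S n) - s i x)) < e/4"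
      using LIMSEQ_D[OF lim.IH[of i, OF lim.prems], of "e/4"] e by force
    have "norm ((LINT x|lborel. norm (f (x + S n) - f x)) - 0) < e" if "n \<ge> N" for n
    proof -
      have tri: "norm (a - b) \<le> norm (a' - b') + (norm (a' - a) + norm (b' - b))" for a b a' b' :: 'b
      proof -
        have "norm (a - b) = norm ((a' - b') + ((b' - b) - (a' - a)))" by simp
        then show ?thesis
          using norm_triangle_ineq[of "a' - b'" "(b' - b) - (a' - a)"] norm_triangle_ineq4[of "b' - b" "a' - a"]
          by linarith
      qed
      have "(LINT x|lborel. norm (f (x + S n) - f x))
        \<le> (LINT x|lborel. norm (s i (x + S n) - s i x) + (norm (s i (x + S n) - f (x + S n)) + norm (s i x - f x)))"
        by (intro integral_mono Bochner_Integration.integrable_add integrable_norm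
            Bochner_Integration.integrable_diff integrable_shift lim.hyps(1) lim.hyps(4) tri)
      also have "\<dots> = (LINT x|lborel. norm (s i (x + S n) - s i x)) +
          ((LINT x|lborel. norm (s i (x + S n) - f (x + S n))) + (LINT x|lborel. norm (s i x - f x)))"
        using integrable_shift[OF lim.hyps(1)] integrable_shift[OF lim.hyps(4)] lim.hyps(1,4) by simp
      also have "(LINT x|lborel. norm (s i (x + S n) - f (x + S n))) = (LINT x|lborel. norm (s i x - f x))"
        by (rule integral_shift[of "\<lambda>x. norm (s i x - f x)"]) measurable
      finally have "(LINT x|lborel. norm (f (x + S n) - f x)) < e"
        using N[OF that] i e by linarith
      moreover have "(LINT x|lborel. norm (f (x + S n) - f x)) \<ge> 0"
        by (intro Bochner_Integration.integral_nonneg) auto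
      ultimately show ?thesis by simp
    qed
    then show "\<exists>no. \<forall>n\<ge>no. norm ((LINT x|lborel. norm (f (x + S n) - f x)) - 0) < e" by blast
  qed
qed

definition shift_L2 :: "'a::euclidean_space \<Rightarrow> ('a, 'b::euclidean_space) L2 \<Rightarrow> ('a, 'b) L2"
  where "shift_L2 s u = abs_L2 (\<lambda>x. rep_L2 u (x + s))"

lemma square_integrable_shift:
  fixes f :: "'a::euclidean_space \<Rightarrow> 'b::euclidean_space"
  assumes "square_integrable f"
  shows "square_integrable (\<lambda>x. f (x + s))"
proof -
  have [measurable]: "f \<in> borel_measurable borel"
    using assms by (simp add: square_integrable_def)
  show ?thesis
    using assms integrable_shift[of "\<lambda>x. (norm (f x))\<^sup>2" s] by (simp add: square_integrable_def)
qed

lemma rep_shift_L2: "AE x in lborel. rep_L2 (shift_L2 s u) x = rep_L2 u (x + s)"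
  unfolding shift_L2_def by (rule rep_abs_L2) (simp add: square_integrable_shift)

lemma shift_L2_inner: "shift_L2 s u \<bullet> shift_L2 s v = u \<bullet> v"
  unfolding shift_L2_def inner_L2_rep[of u v]
  by (simp add: inner_abs_L2 square_integrable_shift integral_shift[of "\<lambda>x. rep_L2 u x \<bullet> rep_L2 v x"])

lemma norm_shift_L2 [simp]: "norm (shift_L2 s u) = norm u"
  by (simp add: norm_eq_sqrt_inner shift_L2_inner)

lemma shift_L2_abs:
  assumes "square_integrable f"
  shows "shift_L2 s (abs_L2 f) = abs_L2 (\<lambda>x. f (x + s))"
  unfolding shift_L2_def
  using AE_lborel_shift[OF rep_abs_L2[OF assms], of s] assms
  by (intro abs_L2_cong) (simp_all add: square_integrable_shift)

lemma shift_L2_shift: "shift_L2 s (shift_L2 r u) = shift_L2 (r + s) u"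
  by (rule L2_eqI) (use rep_shift_L2[of s "shift_L2 r u"] AE_lborel_shift[OF rep_shift_L2[of r u], of s]
    rep_shift_L2[of "r + s" u] in \<open>eventually_elim, simp add: ac_simps\<close>)

lemma shift_L2_zero [simp]: "shift_L2 0 u = u"
  by (simp add: shift_L2_def)

text \<open>The bridge from L1 to L2: the signed square of a component of an L2 function is
  integrable, and its translation error in L1 controls the squared translation error of the
  component.\<close>

lemma square_diff_le_signed_square: "(a - b)\<^sup>2 \<le> 2 * \<bar>a * \<bar>a\<bar> - b * \<bar>b\<bar>\<bar>" for a b :: real
proof -
  have 1: "(a - b)\<^sup>2 \<le> 2 * \<bar>a * \<bar>a\<bar> - b * \<bar>b\<bar>\<bar>" if "a \<ge> b" for a b :: real
  proof (cases "b \<ge> 0 \<or> a \<le> 0")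
    case True
    then have "a * \<bar>a\<bar> - b * \<bar>b\<bar> = (a - b) * \<bar>a + b\<bar>"
      using that by (auto simp: algebra_simps abs_of_nonpos abs_of_nonneg)
    then have "\<bar>a * \<bar>a\<bar> - b * \<bar>b\<bar>\<bar> = \<bar>a - b\<bar> * \<bar>a + b\<bar>"
      by (simp add: abs_mult)
    moreover have "\<bar>a - b\<bar> * \<bar>a - b\<bar> \<le> \<bar>a - b\<bar> * (2 * \<bar>a + b\<bar>)"
      using True that by (intro mult_left_mono) auto
    ultimately show ?thesis by (simp add: power2_eq_square)
  next
    case False
    then have "\<bar>a * \<bar>a\<bar> - b * \<bar>b\<bar>\<bar> = a\<^sup>2 + b\<^sup>2"
      by (simp add: power2_eq_square)
    moreover have "(a - b)\<^sup>2 \<le> 2 * (a\<^sup>2 + b\<^sup>2)"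
      using zero_le_power2[of "a + b"] by (simp add: power2_eq_square algebra_simps)
    ultimately show ?thesis by simp
  qed
  show ?thesis
    using 1[of b a] 1[of a b] by (cases "a \<ge> b") (auto simp: power2_commute abs_minus_commute)
qed

lemma shift_L2_continuous_seq:
  fixes u :: "('a::euclidean_space, 'b::euclidean_space) L2"
  assumes S: "S \<longlonglongrightarrow> 0"
  shows "(\<lambda>n. shift_L2 (S n) u) \<longlonglongrightarrow> u"
proof -
  define F where "F i x = (rep_L2 u x \<bullet> i) * \<bar>rep_L2 u x \<bullet> i\<bar>" for i x
  have Fint: "integrable lborel (F i)" if "i \<in> Basis" for i
  proof (rule Bochner_Integration.integrable_bound)
    show "integrable lborel (\<lambda>x. (norm (rep_L2 u x))\<^sup>2)"
      using square_integrable_rep[of u] by (simp add: square_integrable_def)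
    show "AE x in lborel. norm (F i x) \<le> norm ((norm (rep_L2 u x))\<^sup>2)"
    proof (rule AE_I2)
      fix x :: 'a
      have "norm (F i x) = \<bar>rep_L2 u x \<bullet> i\<bar>\<^sup>2"
        by (simp add: F_def power2_eq_square abs_mult)
      also have "\<dots> \<le> (norm (rep_L2 u x))\<^sup>2"
        by (intro power_mono Basis_le_norm that) auto
      finally show "norm (F i x) \<le> norm ((norm (rep_L2 u x))\<^sup>2)" by simp
    qed
  qed (unfold F_def[abs_def], measurable)
  have bound: "(norm (shift_L2 s u - u))\<^sup>2 \<le> (\<Sum>i\<in>Basis. 2 * (LINT x|lborel. norm (F i (x + s) - F i x)))" for s
  proof -
    have "(norm (shift_L2 s u - u))\<^sup>2 = (LINT x|lborel. (norm (rep_L2 u (x + s) - rep_L2 u x))\<^sup>2)"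
    proof -
      have "shift_L2 s u - u = abs_L2 (\<lambda>x. rep_L2 u (x + s) - rep_L2 u x)"
        using abs_L2_diff[of "\<lambda>x. rep_L2 u (x + s)" "rep_L2 u"]
        by (simp add: shift_L2_def square_integrable_shift)
      then show ?thesis
        by (simp add: power2_norm_eq_inner inner_abs_L2 square_integrable_diff square_integrable_shift)
    qed
    also have "\<dots> \<le> (LINT x|lborel. (\<Sum>i\<in>Basis. 2 * norm (F i (x + s) - F i x)))"
    proof (rule integral_mono)
      show "integrable lborel (\<lambda>x. (norm (rep_L2 u (x + s) - rep_L2 u x))\<^sup>2)"
        using square_integrable_diff[OF square_integrable_shift[OF square_integrable_rep] square_integrable_rep, of u s u]
        by (simp add: square_integrable_def)
      show "integrable lborel (\<lambda>x. \<Sum>i\<in>Basis. 2 * norm (F i (x + s) - F i x))"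
        using Fint integrable_shift[OF Fint]
        by (intro Bochner_Integration.integrable_sum integrable_mult_right integrable_norm Bochner_Integration.integrable_diff) auto
      fix x
      have "(norm (rep_L2 u (x + s) - rep_L2 u x))\<^sup>2 = (\<Sum>i\<in>Basis. (rep_L2 u (x + s) \<bullet> i - rep_L2 u x \<bullet> i)\<^sup>2)"
        unfolding power2_norm_eq_inner by (subst euclidean_inner) (simp add: power2_eq_square inner_diff_left)
      also have "\<dots> \<le> (\<Sum>i\<in>Basis. 2 * norm (F i (x + s) - F i x))"
        by (intro sum_mono) (simp add: F_def square_diff_le_signed_square)
      finally show "(norm (rep_L2 u (x + s) - rep_L2 u x))\<^sup>2 \<le> (\<Sum>i\<in>Basis. 2 * norm (F i (x + s) - F i x))" .
    qed
    also have "\<dots> = (\<Sum>i\<in>Basis. 2 * (LINT x|lborel. norm (F i (x + s) - F i x)))"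
      using Fint integrable_shift[OF Fint] by (subst Bochner_Integration.integral_sum) auto
    finally show ?thesis .
  qed
  have "(\<lambda>n. \<Sum>i\<in>Basis. 2 * (LINT x|lborel. norm (F i (x + S n) - F i x))) \<longlonglongrightarrow> (\<Sum>i\<in>(Basis::'b set). 2 * 0)"
    by (intro tendsto_sum tendsto_mult tendsto_const integrable_translation_continuous Fint S)
  then have "(\<lambda>n. \<Sum>i\<in>Basis. 2 * (LINT x|lborel. norm (F i (x + S n) - F i x))) \<longlonglongrightarrow> 0"
    by simp
  then have "(\<lambda>n. (norm (shift_L2 (S n) u - u))\<^sup>2) \<longlonglongrightarrow> 0"
    by (rule real_squeeze_zero[rotated 2]) (use bound in auto)
  then have "(\<lambda>n. sqrt ((norm (shift_L2 (S n) u - u))\<^sup>2)) \<longlonglongrightarrow> sqrt 0"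
    by (rule tendsto_real_sqrt)
  then show ?thesis
    by (simp add: LIM_zero_iff tendsto_norm_zero_iff)
qed

lemma shift_L2_tendsto:
  fixes u :: "('a::euclidean_space, 'b::euclidean_space) L2"
  shows "((\<lambda>s. shift_L2 s u) \<longlongrightarrow> u) (at 0)"
  unfolding tendsto_at_iff_sequentially by (auto simp: o_def shift_L2_continuous_seq)

subsection \<open>Smooth functions\<close>

lemma Ck_continuous: "Ck k f \<Longrightarrow> continuous_on UNIV f"
proof (cases k)
  case (Suc m)
  assume "Ck k f"
  then obtain f' where "\<And>x. (f has_derivative f' x) (at x)" by (auto simp: Suc)
  then show ?thesis
    by (intro continuous_at_imp_continuous_on ballI) (rule has_derivative_continuous)
qed simp

lemma Ck_Suc_imp: "Ck (Suc k) f \<Longrightarrow> Ck k f"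
proof (induction k arbitrary: f)
  case 0
  then have "continuous_on UNIV f" by (rule Ck_continuous)
  then show ?case by simp
next
  case (Suc k)
  obtain f' where f': "\<And>x. (f has_derivative f' x) (at x)" "\<And>h. Ck (Suc k) (\<lambda>x. f' x h)"
    using Suc.prems unfolding Ck.simps(2)[of "Suc k"] by blast
  then show ?case
    unfolding Ck.simps(2)[of k] using Suc.IH[OF f'(2)] by blast
qed

lemma Ck_const: "Ck k (\<lambda>x. c)"
proof (induction k arbitrary: c)
  case (Suc k)
  then show ?case by (auto intro!: exI[of _ "\<lambda>x h. 0"])
qed simp

lemma Ck_add: "Ck k f \<Longrightarrow> Ck k g \<Longrightarrow> Ck k (\<lambda>x. f x + g x)"
proof (induction k arbitrary: f g)
  case 0
  then show ?case by (auto intro: continuous_on_add)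
next
  case (Suc k)
  obtain f' g' where "\<And>x. (f has_derivative f' x) (at x)" "\<And>h. Ck k (\<lambda>x. f' x h)"
    "\<And>x. (g has_derivative g' x) (at x)" "\<And>h. Ck k (\<lambda>x. g' x h)"
    using Suc.prems by auto
  then show ?case
    by (auto intro!: exI[of _ "\<lambda>x h. f' x h + g' x h"] has_derivative_add Suc.IH)
qed

lemma Ck_mult: "Ck k f \<Longrightarrow> Ck k g \<Longrightarrow> Ck k (\<lambda>x. f x * g x)"
proof (induction k arbitrary: f g)
  case 0
  then show ?case by (auto intro: continuous_on_mult)
next
  case (Suc k)
  obtain f' g' where *: "\<And>x. (f has_derivative f' x) (at x)" "\<And>h. Ck k (\<lambda>x. f' x h)"
    "\<And>x. (g has_derivative g' x) (at x)" "\<And>h. Ck k (\<lambda>x. g' x h)"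
    using Suc.prems by auto
  have "Ck k f" "Ck k g"
    using Suc.prems by (auto intro: Ck_Suc_imp simp del: Ck.simps)
  then show ?case
    using * by (auto intro!: exI[of _ "\<lambda>x h. f x * g' x h + f' x h * g x"] has_derivative_mult Ck_add Suc.IH)
qed

lemma Ck_compose_affine:
  fixes L :: "'a::euclidean_space \<Rightarrow> 'b::euclidean_space"
  assumes L: "bounded_linear L"
  shows "Ck k f \<Longrightarrow> Ck k (\<lambda>x. f (L x + a))"
proof (induction k arbitrary: f)
  case 0
  then show ?case
    using linear_continuous_on[OF L]
    by (auto intro!: continuous_on_compose2[of UNIV f] continuous_intros)
next
  case (Suc k)
  obtain f' where f': "\<And>x. (f has_derivative f' x) (at x)" "\<And>h. Ck k (\<lambda>x. f' x h)"
    using Suc.prems by auto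
  have "((\<lambda>x. f (L x + a)) has_derivative (\<lambda>h. f' (L x + a) (L h))) (at x)" for x
    by (rule has_derivative_compose[OF _ f'(1), of "\<lambda>x. L x + a", simplified])
      (auto intro!: derivative_eq_intros bounded_linear_imp_has_derivative L)
  then show ?case
    using Suc.IH[OF f'(2)] by (auto intro!: exI[of _ "\<lambda>x h. f' (L x + a) (L h)"])
qed

lemma Ck_prod: "finite I \<Longrightarrow> (\<And>i. i \<in> I \<Longrightarrow> Ck k (f i)) \<Longrightarrow> Ck k (\<lambda>x. \<Prod>i\<in>I. f i x)"
  by (induction I rule: finite_induct) (auto intro: Ck_const Ck_mult)

text \<open>The functions \<open>s \<mapsto> p(1/s) exp(-1/s)\<close>, extended by zero to \<open>s \<le> 0\<close>, form a class of
  continuous functions that is closed under differentiation.\<close>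

definition flat :: "real poly \<Rightarrow> real \<Rightarrow> real"
  where "flat p s = (if s > 0 then poly p (1/s) * exp (-(1/s)) else 0)"

lemma poly_exp_tendsto_0: "((\<lambda>s. poly p s * exp (- s)) \<longlongrightarrow> 0) at_top" for p :: "real poly"
proof -
  have "((\<lambda>s. \<Sum>i\<le>degree p. coeff p i * (s ^ i * exp (- s))) \<longlongrightarrow> (\<Sum>i\<le>degree p. coeff p i * 0)) at_top"
    using tendsto_power_div_exp_0
    by (intro tendsto_sum tendsto_mult tendsto_const) (simp add: exp_minus divide_inverse)
  then show ?thesis by (simp add: poly_altdef sum_distrib_right mult.assoc)
qed

lemma flat_tendsto_0: "(flat p \<longlongrightarrow> 0) (at 0)"
proof -
  have "((\<lambda>s. poly p (inverse s) * exp (- inverse s)) \<longlongrightarrow> 0) (at_right 0)"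
    by (rule filterlim_compose[OF poly_exp_tendsto_0 filterlim_inverse_at_top_right])
  then have "(flat p \<longlongrightarrow> 0) (at_right 0)"
    by (rule Lim_transform_eventually)
      (auto simp: flat_def eventually_at_filter divide_inverse intro!: always_eventually)
  moreover have "(flat p \<longlongrightarrow> 0) (at_left 0)"
    by (rule tendsto_eventually) (auto simp: flat_def eventually_at_filter)
  ultimately show ?thesis by (simp add: filterlim_split_at)
qed

text \<open>The factor [:0, 0, 1:] is the square 1/s^2 produced by differentiating 1/s, once inside
  \<open>poly p\<close> and once, with the opposite sign, in the exponential.\<close>

lemma flat_has_derivative:
  "(flat p has_field_derivative flat ((p - pderiv p) * [:0, 0, 1:]) s) (at s)"
proof -
  consider "s > 0" | "s < 0" | "s = 0" by linarith
  then show ?thesis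
  proof cases
    case 1
    have "((\<lambda>s. poly p (1/s) * exp (-(1/s))) has_field_derivative
        flat ((p - pderiv p) * [:0, 0, 1:]) s) (at s)"
      using 1 by (auto intro!: derivative_eq_intros DERIV_chain2[OF poly_DERIV]
          simp: flat_def field_simps power2_eq_square)
    moreover have "\<forall>\<^sub>F t in nhds s. flat p t = poly p (1/t) * exp (-(1/t))"
      using eventually_nhds_in_open[of "{0<..}" s] 1
      by (auto elim!: eventually_mono simp: flat_def)
    ultimately show ?thesis
      by (subst DERIV_cong_ev[OF refl _ refl]) auto
  next
    case 2
    have "\<forall>\<^sub>F t in nhds s. flat p t = 0"
      using eventually_nhds_in_open[of "{..<0}" s] 2
      by (auto elim!: eventually_mono simp: flat_def)
    then show ?thesis
      using 2 by (subst DERIV_cong_ev[OF refl _ refl]) (auto simp: flat_def)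
  next
    case 3
    \<comment> \<open>At the origin the difference quotient is again a function of the class, so
      \<open>flat_tendsto_0\<close> yields the derivative.\<close>
    have "flat p h / h = flat (p * [:0, 1:]) h" for h
      by (simp add: flat_def)
    then have "((\<lambda>h. (flat p (0 + h) - flat p 0) / h) \<longlongrightarrow> 0) (at 0)"
      using flat_tendsto_0[of "p * [:0, 1:]"] by (simp add: flat_def[of p 0])
    then show ?thesis
      unfolding 3 DERIV_def by (simp add: flat_def[of _ 0])
  qed
qed

lemma Ck_flat: "Ck k (flat p)"
proof (induction k arbitrary: p)
  case 0
  show ?case
    by (auto intro!: continuous_at_imp_continuous_on DERIV_isCont[OF flat_has_derivative])
next
  case (Suc k)
  show ?case
    using flat_has_derivative[of p] Suc.IH Ck_mult[OF Suc.IH Ck_const]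
    by (auto simp: has_field_derivative_def
        intro!: exI[of _ "\<lambda>x h. flat ((p - pderiv p) * [:0, 0, 1:]) x * h"])
qed

text \<open>A smooth approximation of the indicator of \<open>box a b\<close> from below. Each
  factor vanishes up to distance 1/k from its face, which keeps the closed support inside the open
  box, and tends to 1 beyond it as k grows. For k = 0 every argument is -1 and the product is
  zero.\<close>

definition bump :: "nat \<Rightarrow> 'a::euclidean_space \<Rightarrow> 'a \<Rightarrow> 'a \<Rightarrow> real"
  where "bump k a b x = (\<Prod>i\<in>Basis. flat 1 (k * ((x - a) \<bullet> i) - 1) * flat 1 (k * ((b - x) \<bullet> i) - 1))"

lemma Ck_bump: "Ck m (bump k a b)"
proof -
  have 1: "Ck m (\<lambda>x. flat 1 (k * ((x - a) \<bullet> i) - 1))" for i :: 'a and a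
  proof -
    have "bounded_linear (\<lambda>x. k * (x \<bullet> i))"
      by (intro bounded_linear_intros)
    from Ck_compose_affine[OF this Ck_flat, of m 1 "- k * (a \<bullet> i) - 1"]
    show ?thesis by (simp add: algebra_simps inner_diff_left)
  qed
  have 2: "Ck m (\<lambda>x. flat 1 (k * ((b - x) \<bullet> i) - 1))" for i :: 'a
  proof -
    have "bounded_linear (\<lambda>x. - (k * (x \<bullet> i)))"
      by (intro bounded_linear_minus bounded_linear_const_mult bounded_linear_inner_left)
    from Ck_compose_affine[OF this Ck_flat, of m 1 "k * (b \<bullet> i) - 1"]
    show ?thesis by (simp add: algebra_simps inner_diff_left)
  qed
  show ?thesis
    unfolding bump_def[abs_def] by (intro Ck_prod Ck_mult 1 2) simp
qed

lemma flat_1_bounds: "0 \<le> flat 1 s" "flat 1 s \<le> 1"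
  by (auto simp: flat_def)

lemma bump_bounds: "0 \<le> bump k a b x" "bump k a b x \<le> 1"
  unfolding bump_def
  by (rule prod_nonneg, rule mult_nonneg_nonneg, rule flat_1_bounds, rule flat_1_bounds)
    (rule prod_le_1, intro conjI mult_nonneg_nonneg mult_le_one flat_1_bounds)

lemma bump_support: "closure {x. bump k a b x \<noteq> 0} \<subseteq> box a b"
proof (cases "k = 0")
  case True
  have "{x. bump k a b x \<noteq> 0} = {}"
    using nonempty_Basis by (auto simp: bump_def True flat_def)
  then show ?thesis by simp
next
  case False
  then have k: "real k > 0" by simp
  let ?C = "\<Inter>i\<in>Basis. {x. (a \<bullet> i + 1/k) \<le> x \<bullet> i \<and> x \<bullet> i \<le> b \<bullet> i - 1/k}"
  have "{x. bump k a b x \<noteq> 0} \<subseteq> ?C"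
  proof (intro subsetI INT_I CollectI)
    fix x i :: 'a assume "x \<in> {x. bump k a b x \<noteq> 0}" and i: "i \<in> Basis"
    then have "flat 1 (k * ((x - a) \<bullet> i) - 1) \<noteq> 0" "flat 1 (k * ((b - x) \<bullet> i) - 1) \<noteq> 0"
      by (auto simp: bump_def)
    then have "k * ((x - a) \<bullet> i) - 1 > 0" "k * ((b - x) \<bullet> i) - 1 > 0"
      by (auto simp: flat_def split: if_splits)
    then show "(a \<bullet> i + 1/k) \<le> x \<bullet> i \<and> x \<bullet> i \<le> b \<bullet> i - 1/k"
      using k by (simp add: field_simps inner_diff_left)
  qed
  moreover have "closed ?C"
    by (intro closed_INT ballI closed_Collect_conj closed_Collect_le continuous_intros)
  ultimately have "closure {x. bump k a b x \<noteq> 0} \<subseteq> ?C"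
    by (rule closure_minimal)
  also have "\<dots> \<subseteq> box a b"
  proof
    fix x assume x: "x \<in> ?C"
    show "x \<in> box a b"
      unfolding mem_box
    proof
      fix i :: 'a assume "i \<in> Basis"
      then have "a \<bullet> i + 1/k \<le> x \<bullet> i" "x \<bullet> i \<le> b \<bullet> i - 1/k"
        using x by auto
      moreover have "1/real k > 0" using k by simp
      ultimately show "a \<bullet> i < x \<bullet> i \<and> x \<bullet> i < b \<bullet> i" by linarith
    qed
  qed
  finally show ?thesis .
qed

lemma bump_tendsto: "(\<lambda>k. bump k a b x) \<longlonglongrightarrow> indicator (box a b) x"
proof (cases "x \<in> box a b")
  case True
  have "(\<lambda>k. bump k a b x) \<longlonglongrightarrow> (\<Prod>i\<in>(Basis::'a set). 1 * 1)"
    unfolding bump_def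
  proof (intro tendsto_prod tendsto_mult)
    have f: "(\<lambda>k. flat 1 (real k * r - 1)) \<longlonglongrightarrow> 1" if r: "r > 0" for r
    proof -
      have lim: "filterlim (\<lambda>k. real k * r - 1) at_top sequentially"
      proof -
        have "filterlim (\<lambda>k. - 1 + r * real k) at_top sequentially"
          by (rule filterlim_tendsto_add_at_top[OF tendsto_const
                filterlim_tendsto_pos_mult_at_top[OF tendsto_const r filterlim_real_sequentially]])
        then show ?thesis by (simp add: algebra_simps)
      qed
      have "((\<lambda>s::real. exp (- inverse s)) \<longlongrightarrow> exp (- 0)) at_top"
        by (intro tendsto_intros tendsto_inverse_0_at_top filterlim_ident)
      then have "((\<lambda>s::real. exp (- (1/s))) \<longlongrightarrow> 1) at_top"
        by (simp add: inverse_eq_divide)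
      then have "((flat 1) \<longlongrightarrow> 1) at_top"
        by (rule Lim_transform_eventually) (auto intro!: eventually_mono[OF eventually_gt_at_top[of 0]] simp: flat_def)
      from filterlim_compose[OF this lim] show ?thesis .
    qed
    fix i :: 'a assume "i \<in> Basis"
    then show "(\<lambda>k. flat 1 (real k * ((x - a) \<bullet> i) - 1)) \<longlonglongrightarrow> 1" "(\<lambda>k. flat 1 (real k * ((b - x) \<bullet> i) - 1)) \<longlonglongrightarrow> 1"
      using True by (auto intro!: f simp: box_def inner_diff_left)
  qed
  then show ?thesis using True by simp
next
  case False
  then have "bump k a b x = 0" for k
    using bump_support[of k a b] closure_subset[of "{x. bump k a b x \<noteq> 0}"] by blast
  then show ?thesis using False by simp
qed

lemma bump_test_function:
  assumes "box a b \<subseteq> S"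
  shows "bump k a b \<in> test_functions S"
proof -
  have "bounded (closure {x. bump k a b x \<noteq> 0})"
    by (rule bounded_subset[OF bounded_box bump_support])
  then show ?thesis
    unfolding test_functions_def compact_eq_bounded_closed
    by (intro CollectI conjI allI Ck_bump closed_closure order_trans[OF bump_support assms])
qed

subsection \<open>Test functions\<close>

lemma test_functionsI:
  assumes "\<And>k. Ck k \<phi>" "compact K" "K \<subseteq> S" "\<And>x. x \<notin> K \<Longrightarrow> \<phi> x = 0"
  shows "\<phi> \<in> test_functions S"
proof -
  have sub: "closure {x. \<phi> x \<noteq> 0} \<subseteq> K"
    using assms(4) by (intro closure_minimal compact_imp_closed assms(2)) auto
  then have "compact (closure {x. \<phi> x \<noteq> 0})"
    using compact_Int_closed[OF assms(2) closed_closure, of "{x. \<phi> x \<noteq> 0}"] by (simp add: inf_absorb2)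
  then show ?thesis
    unfolding test_functions_def using assms(1,3) sub by blast
qed

lemma test_functionsE:
  assumes "\<phi> \<in> test_functions S"
  obtains K where "compact K" "K \<subseteq> S" "\<And>x. x \<notin> K \<Longrightarrow> \<phi> x = 0"
  using assms closure_subset[of "{x. \<phi> x \<noteq> 0}"]
  by (intro that[of "closure {x. \<phi> x \<noteq> 0}"]) (auto simp: test_functions_def)

lemma test_functions_Ck: "\<phi> \<in> test_functions S \<Longrightarrow> Ck k \<phi>"
  by (simp add: test_functions_def)

lemma test_functions_outside: "\<phi> \<in> test_functions S \<Longrightarrow> x \<notin> S \<Longrightarrow> \<phi> x = 0"
  by (metis test_functionsE subsetD)

lemma test_functions_continuous: "\<phi> \<in> test_functions S \<Longrightarrow> continuous_on UNIV \<phi>"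
  by (rule Ck_continuous[OF test_functions_Ck])

lemma test_functions_measurable: "\<phi> \<in> test_functions S \<Longrightarrow> \<phi> \<in> borel_measurable borel"
  by (intro borel_measurable_continuous_onI test_functions_continuous)

lemma test_functions_has_derivative:
  assumes "\<phi> \<in> test_functions S"
  shows "(\<phi> has_derivative frechet_derivative \<phi> (at x)) (at x)"
proof -
  obtain f' where "\<And>x. (\<phi> has_derivative f' x) (at x)"
    using test_functions_Ck[OF assms, of "Suc 0"] by auto
  then show ?thesis
    by (metis differentiableI frechet_derivative_works)
qed

lemma test_functions_mono: "\<phi> \<in> test_functions S \<Longrightarrow> S \<subseteq> S' \<Longrightarrow> \<phi> \<in> test_functions S'"
  by (auto simp: test_functions_def)

lemma test_functions_frechet_derivative:
  assumes "\<phi> \<in> test_functions S"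
  shows "(\<lambda>x. frechet_derivative \<phi> (at x) h) \<in> test_functions S"
proof -
  obtain K where K: "compact K" "K \<subseteq> S" "\<And>x. x \<notin> K \<Longrightarrow> \<phi> x = 0"
    using test_functionsE[OF assms] by blast
  show ?thesis
  proof (rule test_functionsI[OF _ K(1,2)])
    fix k
    obtain f' where f': "\<And>x. (\<phi> has_derivative f' x) (at x)" "\<And>h. Ck k (\<lambda>x. f' x h)"
      using test_functions_Ck[OF assms, of "Suc k"] by auto
    then have "f' x = frechet_derivative \<phi> (at x)" for x
      by (metis frechet_derivative_at)
    then show "Ck k (\<lambda>x. frechet_derivative \<phi> (at x) h)"
      using f'(2)[of h] by simp
  next
    fix x assume x: "x \<notin> K"
    have "\<forall>\<^sub>F y in nhds x. y \<in> - K"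
      using x K(1) by (intro eventually_nhds_in_open) (auto intro: open_Compl compact_imp_closed)
    have "(\<phi> has_derivative (\<lambda>_. 0)) (at x)"
      by (rule has_derivative_transform_within_open[of "\<lambda>_. 0" _ _ _ "- K"])
        (use x K in \<open>auto intro: open_Compl compact_imp_closed\<close>)
    then show "frechet_derivative \<phi> (at x) h = 0"
      by (metis frechet_derivative_at)
  qed
qed

lemma test_functions_add:
  assumes "\<phi> \<in> test_functions S" "\<psi> \<in> test_functions S"
  shows "(\<lambda>x. \<phi> x + \<psi> x) \<in> test_functions S"
proof -
  obtain K where K: "compact K" "K \<subseteq> S" "\<And>x. x \<notin> K \<Longrightarrow> \<phi> x = 0"
    using test_functionsE[OF assms(1)] by blast
  obtain K' where K': "compact K'" "K' \<subseteq> S" "\<And>x. x \<notin> K' \<Longrightarrow> \<psi> x = 0"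
    using test_functionsE[OF assms(2)] by blast
  show ?thesis
    by (rule test_functionsI[OF Ck_add[OF test_functions_Ck[OF assms(1)] test_functions_Ck[OF assms(2)]]
          compact_Un[OF K(1) K'(1)]]) (use K K' in auto)
qed

lemma test_functions_mult:
  assumes "\<phi> \<in> test_functions S" "\<And>k. Ck k f"
  shows "(\<lambda>x. f x * \<phi> x) \<in> test_functions S"
proof -
  obtain K where K: "compact K" "K \<subseteq> S" "\<And>x. x \<notin> K \<Longrightarrow> \<phi> x = 0"
    using test_functionsE[OF assms(1)] by blast
  show ?thesis
    by (rule test_functionsI[OF Ck_mult[OF assms(2) test_functions_Ck[OF assms(1)]] K(1,2)])
      (use K in auto)
qed

lemma test_functions_zero: "(\<lambda>_. 0) \<in> test_functions S"
  by (rule test_functionsI[OF Ck_const, of "{}"]) auto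

lemma test_functions_shift:
  fixes a :: "'a::euclidean_space"
  assumes "\<phi> \<in> test_functions S"
  shows "(\<lambda>x. \<phi> (x + a)) \<in> test_functions {x. x + a \<in> S}"
proof -
  obtain K where K: "compact K" "K \<subseteq> S" "\<And>x. x \<notin> K \<Longrightarrow> \<phi> x = 0"
    using test_functionsE[OF assms] by blast
  have "Ck k (\<lambda>x. \<phi> (x + a))" for k
    using Ck_compose_affine[OF bounded_linear_ident test_functions_Ck[OF assms]] .
  moreover have "compact ((\<lambda>x. x - a) ` K)"
    by (intro compact_continuous_image continuous_intros K(1))
  moreover have "(\<lambda>x. x - a) ` K \<subseteq> {x. x + a \<in> S}"
    using K(2) by auto
  moreover have "\<phi> (x + a) = 0" if "x \<notin> (\<lambda>x. x - a) ` K" for x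
    using that K(3)[of "x + a"] by (auto simp: image_iff) (metis add_diff_cancel)
  ultimately show ?thesis by (rule test_functionsI)
qed

lemma test_functions_tensor:
  assumes "\<eta> \<in> test_functions I" "\<psi> \<in> test_functions S"
  shows "(\<lambda>z. \<eta> (fst z) * \<psi> (snd z)) \<in> test_functions (I \<times> S)"
proof -
  obtain K where K: "compact K" "K \<subseteq> I" "\<And>x. x \<notin> K \<Longrightarrow> \<eta> x = 0"
    using test_functionsE[OF assms(1)] by blast
  obtain K' where K': "compact K'" "K' \<subseteq> S" "\<And>x. x \<notin> K' \<Longrightarrow> \<psi> x = 0"
    using test_functionsE[OF assms(2)] by blast
  have "Ck k (\<lambda>z. \<eta> (fst z))" "Ck k (\<lambda>z. \<psi> (snd z))" for k
    using Ck_compose_affine[OF bounded_linear_fst test_functions_Ck[OF assms(1)], where a=0]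
      Ck_compose_affine[OF bounded_linear_snd test_functions_Ck[OF assms(2)], where a=0] by auto
  then show ?thesis
    by (intro test_functionsI[OF Ck_mult compact_Times[OF K(1) K'(1)]])
      (use K K' in \<open>auto simp: mem_Times_iff\<close>)
qed

lemma test_functions_section:
  fixes \<phi> :: "'a::euclidean_space \<times> 'b::euclidean_space \<Rightarrow> real"
  assumes "\<phi> \<in> test_functions (I \<times> S)"
  shows "(\<lambda>x. \<phi> (t, x)) \<in> test_functions S"
proof -
  obtain K where K: "compact K" "K \<subseteq> I \<times> S" "\<And>x. x \<notin> K \<Longrightarrow> \<phi> x = 0"
    using test_functionsE[OF assms] by blast
  have "Ck k (\<lambda>x. \<phi> (t, x))" for k
    using Ck_compose_affine[of "\<lambda>x. (0, x)", OF _ test_functions_Ck[OF assms], where a="(t, 0)"]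
    by (simp add: bounded_linear_Pair bounded_linear_zero bounded_linear_ident)
  moreover have "compact (snd ` K)"
    by (intro compact_continuous_image continuous_intros K(1))
  moreover have "\<phi> (t, x) = 0" if "x \<notin> snd ` K" for x
    using that K(3)[of "(t, x)"] by (force simp: image_iff)
  ultimately show ?thesis
    using K(2) by (intro test_functionsI[of _ "snd ` K"]) auto
qed

lemma test_functions_bounded:
  assumes "\<phi> \<in> test_functions S"
  obtains M where "M > 0" "\<And>x. \<bar>\<phi> x\<bar> \<le> M"
proof -
  obtain K where K: "compact K" "K \<subseteq> S" "\<And>x. x \<notin> K \<Longrightarrow> \<phi> x = 0"
    using test_functionsE[OF assms] by blast
  have "compact (\<phi> ` K)"
    by (intro compact_continuous_image K(1) continuous_on_subset[OF test_functions_continuous[OF assms]]) auto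
  then obtain M where M: "M > 0" "\<And>y. y \<in> \<phi> ` K \<Longrightarrow> norm y \<le> M"
    using bounded_pos[of "\<phi> ` K"] compact_imp_bounded by auto
  show ?thesis
  proof (rule that[OF M(1)])
    fix x show "\<bar>\<phi> x\<bar> \<le> M"
      using M(2)[of "\<phi> x"] K(3)[of x] M(1) by (cases "x \<in> K") auto
  qed
qed

lemma bounded_support_integrable:
  fixes f :: "'a::euclidean_space \<Rightarrow> 'b::{banach, second_countable_topology}"
  assumes [measurable]: "f \<in> borel_measurable borel" and "\<And>x. norm (f x) \<le> M" "\<And>x. x \<notin> cball 0 R \<Longrightarrow> f x = 0"
  shows "integrable lborel f"
proof (rule Bochner_Integration.integrable_bound)
  have "emeasure lborel (cball (0::'a) R) < \<infinity>"
    by (intro emeasure_compact_finite compact_cball)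
  then show "integrable lborel (\<lambda>x::'a. M * indicator (cball 0 R) x)"
    by (simp add: integrable_indicator_iff)
  show "AE x in lborel. norm (f x) \<le> norm (M * indicator (cball 0 R) x)"
    using assms(2,3) by (intro AE_I2) (auto simp: indicator_def intro: order_trans[OF _ abs_ge_self])
qed simp

lemma test_functions_ball:
  assumes "\<phi> \<in> test_functions S"
  obtains R where "R > 0" "\<And>x. x \<notin> cball 0 R \<Longrightarrow> \<phi> x = 0"
proof -
  obtain K where K: "compact K" "K \<subseteq> S" "\<And>x. x \<notin> K \<Longrightarrow> \<phi> x = 0"
    using test_functionsE[OF assms] by blast
  obtain R where "R > 0" "\<And>y. y \<in> K \<Longrightarrow> norm y \<le> R"
    using bounded_pos[of K] compact_imp_bounded[OF K(1)] by auto
  then show ?thesis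
    using K(3) by (intro that[of R]) auto
qed

lemma test_functions_integrable:
  assumes "\<phi> \<in> test_functions S"
  shows "integrable lborel \<phi>"
proof -
  obtain M where "\<And>x. \<bar>\<phi> x\<bar> \<le> M" using test_functions_bounded[OF assms] by blast
  moreover obtain R where "\<And>x. x \<notin> cball 0 R \<Longrightarrow> \<phi> x = 0" using test_functions_ball[OF assms] by blast
  ultimately show ?thesis
    using test_functions_measurable[OF assms] by (intro bounded_support_integrable[of \<phi> M R]) auto
qed

lemma test_functions_square_integrable:
  assumes "\<phi> \<in> test_functions S"
  shows "square_integrable \<phi>"
proof -
  have "(\<lambda>x. \<phi> x * \<phi> x) \<in> test_functions S"
    by (rule test_functions_mult[OF assms test_functions_Ck[OF assms]])
  from test_functions_integrable[OF this] show ?thesis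
    using test_functions_measurable[OF assms] by (simp add: square_integrable_def power2_eq_square)
qed

lemma square_integrable_vec:
  fixes f :: "'a::euclidean_space \<Rightarrow> real^'n"
  assumes "\<And>i. square_integrable (\<lambda>x. f x $ i)"
  shows "square_integrable f"
proof -
  have "f \<in> borel_measurable borel"
    using assms by (subst borel_measurable_euclidean_space)
      (auto simp: Basis_vec_def inner_axis square_integrable_def)
  moreover have "integrable lborel (\<lambda>x. (norm (f x))\<^sup>2)"
  proof -
    have "(norm (f x))\<^sup>2 = (\<Sum>i\<in>UNIV. (norm (f x $ i))\<^sup>2)" for x
      unfolding power2_norm_eq_inner by (simp add: inner_vec_def)
    then show ?thesis
      using assms by (auto simp: square_integrable_def)
  qed
  ultimately show ?thesis by (simp add: square_integrable_def)
qed

lemma square_integrable_vec_nth: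
  fixes f :: "'a::euclidean_space \<Rightarrow> real^'n"
  assumes "square_integrable f"
  shows "square_integrable (\<lambda>x. f x $ i)"
proof -
  have [measurable]: "f \<in> borel_measurable borel"
    using assms by (simp add: square_integrable_def)
  have "(\<lambda>x. f x \<bullet> axis i 1) \<in> borel_measurable borel" by measurable
  then have "(\<lambda>x. f x $ i) \<in> borel_measurable borel" by (simp add: inner_axis)
  then show ?thesis
    by (rule square_integrable_AE_cong[OF assms, where C=1]) (auto simp: component_le_norm_cart)
qed

lemma grad_square_integrable:
  "\<phi> \<in> test_functions S \<Longrightarrow> square_integrable (grad \<phi>)"
  by (rule square_integrable_vec)
    (simp add: grad_def test_functions_square_integrable[OF test_functions_frechet_derivative])

lemma dx_square_integrable:
  "\<phi> \<in> test_functions S \<Longrightarrow> square_integrable (dx \<phi>)"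
  by (rule square_integrable_vec)
    (simp add: dx_def test_functions_square_integrable[OF test_functions_frechet_derivative])

lemma dt_test_function: "\<phi> \<in> test_functions S \<Longrightarrow> dt \<phi> \<in> test_functions S"
  unfolding dt_def[abs_def] by (rule test_functions_frechet_derivative)

lemma dt_square_integrable: "\<phi> \<in> test_functions S \<Longrightarrow> square_integrable (dt \<phi>)"
  by (rule test_functions_square_integrable[OF dt_test_function])

lemma grad_outside:
  assumes "\<phi> \<in> test_functions S" "x \<notin> S"
  shows "grad \<phi> x = 0"
  using test_functions_outside[OF test_functions_frechet_derivative[OF assms(1)] assms(2)]
  by (simp add: grad_def vec_eq_iff)

lemma dx_outside:
  assumes "\<phi> \<in> test_functions S" "z \<notin> S"
  shows "dx \<phi> z = 0"
  using test_functions_outside[OF test_functions_frechet_derivative[OF assms(1)] assms(2)]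
  by (simp add: dx_def vec_eq_iff)

text \<open>Difference quotients integrate to zero by translation invariance, and they converge
  dominatedly to the directional derivative. This is the only form of integration by parts used for
  test functions.\<close>

lemma integral_frechet_derivative:
  assumes \<phi>: "\<phi> \<in> test_functions S"
  shows "(LINT x|lborel. frechet_derivative \<phi> (at x) h) = 0"
proof -
  have D: "(\<lambda>x. frechet_derivative \<phi> (at x) h) \<in> test_functions S"
    by (rule test_functions_frechet_derivative[OF \<phi>])
  obtain M where M: "M > 0" "\<And>x. \<bar>frechet_derivative \<phi> (at x) h\<bar> \<le> M"
    using test_functions_bounded[OF D] by blast
  obtain R where R: "R > 0" "\<And>x. x \<notin> cball 0 R \<Longrightarrow> \<phi> x = 0"
    using test_functions_ball[OF \<phi>] by blast
  define s where "s n = inverse (real (Suc n))" for n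
  have s: "s \<longlonglongrightarrow> 0" "\<And>n. s n > 0" "\<And>n. s n \<le> 1"
    using LIMSEQ_inverse_real_of_nat by (auto simp: s_def[abs_def] inverse_le_1_iff)
  have line: "((\<lambda>r. \<phi> (x + r *\<^sub>R h)) has_field_derivative frechet_derivative \<phi> (at (x + r *\<^sub>R h)) h) (at r)" for x r
  proof -
    have "((\<lambda>r. \<phi> (x + r *\<^sub>R h)) has_derivative (\<lambda>k. frechet_derivative \<phi> (at (x + r *\<^sub>R h)) (k *\<^sub>R h))) (at r)"
      by (rule has_derivative_compose[OF _ test_functions_has_derivative[OF \<phi>], of "\<lambda>r. x + r *\<^sub>R h"])
        (auto intro!: derivative_eq_intros)
    moreover have "linear (frechet_derivative \<phi> (at (x + r *\<^sub>R h)))"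
      using test_functions_has_derivative[OF \<phi>] has_derivative_linear by blast
    then have "(\<lambda>k. frechet_derivative \<phi> (at (x + r *\<^sub>R h)) (k *\<^sub>R h)) = (*) (frechet_derivative \<phi> (at (x + r *\<^sub>R h)) h)"
      by (intro ext) (simp add: linear_cmul)
    ultimately show ?thesis
      by (simp add: has_field_derivative_def)
  qed
  have lim: "(\<lambda>n. LINT x|lborel. (\<phi> (x + s n *\<^sub>R h) - \<phi> x) / s n) \<longlonglongrightarrow> (LINT x|lborel. frechet_derivative \<phi> (at x) h)"
  \<comment> \<open>Steps are at most 1, so the quotients live in the ball of radius R + norm h; the
    mean value theorem bounds them there by \<open>M\<close>.\<close>
  proof (rule Bochner_Integration.integral_dominated_convergence[where w="\<lambda>x. M * indicator (cball 0 (R + norm h)) x"])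
    show "(\<lambda>x. frechet_derivative \<phi> (at x) h) \<in> borel_measurable lborel"
      using test_functions_measurable[OF D] by simp
    have [measurable]: "\<phi> \<in> borel_measurable borel"
      by (rule test_functions_measurable[OF \<phi>])
    show "(\<lambda>x. (\<phi> (x + s n *\<^sub>R h) - \<phi> x) / s n) \<in> borel_measurable lborel" for n
      by measurable
    have "emeasure lborel (cball (0::'a) (R + norm h)) < \<infinity>"
      by (intro emeasure_compact_finite compact_cball)
    then show "integrable lborel (\<lambda>x::'a. M * indicator (cball 0 (R + norm h)) x)"
      by (simp add: integrable_indicator_iff)
    show "AE x in lborel. (\<lambda>n. (\<phi> (x + s n *\<^sub>R h) - \<phi> x) / s n) \<longlonglongrightarrow> frechet_derivative \<phi> (at x) h"
    proof (rule AE_I2)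
      fix x
      have "((\<lambda>r. (\<phi> (x + r *\<^sub>R h) - \<phi> x) / r) \<longlongrightarrow> frechet_derivative \<phi> (at x) h) (at 0)"
        using line[of x 0] by (simp add: DERIV_def)
      moreover have "filterlim s (at 0) sequentially"
        using s(1,2) by (auto simp: filterlim_at intro!: always_eventually) (metis less_irrefl)
      ultimately show "(\<lambda>n. (\<phi> (x + s n *\<^sub>R h) - \<phi> x) / s n) \<longlonglongrightarrow> frechet_derivative \<phi> (at x) h"
        by (rule filterlim_compose)
    qed
    show "AE x in lborel. norm ((\<phi> (x + s n *\<^sub>R h) - \<phi> x) / s n) \<le> M * indicator (cball 0 (R + norm h)) x" for n
    proof (rule AE_I2)
      fix x
      show "norm ((\<phi> (x + s n *\<^sub>R h) - \<phi> x) / s n) \<le> M * indicator (cball 0 (R + norm h)) x"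
      proof (cases "x \<in> cball 0 (R + norm h)")
        case True
        obtain z where "z > 0" "\<phi> (x + s n *\<^sub>R h) - \<phi> (x + 0 *\<^sub>R h) = (s n - 0) * frechet_derivative \<phi> (at (x + z *\<^sub>R h)) h"
          using MVT2[OF s(2)[of n], of "\<lambda>r. \<phi> (x + r *\<^sub>R h)" "\<lambda>r. frechet_derivative \<phi> (at (x + r *\<^sub>R h)) h"] line
          by blast
        then have "(\<phi> (x + s n *\<^sub>R h) - \<phi> x) / s n = frechet_derivative \<phi> (at (x + z *\<^sub>R h)) h"
          using s(2)[of n] by (simp add: field_simps)
        then show ?thesis using M(2) True by simp
      next
        case False
        have "norm (s n *\<^sub>R h) \<le> norm h"
          using s(2,3)[of n] by (simp add: mult_left_le_one_le)
        moreover have "norm x > R + norm h" using False by simp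
        moreover have "norm x - norm (s n *\<^sub>R h) \<le> norm (x + s n *\<^sub>R h)"
          using norm_triangle_ineq2[of x "- (s n *\<^sub>R h)"] by simp
        ultimately have "norm (x + s n *\<^sub>R h) > R" "norm x > R"
          using norm_ge_zero[of h] by linarith+
        then show ?thesis using R(2) False by simp
      qed
    qed
  qed
  have "(LINT x|lborel. (\<phi> (x + s n *\<^sub>R h) - \<phi> x) / s n) = 0" for n
  proof -
    have "integrable lborel \<phi>" by (rule test_functions_integrable[OF \<phi>])
    then show ?thesis
      using integral_shift[OF test_functions_measurable[OF \<phi>], of "s n *\<^sub>R h"]
      by (simp add: integrable_shift)
  qed
  then show ?thesis
    using lim LIMSEQ_const_iff[of 0 "LINT x|lborel. frechet_derivative \<phi> (at x) h"] by presburger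
qed

subsection \<open>The fundamental lemma of the calculus of variations\<close>

text \<open>The positive and negative parts of \<open>f\<close> are densities of two measures that
  agree on boxes. Boxes are stable under intersection and generate the Borel sets, so the measures
  agree, and then so do the densities almost everywhere.\<close>

lemma box_integrals_zero_imp_AE_zero:
  fixes f :: "'a::euclidean_space \<Rightarrow> real"
  assumes f: "integrable lborel f"
    and zero: "\<And>a b. (LINT x|lborel. f x * indicator (box a b) x) = 0"
  shows "AE x in lborel. f x = 0"
proof -
  have [measurable]: "f \<in> borel_measurable borel"
    using borel_measurable_integrable[OF f] by simp
  let ?p = "\<lambda>x. ennreal (max 0 (f x))" and ?m = "\<lambda>x. ennreal (max 0 (- f x))"
  have ib: "integrable lborel (\<lambda>x. max 0 (s * f x) * indicator B x)" if [measurable]: "B \<in> sets borel" and "\<bar>s\<bar> = 1" for B s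
  proof (rule Bochner_Integration.integrable_bound[OF f])
    have "s * f x \<le> \<bar>f x\<bar>" for x
      using that(2) abs_ge_self[of "s * f x"] by (simp add: abs_mult)
    then show "AE x in lborel. norm (max 0 (s * f x) * indicator B x) \<le> norm (f x)"
      by (auto simp: indicator_def)
  qed measurable
  have nn: "(\<integral>\<^sup>+x. ennreal (max 0 (s * f x)) * indicator B x \<partial>lborel) = ennreal (LINT x|lborel. max 0 (s * f x) * indicator B x)"
    if [measurable]: "B \<in> sets borel" and "\<bar>s\<bar> = 1" for B s
    by (subst nn_integral_eq_integral[OF ib[OF that], symmetric])
      (auto intro!: nn_integral_cong simp: indicator_def)
  have eq: "density lborel ?p = density lborel ?m"
  proof (rule measure_eqI_generator_eq)
    let ?E = "range (\<lambda>(a, b). box a b::'a set)"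
    show "Int_stable ?E"
      by (auto simp: Int_stable_def box_Int_box)
    show "?E \<subseteq> Pow UNIV" "sets (density lborel ?p) = sigma_sets UNIV ?E" "sets (density lborel ?m) = sigma_sets UNIV ?E"
      by (simp_all add: borel_eq_box)
    let ?A = "\<lambda>n::nat. box (- (real n *\<^sub>R One)) (real n *\<^sub>R One) :: 'a set"
    show "range ?A \<subseteq> ?E" "(\<Union>i. ?A i) = UNIV"
      unfolding UN_box_eq_UNIV by auto
    show "emeasure (density lborel ?p) (?A i) \<noteq> \<infinity>" for i
      using nn[of "?A i" 1] by (simp add: emeasure_density)
    show "emeasure (density lborel ?p) X = emeasure (density lborel ?m) X" if XE: "X \<in> ?E" for X
    proof -
      obtain p :: "'a \<times> 'a" where "X = (\<lambda>(a, b). box a b) p" using XE by blast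
      then obtain a b where X: "X = box a b" by (metis case_prod_beta)
      have [measurable]: "X \<in> sets borel" by (simp add: X)
      have "0 = (LINT x|lborel. f x * indicator X x)"
        by (simp only: zero X)
      also have "\<dots> = (LINT x|lborel. max 0 (1 * f x) * indicator X x - max 0 (-1 * f x) * indicator X x)"
        by (intro Bochner_Integration.integral_cong) (auto simp: indicator_def)
      also have "\<dots> = (LINT x|lborel. max 0 (1 * f x) * indicator X x) - (LINT x|lborel. max 0 (-1 * f x) * indicator X x)"
        by (intro Bochner_Integration.integral_diff ib) auto
      finally show ?thesis
        using nn[of X 1] nn[of X "-1"] by (simp add: emeasure_density)
    qed
  qed
  have "AE x in lborel. ?p x = ?m x"
    by (rule sigma_finite_measure.density_unique[OF sigma_finite_lborel _ _ eq]) auto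
  then show ?thesis
    by eventually_elim (auto simp: max_def split: if_splits)
qed

text \<open>Bump functions reach the indicators of boxes inside \<open>S\<close> by dominated
  convergence. An open set is a countable union of such boxes, and inside one of them the box
  criterion applies since the intersection of two boxes is a box.\<close>

lemma fundamental_lemma:
  fixes u :: "('a::euclidean_space, real) L2"
  assumes S: "open S"
    and zero: "\<And>\<phi>. \<phi> \<in> test_functions S \<Longrightarrow> (LINT x|lborel. rep_L2 u x * \<phi> x) = 0"
  shows "AE x in lborel. x \<in> S \<longrightarrow> rep_L2 u x = 0"
proof -
  have sqi: "square_integrable (indicator (box a b) :: 'a \<Rightarrow> real)" for a b
  proof -
    have "(norm (indicator (box a b) x :: real))\<^sup>2 = indicator (box a b) x" for x :: 'a
      by (auto simp: indicator_def)
    then show ?thesis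
      by (simp add: square_integrable_def integrable_indicator_iff emeasure_lborel_box_eq)
  qed
  have iub: "integrable lborel (\<lambda>x. rep_L2 u x * indicator (box a b) x)" for a b
    using square_integrable_inner[OF square_integrable_rep[of u] sqi] by simp
  have box0: "(LINT x|lborel. rep_L2 u x * indicator (box a b) x) = 0" if "box a b \<subseteq> S" for a b
  proof -
    have "(\<lambda>k. LINT x|lborel. rep_L2 u x * bump k a b x) \<longlonglongrightarrow> (LINT x|lborel. rep_L2 u x * indicator (box a b) x)"
    proof (rule Bochner_Integration.integral_dominated_convergence[where w="\<lambda>x. \<bar>rep_L2 u x * indicator (box a b) x\<bar>"])
      show "(\<lambda>x. rep_L2 u x * bump k a b x) \<in> borel_measurable lborel" for k
        using test_functions_measurable[OF bump_test_function[OF order_refl], of k a b] by simp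
      show "AE x in lborel. (\<lambda>k. rep_L2 u x * bump k a b x) \<longlonglongrightarrow> rep_L2 u x * indicator (box a b) x"
        by (intro AE_I2 tendsto_intros bump_tendsto)
      show "AE x in lborel. norm (rep_L2 u x * bump k a b x) \<le> \<bar>rep_L2 u x * indicator (box a b) x\<bar>" for k
      proof (rule AE_I2)
        fix x
        show "norm (rep_L2 u x * bump k a b x) \<le> \<bar>rep_L2 u x * indicator (box a b) x\<bar>"
          using bump_bounds[of k a b x] test_functions_outside[OF bump_test_function[OF order_refl], of x a b k]
          by (cases "x \<in> box a b") (auto simp: abs_mult mult_left_le)
      qed
    qed (use iub in auto)
    then show ?thesis
      using zero[OF bump_test_function[OF that]] by (simp add: LIMSEQ_const_iff)
  qed
  obtain \<D> where D: "countable \<D>" "\<D> \<subseteq> Pow S" "\<And>X. X \<in> \<D> \<Longrightarrow> \<exists>a b. X = box a b" "\<Union>\<D> = S"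
    using open_countable_Union_open_box[OF S] by blast
  have "AE x in lborel. x \<in> X \<longrightarrow> rep_L2 u x = 0" if X: "X \<in> \<D>" for X
  proof -
    obtain a b where ab: "X = box a b" using D(3)[OF X] by blast
    have "AE x in lborel. rep_L2 u x * indicator (box a b) x = 0"
    proof (rule box_integrals_zero_imp_AE_zero[OF iub])
      fix c d :: 'a
      obtain p q where pq: "box a b \<inter> box c d = box p q" by (rule that[OF box_Int_box])
      have "(LINT x|lborel. rep_L2 u x * indicator (box a b) x * indicator (box c d) x)
          = (LINT x|lborel. rep_L2 u x * indicator (box p q) x)"
        by (simp add: pq[symmetric] indicator_inter_arith mult.assoc)
      also have "\<dots> = 0"
        by (rule box0) (use pq D(2) X ab in auto)
      finally show "(LINT x|lborel. rep_L2 u x * indicator (box a b) x * indicator (box c d) x) = 0" .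
    qed
    then show ?thesis
      by eventually_elim (auto simp: ab indicator_def split: if_splits)
  qed
  then have "AE x in lborel. \<forall>X\<in>\<D>. x \<in> X \<longrightarrow> rep_L2 u x = 0"
    using D(1) by (subst AE_ball_countable) auto
  then show ?thesis
    by eventually_elim (use D(4) in blast)
qed

section \<open>Space-time classes viewed as functions of time with values in L2\<close>

subsection \<open>Time sections\<close>

lemma AE_lborel_pair:
  fixes P :: "'a::euclidean_space \<times> 'b::euclidean_space \<Rightarrow> bool"
  assumes "AE z in lborel. P z"
  shows "AE t in lborel. AE x in lborel. P (t, x)"
proof -
  from assms have "AE z in lborel \<Otimes>\<^sub>M lborel. P z" by (simp only: lborel_prod)
  then show ?thesis by (rule lborel_pair.AE_pair)
qed

lemma AE_lborel_pairI:
  fixes P :: "'a::euclidean_space \<times> 'b::euclidean_space \<Rightarrow> bool"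
  assumes "{z. P z} \<in> sets borel" "AE t in lborel. AE x in lborel. P (t, x)"
  shows "AE z in lborel. P z"
  using lborel_pair.AE_pair_measure[of P] assms unfolding lborel_prod by simp

lemma nn_integral_lborel_pair:
  fixes f :: "'a::euclidean_space \<times> 'b::euclidean_space \<Rightarrow> ennreal"
  assumes "f \<in> borel_measurable borel"
  shows "(\<integral>\<^sup>+z. f z \<partial>lborel) = (\<integral>\<^sup>+t. \<integral>\<^sup>+x. f (t, x) \<partial>lborel \<partial>lborel)"
  using lborel.nn_integral_fst[of f lborel] assms by (simp add: lborel_prod)

lemma borel_measurable_pairI:
  fixes f :: "'a::euclidean_space \<times> 'b::euclidean_space \<Rightarrow> 'c::topological_space"
  assumes "f \<in> borel_measurable borel"
  shows "(\<lambda>x. f (t, x)) \<in> borel_measurable borel"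
  using measurable_compose[OF measurable_Pair1'[of t borel borel], of f borel] assms by (simp add: borel_prod)

text \<open>The default 0 concerns only the null set of times at which the slice is not square
  integrable. As \<open>sec\<close> is computed from an arbitrary representative, its algebraic
  rules hold only at almost every time.\<close>

definition sec :: "('a::euclidean_space \<times> 'b::euclidean_space, 'c::euclidean_space) L2 \<Rightarrow> 'a \<Rightarrow> ('b, 'c) L2"
  where "sec u t = (if square_integrable (\<lambda>x. rep_L2 u (t, x)) then abs_L2 (\<lambda>x. rep_L2 u (t, x)) else 0)"

lemma square_integrable_section:
  fixes f :: "'a::euclidean_space \<times> 'b::euclidean_space \<Rightarrow> 'c::euclidean_space"
  assumes "square_integrable f"
  shows "AE t in lborel. square_integrable (\<lambda>x. f (t, x))"
proof -
  have [measurable]: "f \<in> borel_measurable borel"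
    using assms by (simp add: square_integrable_def)
  have "(\<integral>\<^sup>+t. \<integral>\<^sup>+x. ennreal ((norm (f (t, x)))\<^sup>2) \<partial>lborel \<partial>lborel) \<noteq> \<infinity>"
    using assms nn_integral_lborel_pair[of "\<lambda>z. ennreal ((norm (f z))\<^sup>2)"]
    by (simp add: square_integrable_iff_nn_integral)
  moreover have "(\<lambda>t. \<integral>\<^sup>+x. ennreal ((norm (f (t, x)))\<^sup>2) \<partial>lborel) \<in> borel_measurable lborel"
    using lborel.borel_measurable_nn_integral_fst[of "\<lambda>z. ennreal ((norm (f z))\<^sup>2)" lborel] by (simp add: lborel_prod)
  ultimately have "AE t in lborel. (\<integral>\<^sup>+x. ennreal ((norm (f (t, x)))\<^sup>2) \<partial>lborel) \<noteq> \<infinity>"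
    by (intro nn_integral_PInf_AE)
  then show ?thesis
    by eventually_elim (auto simp: square_integrable_iff_nn_integral borel_measurable_pairI less_top)
qed

lemma rep_sec: "AE t in lborel. AE x in lborel. rep_L2 (sec u t) x = rep_L2 u (t, x)"
  using square_integrable_section[OF square_integrable_rep[of u]]
  by eventually_elim (simp add: sec_def rep_abs_L2)

lemma sec_eqI:
  assumes "square_integrable f" "AE z in lborel. rep_L2 u z = f z"
  shows "AE t in lborel. square_integrable (\<lambda>x. f (t, x)) \<and> sec u t = abs_L2 (\<lambda>x. f (t, x))"
  using rep_sec[of u] square_integrable_section[OF assms(1)] AE_lborel_pair[OF assms(2)]
proof eventually_elim
  case (elim t)
  have "AE x in lborel. rep_L2 (sec u t) x = rep_L2 (abs_L2 (\<lambda>x. f (t, x))) x"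
    using elim(1,3) rep_abs_L2[OF elim(2)] by eventually_elim simp
  then show ?case using elim(2) by (auto intro: L2_eqI)
qed

lemma sec_abs_L2:
  assumes "square_integrable f"
  shows "AE t in lborel. square_integrable (\<lambda>x. f (t, x)) \<and> sec (abs_L2 f) t = abs_L2 (\<lambda>x. f (t, x))"
  by (rule sec_eqI[OF assms rep_abs_L2[OF assms]])

lemma sec_add: "AE t in lborel. sec (u + v) t = sec u t + sec v t"
  using sec_eqI[OF square_integrable_add[OF square_integrable_rep square_integrable_rep] rep_L2_add, of u v]
    square_integrable_section[OF square_integrable_rep[of u]] square_integrable_section[OF square_integrable_rep[of v]]
  by eventually_elim (simp add: sec_def abs_L2_add)

lemma sec_diff: "AE t in lborel. sec (u - v) t = sec u t - sec v t"
  using sec_add[of "u - v" v] by eventually_elim simp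

lemma sec_scaleR: "AE t in lborel. sec (r *\<^sub>R u) t = r *\<^sub>R sec u t"
  using sec_eqI[OF square_integrable_scaleR[OF square_integrable_rep] rep_L2_scaleR, of r u]
    square_integrable_section[OF square_integrable_rep[of u]]
  by eventually_elim (simp add: sec_def abs_L2_scaleR)

lemma sec_zero:
  "AE t in lborel. sec (0 :: ('a::euclidean_space \<times> 'b::euclidean_space, 'c::euclidean_space) L2) t = 0"
  using sec_diff[of "0 :: ('a \<times> 'b, 'c) L2" 0] by simp

lemma L2_eqI_sec:
  assumes "AE t in lborel. sec u t = sec v t"
  shows "u = v"
proof (rule L2_eqI, rule AE_lborel_pairI)
  show "{z. rep_L2 u z = rep_L2 v z} \<in> sets borel"
    using measurable_sets[of "\<lambda>z. rep_L2 u z - rep_L2 v z" borel borel "{0}"] by (simp add: vimage_def)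
  show "AE t in lborel. AE x in lborel. rep_L2 u (t, x) = rep_L2 v (t, x)"
    using assms rep_sec[of u] rep_sec[of v]
  proof eventually_elim
    case (elim t)
    show ?case using elim(2,3) unfolding elim(1) by eventually_elim simp
  qed
qed

lemma measurable_square_integrable_section [measurable]:
  fixes u :: "('a::euclidean_space \<times> 'b::euclidean_space, 'c::euclidean_space) L2"
  shows "Measurable.pred borel (\<lambda>t. square_integrable (\<lambda>x. rep_L2 u (t, x)))"
proof -
  have "(\<lambda>t. \<integral>\<^sup>+x. ennreal ((norm (rep_L2 u (t, x)))\<^sup>2) \<partial>lborel) \<in> borel_measurable borel"
    using lborel.borel_measurable_nn_integral_fst[of "\<lambda>z. ennreal ((norm (rep_L2 u z))\<^sup>2)" lborel] by (simp add: lborel_prod)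
  then show ?thesis
    by (simp add: square_integrable_iff_nn_integral borel_measurable_pairI)
qed

text \<open>Scalar measurability suffices throughout: squared norms of sections are expanded into
  inner products wherever an integral over time is taken.\<close>

lemma measurable_sec_inner [measurable]:
  fixes u v :: "('a::euclidean_space \<times> 'b::euclidean_space, 'c::euclidean_space) L2"
  shows "(\<lambda>t. sec u t \<bullet> sec v t) \<in> borel_measurable borel"
proof -
  have "(\<lambda>t. LINT x|lborel. rep_L2 u (t, x) \<bullet> rep_L2 v (t, x)) \<in> borel_measurable borel"
    using lborel.borel_measurable_lebesgue_integral[of "\<lambda>t x. rep_L2 u (t, x) \<bullet> rep_L2 v (t, x)" lborel]
    by (simp add: lborel_prod)
  then have "(\<lambda>t. if square_integrable (\<lambda>x. rep_L2 u (t, x)) \<and> square_integrable (\<lambda>x. rep_L2 v (t, x))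
     then LINT x|lborel. rep_L2 u (t, x) \<bullet> rep_L2 v (t, x) else 0) \<in> borel_measurable borel"
    by measurable
  moreover have "sec u t \<bullet> sec v t = (if square_integrable (\<lambda>x. rep_L2 u (t, x)) \<and> square_integrable (\<lambda>x. rep_L2 v (t, x))
     then LINT x|lborel. rep_L2 u (t, x) \<bullet> rep_L2 v (t, x) else 0)" for t
    by (simp add: sec_def inner_abs_L2)
  ultimately show ?thesis by simp
qed

lemma sec_inner_AE:
  "AE t in lborel. sec u t \<bullet> sec v t = (LINT x|lborel. rep_L2 u (t, x) \<bullet> rep_L2 v (t, x))"
  using square_integrable_section[OF square_integrable_rep[of u]] square_integrable_section[OF square_integrable_rep[of v]]
  by eventually_elim (simp add: sec_def inner_abs_L2)

lemma integrable_sec_inner: "integrable lborel (\<lambda>t. sec u t \<bullet> sec v t)"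
  and inner_L2_sec: "u \<bullet> v = (LINT t|lborel. sec u t \<bullet> sec v t)"
proof -
  let ?f = "\<lambda>z. rep_L2 u z \<bullet> rep_L2 v z"
  have i: "integrable (lborel \<Otimes>\<^sub>M lborel) ?f"
    by (simp add: lborel_prod)
  have m: "(\<lambda>t. LINT x|lborel. ?f (t, x)) \<in> borel_measurable lborel"
    using borel_measurable_integrable[OF lborel_pair.integrable_fst'[OF i]] .
  show "integrable lborel (\<lambda>t. sec u t \<bullet> sec v t)"
    using lborel_pair.integrable_fst'[OF i] m sec_inner_AE[of u v]
    by (subst integrable_cong_AE[where g="\<lambda>t. LINT x|lborel. ?f (t, x)"]) auto
  have "u \<bullet> v = (LINT t|lborel. LINT x|lborel. ?f (t, x))"
    using lborel_pair.integral_fst'[OF i] by (simp add: inner_L2_rep lborel_prod)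
  also have "\<dots> = (LINT t|lborel. sec u t \<bullet> sec v t)"
    using m sec_inner_AE[of u v] by (intro integral_cong_AE) auto
  finally show "u \<bullet> v = (LINT t|lborel. sec u t \<bullet> sec v t)" .
qed

lemma nn_integral_sec_norm:
  "(\<integral>\<^sup>+t. ennreal ((norm (sec u t))\<^sup>2) \<partial>lborel) = ennreal ((norm u)\<^sup>2)"
  using integrable_sec_inner[of u u]
  by (simp add: power2_norm_eq_inner inner_L2_sec[of u u] nn_integral_eq_integral)

lemma sec_shift: "AE t in lborel. sec (shift_L2 (s, 0) u) t = sec u (t + s)"
  using sec_eqI[OF square_integrable_shift[OF square_integrable_rep] rep_shift_L2, of u "(s, 0)"]
    AE_lborel_shift[OF square_integrable_section[OF square_integrable_rep[of u]], of s]
  by eventually_elim (simp add: sec_def)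

subsection \<open>Restriction to a measurable set\<close>

definition restr :: "'a::euclidean_space set \<Rightarrow> ('a, 'b::euclidean_space) L2 \<Rightarrow> ('a, 'b) L2"
  where "restr S u = abs_L2 (\<lambda>z. indicator S z *\<^sub>R rep_L2 u z)"

lemma square_integrable_indicator:
  fixes f :: "'a::euclidean_space \<Rightarrow> 'b::euclidean_space"
  assumes S: "S \<in> sets borel" and f: "square_integrable f"
  shows "square_integrable (\<lambda>z. indicator S z *\<^sub>R f z)"
  by (rule square_integrable_AE_cong[OF f, where C=1])
    (use square_integrable_measurable[OF f] S in \<open>auto simp: indicator_def\<close>)

context
  fixes S :: "'a::euclidean_space set"
  assumes S [measurable]: "S \<in> sets borel"
begin

lemma rep_restr: "AE z in lborel. rep_L2 (restr S u) z = indicator S z *\<^sub>R rep_L2 u z"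
  unfolding restr_def by (rule rep_abs_L2) (simp add: square_integrable_indicator S)

lemma restr_add: "restr S (u + v) = restr S u + restr S v"
  by (rule L2_eqI) (use rep_restr[of "u + v"] rep_restr[of u] rep_restr[of v] rep_L2_add[of u v] rep_L2_add[of "restr S u" "restr S v"]
    in \<open>eventually_elim, simp add: scaleR_add_right\<close>)

lemma restr_diff: "restr S (u - v) = restr S u - restr S v"
  using restr_add[of "u - v" v] by simp

lemma inner_restr_left: "restr S u \<bullet> v = (LINT z|lborel. indicator S z *\<^sub>R (rep_L2 u z \<bullet> rep_L2 v z))"
  unfolding inner_L2_rep
  by (intro integral_cong_AE) (use rep_restr[of u] in \<open>auto elim: eventually_mono\<close>)

lemma inner_restr: "restr S u \<bullet> v = u \<bullet> restr S v"
  using inner_restr_left[of u v] inner_restr_left[of v u] by (simp add: inner_commute)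

lemma restr_idem [simp]: "restr S (restr S u) = restr S u"
  by (rule L2_eqI) (use rep_restr[of "restr S u"] rep_restr[of u] in \<open>eventually_elim, simp add: indicator_def\<close>)

lemma norm_restr_le: "norm (restr S u) \<le> norm u"
proof -
  have "norm (restr S u) * norm (restr S u) = restr S u \<bullet> u"
    using inner_restr[of u "restr S u"]
    by (simp add: power2_eq_square[symmetric] power2_norm_eq_inner inner_commute)
  also have "\<dots> \<le> norm (restr S u) * norm u"
    by (rule norm_cauchy_schwarz)
  finally show ?thesis
    by (cases "restr S u = 0") auto
qed

lemma L2_on_iff_restr: "u \<in> L2_on S \<longleftrightarrow> restr S u = u"
proof
  assume u: "u \<in> L2_on S"
  then have "AE z in lborel. z \<notin> S \<longrightarrow> rep_L2 u z = 0" by (simp add: L2_on_def)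
  then show "restr S u = u"
    using rep_restr[of u] by (intro L2_eqI, eventually_elim) (auto simp: indicator_def)
next
  assume "restr S u = u"
  then have "AE z in lborel. rep_L2 u z = indicator S z *\<^sub>R rep_L2 u z"
    using rep_restr[of u] by simp
  then have "AE z in lborel. z \<notin> S \<longrightarrow> rep_L2 u z = 0"
    by eventually_elim (auto simp: indicator_def)
  then show "u \<in> L2_on S" by (simp add: L2_on_def)
qed

lemma subspace_L2_on: "subspace (L2_on S)"
proof (rule subspaceI)
  have z: "AE z in lborel. rep_L2 (0 :: ('a, 'b::euclidean_space) L2) z = 0" by (rule rep_L2_zero)
  show "(0 :: ('a, 'b) L2) \<in> L2_on S"
    unfolding L2_on_def using z by (auto elim: eventually_mono)
  show "x + y \<in> L2_on S" if "x \<in> L2_on S" "y \<in> L2_on S" for x y :: "('a, 'b) L2"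
    using that by (simp add: L2_on_iff_restr restr_add)
  show "c *\<^sub>R x \<in> L2_on S" if "x \<in> L2_on S" for c and x :: "('a, 'b) L2"
  proof -
    have "AE z in lborel. z \<notin> S \<longrightarrow> rep_L2 x z = 0" using that by (simp add: L2_on_def)
    then have "AE z in lborel. z \<notin> S \<longrightarrow> rep_L2 (c *\<^sub>R x) z = 0"
      using rep_L2_scaleR[of c x] by eventually_elim simp
    then show ?thesis by (simp add: L2_on_def)
  qed
qed

text \<open>The set of fixed points of a continuous projection is closed.\<close>

lemma closed_L2_on: "closed (L2_on S :: ('a, 'b::euclidean_space) L2 set)"
proof -
  have "bounded_linear (restr S :: ('a, 'b) L2 \<Rightarrow> _)"
  proof (rule bounded_linear_intro[where K=1])
    show "restr S (r *\<^sub>R x) = r *\<^sub>R restr S x" for r and x :: "('a, 'b) L2"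
      by (rule L2_eqI) (use rep_restr[of "r *\<^sub>R x"] rep_restr[of x] rep_L2_scaleR[of r x] rep_L2_scaleR[of r "restr S x"]
        in \<open>eventually_elim, simp\<close>)
  qed (auto simp: restr_add norm_restr_le)
  then have "continuous_on UNIV (restr S :: ('a, 'b) L2 \<Rightarrow> _)"
    by (rule linear_continuous_on)
  then have "closed {u :: ('a, 'b) L2. restr S u = u}"
    by (intro closed_Collect_eq continuous_intros)
  moreover have "L2_on S = {u :: ('a, 'b) L2. restr S u = u}"
    using L2_on_iff_restr by auto
  ultimately show ?thesis by simp
qed

lemma L2_of_in_L2_on: "L2_of S f \<in> L2_on S"
proof (cases "square_integrable (\<lambda>x. indicator S x *\<^sub>R f x)")
  case True
  then have "AE z in lborel. z \<notin> S \<longrightarrow> rep_L2 (L2_of S f) z = 0"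
    using rep_abs_L2[OF True] by (auto simp: L2_of_def indicator_def elim: eventually_mono)
  then show ?thesis by (simp add: L2_on_def)
qed (use subspace_0[OF subspace_L2_on] in \<open>simp add: L2_of_def\<close>)

end

lemma restr_time_sec:
  fixes u :: "('a::euclidean_space \<times> 'b::euclidean_space, 'c::euclidean_space) L2"
  assumes I: "I \<in> sets borel"
  shows "AE t in lborel. sec (restr (I \<times> UNIV) u) t = indicator I t *\<^sub>R sec u t"
proof -
  have S: "I \<times> UNIV \<in> sets (borel :: ('a \<times> 'b) measure)"
    using I by (simp flip: borel_prod)
  show ?thesis
    using sec_eqI[OF square_integrable_indicator[OF S square_integrable_rep] rep_restr[OF S], of u]
      square_integrable_section[OF square_integrable_rep[of u]]
    by eventually_elim (auto simp: sec_def indicator_def zero_L2_def)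
qed

lemma L2_of_test_function:
  assumes "\<phi> \<in> test_functions S"
  shows "L2_of S \<phi> = abs_L2 \<phi>"
proof -
  have "(\<lambda>x. indicator S x *\<^sub>R \<phi> x) = \<phi>"
    using test_functions_outside[OF assms] by (intro ext) (auto simp: indicator_def)
  then show ?thesis
    using test_functions_square_integrable[OF assms] by (simp add: L2_of_def)
qed

lemma L2_of_grad:
  assumes "\<phi> \<in> test_functions S"
  shows "L2_of S (grad \<phi>) = abs_L2 (grad \<phi>)"
proof -
  have "(\<lambda>x. indicator S x *\<^sub>R grad \<phi> x) = grad \<phi>"
    using grad_outside[OF assms] by (intro ext) (auto simp: indicator_def)
  then show ?thesis
    using grad_square_integrable[OF assms] by (simp add: L2_of_def)
qed

subsection \<open>The graph of the gradient\<close>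

lemma fundamental_lemma_L2:
  fixes u :: "('a::euclidean_space, real) L2"
  assumes S: "open S" and u: "u \<in> L2_on S" and zero: "\<And>\<phi>. \<phi> \<in> test_functions S \<Longrightarrow> u \<bullet> abs_L2 \<phi> = 0"
  shows "u = 0"
proof -
  have "(LINT x|lborel. rep_L2 u x * \<phi> x) = 0" if "\<phi> \<in> test_functions S" for \<phi>
    using zero[OF that] inner_abs_L2[OF square_integrable_rep[of u] test_functions_square_integrable[OF that]]
    by simp
  then have "AE x in lborel. x \<in> S \<longrightarrow> rep_L2 u x = 0"
    by (rule fundamental_lemma[OF S])
  moreover have "AE x in lborel. x \<notin> S \<longrightarrow> rep_L2 u x = 0"
    using u by (simp add: L2_on_def)
  ultimately show "u = 0"
    using rep_L2_zero[where ?'a='a and ?'b=real] by (intro L2_eqI, eventually_elim) auto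
qed

lemma frechet_derivative_add_test:
  assumes "\<phi> \<in> test_functions S" "\<psi> \<in> test_functions S"
  shows "frechet_derivative (\<lambda>x. \<phi> x + \<psi> x) (at x) h
    = frechet_derivative \<phi> (at x) h + frechet_derivative \<psi> (at x) h"
  using frechet_derivative_at[OF has_derivative_add[OF test_functions_has_derivative[OF assms(1)]
        test_functions_has_derivative[OF assms(2)]], of x] by metis

lemma frechet_derivative_mult_test:
  assumes "\<phi> \<in> test_functions S" "\<psi> \<in> test_functions S"
  shows "frechet_derivative (\<lambda>x. \<phi> x * \<psi> x) (at x) h
    = \<phi> x * frechet_derivative \<psi> (at x) h + frechet_derivative \<phi> (at x) h * \<psi> x"
  using frechet_derivative_at[OF has_derivative_mult[OF test_functions_has_derivative[OF assms(1)]
        test_functions_has_derivative[OF assms(2)]], of x] by metis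

lemma frechet_derivative_scale_test:
  assumes "\<phi> \<in> test_functions S"
  shows "frechet_derivative (\<lambda>x. c * \<phi> x) (at x) h = c * frechet_derivative \<phi> (at x) h"
  using frechet_derivative_at[OF has_derivative_mult_right[OF test_functions_has_derivative[OF assms]], of c x] by metis

lemma test_functions_scale: "\<phi> \<in> test_functions S \<Longrightarrow> (\<lambda>x. c * \<phi> x) \<in> test_functions S"
  by (rule test_functions_mult[OF _ Ck_const])

lemma grad_add:
  assumes "\<phi> \<in> test_functions S" "\<psi> \<in> test_functions S"
  shows "grad (\<lambda>x. \<phi> x + \<psi> x) = (\<lambda>x. grad \<phi> x + grad \<psi> x)"
  by (intro ext) (simp add: grad_def vec_eq_iff frechet_derivative_add_test[OF assms])

lemma grad_scale:
  assumes "\<phi> \<in> test_functions S"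
  shows "grad (\<lambda>x. c * \<phi> x) = (\<lambda>x. c *\<^sub>R grad \<phi> x)"
  by (intro ext) (simp add: grad_def vec_eq_iff frechet_derivative_scale_test[OF assms])

lemma subspace_closure:
  fixes S :: "'a::real_normed_vector set"
  assumes "subspace S"
  shows "subspace (closure S)"
proof (rule subspaceI)
  show "0 \<in> closure S"
    using subspace_0[OF assms] closure_subset by blast
  show "x + y \<in> closure S" if xy: "x \<in> closure S" "y \<in> closure S" for x y
  proof -
    obtain a b where "\<And>n. a n \<in> S" "a \<longlonglongrightarrow> x" "\<And>n. b n \<in> S" "b \<longlonglongrightarrow> y"
      using xy unfolding closure_sequential by blast
    then show ?thesis
      unfolding closure_sequential
      by (intro exI[of _ "\<lambda>n. a n + b n"]) (auto intro: tendsto_add subspace_add[OF assms])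
  qed
  show "c *\<^sub>R x \<in> closure S" if x: "x \<in> closure S" for c x
  proof -
    obtain a where "\<And>n. a n \<in> S" "a \<longlonglongrightarrow> x"
      using x unfolding closure_sequential by blast
    then show ?thesis
      unfolding closure_sequential
      by (intro exI[of _ "\<lambda>n. c *\<^sub>R a n"]) (auto intro: tendsto_intros subspace_scale[OF assms])
  qed
qed

lemma subspace_test_graph:
  "subspace {(L2_of \<Omega> \<phi>, L2_of \<Omega> (grad \<phi>)) | \<phi>. \<phi> \<in> test_functions \<Omega>}" (is "subspace ?G")
proof (rule subspaceI)
  have G: "(abs_L2 \<phi>, abs_L2 (grad \<phi>)) \<in> ?G" if "\<phi> \<in> test_functions \<Omega>" for \<phi>
    using that by (auto simp: L2_of_test_function L2_of_grad intro!: exI[of _ \<phi>])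
  have GE: "\<exists>\<phi>\<in>test_functions \<Omega>. x = (abs_L2 \<phi>, abs_L2 (grad \<phi>))" if "x \<in> ?G" for x
    using that by (auto simp: L2_of_test_function L2_of_grad)
  have g0: "grad (\<lambda>_. 0) = (\<lambda>_. 0)"
    by (intro ext) (simp add: grad_def vec_eq_iff)
  show "0 \<in> ?G"
    using G[OF test_functions_zero, unfolded g0] unfolding zero_prod_def zero_L2_def .
  fix x y c assume x: "x \<in> ?G"
  obtain \<phi> where \<phi>: "\<phi> \<in> test_functions \<Omega>" "x = (abs_L2 \<phi>, abs_L2 (grad \<phi>))"
    using GE[OF x] by blast
  show "c *\<^sub>R x \<in> ?G"
    using G[OF test_functions_scale[OF \<phi>(1), of c]]
    by (simp add: \<phi>(2) grad_scale[OF \<phi>(1)] abs_L2_scaleR grad_square_integrable[OF \<phi>(1)]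
        test_functions_square_integrable[OF \<phi>(1)])
  assume y: "y \<in> ?G"
  obtain \<psi> where \<psi>: "\<psi> \<in> test_functions \<Omega>" "y = (abs_L2 \<psi>, abs_L2 (grad \<psi>))"
    using GE[OF y] by blast
  show "x + y \<in> ?G"
    using G[OF test_functions_add[OF \<phi>(1) \<psi>(1)]] \<phi>(1) \<psi>(1)
    by (simp add: \<phi>(2) \<psi>(2) grad_add[OF \<phi>(1) \<psi>(1)] abs_L2_add grad_square_integrable[OF \<phi>(1)] grad_square_integrable[OF \<psi>(1)]
        test_functions_square_integrable[OF \<phi>(1)] test_functions_square_integrable[OF \<psi>(1)])
qed

lemma subspace_H10_graph: "subspace (H10_graph \<Omega>)"
  unfolding H10_graph_def by (rule subspace_closure[OF subspace_test_graph])

lemma test_graph_in_H10: "\<phi> \<in> test_functions \<Omega> \<Longrightarrow> (abs_L2 \<phi>, abs_L2 (grad \<phi>)) \<in> H10_graph \<Omega>"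
  unfolding H10_graph_def
  by (rule subsetD[OF closure_subset]) (auto simp: L2_of_test_function L2_of_grad intro!: exI[of _ \<phi>])

lemma integrable_scaleR_square_integrable:
  fixes f :: "'a::euclidean_space \<Rightarrow> real" and g :: "'a \<Rightarrow> 'b::euclidean_space"
  assumes f: "square_integrable f" and g: "square_integrable g"
  shows "integrable lborel (\<lambda>x. f x *\<^sub>R g x)"
proof (rule Bochner_Integration.integrable_bound)
  have [measurable]: "f \<in> borel_measurable borel" "g \<in> borel_measurable borel"
    using f g by (auto simp: square_integrable_def)
  show "integrable lborel (\<lambda>x. (norm (f x))\<^sup>2 + (norm (g x))\<^sup>2)"
    using f g by (auto simp: square_integrable_def)
  show "(\<lambda>x. f x *\<^sub>R g x) \<in> borel_measurable lborel"
    by measurable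
  have "\<bar>f x\<bar> * norm (g x) \<le> (norm (f x))\<^sup>2 + (norm (g x))\<^sup>2" for x
  proof -
    have "2 * (\<bar>f x\<bar> * norm (g x)) \<le> (norm (f x))\<^sup>2 + (norm (g x))\<^sup>2"
      using sum_squares_bound[of "\<bar>f x\<bar>" "norm (g x)"] by (simp add: mult.assoc)
    moreover have "0 \<le> \<bar>f x\<bar> * norm (g x)" by simp
    ultimately show ?thesis by linarith
  qed
  then show "AE x in lborel. norm (f x *\<^sub>R g x) \<le> norm ((norm (f x))\<^sup>2 + (norm (g x))\<^sup>2)"
    by (auto intro!: AE_I2)
qed

lemma square_integrable_axis:
  assumes "square_integrable (f :: 'a::euclidean_space \<Rightarrow> real)"
  shows "square_integrable (\<lambda>x. f x *\<^sub>R axis i 1 :: real^'n)"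
  by (rule square_integrable_AE_cong[OF assms, where C=1])
    (use square_integrable_measurable[OF assms] in auto)

lemma integral_vec_nth:
  fixes f :: "'a::euclidean_space \<Rightarrow> real^'n"
  assumes "integrable lborel f"
  shows "(LINT x|lborel. f x) $ i = (LINT x|lborel. f x $ i)"
proof -
  have "(LINT x|lborel. f x \<bullet> axis i 1) = (LINT x|lborel. f x) \<bullet> axis i 1"
    using assms by simp
  then show ?thesis by (simp add: inner_axis)
qed

text \<open>Turns the vector-valued weak identity into scalar L2 inner products with fixed elements;
  in this form each condition is visibly closed and linear in (w, H).\<close>

lemma H1_graph_iff:
  "(w, H) \<in> H1_graph \<Omega> \<longleftrightarrow> w \<in> L2_on \<Omega> \<and> H \<in> L2_on \<Omega> \<and>
    (\<forall>\<phi>\<in>test_functions \<Omega>. \<forall>i. w \<bullet> abs_L2 (\<lambda>x. grad \<phi> x $ i) = - (H \<bullet> abs_L2 (\<lambda>x. \<phi> x *\<^sub>R axis i 1)))"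
proof -
  have "(LINT x|lborel. rep_L2 w x *\<^sub>R grad \<phi> x) = - (LINT x|lborel. \<phi> x *\<^sub>R rep_L2 H x) \<longleftrightarrow>
    (\<forall>i. w \<bullet> abs_L2 (\<lambda>x. grad \<phi> x $ i) = - (H \<bullet> abs_L2 (\<lambda>x. \<phi> x *\<^sub>R axis i 1)))"
    if \<phi>: "\<phi> \<in> test_functions \<Omega>" for \<phi>
  proof -
    have 1: "(LINT x|lborel. rep_L2 w x *\<^sub>R grad \<phi> x) $ i = w \<bullet> abs_L2 (\<lambda>x. grad \<phi> x $ i)" for i
      using inner_abs_L2[OF square_integrable_rep[of w] square_integrable_vec_nth[OF grad_square_integrable[OF \<phi>]]]
      by (simp add: integral_vec_nth integrable_scaleR_square_integrable grad_square_integrable[OF \<phi>])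
    have 2: "(LINT x|lborel. \<phi> x *\<^sub>R rep_L2 H x) $ i = H \<bullet> abs_L2 (\<lambda>x. \<phi> x *\<^sub>R axis i 1)" for i
      using inner_abs_L2[OF square_integrable_rep[of H] square_integrable_axis[OF test_functions_square_integrable[OF \<phi>]]]
      by (simp add: integral_vec_nth integrable_scaleR_square_integrable test_functions_square_integrable[OF \<phi>] inner_axis)
    show ?thesis by (simp add: vec_eq_iff 1 2)
  qed
  then show ?thesis by (auto simp: H1_graph_def)
qed

text \<open>The H1 graph is an intersection of closed conditions, hence contains the closure as soon
  as it contains the graphs of test functions. For these the identity says that the derivative of a
  product of test functions integrates to zero.\<close>

lemma H10_subset_H1:
  fixes \<Omega> :: "(real^'n) set"
  assumes \<Omega>: "open \<Omega>"
  shows "H10_graph \<Omega> \<subseteq> H1_graph \<Omega>"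
  unfolding H10_graph_def
proof (rule closure_minimal)
  have S: "\<Omega> \<in> sets borel" using \<Omega> by simp
  have "H1_graph \<Omega> = (L2_on \<Omega> \<times> L2_on \<Omega>) \<inter> (\<Inter>\<phi>\<in>test_functions \<Omega>. \<Inter>i.
    {z. fst z \<bullet> abs_L2 (\<lambda>x. grad \<phi> x $ i) = - (snd z \<bullet> abs_L2 (\<lambda>x. \<phi> x *\<^sub>R axis i 1))})"
    by (rule set_eqI, clarify) (simp add: H1_graph_iff)
  also have "closed \<dots>"
    by (intro closed_Int closed_Times closed_L2_on[OF S] closed_INT ballI closed_Collect_eq continuous_intros)
  finally show "closed (H1_graph \<Omega>)" .
  show "{(L2_of \<Omega> \<phi>, L2_of \<Omega> (grad \<phi>)) |\<phi>. \<phi> \<in> test_functions \<Omega>} \<subseteq> H1_graph \<Omega>"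
  proof clarify
    fix \<psi> assume \<psi>: "\<psi> \<in> test_functions \<Omega>"
    have "abs_L2 \<psi> \<bullet> abs_L2 (\<lambda>x. grad \<phi> x $ i) = - (abs_L2 (grad \<psi>) \<bullet> abs_L2 (\<lambda>x. \<phi> x *\<^sub>R axis i 1))"
      if \<phi>: "\<phi> \<in> test_functions \<Omega>" for \<phi> i
    proof -
      have sq: "square_integrable \<psi>" "square_integrable \<phi>" "square_integrable (\<lambda>x. grad \<phi> x $ i)"
          "square_integrable (\<lambda>x. grad \<psi> x $ i)"
        by (simp_all add: test_functions_square_integrable[OF \<psi>] test_functions_square_integrable[OF \<phi>]
            square_integrable_vec_nth grad_square_integrable[OF \<psi>] grad_square_integrable[OF \<phi>])
      have "(LINT x|lborel. frechet_derivative (\<lambda>x. \<psi> x * \<phi> x) (at x) (axis i 1)) = 0"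
        by (rule integral_frechet_derivative[OF test_functions_mult[OF \<phi> test_functions_Ck[OF \<psi>]]])
      then have "(LINT x|lborel. \<psi> x * grad \<phi> x $ i + grad \<psi> x $ i * \<phi> x) = 0"
        by (simp add: frechet_derivative_mult_test[OF \<psi> \<phi>] grad_def)
      then have "(LINT x|lborel. \<psi> x * grad \<phi> x $ i) + (LINT x|lborel. grad \<psi> x $ i * \<phi> x) = 0"
        using square_integrable_inner[OF sq(1,3)] square_integrable_inner[OF sq(4,2)] by simp
      then show ?thesis
        using inner_abs_L2[OF sq(1,3)] inner_abs_L2[OF grad_square_integrable[OF \<psi>] square_integrable_axis[OF sq(2)], of i]
        by (simp add: inner_axis mult.commute)
    qed
    then show "(L2_of \<Omega> \<psi>, L2_of \<Omega> (grad \<psi>)) \<in> H1_graph \<Omega>"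
      using L2_of_in_L2_on[OF S, of \<psi>] L2_of_in_L2_on[OF S, of "grad \<psi>"]
      by (simp add: H1_graph_iff L2_of_test_function[OF \<psi>] L2_of_grad[OF \<psi>])
  qed
qed

lemma H1_graph_unique:
  assumes \<Omega>: "open \<Omega>" and "(w, H) \<in> H1_graph \<Omega>" "(w, H') \<in> H1_graph \<Omega>"
  shows "H = H'"
proof -
  have S: "\<Omega> \<in> sets borel" using \<Omega> by simp
  define D where "D = H - H'"
  have D: "D \<in> L2_on \<Omega>"
    using assms(2,3) subspace_diff[OF subspace_L2_on[OF S]] by (auto simp: D_def H1_graph_iff)
  have "AE x in lborel. x \<in> \<Omega> \<longrightarrow> rep_L2 D x $ i = 0" for i
  proof -
    have sq: "square_integrable (\<lambda>x. rep_L2 D x $ i)"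
      by (rule square_integrable_vec_nth[OF square_integrable_rep])
    have "AE x in lborel. x \<in> \<Omega> \<longrightarrow> rep_L2 (abs_L2 (\<lambda>x. rep_L2 D x $ i)) x = 0"
    proof (rule fundamental_lemma[OF \<Omega>])
      fix \<phi> assume \<phi>: "\<phi> \<in> test_functions \<Omega>"
      have "(LINT x|lborel. rep_L2 (abs_L2 (\<lambda>x. rep_L2 D x $ i)) x * \<phi> x) = abs_L2 (\<lambda>x. rep_L2 D x $ i) \<bullet> abs_L2 \<phi>"
        using inner_abs_L2[OF square_integrable_rep test_functions_square_integrable[OF \<phi>], of "abs_L2 (\<lambda>x. rep_L2 D x $ i)"] by simp
      also have "\<dots> = D \<bullet> abs_L2 (\<lambda>x. \<phi> x *\<^sub>R axis i 1)"
        using inner_abs_L2[OF sq test_functions_square_integrable[OF \<phi>]]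
          inner_abs_L2[OF square_integrable_rep[of D] square_integrable_axis[OF test_functions_square_integrable[OF \<phi>]], of i]
        by (simp add: inner_axis mult.commute)
      also have "\<dots> = 0"
        using assms(2,3) \<phi> by (simp add: D_def H1_graph_iff inner_diff_left)
      finally show "(LINT x|lborel. rep_L2 (abs_L2 (\<lambda>x. rep_L2 D x $ i)) x * \<phi> x) = 0" .
    qed
    then show ?thesis
      using rep_abs_L2[OF sq] by eventually_elim simp
  qed
  then have "AE x in lborel. \<forall>i. x \<in> \<Omega> \<longrightarrow> rep_L2 D x $ i = 0"
    by (subst AE_all_countable) simp
  moreover have "AE x in lborel. x \<notin> \<Omega> \<longrightarrow> rep_L2 D x = 0"
    using D by (simp add: L2_on_def)
  ultimately have "D = 0"
    using rep_L2_zero[where ?'a="real^'n" and ?'b="real^'n"]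
    by (intro L2_eqI, eventually_elim) (auto simp: vec_eq_iff)
  then show ?thesis by (simp add: D_def)
qed

subsection \<open>Functions of time with values in the graph of the gradient\<close>

text \<open>The time set is a parameter and membership is stated section by section, so that shifts,
  differences and restrictions to subintervals stay within the notion. Sections vanish off
  \<open>I\<close>, which encodes extension by zero in time.\<close>

definition H10_valued ::
  "real set \<Rightarrow> (real^'n) set \<Rightarrow> ('n st, real) L2 \<Rightarrow> ('n st, real^'n) L2 \<Rightarrow> bool"
  where "H10_valued I \<Omega> v G \<longleftrightarrow> (AE t in lborel. (sec v t, sec G t) \<in> H10_graph \<Omega> \<and>
    (t \<notin> I \<longrightarrow> sec v t = 0 \<and> sec G t = 0))"

lemma H10_valued_add:
  assumes "H10_valued I \<Omega> v G" "H10_valued I \<Omega> w H"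
  shows "H10_valued I \<Omega> (v + w) (G + H)"
  using assms sec_add[of v w] sec_add[of G H] unfolding H10_valued_def
proof eventually_elim
  case (elim t)
  then have "(sec v t, sec G t) + (sec w t, sec H t) \<in> H10_graph \<Omega>"
    by (intro subspace_add[OF subspace_H10_graph]) auto
  then show ?case using elim by auto
qed

lemma H10_valued_scaleR:
  assumes "H10_valued I \<Omega> v G"
  shows "H10_valued I \<Omega> (r *\<^sub>R v) (r *\<^sub>R G)"
  using assms sec_scaleR[of r v] sec_scaleR[of r G] unfolding H10_valued_def
proof eventually_elim
  case (elim t)
  then have "r *\<^sub>R (sec v t, sec G t) \<in> H10_graph \<Omega>"
    by (intro subspace_scale[OF subspace_H10_graph]) auto
  then show ?case using elim by auto
qed

lemma H10_valued_diff:
  assumes "H10_valued I \<Omega> v G" "H10_valued I \<Omega> w H"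
  shows "H10_valued I \<Omega> (v - w) (G - H)"
  using H10_valued_add[OF assms(1) H10_valued_scaleR[OF assms(2), of "-1"]] by simp

lemma H10_valued_shift:
  assumes "H10_valued I \<Omega> v G"
  shows "H10_valued {t. t + s \<in> I} \<Omega> (shift_L2 (s, 0) v) (shift_L2 (s, 0) G)"
  using AE_lborel_shift[OF assms[unfolded H10_valued_def], of s] sec_shift[of s v] sec_shift[of s G]
  unfolding H10_valued_def by eventually_elim auto

lemma H10_valued_restr:
  assumes "H10_valued I \<Omega> v G" and J: "J \<in> sets borel"
  shows "H10_valued (I \<inter> J) \<Omega> (restr (J \<times> UNIV) v) (restr (J \<times> UNIV) G)"
  using assms(1) restr_time_sec[OF J, of v] restr_time_sec[OF J, of G] unfolding H10_valued_def
proof eventually_elim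
  case (elim t)
  then have "indicator J t *\<^sub>R (sec v t, sec G t) \<in> H10_graph \<Omega>"
    by (intro subspace_scale[OF subspace_H10_graph]) auto
  then show ?case using elim by auto
qed

lemma H10_valued_mono: "H10_valued I \<Omega> v G \<Longrightarrow> I \<subseteq> J \<Longrightarrow> H10_valued J \<Omega> v G"
  unfolding H10_valued_def by (erule eventually_mono) blast

lemma sets_Times_borel:
  fixes A :: "'a::euclidean_space set" and B :: "'b::euclidean_space set"
  assumes "A \<in> sets borel" "B \<in> sets borel"
  shows "A \<times> B \<in> sets borel"
  using assms by (simp flip: borel_prod)

lemma sets_Qcyl: "open \<Omega> \<Longrightarrow> Qcyl T \<Omega> \<in> sets borel"
  by (simp add: Qcyl_def open_Times)

lemma open_Qcyl: "open \<Omega> \<Longrightarrow> open (Qcyl T \<Omega>)"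
  by (simp add: Qcyl_def open_Times)

text \<open>Vanishing off the cylinder splits into vanishing at times outside (0,T), recorded by
  \<open>H10_valued\<close>, and vanishing off \<Omega> in each slice, which every element of the
  H10 graph satisfies.\<close>

lemma H10_valued_L2_time_iff:
  fixes \<Omega> :: "(real^'n) set"
  assumes \<Omega>: "open \<Omega>"
  shows "L2_time T \<Omega> (H10_graph \<Omega>) v G \<longleftrightarrow> H10_valued {0<..<T} \<Omega> v G"
proof
  assume L: "L2_time T \<Omega> (H10_graph \<Omega>) v G"
  then have Q: "AE z in lborel. z \<notin> Qcyl T \<Omega> \<longrightarrow> rep_L2 v z = 0" "AE z in lborel. z \<notin> Qcyl T \<Omega> \<longrightarrow> rep_L2 G z = 0"
    and X: "AE t in lborel. t \<in> {0<..<T} \<longrightarrow> (\<exists>(w, H)\<in>H10_graph \<Omega>.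
       (AE x in lborel. rep_L2 v (t, x) = rep_L2 w x) \<and> (AE x in lborel. rep_L2 G (t, x) = rep_L2 H x))"
    by (auto simp: L2_time_def L2_on_def)
  show "H10_valued {0<..<T} \<Omega> v G"
    unfolding H10_valued_def
    using X AE_lborel_pair[OF Q(1)] AE_lborel_pair[OF Q(2)] rep_sec[of v] rep_sec[of G]
  proof eventually_elim
    case (elim t)
    show ?case
    proof (cases "t \<in> {0<..<T}")
      case True
      then obtain w H where wH: "(w, H) \<in> H10_graph \<Omega>" "AE x in lborel. rep_L2 v (t, x) = rep_L2 w x"
        "AE x in lborel. rep_L2 G (t, x) = rep_L2 H x"
        using elim(1) by blast
      have "sec v t = w"
        using elim(4) wH(2) by (intro L2_eqI, eventually_elim) simp
      moreover have "sec G t = H"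
        using elim(5) wH(3) by (intro L2_eqI, eventually_elim) simp
      ultimately show ?thesis using wH(1) True by simp
    next
      case False
      have "sec v t = 0"
        using elim(4,2) rep_L2_zero[where ?'a="real^'n" and ?'b=real] by (intro L2_eqI, eventually_elim) (use False in \<open>auto simp: Qcyl_def\<close>)
      moreover have "sec G t = 0"
        using elim(5,3) rep_L2_zero[where ?'a="real^'n" and ?'b="real^'n"] by (intro L2_eqI, eventually_elim) (use False in \<open>auto simp: Qcyl_def\<close>)
      ultimately show ?thesis using subspace_0[OF subspace_H10_graph[of \<Omega>]] by (simp add: zero_prod_def)
    qed
  qed
next
  assume H: "H10_valued {0<..<T} \<Omega> v G"
  have S: "\<Omega> \<in> sets borel" using \<Omega> by simp
  have on: "u \<in> L2_on (Qcyl T \<Omega>)"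
    if "AE t in lborel. sec u t \<in> L2_on \<Omega> \<and> (t \<notin> {0<..<T} \<longrightarrow> sec u t = 0)" for u :: "('n st, 'b::euclidean_space) L2"
  proof -
    have "AE z in lborel. z \<notin> Qcyl T \<Omega> \<longrightarrow> rep_L2 u z = 0"
    proof (rule AE_lborel_pairI)
      have "{z. rep_L2 u z = 0} \<in> sets borel"
        using measurable_sets[of "rep_L2 u" borel borel "{0}"] by (simp add: vimage_def)
      moreover have "{z. z \<notin> Qcyl T \<Omega> \<longrightarrow> rep_L2 u z = 0} = Qcyl T \<Omega> \<union> {z. rep_L2 u z = 0}" by auto
      ultimately show "{z. z \<notin> Qcyl T \<Omega> \<longrightarrow> rep_L2 u z = 0} \<in> sets borel"
        using sets_Qcyl[OF \<Omega>, of T] by simp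
      show "AE t in lborel. AE x in lborel. (t, x) \<notin> Qcyl T \<Omega> \<longrightarrow> rep_L2 u (t, x) = 0"
        using that rep_sec[of u]
      proof eventually_elim
        case (elim t)
        show ?case
        proof (cases "t \<in> {0<..<T}")
          case True
          have "AE x in lborel. x \<notin> \<Omega> \<longrightarrow> rep_L2 (sec u t) x = 0"
            using elim(1) by (simp add: L2_on_def)
          then show ?thesis
            using elim(2) by eventually_elim (use True in \<open>auto simp: Qcyl_def\<close>)
        next
          case False
          then have "sec u t = 0" using elim(1) by simp
          then show ?thesis
            using elim(2) rep_L2_zero[where ?'a="real^'n" and ?'b="'b"] by (auto elim: eventually_elim2)
        qed
      qed
    qed
    then show ?thesis by (simp add: L2_on_def)
  qed
  have HH: "AE t in lborel. sec v t \<in> L2_on \<Omega> \<and> sec G t \<in> L2_on \<Omega> \<and> (t \<notin> {0<..<T} \<longrightarrow> sec v t = 0 \<and> sec G t = 0)"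
    using H unfolding H10_valued_def
    by eventually_elim (use H10_subset_H1[OF \<Omega>] in \<open>auto simp: H1_graph_iff dest!: subsetD\<close>)
  have "v \<in> L2_on (Qcyl T \<Omega>)" by (rule on) (use HH in \<open>auto elim: eventually_mono\<close>)
  moreover have "G \<in> L2_on (Qcyl T \<Omega>)" by (rule on) (use HH in \<open>auto elim: eventually_mono\<close>)
  moreover have "AE t in lborel. t \<in> {0<..<T} \<longrightarrow> (\<exists>(w, H)\<in>H10_graph \<Omega>.
       (AE x in lborel. rep_L2 v (t, x) = rep_L2 w x) \<and> (AE x in lborel. rep_L2 G (t, x) = rep_L2 H x))"
    using H rep_sec[of v] rep_sec[of G] unfolding H10_valued_def
  proof eventually_elim
    case (elim t)
    then show ?case
      by (intro impI bexI[of _ "(sec v t, sec G t)"]) (auto elim: eventually_mono)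
  qed
  ultimately show "L2_time T \<Omega> (H10_graph \<Omega>) v G" by (simp add: L2_time_def)
qed

text \<open>Makes the description operator in \<open>xgrad\<close> meaningful. That operator ranges
  over gradients with slices in \<open>H1_graph\<close>, so uniqueness has to be shown there and not
  merely in the smaller graph.\<close>

lemma L2_time_H1_unique:
  fixes \<Omega> :: "(real^'n) set"
  assumes \<Omega>: "open \<Omega>" and G: "L2_time T \<Omega> (H1_graph \<Omega>) v G" and G': "L2_time T \<Omega> (H1_graph \<Omega>) v G'"
  shows "G = G'"
proof (rule L2_eqI_sec)
  have Q: "AE z in lborel. z \<notin> Qcyl T \<Omega> \<longrightarrow> rep_L2 G z = 0" "AE z in lborel. z \<notin> Qcyl T \<Omega> \<longrightarrow> rep_L2 G' z = 0"
    and X: "AE t in lborel. t \<in> {0<..<T} \<longrightarrow> (\<exists>(w, H)\<in>H1_graph \<Omega>.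
       (AE x in lborel. rep_L2 v (t, x) = rep_L2 w x) \<and> (AE x in lborel. rep_L2 G (t, x) = rep_L2 H x))"
    and X': "AE t in lborel. t \<in> {0<..<T} \<longrightarrow> (\<exists>(w, H)\<in>H1_graph \<Omega>.
       (AE x in lborel. rep_L2 v (t, x) = rep_L2 w x) \<and> (AE x in lborel. rep_L2 G' (t, x) = rep_L2 H x))"
    using G G' by (auto simp: L2_time_def L2_on_def)
  show "AE t in lborel. sec G t = sec G' t"
    using X X' AE_lborel_pair[OF Q(1)] AE_lborel_pair[OF Q(2)] rep_sec[of G] rep_sec[of G']
  proof eventually_elim
    case (elim t)
    show ?case
    proof (cases "t \<in> {0<..<T}")
      case True
      then obtain w H w' H' where wH: "(w, H) \<in> H1_graph \<Omega>" "AE x in lborel. rep_L2 v (t, x) = rep_L2 w x"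
        "AE x in lborel. rep_L2 G (t, x) = rep_L2 H x" "(w', H') \<in> H1_graph \<Omega>" "AE x in lborel. rep_L2 v (t, x) = rep_L2 w' x"
        "AE x in lborel. rep_L2 G' (t, x) = rep_L2 H' x"
        using elim(1,2) by blast
      have "w = w'"
        using wH(2,5) by (intro L2_eqI, eventually_elim) simp
      then have "H = H'"
        using H1_graph_unique[OF \<Omega>] wH(1,4) by blast
      show ?thesis
        using elim(5,6) wH(3,6) by (intro L2_eqI, eventually_elim) (simp add: \<open>H = H'\<close>)
    next
      case False
      show ?thesis
        using elim(3-6) by (intro L2_eqI, eventually_elim) (use False in \<open>auto simp: Qcyl_def\<close>)
    qed
  qed
qed

context
  fixes \<Omega> :: "(real^'n) set"
  assumes \<Omega>: "open \<Omega>"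
begin

lemma V_space_iff: "v \<in> V_space T \<Omega> \<longleftrightarrow> (\<exists>G. H10_valued {0<..<T} \<Omega> v G)"
  by (simp add: V_space_def H10_valued_L2_time_iff[OF \<Omega>])

lemma xgrad_eqI:
  assumes "H10_valued {0<..<T} \<Omega> v G"
  shows "xgrad T \<Omega> v = G"
  unfolding xgrad_def
proof (rule the_equality)
  have "L2_time T \<Omega> (H10_graph \<Omega>) v G"
    using assms by (simp add: H10_valued_L2_time_iff[OF \<Omega>])
  then show *: "L2_time T \<Omega> (H1_graph \<Omega>) v G"
    using H10_subset_H1[OF \<Omega>] by (auto simp: L2_time_def elim!: eventually_mono)
  show "G' = G" if "L2_time T \<Omega> (H1_graph \<Omega>) v G'" for G'
    by (rule L2_time_H1_unique[OF \<Omega> that *])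
qed

lemma V_space_xgrad: "v \<in> V_space T \<Omega> \<Longrightarrow> H10_valued {0<..<T} \<Omega> v (xgrad T \<Omega> v)"
  using xgrad_eqI V_space_iff by metis

lemma V_space_add: "v \<in> V_space T \<Omega> \<Longrightarrow> w \<in> V_space T \<Omega> \<Longrightarrow> v + w \<in> V_space T \<Omega>"
  using V_space_iff H10_valued_add by metis

lemma V_space_scaleR: "v \<in> V_space T \<Omega> \<Longrightarrow> r *\<^sub>R v \<in> V_space T \<Omega>"
  using V_space_iff H10_valued_scaleR by metis

lemma xgrad_add: "v \<in> V_space T \<Omega> \<Longrightarrow> w \<in> V_space T \<Omega> \<Longrightarrow> xgrad T \<Omega> (v + w) = xgrad T \<Omega> v + xgrad T \<Omega> w"
  by (intro xgrad_eqI H10_valued_add V_space_xgrad)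

lemma xgrad_scaleR: "v \<in> V_space T \<Omega> \<Longrightarrow> xgrad T \<Omega> (r *\<^sub>R v) = r *\<^sub>R xgrad T \<Omega> v"
  by (intro xgrad_eqI H10_valued_scaleR V_space_xgrad)

lemma V_space_L2_on:
  assumes "v \<in> V_space T \<Omega>"
  shows "v \<in> L2_on (Qcyl T \<Omega>)" "xgrad T \<Omega> v \<in> L2_on (Qcyl T \<Omega>)"
  using V_space_xgrad[OF assms] unfolding H10_valued_L2_time_iff[OF \<Omega>, symmetric]
  by (auto simp: L2_time_def)

end

text \<open>Time slices of a space-time test function are test functions in space, and their
  gradients are the slices of \<open>dx\<close>.\<close>

lemma H10_valued_test:
  fixes \<phi> :: "'n::finite st \<Rightarrow> real"
  assumes "\<phi> \<in> test_functions (I \<times> \<Omega>)"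
  shows "H10_valued I \<Omega> (abs_L2 \<phi>) (abs_L2 (dx \<phi>))"
proof -
  have gr: "(\<lambda>x. dx \<phi> (t, x)) = grad (\<lambda>x. \<phi> (t, x))" for t
  proof
    fix x
    have "((\<lambda>x. \<phi> (t, x)) has_derivative (\<lambda>h. frechet_derivative \<phi> (at (t, x)) (0, h))) (at x)"
      by (rule has_derivative_compose[OF _ test_functions_has_derivative[OF assms], of "\<lambda>x. (t, x)"])
        (auto intro!: derivative_eq_intros)
    then have "frechet_derivative (\<lambda>x. \<phi> (t, x)) (at x) = (\<lambda>h. frechet_derivative \<phi> (at (t, x)) (0, h))"
      by (metis frechet_derivative_at)
    then show "dx \<phi> (t, x) = grad (\<lambda>x. \<phi> (t, x)) x"
      by (simp add: dx_def grad_def)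
  qed
  show ?thesis
    unfolding H10_valued_def
    using sec_abs_L2[OF test_functions_square_integrable[OF assms]] sec_abs_L2[OF dx_square_integrable[OF assms]]
  proof eventually_elim
    case (elim t)
    have "(\<lambda>x. \<phi> (t, x)) = (\<lambda>_. 0)" "(\<lambda>x. dx \<phi> (t, x)) = (\<lambda>_. 0)" if "t \<notin> I"
      using that test_functions_outside[OF assms] dx_outside[OF assms] by auto
    then show ?case
      using elim test_graph_in_H10[OF test_functions_section[OF assms, of t]] by (auto simp: gr zero_L2_def)
  qed
qed

subsection \<open>Density of test functions on the cylinder\<close>

definition tens :: "('a::euclidean_space \<Rightarrow> real) \<Rightarrow> ('b::euclidean_space, 'c::euclidean_space) L2 \<Rightarrow> ('a \<times> 'b, 'c) L2"
  where "tens \<eta> w = abs_L2 (\<lambda>z. \<eta> (fst z) *\<^sub>R rep_L2 w (snd z))"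

lemma square_integrable_tens:
  fixes \<eta> :: "'a::euclidean_space \<Rightarrow> real" and f :: "'b::euclidean_space \<Rightarrow> 'c::euclidean_space"
  assumes \<eta>: "square_integrable \<eta>" and f: "square_integrable f"
  shows "square_integrable (\<lambda>z. \<eta> (fst z) *\<^sub>R f (snd z))"
proof -
  have [measurable]: "\<eta> \<in> borel_measurable borel" "f \<in> borel_measurable borel"
    using \<eta> f by (auto simp: square_integrable_def)
  have m: "(\<lambda>z. \<eta> (fst z) *\<^sub>R f (snd z)) \<in> borel_measurable borel"
    by (simp flip: borel_prod)
  have m2: "(\<lambda>z. ennreal ((norm (\<eta> (fst z) *\<^sub>R f (snd z)))\<^sup>2)) \<in> borel_measurable borel"
    using m by measurable
  have "(\<integral>\<^sup>+z. ennreal ((norm (\<eta> (fst z) *\<^sub>R f (snd z)))\<^sup>2) \<partial>lborel)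
      = (\<integral>\<^sup>+t. \<integral>\<^sup>+x. ennreal ((\<eta> t)\<^sup>2) * ennreal ((norm (f x))\<^sup>2) \<partial>lborel \<partial>lborel)"
    unfolding nn_integral_lborel_pair[OF m2] by (simp add: power_mult_distrib ennreal_mult)
  also have "\<dots> = (\<integral>\<^sup>+t. ennreal ((\<eta> t)\<^sup>2) \<partial>lborel) * (\<integral>\<^sup>+x. ennreal ((norm (f x))\<^sup>2) \<partial>lborel)"
    by (simp add: nn_integral_cmult nn_integral_multc)
  also have "\<dots> < \<infinity>"
    using \<eta> f by (auto simp: square_integrable_iff_nn_integral ennreal_mult_less_top)
  finally show ?thesis
    using m by (simp add: square_integrable_iff_nn_integral)
qed

lemma sec_tens:
  assumes "square_integrable \<eta>"
  shows "AE t in lborel. sec (tens \<eta> w) t = \<eta> t *\<^sub>R w"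
  using sec_abs_L2[OF square_integrable_tens[OF assms square_integrable_rep[of w]]] unfolding tens_def[symmetric]
  by eventually_elim (simp add: abs_L2_scaleR[of "rep_L2 w", simplified, symmetric])

lemma power2_norm_L2_sec: "(norm u)\<^sup>2 = (LINT t|lborel. (norm (sec u t))\<^sup>2)"
  by (simp add: power2_norm_eq_inner inner_L2_sec[of u u])

lemma norm_tens:
  assumes \<eta>: "square_integrable \<eta>"
  shows "norm (tens \<eta> w) = norm (abs_L2 \<eta>) * norm w"
proof -
  have [measurable]: "\<eta> \<in> borel_measurable borel"
    using \<eta> by (auto simp: square_integrable_def)
  have "(norm (tens \<eta> w))\<^sup>2 = (LINT t|lborel. (\<eta> t)\<^sup>2 * (norm w)\<^sup>2)"
    unfolding power2_norm_L2_sec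
  proof (rule integral_cong_AE)
    show "AE t in lborel. (norm (sec (tens \<eta> w) t))\<^sup>2 = (\<eta> t)\<^sup>2 * (norm w)\<^sup>2"
      using sec_tens[OF \<eta>, of w] by eventually_elim (simp add: power_mult_distrib)
  qed (simp_all add: power2_norm_eq_inner)
  also have "\<dots> = (norm (abs_L2 \<eta>))\<^sup>2 * (norm w)\<^sup>2"
    by (simp add: power2_norm_eq_inner[of "abs_L2 \<eta>"] inner_abs_L2[OF \<eta> \<eta>] power2_eq_square[of "\<eta> _"])
  finally have "(norm (tens \<eta> w))\<^sup>2 = (norm (abs_L2 \<eta>) * norm w)\<^sup>2"
    by (simp add: power_mult_distrib)
  then show ?thesis by simp
qed

lemma tens_diff_right:
  assumes "square_integrable \<eta>"
  shows "tens \<eta> w - tens \<eta> w' = tens \<eta> (w - w')"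
  by (rule L2_eqI_sec) (use sec_diff[of "tens \<eta> w" "tens \<eta> w'"] sec_tens[OF assms, of w] sec_tens[OF assms, of w']
      sec_tens[OF assms, of "w - w'"] in \<open>eventually_elim, simp add: scaleR_diff_right\<close>)

lemma tens_diff_left:
  assumes "square_integrable \<eta>" "square_integrable \<theta>"
  shows "tens \<eta> w - tens \<theta> w = tens (\<lambda>t. \<eta> t - \<theta> t) w"
  by (rule L2_eqI_sec) (use sec_diff[of "tens \<eta> w" "tens \<theta> w"] sec_tens[OF assms(1), of w] sec_tens[OF assms(2), of w]
      sec_tens[OF square_integrable_diff[OF assms], of w] in \<open>eventually_elim, simp add: scaleR_diff_left\<close>)

lemma tens_abs:
  assumes \<eta>: "square_integrable \<eta>" and f: "square_integrable f"
  shows "tens \<eta> (abs_L2 f) = abs_L2 (\<lambda>z. \<eta> (fst z) *\<^sub>R f (snd z))"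
  by (rule L2_eqI_sec) (use sec_tens[OF \<eta>, of "abs_L2 f"] sec_abs_L2[OF square_integrable_tens[OF \<eta> f]]
      in \<open>eventually_elim, simp add: abs_L2_scaleR[OF f]\<close>)

definition test_graph :: "('n::finite st) set \<Rightarrow> (('n st, real) L2 \<times> ('n st, real^'n) L2) set"
  where "test_graph S = {(abs_L2 \<phi>, abs_L2 (dx \<phi>)) | \<phi>. \<phi> \<in> test_functions S}"

lemma dx_add:
  assumes "\<phi> \<in> test_functions S" "\<psi> \<in> test_functions S"
  shows "dx (\<lambda>x. \<phi> x + \<psi> x) = (\<lambda>x. dx \<phi> x + dx \<psi> x)"
  by (intro ext) (simp add: dx_def vec_eq_iff frechet_derivative_add_test[OF assms])

lemma dx_scale:
  assumes "\<phi> \<in> test_functions S"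
  shows "dx (\<lambda>x. c * \<phi> x) = (\<lambda>x. c *\<^sub>R dx \<phi> x)"
  by (intro ext) (simp add: dx_def vec_eq_iff frechet_derivative_scale_test[OF assms])

lemma subspace_test_graph_st: "subspace (test_graph S)"
proof (rule subspaceI)
  have G: "(abs_L2 \<phi>, abs_L2 (dx \<phi>)) \<in> test_graph S" if "\<phi> \<in> test_functions S" for \<phi>
    using that by (auto simp: test_graph_def)
  have g0: "dx (\<lambda>_. 0) = (\<lambda>_. 0)"
    by (intro ext) (simp add: dx_def vec_eq_iff)
  show "0 \<in> test_graph S"
    using G[OF test_functions_zero, unfolded g0] unfolding zero_prod_def zero_L2_def .
  fix x y c assume "x \<in> test_graph S"
  then obtain \<phi> where \<phi>: "\<phi> \<in> test_functions S" "x = (abs_L2 \<phi>, abs_L2 (dx \<phi>))"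
    by (auto simp: test_graph_def)
  show "c *\<^sub>R x \<in> test_graph S"
    using G[OF test_functions_scale[OF \<phi>(1), of c]]
    by (simp add: \<phi>(2) dx_scale[OF \<phi>(1)] abs_L2_scaleR dx_square_integrable[OF \<phi>(1)]
        test_functions_square_integrable[OF \<phi>(1)])
  assume "y \<in> test_graph S"
  then obtain \<psi> where \<psi>: "\<psi> \<in> test_functions S" "y = (abs_L2 \<psi>, abs_L2 (dx \<psi>))"
    by (auto simp: test_graph_def)
  show "x + y \<in> test_graph S"
    using G[OF test_functions_add[OF \<phi>(1) \<psi>(1)]]
    by (simp add: \<phi>(2) \<psi>(2) dx_add[OF \<phi>(1) \<psi>(1)] abs_L2_add dx_square_integrable[OF \<phi>(1)] dx_square_integrable[OF \<psi>(1)]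
        test_functions_square_integrable[OF \<phi>(1)] test_functions_square_integrable[OF \<psi>(1)])
qed

lemma dx_tensor:
  assumes "\<eta> \<in> test_functions I" "\<psi> \<in> test_functions \<Omega>"
  shows "dx (\<lambda>z. \<eta> (fst z) * \<psi> (snd z)) z = \<eta> (fst z) *\<^sub>R grad \<psi> (snd z)"
proof -
  have "((\<lambda>z. \<eta> (fst z) * \<psi> (snd z)) has_derivative
    (\<lambda>h. \<eta> (fst z) * frechet_derivative \<psi> (at (snd z)) (snd h) + frechet_derivative \<eta> (at (fst z)) (fst h) * \<psi> (snd z))) (at z)"
    by (intro has_derivative_mult has_derivative_compose[OF _ test_functions_has_derivative[OF assms(1)], of fst]
        has_derivative_compose[OF _ test_functions_has_derivative[OF assms(2)], of snd])
      (auto intro!: derivative_eq_intros)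
  moreover have "frechet_derivative \<eta> (at (fst z)) 0 = 0"
    using linear_0[OF has_derivative_linear[OF test_functions_has_derivative[OF assms(1)]]] .
  ultimately show ?thesis
    by (simp add: dx_def grad_def vec_eq_iff frechet_derivative_at[symmetric])
qed

lemma indicator_ivl_square_integrable: "square_integrable (indicator {c<..<d} :: real \<Rightarrow> real)"
proof -
  have "(norm (indicator {c<..<d} x :: real))\<^sup>2 = indicator {c<..<d} x" for x :: real
    by (auto simp: indicator_def)
  then show ?thesis
    by (cases "c \<le> d") (simp_all add: square_integrable_def integrable_indicator_iff)
qed

lemma bump_ivl_test_function: "bump k c d \<in> test_functions {c<..<d}" for c d :: real
  by (rule bump_test_function) (simp add: box_real)

lemma bump_tendsto_L2:
  fixes c d :: real
  shows "(\<lambda>k. norm (abs_L2 (\<lambda>t. indicator {c<..<d} t - bump k c d t))) \<longlonglongrightarrow> (0::real)"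
proof -
  have tf: "bump k c d \<in> test_functions {c<..<d}" for k
    by (rule bump_ivl_test_function)
  have sq: "square_integrable (\<lambda>t. indicator {c<..<d} t - bump k c d t)" for k
    by (rule square_integrable_diff[OF indicator_ivl_square_integrable test_functions_square_integrable[OF tf]])
  have "(\<lambda>k. LINT t|lborel. (indicator {c<..<d} t - bump k c d t)\<^sup>2) \<longlonglongrightarrow> (LINT t::real|lborel. (0::real))"
  proof (rule Bochner_Integration.integral_dominated_convergence[where w="indicator {c<..<d}"])
    show "(\<lambda>t. (indicator {c<..<d} t - bump k c d t)\<^sup>2) \<in> borel_measurable lborel" for k
      using test_functions_measurable[OF tf, of k] by simp
    show "integrable lborel (indicator {c<..<d} :: real \<Rightarrow> real)"
      by (cases "c \<le> d") (simp_all add: integrable_indicator_iff)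
    show "AE t in lborel. (\<lambda>k. (indicator {c<..<d} t - bump k c d t)\<^sup>2) \<longlonglongrightarrow> 0"
    proof (rule AE_I2)
      fix t
      have "(\<lambda>k. (indicator {c<..<d} t - bump k c d t)\<^sup>2) \<longlonglongrightarrow> (indicator {c<..<d} t - indicator (box c d) t)\<^sup>2"
        by (intro tendsto_intros bump_tendsto)
      then show "(\<lambda>k. (indicator {c<..<d} t - bump k c d t)\<^sup>2) \<longlonglongrightarrow> 0"
        by (simp add: box_real)
    qed
    show "AE t in lborel. norm ((indicator {c<..<d} t - bump k c d t)\<^sup>2) \<le> indicator {c<..<d} t" for k
    proof (rule AE_I2)
      fix t
      show "norm ((indicator {c<..<d} t - bump k c d t)\<^sup>2) \<le> indicator {c<..<d} t"
        using bump_bounds[of k c d t] test_functions_outside[OF tf, of t k]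
        by (cases "t \<in> {c<..<d}") (auto simp: abs_square_le_1)
    qed
  qed simp
  then have "(\<lambda>k. (norm (abs_L2 (\<lambda>t. indicator {c<..<d} t - bump k c d t)))\<^sup>2) \<longlonglongrightarrow> (0::real)"
    unfolding power2_norm_eq_inner inner_abs_L2[OF sq sq] by (simp add: power2_eq_square)
  then have "(\<lambda>k. sqrt ((norm (abs_L2 (\<lambda>t. indicator {c<..<d} t - bump k c d t)))\<^sup>2)) \<longlonglongrightarrow> sqrt (0::real)"
    by (rule tendsto_real_sqrt)
  then show ?thesis by simp
qed

lemma tens_bump_tendsto: "(\<lambda>k. tens (bump k c d) u) \<longlonglongrightarrow> tens (indicator {c<..<d}) u" for c d :: real
proof -
  let ?i = "indicator {c<..<d} :: real \<Rightarrow> real"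
  have sqb: "square_integrable (bump k c d)" for k
    by (rule test_functions_square_integrable[OF bump_ivl_test_function])
  have "norm (tens (bump k c d) u - tens ?i u) = norm (abs_L2 (\<lambda>t. ?i t - bump k c d t)) * norm u" for k
    using norm_tens[OF square_integrable_diff[OF indicator_ivl_square_integrable sqb], of c d k u]
    by (simp add: norm_minus_commute tens_diff_left[OF indicator_ivl_square_integrable sqb])
  then have "(\<lambda>k. norm (tens (bump k c d) u - tens ?i u)) \<longlonglongrightarrow> 0 * norm u"
    using tendsto_mult_right[OF bump_tendsto_L2, of c d "norm u"] by simp
  then show ?thesis
    by (simp add: LIM_zero_iff tendsto_norm_zero_iff)
qed

lemma tens_tendsto:
  assumes "square_integrable \<eta>" "u \<longlonglongrightarrow> u0"
  shows "(\<lambda>n. tens \<eta> (u n)) \<longlonglongrightarrow> tens \<eta> u0"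
proof -
  have "(\<lambda>n. norm (tens \<eta> (u n) - tens \<eta> u0)) \<longlonglongrightarrow> norm (abs_L2 \<eta>) * 0"
    unfolding tens_diff_right[OF assms(1)] norm_tens[OF assms(1)]
    using assms(2) by (intro tendsto_mult tendsto_const tendsto_norm_zero LIM_zero)
  then show ?thesis
    by (simp add: LIM_zero_iff tendsto_norm_zero_iff)
qed

text \<open>Two limits in succession: with a smooth spatial factor, bumps in time tend to the
  indicator; then the spatial factor runs through test functions approximating (w, H) in the H1
  norm.\<close>

lemma tens_indicator_in_closure:
  assumes wH: "(w, H) \<in> H10_graph \<Omega>" and cd: "{c<..<d} \<subseteq> I"
  shows "(tens (indicator {c<..<d}) w, tens (indicator {c<..<d}) H) \<in> closure (test_graph (I \<times> \<Omega>))"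
proof -
  let ?i = "indicator {c<..<d} :: real \<Rightarrow> real"
  have tf: "bump k c d \<in> test_functions {c<..<d}" for k
    by (rule bump_ivl_test_function)
  have sqb: "square_integrable (bump k c d)" for k
    by (rule test_functions_square_integrable[OF tf])
  have 1: "(tens ?i (abs_L2 \<psi>), tens ?i (abs_L2 (grad \<psi>))) \<in> closure (test_graph (I \<times> \<Omega>))"
    if \<psi>: "\<psi> \<in> test_functions \<Omega>" for \<psi>
  proof -
    let ?\<phi> = "\<lambda>k z. bump k c d (fst z) * \<psi> (snd z)"
    have "(abs_L2 (?\<phi> k), abs_L2 (dx (?\<phi> k))) = (tens (bump k c d) (abs_L2 \<psi>), tens (bump k c d) (abs_L2 (grad \<psi>)))" for k
      using tens_abs[OF sqb[of k] test_functions_square_integrable[OF \<psi>]] tens_abs[OF sqb[of k] grad_square_integrable[OF \<psi>]]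
      by (simp add: dx_tensor[OF tf \<psi>, abs_def])
    moreover have "?\<phi> k \<in> test_functions (I \<times> \<Omega>)" for k
      by (rule test_functions_mono[OF test_functions_tensor[OF tf \<psi>]]) (use cd in auto)
    moreover have "(abs_L2 (?\<phi> k), abs_L2 (dx (?\<phi> k))) \<in> test_graph (I \<times> \<Omega>)" for k
      unfolding test_graph_def using calculation(2)[of k] by blast
    ultimately have mem: "(tens (bump k c d) (abs_L2 \<psi>), tens (bump k c d) (abs_L2 (grad \<psi>))) \<in> test_graph (I \<times> \<Omega>)" for k
      by metis
    show ?thesis
      unfolding closure_sequential
      by (intro exI[of _ "\<lambda>k. (tens (bump k c d) (abs_L2 \<psi>), tens (bump k c d) (abs_L2 (grad \<psi>)))"] conjI allI mem tendsto_Pair tens_bump_tendsto)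
  qed
  obtain s where s: "\<And>n. s n \<in> {(L2_of \<Omega> \<phi>, L2_of \<Omega> (grad \<phi>)) | \<phi>. \<phi> \<in> test_functions \<Omega>}" "s \<longlonglongrightarrow> (w, H)"
    using wH unfolding H10_graph_def closure_sequential by blast
  have "(tens ?i (fst (s n)), tens ?i (snd (s n))) \<in> closure (test_graph (I \<times> \<Omega>))" for n
    using s(1)[of n] 1 by (auto simp: L2_of_test_function L2_of_grad)
  then show ?thesis
    by (rule closed_sequentially[OF closed_closure _ tendsto_Pair[OF
          tens_tendsto[OF indicator_ivl_square_integrable tendsto_fst[OF s(2), unfolded fst_conv]]
          tens_tendsto[OF indicator_ivl_square_integrable tendsto_snd[OF s(2), unfolded snd_conv]]]])
qed

text \<open>Joint measurability in two independent times, needed to apply Fubini to interpolation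
  errors that depend on a node and on a running time.\<close>

lemma measurable_sec_inner_pair [measurable]:
  fixes u :: "('a::euclidean_space \<times> 'b::euclidean_space, 'c::euclidean_space) L2" and v :: "('d::euclidean_space \<times> 'b, 'c) L2"
  shows "(\<lambda>(s, t). sec u s \<bullet> sec v t) \<in> borel_measurable (borel \<Otimes>\<^sub>M borel)"
proof -
  have [measurable]: "(\<lambda>p. rep_L2 u (fst (fst p), snd p) \<bullet> rep_L2 v (snd (fst p), snd p)) \<in> borel_measurable ((borel \<Otimes>\<^sub>M borel) \<Otimes>\<^sub>M lborel)"
  proof -
    have 1: "(\<lambda>p. (fst (fst p), snd p)) \<in> (borel \<Otimes>\<^sub>M borel) \<Otimes>\<^sub>M lborel \<rightarrow>\<^sub>M (borel :: ('a \<times> 'b) measure)"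
      by (subst borel_prod[symmetric]) measurable
    have 2: "(\<lambda>p. (snd (fst p), snd p)) \<in> (borel \<Otimes>\<^sub>M borel) \<Otimes>\<^sub>M lborel \<rightarrow>\<^sub>M (borel :: ('d \<times> 'b) measure)"
      by (subst borel_prod[symmetric]) measurable
    show ?thesis
      by (intro borel_measurable_inner measurable_compose[OF 1 measurable_rep_L2] measurable_compose[OF 2 measurable_rep_L2])
  qed
  have m: "(\<lambda>p. LINT x|lborel. rep_L2 u (fst p, x) \<bullet> rep_L2 v (snd p, x)) \<in> borel_measurable (borel \<Otimes>\<^sub>M borel)"
    by measurable
  have "(\<lambda>p. if square_integrable (\<lambda>x. rep_L2 u (fst p, x)) \<and> square_integrable (\<lambda>x. rep_L2 v (snd p, x))
     then LINT x|lborel. rep_L2 u (fst p, x) \<bullet> rep_L2 v (snd p, x) else 0) \<in> borel_measurable (borel \<Otimes>\<^sub>M borel)"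
    using m by measurable
  moreover have "(\<lambda>(s, t). sec u s \<bullet> sec v t) = (\<lambda>p. if square_integrable (\<lambda>x. rep_L2 u (fst p, x)) \<and> square_integrable (\<lambda>x. rep_L2 v (snd p, x))
     then LINT x|lborel. rep_L2 u (fst p, x) \<bullet> rep_L2 v (snd p, x) else 0)"
    by (intro ext) (simp add: sec_def inner_abs_L2 split_beta)
  ultimately show ?thesis by simp
qed

lemma nn_integral_sec_translate:
  "(\<integral>\<^sup>+s. ennreal ((norm (sec u (s + r) - sec u s))\<^sup>2) \<partial>lborel) = ennreal ((norm (shift_L2 (r, 0) u - u))\<^sup>2)"
  unfolding nn_integral_sec_norm[symmetric]
  by (intro nn_integral_cong_AE) (use sec_diff[of "shift_L2 (r, 0) u" u] sec_shift[of r u] in \<open>eventually_elim, simp\<close>)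

lemma sec_sum:
  "finite J \<Longrightarrow> AE t in lborel. sec (\<Sum>j\<in>J. u j) t = (\<Sum>j\<in>J. sec (u j) t)"
proof (induction J rule: finite_induct)
  case empty
  show ?case
    using sec_zero by simp
next
  case (insert j J)
  show ?case
    using sec_add[of "u j" "\<Sum>j\<in>J. u j"] insert.IH by eventually_elim (simp add: insert.hyps)
qed

lemma power2_norm_diff_inner: "(norm (x - y))\<^sup>2 = x \<bullet> x - 2 * (x \<bullet> y) + y \<bullet> y" for x y :: "'a::real_inner"
  by (simp add: power2_norm_eq_inner inner_diff_left inner_diff_right inner_commute)

text \<open>Piecewise constant interpolation in time: averaging the interpolation error over the position
  of the nodes bounds it by the modulus of continuity of translations, so that some position of
  the nodes, at which the values lie in the graph of \<open>H\<^sub>0\<^sup>1\<close>, is good.\<close>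

lemma H10_valued_in_closure:
  fixes v :: "('n::finite st, real) L2" and G :: "('n st, real^'n) L2"
  assumes V: "H10_valued {a<..<b} \<Omega> v G" and ab: "a < b"
  shows "(v, G) \<in> closure (test_graph ({a<..<b} \<times> \<Omega>))"
proof -
  let ?C = "closure (test_graph ({a<..<b} \<times> \<Omega>))"
  have "\<exists>y\<in>?C. dist y (v, G) < e" if e: "e > 0" for e
  proof -
    obtain d1 where d1: "d1 > 0" "\<And>s. s \<noteq> 0 \<Longrightarrow> norm s < d1 \<Longrightarrow> norm (shift_L2 s v - v) < e/4"
      using LIM_D[OF shift_L2_tendsto[of v], of "e/4"] e by auto
    obtain d2 where d2: "d2 > 0" "\<And>s. s \<noteq> 0 \<Longrightarrow> norm s < d2 \<Longrightarrow> norm (shift_L2 s G - G) < e/4"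
      using LIM_D[OF shift_L2_tendsto[of G], of "e/4"] e by auto
    define d where "d = min d1 d2"
    have d: "d > 0" using d1 d2 by (simp add: d_def)
    have small: "(norm (shift_L2 (r, 0) v - v))\<^sup>2 + (norm (shift_L2 (r, 0) G - G))\<^sup>2 \<le> e\<^sup>2 / 8" if "\<bar>r\<bar> < d" for r
    proof -
      have "norm (shift_L2 (r, 0) v - v) \<le> e/4"
      proof (cases "r = 0")
        case True
        then show ?thesis using e by (simp flip: zero_prod_def)
      next
        case False
        then show ?thesis using d1(2)[of "(r, 0)"] that by (simp add: d_def zero_prod_def norm_Pair)
      qed
      moreover have "norm (shift_L2 (r, 0) G - G) \<le> e/4"
      proof (cases "r = 0")
        case True
        then show ?thesis using e by (simp flip: zero_prod_def)
      next
        case False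
        then show ?thesis using d2(2)[of "(r, 0)"] that by (simp add: d_def zero_prod_def norm_Pair)
      qed
      ultimately have "(norm (shift_L2 (r, 0) v - v))\<^sup>2 \<le> (e/4)\<^sup>2" "(norm (shift_L2 (r, 0) G - G))\<^sup>2 \<le> (e/4)\<^sup>2"
        by (auto intro!: power_mono)
      then show ?thesis by (simp add: power_divide)
    qed
    obtain N0 where N0: "(b - a) / d < real N0" using reals_Archimedean2 by blast
    define N where "N = Suc N0"
    define h where "h = (b - a) / real N"
    have N: "N > 0" by (simp add: N_def)
    have h: "h > 0" "real N * h = b - a" using ab N by (simp_all add: h_def)
    have hd: "h < d"
    proof -
      have "(b - a) / d < real N" using N0 by (simp add: N_def)
      then show ?thesis using d N by (simp add: h_def field_simps)
    qed
    define I where "I j = {a + real j * h <..< a + (real j + 1) * h}" for j :: nat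
    have [measurable]: "I j \<in> sets borel" for j by (simp add: I_def)
    \<comment> \<open>The squared distance between the values at times s and t, for function and
      gradient together, spelled out in inner products for the sake of measurability.\<close>
    define K where "K s t = ennreal ((sec v t \<bullet> sec v t - 2 * (sec v t \<bullet> sec v s) + sec v s \<bullet> sec v s)
        + (sec G t \<bullet> sec G t - 2 * (sec G t \<bullet> sec G s) + sec G s \<bullet> sec G s))" for s t
    have K: "K s t = ennreal ((norm (sec v t - sec v s))\<^sup>2) + ennreal ((norm (sec G t - sec G s))\<^sup>2)" for s t
      by (simp add: K_def flip: power2_norm_diff_inner)
    have Kmeas [measurable (raw)]: "(\<lambda>x. K (f x) (g x)) \<in> borel_measurable M"
      if [measurable]: "f \<in> M \<rightarrow>\<^sub>M borel" "g \<in> M \<rightarrow>\<^sub>M borel" for f g and M :: "'z measure"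
      unfolding K_def by measurable
    have Kmeas2 [measurable]: "(\<lambda>(s, t). K s t) \<in> borel_measurable (borel \<Otimes>\<^sub>M borel)"
      "(\<lambda>(s, t). K s (t + s)) \<in> borel_measurable (borel \<Otimes>\<^sub>M borel)" "(\<lambda>t. K s t) \<in> borel_measurable borel" for s
      unfolding K_def by measurable
    \<comment> \<open>\<open>F s\<close> is the squared error of the piecewise constant interpolant
      whose node in the j-th cell has offset \<open>s\<close>. Integrating it over offsets in (0,h)
      moves the nodes through whole cells, so each summand becomes a double integral over one cell
      squared.\<close>
    define F where "F s = (\<Sum>j<N. \<integral>\<^sup>+t. indicator (I j) t * K (s + (a + real j * h)) t \<partial>lborel)" for s
    have Im[measurable]: "(\<lambda>s. \<integral>\<^sup>+t. indicator (I j) t * K s t \<partial>lborel) \<in> borel_measurable borel" for j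
    proof -
      have "(\<lambda>(s, t). indicator (I j) t * K s t) \<in> borel_measurable (borel \<Otimes>\<^sub>M lborel)"
        unfolding K_def by measurable
      then show ?thesis by (rule lborel.borel_measurable_nn_integral)
    qed
    have Fmeas[measurable]: "F \<in> borel_measurable borel"
      unfolding F_def[abs_def] by (intro borel_measurable_sum measurable_compose[OF _ Im]) measurable
    have disj: "j = j'" if "t \<in> I j" "t \<in> I j'" for t j j'
    proof -
      have "real j * h < (real j' + 1) * h" "real j' * h < (real j + 1) * h"
        using that by (auto simp: I_def)
      then show ?thesis using h(1) by (simp add: mult_less_cancel_right)
    qed
    have "(\<integral>\<^sup>+s. indicator {0<..<h} s * F s \<partial>lborel)
        = (\<Sum>j<N. \<integral>\<^sup>+s. indicator {0<..<h} s * (\<integral>\<^sup>+t. indicator (I j) t * K (s + (a + real j * h)) t \<partial>lborel) \<partial>lborel)"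
      unfolding F_def sum_distrib_left
      by (intro nn_integral_sum borel_measurable_times measurable_compose[OF _ Im]) measurable
    also have "\<dots> = (\<Sum>j<N. \<integral>\<^sup>+s. indicator (I j) s * (\<integral>\<^sup>+t. indicator (I j) t * K s t \<partial>lborel) \<partial>lborel)"
    proof (intro sum.cong refl)
      fix j
      have "(\<integral>\<^sup>+s. indicator (I j) (s + (a + real j * h)) * (\<integral>\<^sup>+t. indicator (I j) t * K (s + (a + real j * h)) t \<partial>lborel) \<partial>lborel)
        = (\<integral>\<^sup>+s. indicator (I j) s * (\<integral>\<^sup>+t. indicator (I j) t * K s t \<partial>lborel) \<partial>lborel)"
        by (intro nn_integral_shift[of "\<lambda>s. indicator (I j) s * (\<integral>\<^sup>+t. indicator (I j) t * K s t \<partial>lborel)"] borel_measurable_times Im) measurable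
      moreover have "indicator (I j) (s + (a + real j * h)) = (indicator {0<..<h} s :: ennreal)" for s
        by (auto simp: I_def indicator_def algebra_simps)
      ultimately show "(\<integral>\<^sup>+s. indicator {0<..<h} s * (\<integral>\<^sup>+t. indicator (I j) t * K (s + (a + real j * h)) t \<partial>lborel) \<partial>lborel)
        = (\<integral>\<^sup>+s. indicator (I j) s * (\<integral>\<^sup>+t. indicator (I j) t * K s t \<partial>lborel) \<partial>lborel)"
        by simp
    qed
    also have "\<dots> = (\<integral>\<^sup>+s. (\<Sum>j<N. indicator (I j) s * (\<integral>\<^sup>+t. indicator (I j) t * K s t \<partial>lborel)) \<partial>lborel)"
      by (intro nn_integral_sum[symmetric] borel_measurable_times) (auto simp: Im)
    \<comment> \<open>Two times in a common cell differ by less than h, and they share at most one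
      cell, so the sum over cells is dominated by the strip around the diagonal.\<close>
    also have "\<dots> \<le> (\<integral>\<^sup>+s. (\<integral>\<^sup>+t. indicator {-h<..<h} (t - s) * K s t \<partial>lborel) \<partial>lborel)"
    proof (rule nn_integral_mono)
      fix s
      have "(\<Sum>j<N. indicator (I j) s * (\<integral>\<^sup>+t. indicator (I j) t * K s t \<partial>lborel))
        = (\<integral>\<^sup>+t. (\<Sum>j<N. indicator (I j) s * (indicator (I j) t * K s t)) \<partial>lborel)"
        by (subst nn_integral_sum) (auto simp: nn_integral_cmult)
      also have "\<dots> \<le> (\<integral>\<^sup>+t. indicator {-h<..<h} (t - s) * K s t \<partial>lborel)"
      proof (rule nn_integral_mono)
        fix t
        show "(\<Sum>j<N. indicator (I j) s * (indicator (I j) t * K s t)) \<le> indicator {-h<..<h} (t - s) * K s t"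
        proof (cases "\<exists>j<N. s \<in> I j \<and> t \<in> I j")
          case True
          then obtain j0 where j0: "j0 < N" "s \<in> I j0" "t \<in> I j0" by blast
          have "(\<Sum>j<N. indicator (I j) s * (indicator (I j) t * K s t)) = (\<Sum>j<N. if j = j0 then K s t else 0)"
            using j0 disj by (intro sum.cong) (auto simp: indicator_def)
          also have "\<dots> = K s t" using j0 by simp
          also have "\<dots> = indicator {-h<..<h} (t - s) * K s t"
            using j0 by (auto simp: I_def indicator_def algebra_simps)
          finally show ?thesis by simp
        next
          case False
          then have "(\<Sum>j<N. indicator (I j) s * (indicator (I j) t * K s t)) = 0"
            by (intro sum.neutral) (auto simp: indicator_def)
          then show ?thesis by (simp only: zero_le)
        qed
      qed
      finally show "(\<Sum>j<N. indicator (I j) s * (\<integral>\<^sup>+t. indicator (I j) t * K s t \<partial>lborel)) \<le> (\<integral>\<^sup>+t. indicator {-h<..<h} (t - s) * K s t \<partial>lborel)" .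
    qed
    also have "\<dots> = (\<integral>\<^sup>+s. (\<integral>\<^sup>+r. indicator {-h<..<h} r * K s (r + s) \<partial>lborel) \<partial>lborel)"
    proof (rule nn_integral_cong)
      fix s
      have "(\<lambda>t. indicator {-h<..<h} (t - s) * K s t) \<in> borel_measurable borel"
        by measurable
      from nn_integral_shift[OF this, of s]
      show "(\<integral>\<^sup>+t. indicator {-h<..<h} (t - s) * K s t \<partial>lborel) = (\<integral>\<^sup>+r. indicator {-h<..<h} r * K s (r + s) \<partial>lborel)"
        by simp
    qed
    also have "\<dots> = (\<integral>\<^sup>+r. (\<integral>\<^sup>+s. indicator {-h<..<h} r * K s (r + s) \<partial>lborel) \<partial>lborel)"
    proof -
      have "(\<lambda>(r, s). indicator {-h<..<h} r * K s (r + s)) \<in> borel_measurable (lborel \<Otimes>\<^sub>M lborel)"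
        unfolding K_def by measurable
      from lborel_pair.Fubini'[OF this] show ?thesis .
    qed
    \<comment> \<open>With the time difference \<open>r\<close> frozen, the inner integral is the
      squared translation error of v and G, which \<open>small\<close> bounds because h < d.\<close>
    also have "\<dots> \<le> (\<integral>\<^sup>+r. ennreal (e\<^sup>2 / 8) * indicator {-h<..<h} r \<partial>lborel)"
    proof (rule nn_integral_mono)
      fix r
      have "(\<integral>\<^sup>+s. K s (r + s) \<partial>lborel) = ennreal ((norm (shift_L2 (r, 0) v - v))\<^sup>2) + ennreal ((norm (shift_L2 (r, 0) G - G))\<^sup>2)"
      proof -
        have m: "(\<lambda>s. ennreal ((norm (sec v (s + r) - sec v s))\<^sup>2)) \<in> borel_measurable lborel"
          "(\<lambda>s. ennreal ((norm (sec G (s + r) - sec G s))\<^sup>2)) \<in> borel_measurable lborel"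
          unfolding power2_norm_diff_inner by measurable
        show ?thesis
          unfolding K add.commute[of r] by (subst nn_integral_add[OF m]) (simp only: nn_integral_sec_translate)
      qed
      moreover have "(norm (shift_L2 (r, 0) v - v))\<^sup>2 + (norm (shift_L2 (r, 0) G - G))\<^sup>2 \<le> e\<^sup>2 / 8"
        if "r \<in> {-h<..<h}"
        by (rule small) (use that hd in auto)
      ultimately have *: "r \<in> {-h<..<h} \<Longrightarrow> (\<integral>\<^sup>+s. K s (r + s) \<partial>lborel) \<le> ennreal (e\<^sup>2 / 8)"
        by (simp only: ennreal_plus[symmetric] zero_le_power2 ennreal_leI)
      show "(\<integral>\<^sup>+s. indicator {-h<..<h} r * K s (r + s) \<partial>lborel) \<le> ennreal (e\<^sup>2 / 8) * indicator {-h<..<h} r"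
        using * by (cases "r \<in> {-h<..<h}") auto
    qed
    \<comment> \<open>The admissible differences fill an interval of length 2h, and e^2/8 times 2h
      is e^2/4 times h.\<close>
    also have "\<dots> = ennreal (e\<^sup>2 / 4 * h)"
      using h by (simp add: nn_integral_cmult_indicator flip: ennreal_mult)
    finally have Fint: "(\<integral>\<^sup>+s. indicator {0<..<h} s * F s \<partial>lborel) \<le> ennreal (e\<^sup>2 / 4 * h)" .
    define good where "good t \<longleftrightarrow> (sec v t, sec G t) \<in> H10_graph \<Omega>" for t
    have goodAE: "AE s in lborel. \<forall>j::nat. good (s + (a + real j * h))"
      using V unfolding H10_valued_def good_def
      by (subst AE_all_countable) (auto intro!: AE_lborel_shift[where P="\<lambda>t. (sec v t, sec G t) \<in> H10_graph \<Omega>"] elim: eventually_mono)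
    \<comment> \<open>If the error were at least e^2/2 at almost every offset, its integral over
      (0,h) would be at least e^2/2 times h, twice the bound just found. Restricting to offsets with
      good nodes discards only a null set.\<close>
    have "\<exists>s. s \<in> {0<..<h} \<and> (\<forall>j. good (s + (a + real j * h))) \<and> F s < ennreal (e\<^sup>2 / 2)"
    proof (rule ccontr)
      assume nt: "\<not> ?thesis"
      have "AE s in lborel. ennreal (e\<^sup>2 / 2) * indicator {0<..<h} s \<le> indicator {0<..<h} s * F s"
        using goodAE
      proof eventually_elim
        case (elim s)
        show ?case
        proof (cases "s \<in> {0<..<h}")
          case True
          then have "\<not> F s < ennreal (e\<^sup>2 / 2)" using nt elim by blast
          then show ?thesis using True by simp
        qed simp
      qed
      then have "(\<integral>\<^sup>+s. ennreal (e\<^sup>2 / 2) * indicator {0<..<h} s \<partial>lborel) \<le> ennreal (e\<^sup>2 / 4 * h)"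
        by (rule order_trans[OF nn_integral_mono_AE Fint])
      moreover have "(\<integral>\<^sup>+s. ennreal (e\<^sup>2 / 2) * indicator {0<..<h} s \<partial>lborel) = ennreal (e\<^sup>2 / 2 * h)"
        using h by (simp add: nn_integral_cmult_indicator flip: ennreal_mult)
      ultimately have "e\<^sup>2 / 2 * h \<le> e\<^sup>2 / 4 * h" using h e by simp
      then show False using h e by simp
    qed
    then obtain s where s: "\<And>j. good (s + (a + real j * h))" "F s < ennreal (e\<^sup>2 / 2)" by blast
    define p where "p j = s + (a + real j * h)" for j :: nat
    define y where "y = (\<Sum>j<N. (tens (indicator (I j)) (sec v (p j)), tens (indicator (I j)) (sec G (p j))))"
    have y: "y \<in> ?C"
      unfolding y_def
    proof (intro subspace_sum[OF subspace_closure[OF subspace_test_graph_st]])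
      fix j assume "j \<in> {..<N}"
      then have "(real j + 1) * h \<le> real N * h" using h(1) by (intro mult_right_mono) auto
      then have "I j \<subseteq> {a<..<b}"
        using h by (auto simp: I_def) (smt (verit) mult_nonneg_nonneg of_nat_0_le_iff)
      then show "(tens (indicator (I j)) (sec v (p j)), tens (indicator (I j)) (sec G (p j))) \<in> ?C"
        using s(1)[of j] unfolding I_def p_def good_def by (intro tens_indicator_in_closure)
    qed
    have secy: "AE t in lborel. sec (v - fst y) t = sec v t - (\<Sum>j<N. indicator (I j) t *\<^sub>R sec v (p j))"
    proof -
      have fy: "fst y = (\<Sum>j<N. tens (indicator (I j)) (sec v (p j)))" by (simp add: y_def fst_sum)
      have "AE t in lborel. \<forall>j. sec (tens (indicator (I j)) (sec v (p j))) t = indicator (I j) t *\<^sub>R sec v (p j)"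
        unfolding AE_all_countable I_def by (intro allI sec_tens indicator_ivl_square_integrable)
      then show ?thesis
        using sec_diff[of v "fst y"] sec_sum[OF finite_lessThan[of N], of "\<lambda>j. tens (indicator (I j)) (sec v (p j))"]
        unfolding fy by eventually_elim simp
    qed
    have secy': "AE t in lborel. sec (G - snd y) t = sec G t - (\<Sum>j<N. indicator (I j) t *\<^sub>R sec G (p j))"
    proof -
      have fy: "snd y = (\<Sum>j<N. tens (indicator (I j)) (sec G (p j)))" by (simp add: y_def snd_sum)
      have "AE t in lborel. \<forall>j. sec (tens (indicator (I j)) (sec G (p j))) t = indicator (I j) t *\<^sub>R sec G (p j)"
        unfolding AE_all_countable I_def by (intro allI sec_tens indicator_ivl_square_integrable)
      then show ?thesis
        using sec_diff[of G "snd y"] sec_sum[OF finite_lessThan[of N], of "\<lambda>j. tens (indicator (I j)) (sec G (p j))"]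
        unfolding fy by eventually_elim simp
    qed
    \<comment> \<open>The cells are open, so their endpoints are covered by none of them and must be
      excluded.\<close>
    have grid: "AE t in lborel. t \<notin> range (\<lambda>j::nat. a + real j * h)"
      by (intro AE_not_in countable_imp_null_set_lborel) auto
    have pt: "AE t in lborel. ennreal ((norm (sec (v - fst y) t))\<^sup>2) + ennreal ((norm (sec (G - snd y) t))\<^sup>2)
        \<le> (\<Sum>j<N. indicator (I j) t * K (p j) t)"
      using secy secy' grid V[unfolded H10_valued_def]
    proof eventually_elim
      case (elim t)
      show ?case
      proof (cases "t \<in> {a<..<b}")
        case True
        define j0 where "j0 = nat \<lfloor>(t - a) / h\<rfloor>"
        have fl: "real j0 \<le> (t - a) / h" "(t - a) / h < real j0 + 1"
          using True h(1) by (auto simp: j0_def)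
        have le: "real j0 * h \<le> t - a" "t - a < (real j0 + 1) * h"
          using fl h(1) by (simp_all add: field_simps)
        have "real j0 * h < real N * h" using le True h(2) by simp
        then have "j0 < N" using h(1) by simp
        moreover have "t \<in> I j0"
          using le elim(3) by (auto simp: I_def less_le algebra_simps)
        ultimately have j0: "j0 < N" "t \<in> I j0" by auto
        have i: "indicator (I j) t = (if j = j0 then 1 else 0 :: real)" for j
        proof (cases "j = j0")
          case False
          then have "t \<notin> I j" using disj[OF j0(2)] by blast
          then show ?thesis using False by simp
        qed (use j0 in simp)
        have "(\<Sum>j<N. indicator (I j) t *\<^sub>R sec v (p j)) = sec v (p j0)" "(\<Sum>j<N. indicator (I j) t *\<^sub>R sec G (p j)) = sec G (p j0)"
          using j0(1) by (simp_all add: i if_distrib[of "\<lambda>c. c *\<^sub>R _"] cong: if_cong)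
        then have "ennreal ((norm (sec (v - fst y) t))\<^sup>2) + ennreal ((norm (sec (G - snd y) t))\<^sup>2) = indicator (I j0) t * K (p j0) t"
          using elim(1,2) j0(2) by (simp add: K)
        also have "\<dots> \<le> (\<Sum>j<N. indicator (I j) t * K (p j) t)"
          using j0(1) by (intro member_le_sum) auto
        finally show ?thesis .
      next
        case False
        have "t \<notin> I j" if "j < N" for j
        proof
          assume "t \<in> I j"
          moreover have "(real j + 1) * h \<le> real N * h" using h(1) that by (intro mult_right_mono) auto
          moreover have "real j * h \<ge> 0" using h(1) by simp
          ultimately show False using False h(2) by (auto simp: I_def)
        qed
        then show ?thesis
          using elim False by (simp add: indicator_def)
      qed
    qed
    have "ennreal ((norm (v - fst y))\<^sup>2) + ennreal ((norm (G - snd y))\<^sup>2)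
      = (\<integral>\<^sup>+t. ennreal ((norm (sec (v - fst y) t))\<^sup>2) + ennreal ((norm (sec (G - snd y) t))\<^sup>2) \<partial>lborel)"
    proof -
      have m: "(\<lambda>t. ennreal ((norm (sec (v - fst y) t))\<^sup>2)) \<in> borel_measurable lborel"
          "(\<lambda>t. ennreal ((norm (sec (G - snd y) t))\<^sup>2)) \<in> borel_measurable lborel"
        unfolding power2_norm_eq_inner by measurable
      show ?thesis
        by (subst nn_integral_add[OF m]) (simp only: nn_integral_sec_norm)
    qed
    also have "\<dots> \<le> (\<integral>\<^sup>+t. (\<Sum>j<N. indicator (I j) t * K (p j) t) \<partial>lborel)"
      by (rule nn_integral_mono_AE[OF pt])
    also have "\<dots> = F s"
      unfolding F_def p_def by (subst nn_integral_sum) auto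
    also have "\<dots> < ennreal (e\<^sup>2 / 2)" by (rule s(2))
    finally have "ennreal ((norm (v - fst y))\<^sup>2 + (norm (G - snd y))\<^sup>2) < ennreal (e\<^sup>2 / 2)"
      by (simp only: ennreal_plus zero_le_power2)
    then have "(norm (v - fst y))\<^sup>2 + (norm (G - snd y))\<^sup>2 < e\<^sup>2 / 2"
      by (subst (asm) ennreal_less_iff) auto
    also have "\<dots> \<le> e\<^sup>2" by simp
    finally have "sqrt ((norm (v - fst y))\<^sup>2 + (norm (G - snd y))\<^sup>2) < sqrt (e\<^sup>2)"
      by (rule real_sqrt_less_mono)
    then have "dist y (v, G) < e"
      using e by (simp add: dist_norm norm_prod_def norm_minus_commute)
    then show ?thesis using y by blast
  qed
  then have "(v, G) \<in> closure ?C" by (intro iffD2[OF closure_approachable] allI impI)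
  then show ?thesis by simp
qed

section \<open>Inequalities and identities carried from test functions to V by density\<close>

subsection \<open>The Friedrichs inequality\<close>

text \<open>The integrand is the derivative of x_i \<phi>^2 in direction x_i.\<close>

lemma integral_test_weighted:
  fixes \<phi> :: "'n::finite st \<Rightarrow> real"
  assumes \<phi>: "\<phi> \<in> test_functions S"
  shows "(LINT z|lborel. \<phi> z * \<phi> z + 2 * (snd z $ i * dx \<phi> z $ i * \<phi> z)) = 0"
proof -
  let ?f = "\<lambda>z :: 'n st. snd z $ i"
  have bl: "bounded_linear ?f"
    by (rule bounded_linear_compose[OF bounded_linear_vec_nth bounded_linear_snd])
  have "Ck k (\<lambda>x::real. x)" for k
  proof (cases k)
    case (Suc m)
    then show ?thesis
      by (auto intro!: exI[of _ "\<lambda>x h. h"] Ck_const)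
  qed simp
  then have Cf: "Ck k ?f" for k
    using Ck_compose_affine[OF bl, of k "\<lambda>x. x" 0] by simp
  have \<phi>2: "(\<lambda>z. \<phi> z * \<phi> z) \<in> test_functions S"
    by (rule test_functions_mult[OF \<phi> test_functions_Ck[OF \<phi>]])
  have tf: "(\<lambda>z. ?f z * (\<phi> z * \<phi> z)) \<in> test_functions S"
    by (rule test_functions_mult[OF \<phi>2 Cf])
  have "frechet_derivative (\<lambda>z. ?f z * (\<phi> z * \<phi> z)) (at z) (0, axis i 1) = \<phi> z * \<phi> z + 2 * (snd z $ i * dx \<phi> z $ i * \<phi> z)" for z
  proof -
    have "((\<lambda>z. ?f z * (\<phi> z * \<phi> z)) has_derivative
      (\<lambda>h. ?f z * (\<phi> z * frechet_derivative \<phi> (at z) h + frechet_derivative \<phi> (at z) h * \<phi> z) + ?f h * (\<phi> z * \<phi> z))) (at z)"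
      by (intro has_derivative_mult bounded_linear_imp_has_derivative bl test_functions_has_derivative[OF \<phi>])
    then show ?thesis
      by (simp add: frechet_derivative_at[symmetric] dx_def axis_def algebra_simps)
  qed
  then show ?thesis
    using integral_frechet_derivative[OF tf, of "(0, axis i 1)"] by simp
qed

text \<open>Since |x_i| \<le> R on \<Omega>, the weighted identity and Cauchy-Schwarz bound the
  squared norm of \<phi> by 2 R times the product of the norms of its spatial gradient and of
  \<phi>. One coordinate direction is enough, and boundedness of \<Omega> is all that is asked of
  the domain.\<close>

lemma test_function_Poincare:
  fixes \<phi> :: "'n::finite st \<Rightarrow> real"
  assumes \<phi>: "\<phi> \<in> test_functions (I \<times> \<Omega>)" and R: "\<And>x. x \<in> \<Omega> \<Longrightarrow> norm x \<le> R" "0 \<le> R"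
  shows "norm (abs_L2 \<phi>) \<le> 2 * R * norm (abs_L2 (dx \<phi>))"
proof -
  obtain i :: 'n where True by blast
  have sq: "square_integrable \<phi>" "square_integrable (dx \<phi>)"
    by (rule test_functions_square_integrable[OF \<phi>], rule dx_square_integrable[OF \<phi>])
  have bound: "norm (snd z $ i * dx \<phi> z $ i) \<le> norm (R *\<^sub>R dx \<phi> z)" for z
  proof (cases "z \<in> I \<times> \<Omega>")
    case True
    then have "norm (snd z) \<le> R" using R by auto
    then have "\<bar>snd z $ i\<bar> \<le> R" using component_le_norm_cart[of "snd z" i] by linarith
    then show ?thesis
      using component_le_norm_cart[of "dx \<phi> z" i] R(2) by (auto simp: abs_mult intro!: mult_mono)
  next
    case False
    then show ?thesis using dx_outside[OF \<phi> False] by simp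
  qed
  have sqR: "square_integrable (\<lambda>z. R *\<^sub>R dx \<phi> z)"
    by (rule square_integrable_scaleR[OF sq(2)])
  have sqw: "square_integrable (\<lambda>z. snd z $ i * dx \<phi> z $ i)"
  proof (rule square_integrable_AE_cong[OF sqR, where C=1])
    have "(\<lambda>z :: 'n st. snd z \<bullet> axis i 1) \<in> borel_measurable borel" by (simp flip: borel_prod)
    then have "(\<lambda>z :: 'n st. snd z $ i) \<in> borel_measurable borel" by (simp add: inner_axis)
    then show "(\<lambda>z. snd z $ i * dx \<phi> z $ i) \<in> borel_measurable borel"
      using square_integrable_measurable[OF square_integrable_vec_nth[OF sq(2)]] by simp
  qed (use bound in auto)
  have "0 = (LINT z|lborel. \<phi> z * \<phi> z + 2 * (snd z $ i * dx \<phi> z $ i * \<phi> z))"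
    by (rule integral_test_weighted[OF \<phi>, symmetric])
  also have "\<dots> = (LINT z|lborel. \<phi> z * \<phi> z) + 2 * (LINT z|lborel. snd z $ i * dx \<phi> z $ i * \<phi> z)"
    using square_integrable_inner[OF sq(1) sq(1)] square_integrable_inner[OF sqw sq(1)] by simp
  also have "(LINT z|lborel. \<phi> z * \<phi> z) = (norm (abs_L2 \<phi>))\<^sup>2"
    by (simp add: power2_norm_eq_inner inner_abs_L2[OF sq(1) sq(1)])
  also have "(LINT z|lborel. snd z $ i * dx \<phi> z $ i * \<phi> z) = abs_L2 (\<lambda>z. snd z $ i * dx \<phi> z $ i) \<bullet> abs_L2 \<phi>"
    by (simp add: inner_abs_L2[OF sqw sq(1)])
  finally have "(norm (abs_L2 \<phi>))\<^sup>2 = - 2 * (abs_L2 (\<lambda>z. snd z $ i * dx \<phi> z $ i) \<bullet> abs_L2 \<phi>)" by simp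
  also have "\<dots> \<le> 2 * (norm (abs_L2 (\<lambda>z. snd z $ i * dx \<phi> z $ i)) * norm (abs_L2 \<phi>))"
    using Cauchy_Schwarz_ineq2[of "abs_L2 (\<lambda>z. snd z $ i * dx \<phi> z $ i)" "abs_L2 \<phi>"] by linarith
  also have "\<dots> \<le> 2 * ((R * norm (abs_L2 (dx \<phi>))) * norm (abs_L2 \<phi>))"
  proof -
    have "norm (abs_L2 (\<lambda>z. snd z $ i * dx \<phi> z $ i)) \<le> norm (abs_L2 (\<lambda>z. R *\<^sub>R dx \<phi> z))"
      by (rule norm_abs_L2_le[OF sqw sqR]) (use bound in auto)
    also have "\<dots> = R * norm (abs_L2 (dx \<phi>))"
      using R(2) by (simp add: abs_L2_scaleR[OF sq(2), symmetric])
    finally show ?thesis by (intro mult_left_mono mult_right_mono) auto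
  qed
  finally have "norm (abs_L2 \<phi>) * norm (abs_L2 \<phi>) \<le> (2 * R * norm (abs_L2 (dx \<phi>))) * norm (abs_L2 \<phi>)"
    by (simp add: power2_eq_square)
  then show ?thesis
    using R(2) by (cases "abs_L2 \<phi> = 0") (auto simp: mult_le_cancel_right)
qed

lemma closure_test_graph_Poincare:
  assumes "(v, G) \<in> closure (test_graph (I \<times> \<Omega>))" and "\<And>x. x \<in> \<Omega> \<Longrightarrow> norm x \<le> R" "0 \<le> R"
  shows "norm v \<le> 2 * R * norm G"
proof -
  have "closure (test_graph (I \<times> \<Omega>)) \<subseteq> {p. norm (fst p) \<le> 2 * R * norm (snd p)}"
  proof (rule closure_minimal)
    show "test_graph (I \<times> \<Omega>) \<subseteq> {p. norm (fst p) \<le> 2 * R * norm (snd p)}"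
      using test_function_Poincare[of _ I \<Omega> R] assms(2,3) by (auto simp: test_graph_def)
    show "closed {p :: (('a st, real) L2 \<times> ('a st, real^'a) L2). norm (fst p) \<le> 2 * R * norm (snd p)}"
      by (intro closed_Collect_le continuous_intros)
  qed
  then show ?thesis using assms(1) by auto
qed

subsection \<open>Multiplication operators\<close>

text \<open>A fibrewise linear map \<open>F\<close> acts on square-integrable functions on \<open>Q\<close> by \<open>u \<mapsto> (\<lambda>z. F z (u z))\<close>;
  this covers the zero-order coefficient, the drift and the diffusion matrix at once.\<close>

definition multiplier :: "'a::euclidean_space set \<Rightarrow> ('a \<Rightarrow> 'b::euclidean_space \<Rightarrow> 'c::euclidean_space) \<Rightarrow> real \<Rightarrow> bool"
  where "multiplier Q F C \<longleftrightarrow> (\<forall>z. linear (F z)) \<and>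
    (\<forall>f\<in>borel_measurable borel. (\<lambda>z. indicator Q z *\<^sub>R F z (f z)) \<in> borel_measurable borel) \<and>
    (AE z in lborel. z \<in> Q \<longrightarrow> (\<forall>y. norm (F z y) \<le> C * norm y))"

definition mul_op :: "'a::euclidean_space set \<Rightarrow> ('a \<Rightarrow> 'b::euclidean_space \<Rightarrow> 'c::euclidean_space) \<Rightarrow> ('a, 'b) L2 \<Rightarrow> ('a, 'c) L2"
  where "mul_op Q F u = abs_L2 (\<lambda>z. indicator Q z *\<^sub>R F z (rep_L2 u z))"

context
  fixes Q :: "'a::euclidean_space set" and F :: "'a \<Rightarrow> 'b::euclidean_space \<Rightarrow> 'c::euclidean_space" and C :: real
  assumes F: "multiplier Q F C" and C: "0 \<le> C"
begin

lemma square_integrable_multiplier: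
  assumes "square_integrable f"
  shows "square_integrable (\<lambda>z. indicator Q z *\<^sub>R F z (f z))"
proof (rule square_integrable_AE_cong[OF assms, where C=C])
  show "(\<lambda>z. indicator Q z *\<^sub>R F z (f z)) \<in> borel_measurable borel"
    using F square_integrable_measurable[OF assms] by (simp add: multiplier_def)
  have "AE z in lborel. z \<in> Q \<longrightarrow> (\<forall>y. norm (F z y) \<le> C * norm y)"
    using F by (simp add: multiplier_def)
  then show "AE z in lborel. norm (indicator Q z *\<^sub>R F z (f z)) \<le> C * norm (f z)"
    by eventually_elim (use C in \<open>auto simp: indicator_def\<close>)
qed

lemma rep_mul_op: "AE z in lborel. rep_L2 (mul_op Q F u) z = indicator Q z *\<^sub>R F z (rep_L2 u z)"
  unfolding mul_op_def by (rule rep_abs_L2[OF square_integrable_multiplier[OF square_integrable_rep]])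

lemma mul_op_add: "mul_op Q F (u + v) = mul_op Q F u + mul_op Q F v"
proof (rule L2_eqI)
  have lin: "linear (F z)" for z using F by (simp add: multiplier_def)
  show "AE z in lborel. rep_L2 (mul_op Q F (u + v)) z = rep_L2 (mul_op Q F u + mul_op Q F v) z"
    using rep_mul_op[of "u + v"] rep_mul_op[of u] rep_mul_op[of v] rep_L2_add[of u v] rep_L2_add[of "mul_op Q F u" "mul_op Q F v"]
    by eventually_elim (simp add: linear_add[OF lin] scaleR_add_right)
qed

lemma mul_op_scaleR: "mul_op Q F (r *\<^sub>R u) = r *\<^sub>R mul_op Q F u"
proof (rule L2_eqI)
  have lin: "linear (F z)" for z using F by (simp add: multiplier_def)
  show "AE z in lborel. rep_L2 (mul_op Q F (r *\<^sub>R u)) z = rep_L2 (r *\<^sub>R mul_op Q F u) z"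
    using rep_mul_op[of "r *\<^sub>R u"] rep_mul_op[of u] rep_L2_scaleR[of r u] rep_L2_scaleR[of r "mul_op Q F u"]
    by eventually_elim (simp add: linear_cmul[OF lin])
qed

lemma norm_mul_op: "norm (mul_op Q F u) \<le> C * norm u"
proof -
  have "AE z in lborel. z \<in> Q \<longrightarrow> (\<forall>y. norm (F z y) \<le> C * norm y)"
    using F by (simp add: multiplier_def)
  then have "AE z in lborel. norm (indicator Q z *\<^sub>R F z (rep_L2 u z)) \<le> norm (C *\<^sub>R rep_L2 u z)"
    by eventually_elim (use C in \<open>auto simp: indicator_def\<close>)
  then have "norm (mul_op Q F u) \<le> norm (abs_L2 (\<lambda>z. C *\<^sub>R rep_L2 u z))"
    unfolding mul_op_def
    by (intro norm_abs_L2_le square_integrable_multiplier square_integrable_scaleR square_integrable_rep)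
  then show ?thesis
    using C by (simp add: abs_L2_scaleR[symmetric])
qed

lemma bounded_linear_mul_op: "bounded_linear (mul_op Q F)"
  by (rule bounded_linear_intro[where K=C]) (auto simp: mul_op_add mul_op_scaleR norm_mul_op mult.commute[of _ C])

lemma mul_op_abs:
  assumes "square_integrable f"
  shows "mul_op Q F (abs_L2 f) = abs_L2 (\<lambda>z. indicator Q z *\<^sub>R F z (f z))"
  unfolding mul_op_def
  by (rule abs_L2_cong) (use rep_abs_L2[OF assms] in \<open>auto intro: square_integrable_multiplier assms elim: eventually_mono\<close>)

lemma inner_mul_op: "mul_op Q F u \<bullet> v = (LINT z|lborel. indicator Q z *\<^sub>R (F z (rep_L2 u z) \<bullet> rep_L2 v z))"
  using inner_abs_L2[OF square_integrable_multiplier[OF square_integrable_rep] square_integrable_rep, of u v]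
  by (simp add: mul_op_def)

end

lemma Linf_onE:
  assumes "Linf_on S f"
  obtains C where "0 \<le> C" "AE x in lborel. x \<in> S \<longrightarrow> norm (f x) \<le> C"
proof -
  obtain C where C: "AE x in lborel. x \<in> S \<longrightarrow> norm (f x) \<le> C"
    using assms by (auto simp: Linf_on_def)
  have "AE x in lborel. x \<in> S \<longrightarrow> norm (f x) \<le> max 0 C"
    using C by eventually_elim auto
  then show ?thesis by (intro that[of "max 0 C"]) auto
qed

lemma Linf_on_multiplier_mult:
  fixes c :: "'a::euclidean_space \<Rightarrow> real"
  assumes "Linf_on Q c"
  obtains C where "0 \<le> C" "multiplier Q (\<lambda>z y :: real. c z * y) C"
proof -
  obtain C where C: "0 \<le> C" "AE x in lborel. x \<in> Q \<longrightarrow> norm (c x) \<le> C"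
    using Linf_onE[OF assms] by blast
  have m: "(\<lambda>z. indicator Q z *\<^sub>R c z) \<in> borel_measurable borel"
    using assms by (simp add: Linf_on_def set_borel_measurable_def)
  have "multiplier Q (\<lambda>z y :: real. c z * y) C"
    unfolding multiplier_def
  proof (intro conjI allI ballI)
    fix f :: "'a \<Rightarrow> real" assume [measurable]: "f \<in> borel_measurable borel"
    have "(\<lambda>z. (indicator Q z *\<^sub>R c z) * f z) \<in> borel_measurable borel"
      using m by measurable
    then show "(\<lambda>z. indicator Q z *\<^sub>R (c z * f z)) \<in> borel_measurable borel"
      by (simp add: mult.assoc)
  next
    show "AE z in lborel. z \<in> Q \<longrightarrow> (\<forall>y. norm (c z * y) \<le> C * norm y)"
      using C(2) by eventually_elim (auto simp: abs_mult intro!: mult_right_mono)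
  qed (auto intro!: linearI simp: algebra_simps)
  then show ?thesis using that C by blast
qed

lemma Linf_on_multiplier_inner:
  fixes b :: "'a::euclidean_space \<Rightarrow> 'b::euclidean_space"
  assumes "Linf_on Q b"
  obtains C where "0 \<le> C" "multiplier Q (\<lambda>z y. b z \<bullet> y) C"
proof -
  obtain C where C: "0 \<le> C" "AE x in lborel. x \<in> Q \<longrightarrow> norm (b x) \<le> C"
    using Linf_onE[OF assms] by blast
  have m: "(\<lambda>z. indicator Q z *\<^sub>R b z) \<in> borel_measurable borel"
    using assms by (simp add: Linf_on_def set_borel_measurable_def)
  have "multiplier Q (\<lambda>z y. b z \<bullet> y) C"
    unfolding multiplier_def
  proof (intro conjI allI ballI)
    fix f :: "'a \<Rightarrow> 'b" assume [measurable]: "f \<in> borel_measurable borel"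
    have "(\<lambda>z. (indicator Q z *\<^sub>R b z) \<bullet> f z) \<in> borel_measurable borel"
      using m by measurable
    then show "(\<lambda>z. indicator Q z *\<^sub>R (b z \<bullet> f z)) \<in> borel_measurable borel"
      by simp
  next
    show "AE z in lborel. z \<in> Q \<longrightarrow> (\<forall>y. norm (b z \<bullet> y) \<le> C * norm y)"
      using C(2)
    proof eventually_elim
      case (elim z)
      show ?case
      proof (intro impI allI)
        fix y assume "z \<in> Q"
        have "norm (b z \<bullet> y) \<le> norm (b z) * norm y" using Cauchy_Schwarz_ineq2[of "b z" y] by simp
        also have "\<dots> \<le> C * norm y" using elim \<open>z \<in> Q\<close> by (intro mult_right_mono) auto
        finally show "norm (b z \<bullet> y) \<le> C * norm y" .
      qed
    qed
  qed (auto intro!: linearI simp: inner_add_right)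
  then show ?thesis using that C by blast
qed

text \<open>The weak definition of \<open>q = -\<onehalf> div\<^sub>x b + c\<close> extends from the test functions \<open>\<phi>\<^sup>2\<close> to \<open>v\<^sup>2\<close>.\<close>

lemma half_div_plus_identity:
  fixes \<Omega> :: "(real^'n) set"
  assumes b: "0 \<le> Cb" "multiplier (Qcyl T \<Omega>) (\<lambda>z y. b z \<bullet> y) Cb"
    and c: "0 \<le> Cc" "multiplier (Qcyl T \<Omega>) (\<lambda>z y. c z * y) Cc"
    and q: "0 \<le> Cq" "multiplier (Qcyl T \<Omega>) (\<lambda>z y. q z * y) Cq"
    and qeq: "is_half_div_plus T \<Omega> b c q"
    and v: "(v, G) \<in> closure (test_graph (Qcyl T \<Omega>))"
  shows "mul_op (Qcyl T \<Omega>) (\<lambda>z y. q z * y) v \<bullet> v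
    = mul_op (Qcyl T \<Omega>) (\<lambda>z y. b z \<bullet> y) G \<bullet> v + mul_op (Qcyl T \<Omega>) (\<lambda>z y. c z * y) v \<bullet> v"
proof -
  let ?Q = "Qcyl T \<Omega>"
  let ?q = "mul_op ?Q (\<lambda>z y. q z * y)" and ?b = "mul_op ?Q (\<lambda>z y. b z \<bullet> y)" and ?c = "mul_op ?Q (\<lambda>z y. c z * y)"
  let ?E = "{p. ?q (fst p) \<bullet> fst p = ?b (snd p) \<bullet> fst p + ?c (fst p) \<bullet> fst p}"
  \<comment> \<open>Both sides are continuous in the pair (v, G), so it suffices to check the
    identity on test functions.\<close>
  have "closure (test_graph ?Q) \<subseteq> ?E"
  proof (rule closure_minimal)
    have cont: "continuous_on UNIV ?q" "continuous_on UNIV ?b" "continuous_on UNIV ?c"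
      using bounded_linear_mul_op[OF q(2,1)] bounded_linear_mul_op[OF b(2,1)] bounded_linear_mul_op[OF c(2,1)]
      by (auto intro: linear_continuous_on)
    show "closed ?E"
      by (intro closed_Collect_eq continuous_intros continuous_on_compose2[OF cont(1)]
          continuous_on_compose2[OF cont(2)] continuous_on_compose2[OF cont(3)]) auto
    show "test_graph ?Q \<subseteq> ?E"
    proof
      fix p assume "p \<in> test_graph ?Q"
      then obtain \<phi> where \<phi>: "\<phi> \<in> test_functions ?Q" and p: "p = (abs_L2 \<phi>, abs_L2 (dx \<phi>))"
        by (auto simp: test_graph_def)
      have sq: "square_integrable \<phi>" "square_integrable (dx \<phi>)"
        by (rule test_functions_square_integrable[OF \<phi>], rule dx_square_integrable[OF \<phi>])
      have "(\<lambda>z. \<phi> z * \<phi> z) \<in> test_functions ?Q"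
        by (rule test_functions_mult[OF \<phi> test_functions_Ck[OF \<phi>]])
      then have "(LINT z:?Q|lborel. q z * (\<phi> z * \<phi> z)) = 1/2 * (LINT z:?Q|lborel. b z \<bullet> dx (\<lambda>z. \<phi> z * \<phi> z) z)
          + (LINT z:?Q|lborel. c z * (\<phi> z * \<phi> z))"
        by (rule bspec[OF qeq[unfolded is_half_div_plus_def]])
      \<comment> \<open>The factor 2 cancels the one half in front of the divergence and leaves b .
        grad \<phi> times \<phi>.\<close>
      moreover have "dx (\<lambda>z. \<phi> z * \<phi> z) z = (2 * \<phi> z) *\<^sub>R dx \<phi> z" for z
        by (simp add: dx_def vec_eq_iff frechet_derivative_mult_test[OF \<phi> \<phi>])
      moreover have "?q (abs_L2 \<phi>) \<bullet> abs_L2 \<phi> = (LINT z:?Q|lborel. q z * (\<phi> z * \<phi> z))"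
        unfolding mul_op_abs[OF q(2,1) sq(1)] inner_abs_L2[OF square_integrable_multiplier[OF q(2,1) sq(1)] sq(1)]
        by (simp add: set_lebesgue_integral_def mult.assoc)
      moreover have "?c (abs_L2 \<phi>) \<bullet> abs_L2 \<phi> = (LINT z:?Q|lborel. c z * (\<phi> z * \<phi> z))"
        unfolding mul_op_abs[OF c(2,1) sq(1)] inner_abs_L2[OF square_integrable_multiplier[OF c(2,1) sq(1)] sq(1)]
        by (simp add: set_lebesgue_integral_def mult.assoc)
      moreover have "?b (abs_L2 (dx \<phi>)) \<bullet> abs_L2 \<phi> = (LINT z:?Q|lborel. \<phi> z * (b z \<bullet> dx \<phi> z))"
        unfolding mul_op_abs[OF b(2,1) sq(2)] inner_abs_L2[OF square_integrable_multiplier[OF b(2,1) sq(2)] sq(1)]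
        by (simp add: set_lebesgue_integral_def mult_ac)
      ultimately show "p \<in> ?E" by (simp add: p mult.assoc)
    qed
  qed
  then show ?thesis using v by auto
qed

section \<open>Energy theory for the weak evolution equation\<close>

subsection \<open>Weak time derivatives\<close>

abbreviation tshift :: "real \<Rightarrow> (real \<times> 'a::euclidean_space, 'b::euclidean_space) L2 \<Rightarrow> (real \<times> 'a, 'b) L2"
  where "tshift r \<equiv> shift_L2 (r, 0)"

lemma inner_tshift: "tshift (- r) w \<bullet> u = w \<bullet> tshift r u"
  using shift_L2_inner[of "(r, 0)" "tshift (- r) w" u] by (simp add: shift_L2_shift flip: zero_prod_def)

text \<open>The distributional equation d_t u + div \<sigma> = f on I x \<Omega>. Writing it with L2
  inner products lets time shifts be moved between the two factors.\<close>

definition weak_eq ::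
  "real set \<Rightarrow> (real^'n) set \<Rightarrow> ('n st, real) L2 \<Rightarrow> ('n st, real^'n) L2 \<Rightarrow> ('n st, real) L2 \<Rightarrow> bool"
  where "weak_eq I \<Omega> u \<sigma> f \<longleftrightarrow> (\<forall>\<phi>\<in>test_functions (I \<times> \<Omega>).
    u \<bullet> abs_L2 (dt \<phi>) + \<sigma> \<bullet> abs_L2 (dx \<phi>) + f \<bullet> abs_L2 \<phi> = 0)"

lemma test_function_line_derivative:
  assumes "\<phi> \<in> test_functions S"
  shows "((\<lambda>r. \<phi> (x + r *\<^sub>R h)) has_field_derivative frechet_derivative \<phi> (at (x + r *\<^sub>R h)) h) (at r)"
proof -
  have "((\<lambda>r. \<phi> (x + r *\<^sub>R h)) has_derivative (\<lambda>k. frechet_derivative \<phi> (at (x + r *\<^sub>R h)) (k *\<^sub>R h))) (at r)"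
    by (rule has_derivative_compose[OF _ test_functions_has_derivative[OF assms], of "\<lambda>r. x + r *\<^sub>R h"])
      (auto intro!: derivative_eq_intros)
  moreover have "linear (frechet_derivative \<phi> (at (x + r *\<^sub>R h)))"
    using test_functions_has_derivative[OF assms] has_derivative_linear by blast
  then have "(\<lambda>k. frechet_derivative \<phi> (at (x + r *\<^sub>R h)) (k *\<^sub>R h)) = (*) (frechet_derivative \<phi> (at (x + r *\<^sub>R h)) h)"
    by (intro ext) (simp add: linear_cmul)
  ultimately show ?thesis
    by (simp add: has_field_derivative_def)
qed

lemma test_function_line_bound:
  assumes \<phi>: "\<phi> \<in> test_functions S" and M: "\<And>x. \<bar>frechet_derivative \<phi> (at x) h\<bar> \<le> M"
  shows "\<bar>\<phi> (x + s *\<^sub>R h) - \<phi> x\<bar> \<le> M * \<bar>s\<bar>"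
proof -
  have "norm ((\<lambda>r. \<phi> (x + r *\<^sub>R h)) s - (\<lambda>r. \<phi> (x + r *\<^sub>R h)) 0) \<le> M * norm (s - 0)"
    by (rule field_differentiable_bound[of UNIV _ "\<lambda>r. frechet_derivative \<phi> (at (x + r *\<^sub>R h)) h"])
      (use test_function_line_derivative[OF \<phi>] M in auto)
  then show ?thesis by simp
qed

text \<open>The mean value bound is used twice, first for the derivative and then for the remainder;
  hence the constant M rather than M/2.\<close>

lemma test_function_Taylor:
  assumes \<phi>: "\<phi> \<in> test_functions S"
    and M: "\<And>x. \<bar>frechet_derivative (\<lambda>x. frechet_derivative \<phi> (at x) h) (at x) h\<bar> \<le> M"
  shows "\<bar>\<phi> (x + s *\<^sub>R h) - \<phi> x - s * frechet_derivative \<phi> (at x) h\<bar> \<le> M * s\<^sup>2"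
proof -
  let ?D = "\<lambda>x. frechet_derivative \<phi> (at x) h"
  let ?g = "\<lambda>r. \<phi> (x + r *\<^sub>R h) - r * ?D x"
  have M0: "0 \<le> M" using M[of 0] by linarith
  have "norm (?g s - ?g 0) \<le> (M * \<bar>s\<bar>) * norm (s - 0)"
  proof (rule field_differentiable_bound[of "closed_segment 0 s" _ "\<lambda>r. ?D (x + r *\<^sub>R h) - ?D x"])
    show "(?g has_field_derivative ?D (x + r *\<^sub>R h) - ?D x) (at r within closed_segment 0 s)" for r
      by (rule has_field_derivative_at_within) (auto intro!: derivative_eq_intros test_function_line_derivative[OF \<phi>])
    show "norm (?D (x + r *\<^sub>R h) - ?D x) \<le> M * \<bar>s\<bar>" if "r \<in> closed_segment 0 s" for r
    proof -
      have "\<bar>r\<bar> \<le> \<bar>s\<bar>" using that by (auto simp: closed_segment_eq_real_ivl split: if_splits)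
      then have "M * \<bar>r\<bar> \<le> M * \<bar>s\<bar>" using M0 by (rule mult_left_mono)
      then show ?thesis
        using test_function_line_bound[OF test_functions_frechet_derivative[OF \<phi>] M, of x r] by simp
    qed
  qed auto
  then show ?thesis by (simp add: power2_eq_square algebra_simps)
qed

text \<open>The pointwise remainder M s^2 becomes an L2 bound because, for |s| \<le> 1, the
  remainder is supported in one fixed ball.\<close>

lemma shift_test_function_Taylor:
  fixes \<phi> :: "'a::euclidean_space \<Rightarrow> real"
  assumes \<phi>: "\<phi> \<in> test_functions S"
  obtains C where "0 \<le> C" "\<And>s. \<bar>s\<bar> \<le> 1 \<Longrightarrow>
    norm (shift_L2 (s *\<^sub>R h) (abs_L2 \<phi>) - abs_L2 \<phi> - s *\<^sub>R abs_L2 (\<lambda>x. frechet_derivative \<phi> (at x) h)) \<le> C * s\<^sup>2"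
proof -
  let ?D = "\<lambda>x. frechet_derivative \<phi> (at x) h"
  have D: "?D \<in> test_functions S"
    by (rule test_functions_frechet_derivative[OF \<phi>])
  obtain M where M: "M > 0" "\<And>x. \<bar>frechet_derivative ?D (at x) h\<bar> \<le> M"
    using test_functions_bounded[OF test_functions_frechet_derivative[OF D, of h]] by blast
  obtain R where R: "R > 0" "\<And>x. x \<notin> cball 0 R \<Longrightarrow> \<phi> x = 0" using test_functions_ball[OF \<phi>] by blast
  obtain R' where R': "R' > 0" "\<And>x. x \<notin> cball 0 R' \<Longrightarrow> ?D x = 0" using test_functions_ball[OF D] by blast
  \<comment> \<open>Contains the supports of \<phi>, of its derivative, and of all translates by at
    most \<open>h\<close>.\<close>
  define B where "B = cball (0::'a) (max R R' + norm h)"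
  have sqB: "square_integrable (\<lambda>x. indicator B x :: real)"
  proof -
    have "(norm (indicator B x :: real))\<^sup>2 = indicator B x" for x by (auto simp: indicator_def)
    moreover have "emeasure lborel B < \<infinity>" unfolding B_def by (intro emeasure_compact_finite compact_cball)
    moreover have "B \<in> sets borel" by (simp add: B_def)
    ultimately show ?thesis by (simp add: square_integrable_def integrable_indicator_iff)
  qed
  have sq: "square_integrable \<phi>" "square_integrable ?D"
    using test_functions_square_integrable[OF \<phi>] test_functions_square_integrable[OF D] by auto
  show ?thesis
  proof (rule that[of "M * norm (abs_L2 (\<lambda>x. indicator B x :: real))"])
    show "0 \<le> M * norm (abs_L2 (\<lambda>x. indicator B x :: real))" using M(1) by simp
    fix s :: real assume s: "\<bar>s\<bar> \<le> 1"
    let ?e = "\<lambda>x. \<phi> (x + s *\<^sub>R h) - \<phi> x - s *\<^sub>R ?D x"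
    have sqe: "square_integrable ?e"
      by (intro square_integrable_diff square_integrable_scaleR square_integrable_shift sq)
    have sqM: "square_integrable (\<lambda>x. (M * s\<^sup>2) *\<^sub>R (indicator B x :: real))"
      by (rule square_integrable_scaleR[OF sqB])
    have "shift_L2 (s *\<^sub>R h) (abs_L2 \<phi>) - abs_L2 \<phi> - s *\<^sub>R abs_L2 ?D = abs_L2 ?e"
      by (simp only: shift_L2_abs[OF sq(1)] abs_L2_scaleR[OF sq(2)]
          abs_L2_diff square_integrable_diff square_integrable_scaleR square_integrable_shift sq)
    moreover have "norm (abs_L2 ?e) \<le> norm (abs_L2 (\<lambda>x. (M * s\<^sup>2) *\<^sub>R (indicator B x :: real)))"
    proof (rule norm_abs_L2_le[OF sqe sqM], rule AE_I2)
      fix x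
      show "norm (?e x) \<le> norm ((M * s\<^sup>2) *\<^sub>R (indicator B x :: real))"
      proof (cases "x \<in> B")
        case True
        then show ?thesis
          using test_function_Taylor[OF \<phi> M(2), of x s] M(1) by (simp add: abs_mult)
      next
        case False
        then have x: "norm x > max R R' + norm h" by (simp add: B_def)
        have "norm (s *\<^sub>R h) \<le> norm h" using s by (simp add: mult_left_le_one_le)
        moreover have "norm x - norm (s *\<^sub>R h) \<le> norm (x + s *\<^sub>R h)"
          using norm_triangle_ineq2[of x "- (s *\<^sub>R h)"] by simp
        ultimately have "norm (x + s *\<^sub>R h) > R" "norm x > R" "norm x > R'"
          using x norm_ge_zero[of h] by linarith+
        then show ?thesis using R(2) R'(2) by simp
      qed
    qed
    moreover have "norm (abs_L2 (\<lambda>x. (M * s\<^sup>2) *\<^sub>R (indicator B x :: real))) = M * norm (abs_L2 (\<lambda>x. indicator B x :: real)) * s\<^sup>2"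
      unfolding abs_L2_scaleR[OF sqB, symmetric] norm_scaleR using M(1) by simp
    ultimately show "norm (shift_L2 (s *\<^sub>R h) (abs_L2 \<phi>) - abs_L2 \<phi> - s *\<^sub>R abs_L2 ?D)
      \<le> M * norm (abs_L2 (\<lambda>x. indicator B x :: real)) * s\<^sup>2" by simp
  qed
qed

text \<open>Although \<open>u\<close> is merely square integrable, the shift can be transferred to
  the smooth factor, whose expansion in L2 gives the derivative.\<close>

lemma tshift_test_has_derivative:
  fixes \<phi> :: "'n::finite st \<Rightarrow> real"
  assumes \<phi>: "\<phi> \<in> test_functions S"
  shows "((\<lambda>r. tshift r u \<bullet> abs_L2 \<phi>) has_field_derivative - (tshift r u \<bullet> abs_L2 (dt \<phi>))) (at r)"
proof -
  obtain C where C: "0 \<le> C" "\<And>s. \<bar>s\<bar> \<le> 1 \<Longrightarrow>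
    norm (shift_L2 (s *\<^sub>R (1, 0)) (abs_L2 \<phi>) - abs_L2 \<phi> - s *\<^sub>R abs_L2 (\<lambda>x. frechet_derivative \<phi> (at x) (1, 0))) \<le> C * s\<^sup>2"
    using shift_test_function_Taylor[OF \<phi>, of "(1, 0)"] by blast
  have T: "norm (tshift s (abs_L2 \<phi>) - abs_L2 \<phi> - s *\<^sub>R abs_L2 (dt \<phi>)) \<le> C * s\<^sup>2" if "\<bar>s\<bar> \<le> 1" for s
    using C(2)[OF that] by (simp add: dt_def[abs_def])
  let ?g = "\<lambda>r. tshift r u \<bullet> abs_L2 \<phi>" and ?L = "- (tshift r u \<bullet> abs_L2 (dt \<phi>))"
  have est: "\<bar>(?g (r + s) - ?g r) / s - ?L\<bar> \<le> norm u * C * \<bar>s\<bar>" if s: "s \<noteq> 0" "\<bar>s\<bar> \<le> 1" for s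
  proof -
    let ?e = "tshift (- s) (abs_L2 \<phi>) - abs_L2 \<phi> - (- s) *\<^sub>R abs_L2 (dt \<phi>)"
    have "?g (r + s) = tshift r u \<bullet> tshift (- s) (abs_L2 \<phi>)"
      using inner_tshift[of s "abs_L2 \<phi>" "tshift r u"] by (simp add: shift_L2_shift inner_commute)
    then have "?g (r + s) - ?g r - s * ?L = tshift r u \<bullet> ?e"
      by (simp add: inner_diff_right inner_add_right)
    then have "\<bar>?g (r + s) - ?g r - s * ?L\<bar> \<le> norm u * norm ?e"
      using Cauchy_Schwarz_ineq2[of "tshift r u" ?e] by simp
    also have "\<dots> \<le> norm u * (C * s\<^sup>2)"
      using T[of "- s"] s by (intro mult_left_mono) auto
    finally have "\<bar>?g (r + s) - ?g r - s * ?L\<bar> / \<bar>s\<bar> \<le> norm u * (C * s\<^sup>2) / \<bar>s\<bar>"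
      by (rule divide_right_mono) simp
    moreover have "\<bar>?g (r + s) - ?g r - s * ?L\<bar> / \<bar>s\<bar> = \<bar>(?g (r + s) - ?g r) / s - ?L\<bar>"
      using s(1) by (simp add: abs_divide[symmetric] add_divide_distrib diff_divide_distrib del: abs_divide)
    moreover have "norm u * (C * s\<^sup>2) / \<bar>s\<bar> = norm u * C * \<bar>s\<bar>"
      using s(1) by (simp add: power2_eq_square abs_if)
    ultimately show ?thesis by simp
  qed
  have "((\<lambda>s. (?g (r + s) - ?g r) / s) \<longlongrightarrow> ?L) (at 0)"
  proof (rule LIM_zero_cancel, rule tendsto_rabs_zero_cancel,
      rule tendsto_sandwich[where f="\<lambda>_. 0" and h="\<lambda>s. norm u * C * \<bar>s\<bar>"])
    show "\<forall>\<^sub>F s in at 0. \<bar>(?g (r + s) - ?g r) / s - ?L\<bar> \<le> norm u * C * \<bar>s\<bar>"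
      using est unfolding eventually_at by (intro exI[of _ 1]) (auto simp: dist_real_def)
    show "((\<lambda>s. norm u * C * \<bar>s\<bar>) \<longlongrightarrow> 0) (at 0)"
      by (auto intro!: tendsto_eq_intros)
  qed auto
  then show ?thesis by (simp add: DERIV_def)
qed

lemma frechet_derivative_shift:
  assumes \<phi>: "\<phi> \<in> test_functions S"
  shows "frechet_derivative (\<lambda>z. \<phi> (z + a)) (at z) h = frechet_derivative \<phi> (at (z + a)) h"
proof -
  have "((\<lambda>z. \<phi> (z + a)) has_derivative frechet_derivative \<phi> (at (z + a))) (at z)"
    by (rule has_derivative_compose[OF _ test_functions_has_derivative[OF \<phi>], of "\<lambda>z. z + a" "\<lambda>h. h", simplified])
      (auto intro!: derivative_eq_intros)
  then show ?thesis by (metis frechet_derivative_at)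
qed

text \<open>Test functions supported in (0, T - h) may be translated forward by any r \<le> h
  without leaving (0, T); moving the translation onto the data yields the equation for shifted
  data.\<close>

lemma weak_eq_shift:
  fixes \<phi> :: "'n::finite st \<Rightarrow> real"
  assumes W: "weak_eq {0<..<T} \<Omega> u \<sigma> f" and \<phi>: "\<phi> \<in> test_functions ({0<..<T - h} \<times> \<Omega>)" and r: "0 \<le> r" "r \<le> h"
  shows "tshift r u \<bullet> abs_L2 (dt \<phi>) + tshift r \<sigma> \<bullet> abs_L2 (dx \<phi>) + tshift r f \<bullet> abs_L2 \<phi> = 0"
proof -
  let ?\<phi> = "\<lambda>z. \<phi> (z + (- r, 0))"
  have "?\<phi> \<in> test_functions ({0<..<T} \<times> \<Omega>)"
    by (rule test_functions_mono[OF test_functions_shift[OF \<phi>]]) (use r in auto)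
  then have "u \<bullet> abs_L2 (dt ?\<phi>) + \<sigma> \<bullet> abs_L2 (dx ?\<phi>) + f \<bullet> abs_L2 ?\<phi> = 0"
    using W unfolding weak_eq_def by blast
  moreover have "abs_L2 ?\<phi> = tshift (- r) (abs_L2 \<phi>)"
    by (rule shift_L2_abs[OF test_functions_square_integrable[OF \<phi>], symmetric])
  moreover have "abs_L2 (dt ?\<phi>) = tshift (- r) (abs_L2 (dt \<phi>))"
    using shift_L2_abs[OF dt_square_integrable[OF \<phi>], of "(- r, 0)"]
    by (simp add: dt_def[abs_def] frechet_derivative_shift[OF \<phi>])
  moreover have "abs_L2 (dx ?\<phi>) = tshift (- r) (abs_L2 (dx \<phi>))"
    using shift_L2_abs[OF dx_square_integrable[OF \<phi>], of "(- r, 0)"]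
    by (simp add: dx_def[abs_def] frechet_derivative_shift[OF \<phi>])
  ultimately show ?thesis
    using inner_tshift[of r "abs_L2 \<phi>" f] inner_tshift[of r "abs_L2 (dt \<phi>)" u] inner_tshift[of r "abs_L2 (dx \<phi>)" \<sigma>]
    by (simp add: inner_commute)
qed

text \<open>The mean value theorem for the scalar function r \<mapsto> (shifted u) . \<phi> replaces
  integration of vector-valued functions over the shift. The intermediate point \<xi> depends on
  \<phi>, so it must be eliminated before passing to limits of test functions.\<close>

lemma weak_eq_increment:
  fixes \<phi> :: "'n::finite st \<Rightarrow> real"
  assumes W: "weak_eq {0<..<T} \<Omega> u \<sigma> f" and \<phi>: "\<phi> \<in> test_functions ({0<..<T - h} \<times> \<Omega>)" and h: "0 < h"
  obtains \<xi> where "0 < \<xi>" "\<xi> < h"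
    "(tshift h u - u) \<bullet> abs_L2 \<phi> = h * (tshift \<xi> \<sigma> \<bullet> abs_L2 (dx \<phi>) + tshift \<xi> f \<bullet> abs_L2 \<phi>)"
proof -
  obtain \<xi> where \<xi>: "0 < \<xi>" "\<xi> < h"
    "tshift h u \<bullet> abs_L2 \<phi> - tshift 0 u \<bullet> abs_L2 \<phi> = (h - 0) * (- (tshift \<xi> u \<bullet> abs_L2 (dt \<phi>)))"
    using MVT2[OF h, of "\<lambda>r. tshift r u \<bullet> abs_L2 \<phi>" "\<lambda>r. - (tshift r u \<bullet> abs_L2 (dt \<phi>))"] tshift_test_has_derivative[OF \<phi>]
    by blast
  have "tshift \<xi> u \<bullet> abs_L2 (dt \<phi>) + tshift \<xi> \<sigma> \<bullet> abs_L2 (dx \<phi>) + tshift \<xi> f \<bullet> abs_L2 \<phi> = 0"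
    by (rule weak_eq_shift[OF W \<phi>]) (use \<xi> in auto)
  then have "- (tshift \<xi> u \<bullet> abs_L2 (dt \<phi>)) = tshift \<xi> \<sigma> \<bullet> abs_L2 (dx \<phi>) + tshift \<xi> f \<bullet> abs_L2 \<phi>"
    by linarith
  then show ?thesis
    using that[OF \<xi>(1,2)] \<xi>(3) by (simp add: inner_diff_left flip: zero_prod_def)
qed

text \<open>Bounds that are uniform in the intermediate point are closed conditions on the test pair
  and extend to the closure. The first is accurate up to the translation error of the data and
  serves the energy identity; the second is a crude bound for a priori estimates.\<close>

lemma weak_eq_increment_bound:
  assumes W: "weak_eq {0<..<T} \<Omega> u \<sigma> f" and h: "0 < h"
    and \<omega>: "\<And>r. 0 < r \<Longrightarrow> r < h \<Longrightarrow> norm (tshift r \<sigma> - \<sigma>) \<le> \<omega>1" "\<And>r. 0 < r \<Longrightarrow> r < h \<Longrightarrow> norm (tshift r f - f) \<le> \<omega>2"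
    and \<Phi>: "(\<Phi>, G) \<in> closure (test_graph ({0<..<T - h} \<times> \<Omega>))"
  shows "\<bar>(tshift h u - u) \<bullet> \<Phi> - h * (\<sigma> \<bullet> G + f \<bullet> \<Phi>)\<bar> \<le> h * (\<omega>1 * norm G + \<omega>2 * norm \<Phi>)"
    and "\<bar>(tshift h u - u) \<bullet> \<Phi>\<bar> \<le> h * (norm \<sigma> * norm G + norm f * norm \<Phi>)"
proof -
  let ?C = "test_graph ({0<..<T - h} \<times> \<Omega>)"
  let ?E = "{p. \<bar>(tshift h u - u) \<bullet> fst p - h * (\<sigma> \<bullet> snd p + f \<bullet> fst p)\<bar> \<le> h * (\<omega>1 * norm (snd p) + \<omega>2 * norm (fst p))
     \<and> \<bar>(tshift h u - u) \<bullet> fst p\<bar> \<le> h * (norm \<sigma> * norm (snd p) + norm f * norm (fst p))}"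
  have "closure ?C \<subseteq> ?E"
  proof (rule closure_minimal)
    show "closed ?E"
      by (intro closed_Collect_conj closed_Collect_le continuous_intros)
    show "?C \<subseteq> ?E"
    proof
      fix p assume "p \<in> ?C"
      then obtain \<phi> where \<phi>: "\<phi> \<in> test_functions ({0<..<T - h} \<times> \<Omega>)" and p: "p = (abs_L2 \<phi>, abs_L2 (dx \<phi>))"
        by (auto simp: test_graph_def)
      let ?a = "abs_L2 \<phi>" and ?d = "abs_L2 (dx \<phi>)"
      obtain \<xi> where \<xi>: "0 < \<xi>" "\<xi> < h"
        "(tshift h u - u) \<bullet> ?a = h * (tshift \<xi> \<sigma> \<bullet> ?d + tshift \<xi> f \<bullet> ?a)"
        using weak_eq_increment[OF W \<phi> h] by blast
      have "\<bar>(tshift h u - u) \<bullet> ?a - h * (\<sigma> \<bullet> ?d + f \<bullet> ?a)\<bar> = h * \<bar>(tshift \<xi> \<sigma> - \<sigma>) \<bullet> ?d + (tshift \<xi> f - f) \<bullet> ?a\<bar>"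
        unfolding \<xi>(3) using h by (simp add: inner_diff_left abs_mult flip: right_diff_distrib)
      also have "\<dots> \<le> h * (\<omega>1 * norm ?d + \<omega>2 * norm ?a)"
      proof (intro mult_left_mono)
        have "\<bar>(tshift \<xi> \<sigma> - \<sigma>) \<bullet> ?d\<bar> \<le> \<omega>1 * norm ?d"
          by (rule order_trans[OF Cauchy_Schwarz_ineq2]) (intro mult_right_mono \<omega> \<xi> norm_ge_zero)
        moreover have "\<bar>(tshift \<xi> f - f) \<bullet> ?a\<bar> \<le> \<omega>2 * norm ?a"
          by (rule order_trans[OF Cauchy_Schwarz_ineq2]) (intro mult_right_mono \<omega> \<xi> norm_ge_zero)
        ultimately show "\<bar>(tshift \<xi> \<sigma> - \<sigma>) \<bullet> ?d + (tshift \<xi> f - f) \<bullet> ?a\<bar> \<le> \<omega>1 * norm ?d + \<omega>2 * norm ?a"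
          by linarith
      qed (use h in auto)
      finally have 1: "\<bar>(tshift h u - u) \<bullet> ?a - h * (\<sigma> \<bullet> ?d + f \<bullet> ?a)\<bar> \<le> h * (\<omega>1 * norm ?d + \<omega>2 * norm ?a)" .
      have "\<bar>(tshift h u - u) \<bullet> ?a\<bar> = h * \<bar>tshift \<xi> \<sigma> \<bullet> ?d + tshift \<xi> f \<bullet> ?a\<bar>"
        unfolding \<xi>(3) using h by (simp add: abs_mult)
      also have "\<dots> \<le> h * (norm \<sigma> * norm ?d + norm f * norm ?a)"
        using Cauchy_Schwarz_ineq2[of "tshift \<xi> \<sigma>" ?d] Cauchy_Schwarz_ineq2[of "tshift \<xi> f" ?a] h
        by (intro mult_left_mono) auto
      finally show "p \<in> ?E" using 1 by (simp add: p)
    qed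
  qed
  then show "\<bar>(tshift h u - u) \<bullet> \<Phi> - h * (\<sigma> \<bullet> G + f \<bullet> \<Phi>)\<bar> \<le> h * (\<omega>1 * norm G + \<omega>2 * norm \<Phi>)"
    and "\<bar>(tshift h u - u) \<bullet> \<Phi>\<bar> \<le> h * (norm \<sigma> * norm G + norm f * norm \<Phi>)"
    using \<Phi> by auto
qed

subsection \<open>The energy identity\<close>

lemma norm_L2_le_sec:
  fixes u :: "('a::euclidean_space \<times> 'b::euclidean_space, 'c::euclidean_space) L2" and v :: "('a \<times> 'b, 'd::euclidean_space) L2"
  assumes "AE t in lborel. norm (sec u t) \<le> norm (sec v t)"
  shows "norm u \<le> norm v"
proof -
  have "(norm u)\<^sup>2 \<le> (norm v)\<^sup>2"
    unfolding power2_norm_L2_sec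
  proof (rule integral_mono_AE)
    show "AE t in lborel. (norm (sec u t))\<^sup>2 \<le> (norm (sec v t))\<^sup>2"
      using assms by eventually_elim (simp add: power_mono)
  qed (simp_all only: power2_norm_eq_inner integrable_sec_inner)
  then show ?thesis by simp
qed

text \<open>For h > 0, \<open>window u h t / h\<close> is the forward moving average of the squared
  norm of u(t), a substitute for the value at time t before a continuous representative is
  available.\<close>

definition window :: "(real \<times> 'b::euclidean_space, 'c::euclidean_space) L2 \<Rightarrow> real \<Rightarrow> real \<Rightarrow> real"
  where "window u h t = (LINT r|lborel. indicator {t<..<t + h} r * (sec u r \<bullet> sec u r))"

lemma integrable_indicator_sec:
  assumes "A \<in> sets borel"
  shows "integrable lborel (\<lambda>r. indicator A r * (sec u r \<bullet> sec u r))"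
  using integrable_mult_indicator[OF _ integrable_sec_inner[of u u], of A] assms by simp

text \<open>Pointwise in time the product is |u(t+h)|^2 - |u(t)|^2. After shifting the first term,
  integration over (t1,t2) cancels everything except the two end windows.\<close>

lemma energy_increment:
  fixes u :: "(real \<times> 'b::euclidean_space, 'c::euclidean_space) L2"
  assumes t: "t1 \<le> t2" "0 < h"
  shows "(tshift h u - u) \<bullet> restr ({t1<..<t2} \<times> UNIV) (tshift h u + u) = window u h t2 - window u h t1"
proof -
  let ?e = "\<lambda>r. sec u r \<bullet> sec u r" and ?J = "{t1<..<t2}"
  have iJ: "integrable lborel (\<lambda>t. indicator ?J t * ?e (t + h))"
    using integrable_shift[OF integrable_indicator_sec[of "{t1 + h<..<t2 + h}" u], of h]
    by (simp add: indicator_def)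
  have "(tshift h u - u) \<bullet> restr (?J \<times> UNIV) (tshift h u + u)
      = (LINT t|lborel. sec (tshift h u - u) t \<bullet> sec (restr (?J \<times> UNIV) (tshift h u + u)) t)"
    by (rule inner_L2_sec)
  also have "\<dots> = (LINT t|lborel. indicator ?J t * ?e (t + h) - indicator ?J t * ?e t)"
  proof (rule integral_cong_AE)
    show "(\<lambda>t. indicator ?J t * ?e (t + h) - indicator ?J t * ?e t) \<in> borel_measurable lborel"
      by measurable
    show "AE t in lborel. sec (tshift h u - u) t \<bullet> sec (restr (?J \<times> UNIV) (tshift h u + u)) t
        = indicator ?J t * ?e (t + h) - indicator ?J t * ?e t"
      using sec_diff[of "tshift h u" u] sec_add[of "tshift h u" u] sec_shift[of h u]
        restr_time_sec[of ?J "tshift h u + u", simplified]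
    proof eventually_elim
      case (elim t)
      show ?case
        unfolding elim
        by (simp add: inner_diff_left inner_diff_right inner_add_right inner_commute algebra_simps)
    qed
  qed measurable
  also have "\<dots> = (LINT t|lborel. indicator ?J t * ?e (t + h)) - (LINT t|lborel. indicator ?J t * ?e t)"
    by (intro Bochner_Integration.integral_diff iJ integrable_indicator_sec) simp
  also have "(LINT t|lborel. indicator ?J t * ?e (t + h)) = (LINT t|lborel. indicator {t1 + h<..<t2 + h} t * ?e t)"
    using integral_shift[of "\<lambda>r. indicator {t1 + h<..<t2 + h} r * ?e r" h] by (simp add: indicator_def)
  also have "(LINT t|lborel. indicator {t1 + h<..<t2 + h} t * ?e t) - (LINT t|lborel. indicator ?J t * ?e t)
    = (LINT t|lborel. indicator {t1 + h<..<t2 + h} t * ?e t - indicator ?J t * ?e t)"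
    by (intro Bochner_Integration.integral_diff[symmetric] integrable_indicator_sec) auto
  also have "\<dots> = (LINT t|lborel. indicator {t2<..<t2 + h} t * ?e t - indicator {t1<..<t1 + h} t * ?e t)"
  proof (rule integral_cong_AE)
    \<comment> \<open>Off the four endpoints the difference of indicators telescopes, also when h
      exceeds t2 - t1 and the windows overlap.\<close>
    have "AE t in lborel. t \<notin> {t1, t2, t1 + h, t2 + h}"
      by (intro AE_not_in finite_imp_null_set_lborel) simp
    then show "AE t in lborel. indicator {t1 + h<..<t2 + h} t * ?e t - indicator ?J t * ?e t
        = indicator {t2<..<t2 + h} t * ?e t - indicator {t1<..<t1 + h} t * ?e t"
    proof eventually_elim
      case (elim r)
      have "indicator {t1 + h<..<t2 + h} r - indicator ?J r = (indicator {t2<..<t2 + h} r - indicator {t1<..<t1 + h} r :: real)"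
        using elim t by (auto simp: indicator_def)
      then show ?case by (metis left_diff_distrib)
    qed
  qed measurable
  also have "\<dots> = window u h t2 - window u h t1"
    unfolding window_def by (intro Bochner_Integration.integral_diff integrable_indicator_sec) auto
  finally show ?thesis .
qed

lemma closure_test_graph_mono: "S \<subseteq> S' \<Longrightarrow> closure (test_graph S) \<subseteq> closure (test_graph S')"
  unfolding test_graph_def by (rule closure_mono) (use test_functions_mono in blast)

text \<open>Cutting off sharply in time is harmless, since approximability by test functions
  requires regularity in space only. This makes u(t+h) + u(t) on (t1,t2) an admissible test
  pair.\<close>

lemma H10_valued_window_sum:
  assumes V: "H10_valued I \<Omega> u G" and J: "t1 < t2" "{t1<..<t2} \<subseteq> J'"
  shows "(restr ({t1<..<t2} \<times> UNIV) (tshift h u + u), restr ({t1<..<t2} \<times> UNIV) (tshift h G + G))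
    \<in> closure (test_graph (J' \<times> \<Omega>))"
proof -
  have "H10_valued UNIV \<Omega> (tshift h u + u) (tshift h G + G)"
    by (intro H10_valued_add H10_valued_mono[OF H10_valued_shift[OF V, of h]] H10_valued_mono[OF V]) auto
  from H10_valued_restr[OF this, of "{t1<..<t2}"]
  have "H10_valued {t1<..<t2} \<Omega> (restr ({t1<..<t2} \<times> UNIV) (tshift h u + u)) (restr ({t1<..<t2} \<times> UNIV) (tshift h G + G))"
    by simp
  from H10_valued_in_closure[OF this J(1)]
  show ?thesis
    using closure_test_graph_mono[of "{t1<..<t2} \<times> \<Omega>" "J' \<times> \<Omega>"] J(2) by blast
qed

lemma sets_time_UNIV [measurable, simp]:
  "{a<..<b::real} \<times> (UNIV :: 'b::euclidean_space set) \<in> sets borel"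
  by (rule sets_Times_borel) auto

lemma norm_window_sum: "norm (restr ({t1<..<t2::real} \<times> UNIV) (tshift h u + u)) \<le> 2 * norm u"
  using norm_restr_le[OF sets_time_UNIV, of t1 t2 "tshift h u + u"] norm_triangle_ineq[of "tshift h u" u] by simp

lemma norm_tshift_diff_le: "norm (tshift r w - w) \<le> 2 * norm w"
  using norm_triangle_ineq4[of "tshift r w" w] by simp

text \<open>The condition t2 + h \<le> T places the test pair inside (0, T - h). After division by
  h, the bound on the moving averages is uniform in h.\<close>

lemma window_difference_bound:
  assumes W: "weak_eq {0<..<T} \<Omega> u \<sigma> f" and V: "H10_valued {0<..<T} \<Omega> u G"
    and t: "0 \<le> t1" "t1 \<le> t2" "t2 + h \<le> T" "0 < h"
  shows "\<bar>window u h t2 - window u h t1\<bar> \<le> h * (2 * norm \<sigma> * norm G + 2 * norm f * norm u)"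
proof (cases "t1 = t2")
  case True
  then show ?thesis using t by simp
next
  case False
  let ?\<Phi> = "restr ({t1<..<t2} \<times> UNIV) (tshift h u + u)" and ?G = "restr ({t1<..<t2} \<times> UNIV) (tshift h G + G)"
  have "(?\<Phi>, ?G) \<in> closure (test_graph ({0<..<T - h} \<times> \<Omega>))"
    by (rule H10_valued_window_sum[OF V]) (use t False in auto)
  from weak_eq_increment_bound(2)[OF W t(4) norm_tshift_diff_le norm_tshift_diff_le this]
  have "\<bar>window u h t2 - window u h t1\<bar> \<le> h * (norm \<sigma> * norm ?G + norm f * norm ?\<Phi>)"
    unfolding energy_increment[OF t(2,4), symmetric] by blast
  also have "\<dots> \<le> h * (norm \<sigma> * (2 * norm G) + norm f * (2 * norm u))"
    using t(4) by (intro mult_left_mono add_mono norm_window_sum) auto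
  finally show ?thesis by (simp add: mult_ac)
qed

text \<open>The moving average minus \<open>e\<close> is an average of translation differences, so
  by Fubini its L1 norm is at most the largest L1 translation error within distance h.\<close>

lemma average_L1_bound:
  fixes e :: "real \<Rightarrow> real"
  assumes e: "integrable lborel e" and h: "0 < h"
    and \<epsilon>: "\<And>r. 0 < r \<Longrightarrow> r < h \<Longrightarrow> (LINT t|lborel. norm (e (t + r) - e t)) \<le> \<epsilon>"
  shows "integrable lborel (\<lambda>t. (LINT r|lborel. indicator {t<..<t + h} r * e r) / h - e t)"
    and "(LINT t|lborel. norm ((LINT r|lborel. indicator {t<..<t + h} r * e r) / h - e t)) \<le> \<epsilon>"
proof -
  have [measurable]: "e \<in> borel_measurable borel"
    using borel_measurable_integrable[OF e] by simp
  have eps0: "0 \<le> \<epsilon>"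
    using order_trans[OF _ \<epsilon>[of "h/2"], of 0] h by (simp add: Bochner_Integration.integral_nonneg)
  let ?A = "\<lambda>t. LINT r|lborel. indicator {t<..<t + h} r * e r"
  have [measurable]: "?A \<in> borel_measurable borel"
  proof -
    have "(\<lambda>(t, r). indicator {t<..<t + h} r * e r) \<in> borel_measurable (borel \<Otimes>\<^sub>M lborel)"
      by (simp add: indicator_def) measurable
    then show ?thesis by (rule lborel.borel_measurable_lebesgue_integral)
  qed
  have pt: "ennreal (norm (?A t / h - e t)) \<le> ennreal (1/h) * (\<integral>\<^sup>+r. indicator {0<..<h} r * ennreal (norm (e (t + r) - e t)) \<partial>lborel)" for t
  proof -
    have i1: "integrable lborel (\<lambda>r. indicator {0<..<h} r * e (r + t))"
      using integrable_mult_indicator[OF _ integrable_shift[OF e, of t], of "{0<..<h}"] by simp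
    have i2: "integrable lborel (\<lambda>r. indicator {0<..<h} r * e t)"
      using h by (intro integrable_mult_left) (simp add: integrable_indicator_iff)
    have "?A t = (LINT r|lborel. indicator {0<..<h} r * e (r + t))"
      using integral_shift[of "\<lambda>r. indicator {t<..<t + h} r * e r" t] by (simp add: indicator_def add.commute)
    moreover have "h * e t = (LINT r|lborel. indicator {0<..<h} r * e t)"
      using h by simp
    ultimately have "?A t - h * e t = (LINT r|lborel. indicator {0<..<h} r * e (r + t) - indicator {0<..<h} r * e t)"
      by (simp only: Bochner_Integration.integral_diff[OF i1 i2])
    then have "ennreal (norm (?A t - h * e t)) \<le> (\<integral>\<^sup>+r. norm (indicator {0<..<h} r * e (r + t) - indicator {0<..<h} r * e t) \<partial>lborel)"
      using integral_norm_bound_ennreal[OF Bochner_Integration.integrable_diff[OF i1 i2]] by simp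
    also have "\<dots> = (\<integral>\<^sup>+r. indicator {0<..<h} r * ennreal (norm (e (t + r) - e t)) \<partial>lborel)"
      by (intro nn_integral_cong) (auto simp: indicator_def add.commute)
    finally have "ennreal (1/h) * ennreal (norm (?A t - h * e t)) \<le> ennreal (1/h) * (\<integral>\<^sup>+r. indicator {0<..<h} r * ennreal (norm (e (t + r) - e t)) \<partial>lborel)"
      by (rule mult_left_mono) simp
    moreover have "ennreal (1/h) * ennreal (norm (?A t - h * e t)) = ennreal (norm (?A t / h - e t))"
    proof -
      have "1/h * norm (?A t - h * e t) = norm (1/h * (?A t - h * e t))"
        unfolding norm_mult using h by simp
      also have "1/h * (?A t - h * e t) = ?A t / h - e t"
        using h by (simp add: field_simps)
      finally show ?thesis using h by (simp flip: ennreal_mult)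
    qed
    ultimately show ?thesis by simp
  qed
  have "(\<integral>\<^sup>+t. ennreal (norm (?A t / h - e t)) \<partial>lborel)
    \<le> (\<integral>\<^sup>+t. ennreal (1/h) * (\<integral>\<^sup>+r. indicator {0<..<h} r * ennreal (norm (e (t + r) - e t)) \<partial>lborel) \<partial>lborel)"
    by (intro nn_integral_mono pt)
  also have "\<dots> = ennreal (1/h) * (\<integral>\<^sup>+t. (\<integral>\<^sup>+r. indicator {0<..<h} r * ennreal (norm (e (t + r) - e t)) \<partial>lborel) \<partial>lborel)"
  proof (rule nn_integral_cmult)
    have "(\<lambda>(t, r). indicator {0<..<h} r * ennreal (norm (e (t + r) - e t))) \<in> borel_measurable (lborel \<Otimes>\<^sub>M lborel)"
      by measurable
    then show "(\<lambda>t. \<integral>\<^sup>+r. indicator {0<..<h} r * ennreal (norm (e (t + r) - e t)) \<partial>lborel) \<in> borel_measurable lborel"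
      by (rule lborel.borel_measurable_nn_integral)
  qed
  also have "(\<integral>\<^sup>+t. (\<integral>\<^sup>+r. indicator {0<..<h} r * ennreal (norm (e (t + r) - e t)) \<partial>lborel) \<partial>lborel)
    = (\<integral>\<^sup>+r. (\<integral>\<^sup>+t. indicator {0<..<h} r * ennreal (norm (e (t + r) - e t)) \<partial>lborel) \<partial>lborel)"
  proof -
    have "(\<lambda>(t, r). indicator {0<..<h} r * ennreal (norm (e (t + r) - e t))) \<in> borel_measurable (lborel \<Otimes>\<^sub>M lborel)"
      by measurable
    from lborel_pair.Fubini'[OF this] show ?thesis by simp
  qed
  also have "\<dots> \<le> (\<integral>\<^sup>+r. ennreal \<epsilon> * indicator {0<..<h} r \<partial>lborel)"
  proof (rule nn_integral_mono)
    fix r :: real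
    show "(\<integral>\<^sup>+t. indicator {0<..<h} r * ennreal (norm (e (t + r) - e t)) \<partial>lborel) \<le> ennreal \<epsilon> * indicator {0<..<h} r"
    proof (cases "r \<in> {0<..<h}")
      case True
      have "integrable lborel (\<lambda>t. norm (e (t + r) - e t))"
        by (intro integrable_norm Bochner_Integration.integrable_diff integrable_shift e)
      then have "(\<integral>\<^sup>+t. ennreal (norm (e (t + r) - e t)) \<partial>lborel) = ennreal (LINT t|lborel. norm (e (t + r) - e t))"
        by (intro nn_integral_eq_integral) auto
      then show ?thesis using \<epsilon>[of r] True by (simp add: ennreal_leI)
    qed simp
  qed
  also have "\<dots> = ennreal (\<epsilon> * h)"
    using h eps0 by (simp add: nn_integral_cmult_indicator flip: ennreal_mult)
  finally have "(\<integral>\<^sup>+t. ennreal (norm (?A t / h - e t)) \<partial>lborel) \<le> ennreal (1/h) * ennreal (\<epsilon> * h)"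
    by (simp add: mult_left_mono)
  also have "\<dots> = ennreal \<epsilon>"
    using h eps0 by (simp flip: ennreal_mult)
  finally have fin: "(\<integral>\<^sup>+t. ennreal (norm (?A t / h - e t)) \<partial>lborel) \<le> ennreal \<epsilon>" .
  then have "(\<integral>\<^sup>+t. ennreal (norm (?A t / h - e t)) \<partial>lborel) < \<infinity>"
    using le_less_trans by fastforce
  then show int: "integrable lborel (\<lambda>t. ?A t / h - e t)"
    by (intro integrableI_bounded) auto
  from nn_integral_eq_integral[OF integrable_norm[OF int]] fin
  show "(LINT t|lborel. norm (?A t / h - e t)) \<le> \<epsilon>" using eps0 by (simp add: ennreal_le_iff)
qed

text \<open>Differentiation of the integral almost everywhere, along some sequence of window
  lengths: continuity of translations gives L1 convergence, and a subsequence converges almost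
  everywhere.\<close>

lemma average_AE_subseq:
  fixes e :: "real \<Rightarrow> real"
  assumes e: "integrable lborel e"
  obtains s where "\<And>n::nat. s n > 0" "s \<longlonglongrightarrow> 0"
    "AE t in lborel. (\<lambda>n. (LINT r|lborel. indicator {t<..<t + s n} r * e r) / s n) \<longlonglongrightarrow> e t"
proof -
  have [measurable]: "e \<in> borel_measurable borel"
    using borel_measurable_integrable[OF e] by simp
  let ?A = "\<lambda>h t. LINT r|lborel. indicator {t<..<t + h} r * e r"
  have tr: "((\<lambda>r. LINT t|lborel. norm (e (t + r) - e t)) \<longlongrightarrow> 0) (at 0)"
    unfolding tendsto_at_iff_sequentially by (auto simp: o_def intro!: integrable_translation_continuous[OF e, unfolded real_norm_def])
  define s0 where "s0 n = inverse (real (Suc n))" for n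
  have s0: "s0 n > 0" "s0 \<longlonglongrightarrow> 0" for n
    using LIMSEQ_inverse_real_of_nat by (auto simp: s0_def[abs_def])
  have "(\<lambda>n. LINT t|lborel. norm (?A (s0 n) t / s0 n - e t)) \<longlonglongrightarrow> 0"
  proof (rule LIMSEQ_I)
    fix \<epsilon> :: real assume "\<epsilon> > 0"
    then obtain d where d: "d > 0" "\<And>r. r \<noteq> 0 \<Longrightarrow> norm r < d \<Longrightarrow> norm (LINT t|lborel. norm (e (t + r) - e t)) < \<epsilon> / 2"
      using LIM_D[OF tr, of "\<epsilon> / 2"] by auto
    obtain N where N: "\<And>n. n \<ge> N \<Longrightarrow> s0 n < d"
      using LIMSEQ_D[OF s0(2) d(1)] by force
    have "(LINT t|lborel. norm (?A (s0 n) t / s0 n - e t)) \<le> \<epsilon> / 2" if "n \<ge> N" for n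
      using N[OF that] s0(1)[of n] d(2) by (intro average_L1_bound(2)[OF e]) (auto simp: less_imp_le)
    then have "norm ((LINT t|lborel. norm (?A (s0 n) t / s0 n - e t)) - 0) < \<epsilon>" if "n \<ge> N" for n
      using that \<open>\<epsilon> > 0\<close> by (fastforce simp: abs_of_nonneg Bochner_Integration.integral_nonneg)
    then show "\<exists>no. \<forall>n\<ge>no. norm ((LINT t|lborel. norm (?A (s0 n) t / s0 n - e t)) - 0) < \<epsilon>" by blast
  qed
  moreover have "integrable lborel (\<lambda>t. ?A (s0 n) t / s0 n - e t)" for n
  proof (rule average_L1_bound(1)[OF e s0(1)])
    fix r
    have "(LINT t|lborel. norm (e (t + r) - e t)) \<le> (LINT t|lborel. norm (e (t + r)) + norm (e t))"
      by (intro integral_mono integrable_norm Bochner_Integration.integrable_diff Bochner_Integration.integrable_add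
          integrable_shift e norm_triangle_ineq4)
    also have "\<dots> = (LINT t|lborel. norm (e (t + r))) + (LINT t|lborel. norm (e t))"
      by (intro Bochner_Integration.integral_add integrable_norm integrable_shift e)
    also have "(LINT t|lborel. norm (e (t + r))) = (LINT t|lborel. norm (e t))"
      by (rule integral_shift) measurable
    finally show "(LINT t|lborel. norm (e (t + r) - e t)) \<le> 2 * (LINT t|lborel. norm (e t))" by simp
  qed
  ultimately obtain r where r: "strict_mono r" "AE t in lborel. (\<lambda>n. ?A (s0 (r n)) t / s0 (r n) - e t) \<longlonglongrightarrow> 0"
    using tendsto_L1_AE_subseq[of lborel "\<lambda>n t. ?A (s0 n) t / s0 n - e t"] by blast
  show ?thesis
  proof (rule that[of "\<lambda>n. s0 (r n)"])
    show "(\<lambda>n. s0 (r n)) \<longlonglongrightarrow> 0"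
      using LIMSEQ_subseq_LIMSEQ[OF s0(2) r(1)] by (simp add: o_def)
    show "AE t in lborel. (\<lambda>n. ?A (s0 (r n)) t / s0 (r n)) \<longlonglongrightarrow> e t"
      using r(2) by eventually_elim (rule LIM_zero_cancel)
  qed (use s0 in auto)
qed

lemma AE_interval_ex:
  fixes a b :: real
  assumes "AE x in lborel. P x" "a < b"
  shows "\<exists>x. a < x \<and> x < b \<and> P x"
proof (rule ccontr)
  assume "\<not> ?thesis"
  then have "AE x in lborel. x \<notin> {a<..<b}"
    using assms(1) by (auto elim!: eventually_mono)
  then have "{a<..<b} \<in> null_sets lborel"
    by (subst AE_iff_null_sets) auto
  then show False using assms(2) by (simp add: null_sets_def)
qed

text \<open>In the limit of short windows the squared norms at almost any two times differ by at
  most B. Comparing one such time with its average over (0,T), which is the squared norm of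
  \<open>u\<close> divided by T, bounds the value itself.\<close>

lemma sup_bound:
  assumes W: "weak_eq {0<..<T} \<Omega> u \<sigma> f" and V: "H10_valued {0<..<T} \<Omega> u G" and T: "0 < T"
  shows "AE t in lborel. t \<in> {0<..<T} \<longrightarrow>
    (norm (sec u t))\<^sup>2 \<le> (norm u)\<^sup>2 / T + (2 * norm \<sigma> * norm G + 2 * norm f * norm u)"
proof -
  let ?e = "\<lambda>r. sec u r \<bullet> sec u r"
  define B where "B = 2 * norm \<sigma> * norm G + 2 * norm f * norm u"
  obtain s where s: "\<And>n::nat. s n > 0" "s \<longlonglongrightarrow> 0"
    and lim: "AE t in lborel. (\<lambda>n. (LINT r|lborel. indicator {t<..<t + s n} r * ?e r) / s n) \<longlonglongrightarrow> ?e t"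
    using average_AE_subseq[OF integrable_sec_inner[of u u]] by blast
  let ?ok = "\<lambda>t. (\<lambda>n. window u (s n) t / s n) \<longlonglongrightarrow> ?e t"
  have ok: "AE t in lborel. ?ok t" using lim by (simp add: window_def)
  have cmp: "\<bar>?e t - ?e t'\<bar> \<le> B" if t: "0 < t" "t < T" "0 < t'" "t' < T" "?ok t" "?ok t'" for t t'
  proof -
    have ev: "\<forall>\<^sub>F n in sequentially. s n < T - max t t'"
      using order_tendstoD(2)[OF s(2), of "T - max t t'"] t by auto
    have "\<forall>\<^sub>F n in sequentially. \<bar>window u (s n) t / s n - window u (s n) t' / s n\<bar> \<le> B"
      using ev
    proof eventually_elim
      case (elim n)
      have "\<bar>window u (s n) t - window u (s n) t'\<bar> \<le> s n * B"
      proof (cases "t' \<le> t")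
        case True
        then show ?thesis
          using window_difference_bound[OF W V, of t' t "s n"] t s(1)[of n] elim by (simp add: B_def)
      next
        case False
        then show ?thesis
          using window_difference_bound[OF W V, of t t' "s n"] t s(1)[of n] elim by (simp add: B_def abs_minus_commute)
      qed
      then have "\<bar>window u (s n) t - window u (s n) t'\<bar> / s n \<le> B"
        using s(1)[of n] by (simp add: divide_le_eq mult.commute)
      then show ?case
        using s(1)[of n] by (simp add: diff_divide_distrib[symmetric] abs_divide)
    qed
    then show ?thesis
      by (rule tendsto_upperbound[OF tendsto_rabs[OF tendsto_diff[OF t(5,6)]]]) simp
  qed
  show ?thesis
    using ok
  proof eventually_elim
    case (elim t)
    show ?case
    proof
      assume t: "t \<in> {0<..<T}"
      \<comment> \<open>Integrates e(t) - B \<le> e(r) over r in (0,T).\<close>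
      have "(LINT r|lborel. indicator {0<..<T} r * (?e t - B)) \<le> (LINT r|lborel. ?e r)"
      proof (rule integral_mono_AE[OF _ integrable_sec_inner])
        show "integrable lborel (\<lambda>r. indicator {0<..<T} r * (?e t - B))"
          using T by (intro integrable_mult_left) (simp add: integrable_indicator_iff)
        show "AE r in lborel. indicator {0<..<T} r * (?e t - B) \<le> ?e r"
          using ok
        proof eventually_elim
          case (elim r)
          show ?case
          proof (cases "r \<in> {0<..<T}")
            case True
            then have "\<bar>?e t - ?e r\<bar> \<le> B"
              using cmp[of t r] t \<open>?ok t\<close> elim by auto
            then show ?thesis using True by simp
          qed simp
        qed
      qed
      then have "T * (?e t - B) \<le> (norm u)\<^sup>2"
        using T by (simp add: power2_norm_eq_inner inner_L2_sec[of u u])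
      then show "(norm (sec u t))\<^sup>2 \<le> (norm u)\<^sup>2 / T + (2 * norm \<sigma> * norm G + 2 * norm f * norm u)"
        unfolding B_def[symmetric] power2_norm_eq_inner using T by (simp add: field_simps)
    qed
  qed
qed

lemma restr_inner_test:
  fixes \<psi> :: "'a::euclidean_space \<times> 'b::euclidean_space \<Rightarrow> 'c::euclidean_space"
  assumes "square_integrable \<psi>" "\<And>z. z \<notin> J \<times> UNIV \<Longrightarrow> \<psi> z = 0" and J: "J \<times> (UNIV :: 'b set) \<in> sets borel"
  shows "restr (J \<times> UNIV) w \<bullet> abs_L2 \<psi> = w \<bullet> abs_L2 \<psi>"
proof -
  have "restr (J \<times> UNIV) (abs_L2 \<psi>) = abs_L2 \<psi>"
  proof -
    have "AE z in lborel. z \<notin> J \<times> UNIV \<longrightarrow> rep_L2 (abs_L2 \<psi>) z = 0"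
      using rep_abs_L2[OF assms(1)] by eventually_elim (use assms(2) in auto)
    then show ?thesis using L2_on_iff_restr[OF J, of "abs_L2 \<psi>"] by (simp add: L2_on_def)
  qed
  then show ?thesis using inner_restr[OF J, of w "abs_L2 \<psi>"] by simp
qed

text \<open>By linearity, time differences solve an equation of the same kind whose data are
  translation differences. Feeding them into the sup bound turns an a priori estimate into a modulus
  of continuity.\<close>

lemma weak_eq_difference:
  fixes u :: "('n::finite st, real) L2"
  assumes W: "weak_eq {0<..<T} \<Omega> u \<sigma> f" and k: "0 \<le> k"
  shows "weak_eq {0<..<T - k} \<Omega> (restr ({0<..<T - k} \<times> UNIV) (tshift k u - u)) (tshift k \<sigma> - \<sigma>) (tshift k f - f)"
  unfolding weak_eq_def
proof
  fix \<phi> :: "'n st \<Rightarrow> real" assume \<phi>: "\<phi> \<in> test_functions ({0<..<T - k} \<times> \<Omega>)"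
  have "\<phi> \<in> test_functions ({0<..<T} \<times> \<Omega>)"
    by (rule test_functions_mono[OF \<phi>]) (use k in auto)
  then have "u \<bullet> abs_L2 (dt \<phi>) + \<sigma> \<bullet> abs_L2 (dx \<phi>) + f \<bullet> abs_L2 \<phi> = 0"
    using W unfolding weak_eq_def by blast
  moreover have "tshift k u \<bullet> abs_L2 (dt \<phi>) + tshift k \<sigma> \<bullet> abs_L2 (dx \<phi>) + tshift k f \<bullet> abs_L2 \<phi> = 0"
    by (rule weak_eq_shift[OF W \<phi> k order_refl])
  moreover have "restr ({0<..<T - k} \<times> UNIV) (tshift k u - u) \<bullet> abs_L2 (dt \<phi>) = (tshift k u - u) \<bullet> abs_L2 (dt \<phi>)"
    by (rule restr_inner_test[OF dt_square_integrable[OF \<phi>] test_functions_outside[OF dt_test_function[OF \<phi>]]]) auto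
  ultimately show "restr ({0<..<T - k} \<times> UNIV) (tshift k u - u) \<bullet> abs_L2 (dt \<phi>)
      + (tshift k \<sigma> - \<sigma>) \<bullet> abs_L2 (dx \<phi>) + (tshift k f - f) \<bullet> abs_L2 \<phi> = 0"
    by (simp add: inner_diff_left)
qed

lemma tshift_small:
  fixes w :: "(real \<times> 'a::euclidean_space, 'b::euclidean_space) L2"
  assumes "\<epsilon> > 0"
  obtains d where "d > 0" "\<And>r. \<bar>r\<bar> < d \<Longrightarrow> norm (tshift r w - w) < \<epsilon>"
proof -
  obtain d where d: "d > 0" "\<And>s. s \<noteq> 0 \<Longrightarrow> norm s < d \<Longrightarrow> norm (shift_L2 s w - w) < \<epsilon>"
    using LIM_D[OF shift_L2_tendsto[of w] assms] by auto
  have "norm (tshift r w - w) < \<epsilon>" if "\<bar>r\<bar> < d" for r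
  proof (cases "r = 0")
    case True
    then show ?thesis using assms by (simp flip: zero_prod_def)
  next
    case False
    then show ?thesis using d(2)[of "(r, 0)"] that by (simp add: zero_prod_def norm_Pair)
  qed
  then show ?thesis using that d(1) by blast
qed

text \<open>The sup bound for the increment over k involves only translation errors of u, G,
  \<sigma> and f, which are all small for small k.\<close>

lemma sec_time_modulus:
  fixes \<Omega> :: "(real^'n) set"
  assumes W: "weak_eq {0<..<T} \<Omega> u \<sigma> f" and V: "H10_valued {0<..<T} \<Omega> u G" and T: "0 < T" and \<epsilon>: "\<epsilon> > 0"
  shows "\<exists>d>0. \<forall>k. 0 < k \<longrightarrow> k < d \<longrightarrow> (AE t in lborel. t \<in> {0<..<T - k} \<longrightarrow> norm (sec u (t + k) - sec u t) \<le> \<epsilon>)"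
proof -
  \<comment> \<open>With k < T/2 one has 1/(T - k) \<le> 2/T, and the flux and source terms
    contribute 2 a^2 each; so the bound is M a^2, which the choice of \<open>a\<close> makes equal
    to \<epsilon>^2.\<close>
  define M where "M = 2 / T + 4"
  have M: "M > 0" using T by (simp add: M_def add_pos_pos)
  define a where "a = \<epsilon> / sqrt M"
  have a: "a > 0" "a\<^sup>2 * M = \<epsilon>\<^sup>2" using M \<epsilon> by (simp_all add: a_def power_divide)
  obtain d1 where d1: "d1 > 0" "\<And>r. \<bar>r\<bar> < d1 \<Longrightarrow> norm (tshift r u - u) < a" using tshift_small[OF a(1)] by blast
  obtain d2 where d2: "d2 > 0" "\<And>r. \<bar>r\<bar> < d2 \<Longrightarrow> norm (tshift r G - G) < a" using tshift_small[OF a(1)] by blast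
  obtain d3 where d3: "d3 > 0" "\<And>r. \<bar>r\<bar> < d3 \<Longrightarrow> norm (tshift r \<sigma> - \<sigma>) < a" using tshift_small[OF a(1)] by blast
  obtain d4 where d4: "d4 > 0" "\<And>r. \<bar>r\<bar> < d4 \<Longrightarrow> norm (tshift r f - f) < a" using tshift_small[OF a(1)] by blast
  define d where "d = min (T / 2) (min (min d1 d2) (min d3 d4))"
  show ?thesis
  proof (intro exI[of _ d] conjI allI impI)
    show "d > 0" using T d1 d2 d3 d4 by (simp add: d_def)
    fix k assume k: "0 < k" "k < d"
    let ?J = "{0<..<T - k} \<times> (UNIV :: (real^'n) set)"
    define D where "D = restr ?J (tshift k u - u)"
    define H where "H = restr ?J (tshift k G - G)"
    have Tk: "T - k \<ge> T / 2" "T - k > 0" using k T by (auto simp: d_def)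
    have "H10_valued UNIV \<Omega> (tshift k u - u) (tshift k G - G)"
      by (intro H10_valued_diff H10_valued_mono[OF H10_valued_shift[OF V, of k]] H10_valued_mono[OF V]) auto
    from H10_valued_restr[OF this, of "{0<..<T - k}"]
    have VD: "H10_valued {0<..<T - k} \<Omega> D H" by (simp add: D_def H_def)
    have small: "norm D \<le> a" "norm H \<le> a" "norm (tshift k \<sigma> - \<sigma>) \<le> a" "norm (tshift k f - f) \<le> a"
      using norm_restr_le[OF sets_time_UNIV, of 0 "T - k" "tshift k u - u"]
        norm_restr_le[OF sets_time_UNIV, of 0 "T - k" "tshift k G - G"]
        d1(2)[of k] d2(2)[of k] d3(2)[of k] d4(2)[of k] k by (auto simp: D_def H_def d_def)
    have "(norm D)\<^sup>2 / (T - k) + (2 * norm (tshift k \<sigma> - \<sigma>) * norm H + 2 * norm (tshift k f - f) * norm D)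
      \<le> a\<^sup>2 / (T / 2) + (2 * a * a + 2 * a * a)"
      using small Tk T a(1) by (intro add_mono frac_le mult_mono power_mono) auto
    also have "\<dots> = a\<^sup>2 * M" by (simp add: M_def power2_eq_square algebra_simps)
    also have "\<dots> = \<epsilon>\<^sup>2" by (rule a(2))
    finally have bd: "(norm D)\<^sup>2 / (T - k) + (2 * norm (tshift k \<sigma> - \<sigma>) * norm H + 2 * norm (tshift k f - f) * norm D) \<le> \<epsilon>\<^sup>2" .
    have "AE t in lborel. t \<in> {0<..<T - k} \<longrightarrow> (norm (sec D t))\<^sup>2 \<le> \<epsilon>\<^sup>2"
      using sup_bound[OF weak_eq_difference[OF W less_imp_le[OF k(1)]] VD[unfolded D_def] Tk(2)]
      unfolding D_def[symmetric] by eventually_elim (use bd in auto)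
    then show "AE t in lborel. t \<in> {0<..<T - k} \<longrightarrow> norm (sec u (t + k) - sec u t) \<le> \<epsilon>"
      using sec_diff[of "tshift k u" u] sec_shift[of k u] restr_time_sec[of "{0<..<T - k}" "tshift k u - u", simplified]
    proof eventually_elim
      case (elim t)
      show ?case
      proof
        assume t: "t \<in> {0<..<T - k}"
        then have "sec D t = sec u (t + k) - sec u t"
          using elim by (simp add: D_def)
        then have "(norm (sec u (t + k) - sec u t))\<^sup>2 \<le> \<epsilon>\<^sup>2" using elim(1) t by simp
        then show "norm (sec u (t + k) - sec u t) \<le> \<epsilon>" using \<epsilon> by (simp add: power2_le_iff_abs_le)
      qed
    qed
  qed
qed

text \<open>The exceptional null set of times in the modulus depends on the increment k. Exchanging
  the order of the two quantifiers yields a set \<open>Gd\<close> of almost all times at which the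
  estimate holds for almost every k; on it \<open>sec u\<close> is uniformly continuous, and its
  closure contains [0,T].\<close>

lemma continuous_representative:
  fixes \<Omega> :: "(real^'n) set"
  assumes W: "weak_eq {0<..<T} \<Omega> u \<sigma> f" and V: "H10_valued {0<..<T} \<Omega> u G" and T: "0 < T"
  obtains w where "continuous_on {0..T} w" "AE t in lborel. t \<in> {0<..<T} \<longrightarrow> sec u t = w t"
proof -
  have "\<forall>n. \<exists>d>0. \<forall>k. 0 < k \<longrightarrow> k < d \<longrightarrow> (AE t in lborel. t \<in> {0<..<T - k} \<longrightarrow> norm (sec u (t + k) - sec u t) \<le> inverse (real (Suc n)))"
    by (intro allI sec_time_modulus[OF W V T]) simp
  from choice[OF this] obtain d where dd: "\<forall>n. d n > 0 \<and>
    (\<forall>k. 0 < k \<longrightarrow> k < d n \<longrightarrow> (AE t in lborel. t \<in> {0<..<T - k} \<longrightarrow> norm (sec u (t + k) - sec u t) \<le> inverse (real (Suc n))))"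
    by blast
  have d: "d n > 0"
    "0 < k \<Longrightarrow> k < d n \<Longrightarrow> AE t in lborel. t \<in> {0<..<T - k} \<longrightarrow> norm (sec u (t + k) - sec u t) \<le> inverse (real (Suc n))" for n k
    using dd by blast+
  \<comment> \<open>Squared norms keep the relation measurable in (k, t), as the exchange of
    quantifiers requires.\<close>
  define P where "P n k t \<longleftrightarrow> (0 < k \<and> k < d n \<and> 0 < t \<and> t + k < T \<longrightarrow> (norm (sec u (t + k) - sec u t))\<^sup>2 \<le> (inverse (real (Suc n)))\<^sup>2)" for n k t
  have "AE t in lborel. \<forall>n. AE k in lborel. P n k t"
    unfolding AE_all_countable
  proof
    fix n
    have "{x \<in> space (lborel \<Otimes>\<^sub>M lborel). P n (fst x) (snd x)} \<in> sets (lborel \<Otimes>\<^sub>M lborel)"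
      unfolding P_def power2_norm_diff_inner by measurable
    moreover have "AE k in lborel. AE t in lborel. P n k t"
    proof (rule AE_I2)
      fix k
      show "AE t in lborel. P n k t"
      proof (cases "0 < k \<and> k < d n")
        case True
        then show ?thesis
          using d(2)[of k n] by (auto simp: P_def intro!: power_mono elim!: eventually_mono)
      qed (auto simp: P_def)
    qed
    ultimately show "AE t in lborel. AE k in lborel. P n k t"
      using lborel_pair.AE_commute by blast
  qed
  define Gd where "Gd = {t. 0 < t \<and> t < T \<and> (\<forall>n. AE k in lborel. P n k t)}"
  have GdAE: "AE t in lborel. t \<in> {0<..<T} \<longrightarrow> t \<in> Gd"
    using \<open>AE t in lborel. \<forall>n. AE k in lborel. P n k t\<close> by eventually_elim (auto simp: Gd_def)
  \<comment> \<open>At a good time the estimate holds only for almost every increment, possibly not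
    for t' - t itself. Hence t and t' are both compared with a common later time s, which explains
    the factor 2.\<close>
  have near: "norm (sec u t' - sec u t) \<le> 2 * inverse (real (Suc n))"
    if t: "t \<in> Gd" "t' \<in> Gd" "t < t'" "t' - t < d n / 2" for t t' n
  proof -
    have "AE s in lborel. P n (s + (- t)) t" "AE s in lborel. P n (s + (- t')) t'"
      using t(1,2) AE_lborel_shift[of "\<lambda>k. P n k t" "- t"] AE_lborel_shift[of "\<lambda>k. P n k t'" "- t'"]
      unfolding Gd_def by blast+
    then have "AE s in lborel. P n (s + (- t)) t \<and> P n (s + (- t')) t'" by eventually_elim simp
    \<comment> \<open>Leaves an interval of positive length after t' and before T from which s is
      taken; its length keeps both increments below \<open>d n\<close>.\<close>
    moreover have "t' < min T (t' + d n / 2)" using t(2) d(1)[of n] by (auto simp: Gd_def)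
    ultimately obtain s where s: "t' < s" "s < min T (t' + d n / 2)" "P n (s + (- t)) t" "P n (s + (- t')) t'"
      using AE_interval_ex by blast
    have "(norm (sec u s - sec u t))\<^sup>2 \<le> (inverse (real (Suc n)))\<^sup>2" "(norm (sec u s - sec u t'))\<^sup>2 \<le> (inverse (real (Suc n)))\<^sup>2"
    proof -
      have "t < s" "s - t < d n" "s - t' < d n" "0 < t" "0 < t'" "s < T"
        using s(1,2) t d(1)[of n] by (auto simp: Gd_def)
      then show "(norm (sec u s - sec u t))\<^sup>2 \<le> (inverse (real (Suc n)))\<^sup>2" "(norm (sec u s - sec u t'))\<^sup>2 \<le> (inverse (real (Suc n)))\<^sup>2"
        using s(1,3,4) unfolding P_def by simp_all
    qed
    then have "norm (sec u s - sec u t) \<le> inverse (real (Suc n))" "norm (sec u s - sec u t') \<le> inverse (real (Suc n))"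
      by (auto intro: power2_le_imp_le)
    then show ?thesis
      using norm_triangle_ineq4[of "sec u s - sec u t" "sec u s - sec u t'"] by simp
  qed
  have uc: "uniformly_continuous_on Gd (sec u)"
    unfolding uniformly_continuous_on_def
  proof (intro allI impI)
    fix \<epsilon> :: real assume "\<epsilon> > 0"
    then obtain n where n: "inverse (real (Suc n)) < \<epsilon> / 2" using reals_Archimedean[of "\<epsilon> / 2"] by auto
    have "dist (sec u t') (sec u t) < \<epsilon>" if "t \<in> Gd" "t' \<in> Gd" "dist t' t < d n / 2" for t t'
    proof (cases t t' rule: linorder_cases)
      case less
      then show ?thesis using near[of t t' n] that n by (simp add: dist_norm dist_real_def)
    next
      case equal
      then show ?thesis using \<open>\<epsilon> > 0\<close> by simp
    next
      case greater
      then show ?thesis using near[of t' t n] that n by (simp add: dist_norm dist_real_def norm_minus_commute)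
    qed
    then show "\<exists>\<delta>>0. \<forall>x\<in>Gd. \<forall>x'\<in>Gd. dist x' x < \<delta> \<longrightarrow> dist (sec u x') (sec u x) < \<epsilon>"
      using d(1)[of n] by (intro exI[of _ "d n / 2"]) auto
  qed
  obtain w where w: "uniformly_continuous_on (closure Gd) w" "\<And>x. x \<in> Gd \<Longrightarrow> sec u x = w x"
    by (rule uniformly_continuous_on_extension_on_closure[OF uc], rule that)
  have sub: "{0..T} \<subseteq> closure Gd"
  proof
    fix t assume t: "t \<in> {0..T}"
    show "t \<in> closure Gd"
      unfolding closure_approachable
    proof (intro allI impI)
      fix \<epsilon> :: real assume \<epsilon>: "\<epsilon> > 0"
      have "max 0 (t - \<epsilon>) < min T (t + \<epsilon>)" using t T \<epsilon> by auto
      from AE_interval_ex[OF GdAE this] obtain x where "max 0 (t - \<epsilon>) < x" "x < min T (t + \<epsilon>)" "x \<in> {0<..<T} \<longrightarrow> x \<in> Gd"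
        by blast
      then show "\<exists>y\<in>Gd. dist y t < \<epsilon>"
        by (intro bexI[of _ x]) (auto simp: dist_real_def)
    qed
  qed
  show ?thesis
  proof (rule that)
    show "continuous_on {0..T} w"
      by (rule continuous_on_subset[OF uniformly_continuous_imp_continuous[OF w(1)] sub])
    show "AE t in lborel. t \<in> {0<..<T} \<longrightarrow> sec u t = w t"
      using GdAE by eventually_elim (use w(2) in auto)
  qed
qed

lemma window_near:
  assumes "AE r in lborel. r \<in> {c<..<c + h} \<longrightarrow> \<bar>sec u r \<bullet> sec u r - L\<bar> \<le> \<epsilon>" "0 < h"
  shows "\<bar>window u h c - h * L\<bar> \<le> h * \<epsilon>"
proof -
  have i: "integrable lborel (\<lambda>r. indicator {c<..<c + h} r * x)" for x :: real
    using assms(2) by (intro integrable_mult_left) (simp add: integrable_indicator_iff)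
  have c: "(LINT r|lborel. indicator {c<..<c + h} r * x) = h * x" for x :: real
    using assms(2) by simp
  have "window u h c \<le> (LINT r|lborel. indicator {c<..<c + h} r * (L + \<epsilon>))"
    unfolding window_def
    by (rule integral_mono_AE[OF integrable_indicator_sec i])
      (use assms(1) in \<open>auto simp: indicator_def elim!: eventually_mono\<close>)
  moreover have "(LINT r|lborel. indicator {c<..<c + h} r * (L - \<epsilon>)) \<le> window u h c"
    unfolding window_def
    by (rule integral_mono_AE[OF i integrable_indicator_sec])
      (use assms(1) in \<open>auto simp: indicator_def elim!: eventually_mono\<close>)
  ultimately show ?thesis
    unfolding c by (simp add: abs_le_iff algebra_simps)
qed

text \<open>At times of the cut-off tail, u(t+h) is zero, so the size of u(t) equals that of the
  increment.\<close>

lemma restr_tail_le: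
  fixes u :: "(real \<times> 'b::euclidean_space, 'c::euclidean_space) L2"
  assumes "AE t in lborel. t \<notin> {0<..<T} \<longrightarrow> sec u t = 0" "0 < h"
  shows "norm (restr ({0<..<T - h} \<times> UNIV) u - u) \<le> norm (tshift h u - u)"
proof (rule norm_L2_le_sec)
  have *: "AE t in lborel. t + h \<notin> {0<..<T} \<longrightarrow> sec u (t + h) = 0"
    using AE_lborel_shift[OF assms(1), of h] by simp
  show "AE t in lborel. norm (sec (restr ({0<..<T - h} \<times> UNIV) u - u) t) \<le> norm (sec (tshift h u - u) t)"
    using sec_diff[of "restr ({0<..<T - h} \<times> UNIV) u" u] sec_diff[of "tshift h u" u] sec_shift[of h u]
      restr_time_sec[of "{0<..<T - h}" u, simplified] assms(1) *
  proof eventually_elim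
    case (elim t)
    then show ?case
      using assms(2) by (cases "t \<in> {0<..<T - h}"; cases "t \<le> 0") auto
  qed
qed

text \<open>Testing with u(t+h) + u(t) on (0, T - h), the left side is a difference of end windows,
  each h times a trace value up to h \<epsilon> by continuity of \<open>w\<close>. The test pair
  tends to 2 (u, G), which gives the factor 2 on the right. All errors are O(h \<epsilon>), and h
  cancels.\<close>

lemma energy_identity:
  fixes \<Omega> :: "(real^'n) set"
  assumes W: "weak_eq {0<..<T} \<Omega> u \<sigma> f" and V: "H10_valued {0<..<T} \<Omega> u G" and T: "0 < T"
    and w: "continuous_on {0..T} w" "AE t in lborel. t \<in> {0<..<T} \<longrightarrow> sec u t = w t"
  shows "(norm (w T))\<^sup>2 - (norm (w 0))\<^sup>2 = 2 * (\<sigma> \<bullet> G + f \<bullet> u)"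
proof -
  let ?X = "((norm (w T))\<^sup>2 - (norm (w 0))\<^sup>2) - 2 * (\<sigma> \<bullet> G + f \<bullet> u)"
  \<comment> \<open>Collects the error factors: 2 from the two end windows, 2 |G| and 2 |u| from the
    moduli of \<sigma> and f, 3 |\<sigma>| and 3 |f| from replacing the test pair by 2 (u,
    G).\<close>
  define K where "K = 2 + 2 * norm G + 2 * norm u + 3 * norm \<sigma> + 3 * norm f"
  have K: "K > 0" unfolding K_def by (intro add_pos_nonneg) auto
  have zu: "AE t in lborel. t \<notin> {0<..<T} \<longrightarrow> sec u t = 0" "AE t in lborel. t \<notin> {0<..<T} \<longrightarrow> sec G t = 0"
    using V unfolding H10_valued_def by (auto elim: eventually_mono)
  have est: "\<bar>?X\<bar> \<le> K * \<epsilon>" if \<epsilon>: "\<epsilon> > 0" for \<epsilon>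
  proof -
    have cE: "continuous_on {0..T} (\<lambda>t. w t \<bullet> w t)" by (intro continuous_intros w(1))
    obtain e1 where e1: "e1 > 0" "\<And>t. t \<in> {0..T} \<Longrightarrow> dist t 0 < e1 \<Longrightarrow> dist (w t \<bullet> w t) (w 0 \<bullet> w 0) < \<epsilon>"
      using cE[unfolded continuous_on_iff, THEN bspec, of 0] \<epsilon> T by auto
    obtain e2 where e2: "e2 > 0" "\<And>t. t \<in> {0..T} \<Longrightarrow> dist t T < e2 \<Longrightarrow> dist (w t \<bullet> w t) (w T \<bullet> w T) < \<epsilon>"
      using cE[unfolded continuous_on_iff, THEN bspec, of T] \<epsilon> T by auto
    obtain d1 where d1: "d1 > 0" "\<And>r. \<bar>r\<bar> < d1 \<Longrightarrow> norm (tshift r u - u) < \<epsilon>" using tshift_small[OF \<epsilon>] by blast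
    obtain d2 where d2: "d2 > 0" "\<And>r. \<bar>r\<bar> < d2 \<Longrightarrow> norm (tshift r G - G) < \<epsilon>" using tshift_small[OF \<epsilon>] by blast
    obtain d3 where d3: "d3 > 0" "\<And>r. \<bar>r\<bar> < d3 \<Longrightarrow> norm (tshift r \<sigma> - \<sigma>) < \<epsilon>" using tshift_small[OF \<epsilon>] by blast
    obtain d4 where d4: "d4 > 0" "\<And>r. \<bar>r\<bar> < d4 \<Longrightarrow> norm (tshift r f - f) < \<epsilon>" using tshift_small[OF \<epsilon>] by blast
    \<comment> \<open>Halving the minimum makes h strictly smaller than each of the bounds.\<close>
    define h where "h = min (min (T / 2) (min e1 e2)) (min (min d1 d2) (min d3 d4)) / 2"
    have h: "0 < h" "h < T" "h < e1" "h < e2" "h < d1" "h < d2" "h < d3" "h < d4"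
      using T e1(1) e2(1) d1(1) d2(1) d3(1) d4(1) by (auto simp: h_def min_def)
    let ?J = "{0<..<T - h} \<times> (UNIV :: (real^'n) set)"
    let ?\<Phi> = "restr ?J (tshift h u + u)" and ?H = "restr ?J (tshift h G + G)"
    have cl: "(?\<Phi>, ?H) \<in> closure (test_graph ({0<..<T - h} \<times> \<Omega>))"
      by (rule H10_valued_window_sum[OF V]) (use h in auto)
    have "\<bar>(tshift h u - u) \<bullet> ?\<Phi> - h * (\<sigma> \<bullet> ?H + f \<bullet> ?\<Phi>)\<bar> \<le> h * (\<epsilon> * norm ?H + \<epsilon> * norm ?\<Phi>)"
      by (rule weak_eq_increment_bound(1)[OF W h(1) _ _ cl])
        (use d3(2) d4(2) h in \<open>auto intro!: less_imp_le\<close>)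
    also have "\<dots> \<le> h * (\<epsilon> * (2 * norm G) + \<epsilon> * (2 * norm u))"
      using h(1) \<epsilon> by (intro mult_left_mono add_mono norm_window_sum) auto
    finally have 1: "\<bar>(window u h (T - h) - window u h 0) - h * (\<sigma> \<bullet> ?H + f \<bullet> ?\<Phi>)\<bar> \<le> h * (\<epsilon> * (2 * norm G) + \<epsilon> * (2 * norm u))"
      using energy_increment[of 0 "T - h" h u] h by simp
    \<comment> \<open>One translation error comes from the shift and two from the tail cut off on (T
      - h, T).\<close>
    have near2: "norm (restr ?J (tshift h v + v) - 2 *\<^sub>R v) \<le> 3 * \<epsilon>"
      if "AE t in lborel. t \<notin> {0<..<T} \<longrightarrow> sec v t = 0" "norm (tshift h v - v) < \<epsilon>" for v :: "('n st, 'b::euclidean_space) L2"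
    proof -
      have "restr ?J (tshift h v + v) - 2 *\<^sub>R v = restr ?J (tshift h v - v) + 2 *\<^sub>R (restr ?J v - v)"
        by (simp add: restr_add restr_diff scaleR_diff_right) (simp add: scaleR_2)
      also have "norm \<dots> \<le> norm (tshift h v - v) + 2 * norm (tshift h v - v)"
        using norm_restr_le[OF sets_time_UNIV, of 0 "T - h" "tshift h v - v"] restr_tail_le[OF that(1) h(1)]
        by (intro order_trans[OF norm_triangle_ineq] add_mono) auto
      finally show ?thesis using that(2) by simp
    qed
    have 2: "\<bar>\<sigma> \<bullet> ?H - 2 * (\<sigma> \<bullet> G)\<bar> \<le> norm \<sigma> * (3 * \<epsilon>)"
    proof -
      have "\<bar>\<sigma> \<bullet> (?H - 2 *\<^sub>R G)\<bar> \<le> norm \<sigma> * norm (?H - 2 *\<^sub>R G)" by (rule Cauchy_Schwarz_ineq2)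
      also have "\<dots> \<le> norm \<sigma> * (3 * \<epsilon>)"
        using d2(2)[of h] h by (intro mult_left_mono near2 zu(2)) auto
      finally show ?thesis by (simp add: inner_diff_right)
    qed
    have 3: "\<bar>f \<bullet> ?\<Phi> - 2 * (f \<bullet> u)\<bar> \<le> norm f * (3 * \<epsilon>)"
    proof -
      have "\<bar>f \<bullet> (?\<Phi> - 2 *\<^sub>R u)\<bar> \<le> norm f * norm (?\<Phi> - 2 *\<^sub>R u)" by (rule Cauchy_Schwarz_ineq2)
      also have "\<dots> \<le> norm f * (3 * \<epsilon>)"
        using d1(2)[of h] h by (intro mult_left_mono near2 zu(1)) auto
      finally show ?thesis by (simp add: inner_diff_right)
    qed
    have 4: "\<bar>window u h 0 - h * (norm (w 0))\<^sup>2\<bar> \<le> h * \<epsilon>"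
    proof (rule window_near[OF _ h(1)])
      show "AE r in lborel. r \<in> {0<..<0 + h} \<longrightarrow> \<bar>sec u r \<bullet> sec u r - (norm (w 0))\<^sup>2\<bar> \<le> \<epsilon>"
        using w(2)
      proof eventually_elim
        case (elim r)
        then show ?case using e1(2)[of r] h by (auto simp: power2_norm_eq_inner dist_real_def)
      qed
    qed
    have 5: "\<bar>window u h (T - h) - h * (norm (w T))\<^sup>2\<bar> \<le> h * \<epsilon>"
    proof (rule window_near[OF _ h(1)])
      show "AE r in lborel. r \<in> {T - h<..<T - h + h} \<longrightarrow> \<bar>sec u r \<bullet> sec u r - (norm (w T))\<^sup>2\<bar> \<le> \<epsilon>"
        using w(2)
      proof eventually_elim
        case (elim r)
        then show ?case using e2(2)[of r] h by (auto simp: power2_norm_eq_inner dist_real_def)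
      qed
    qed
    have 6: "\<bar>h * (\<sigma> \<bullet> ?H + f \<bullet> ?\<Phi>) - h * (2 * (\<sigma> \<bullet> G + f \<bullet> u))\<bar> \<le> h * (norm \<sigma> * (3 * \<epsilon>) + norm f * (3 * \<epsilon>))"
    proof -
      have "\<bar>h * (\<sigma> \<bullet> ?H + f \<bullet> ?\<Phi>) - h * (2 * (\<sigma> \<bullet> G + f \<bullet> u))\<bar> = h * \<bar>(\<sigma> \<bullet> ?H - 2 * (\<sigma> \<bullet> G)) + (f \<bullet> ?\<Phi> - 2 * (f \<bullet> u))\<bar>"
      proof -
        have eq: "h * (\<sigma> \<bullet> ?H + f \<bullet> ?\<Phi>) - h * (2 * (\<sigma> \<bullet> G + f \<bullet> u)) = h * ((\<sigma> \<bullet> ?H - 2 * (\<sigma> \<bullet> G)) + (f \<bullet> ?\<Phi> - 2 * (f \<bullet> u)))"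
          by (simp add: algebra_simps)
        show ?thesis unfolding eq using h(1) by (simp only: abs_mult abs_of_pos)
      qed
      also have "\<dots> \<le> h * (norm \<sigma> * (3 * \<epsilon>) + norm f * (3 * \<epsilon>))"
        using 2 3 h(1) by (intro mult_left_mono) linarith+
      finally show ?thesis .
    qed
    have "\<bar>h * (norm (w T))\<^sup>2 - h * (norm (w 0))\<^sup>2 - h * (2 * (\<sigma> \<bullet> G + f \<bullet> u))\<bar>
      \<le> h * \<epsilon> + h * \<epsilon> + h * (\<epsilon> * (2 * norm G) + \<epsilon> * (2 * norm u)) + h * (norm \<sigma> * (3 * \<epsilon>) + norm f * (3 * \<epsilon>))"
      using 1 4 5 6 by linarith
    moreover have "h * (norm (w T))\<^sup>2 - h * (norm (w 0))\<^sup>2 - h * (2 * (\<sigma> \<bullet> G + f \<bullet> u)) = h * ?X"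
      by (simp only: right_diff_distrib)
    moreover have "h * \<epsilon> + h * \<epsilon> + h * (\<epsilon> * (2 * norm G) + \<epsilon> * (2 * norm u)) + h * (norm \<sigma> * (3 * \<epsilon>) + norm f * (3 * \<epsilon>)) = h * (K * \<epsilon>)"
      by (simp add: K_def algebra_simps)
    ultimately have "h * \<bar>?X\<bar> \<le> h * (K * \<epsilon>)" using h(1) by (simp only: abs_mult abs_of_pos)
    then show ?thesis using h(1) by simp
  qed
  have "?X = 0"
  proof (rule ccontr)
    assume "?X \<noteq> 0"
    then have "\<bar>?X\<bar> > 0" by simp
    then have "\<bar>?X\<bar> \<le> K * (\<bar>?X\<bar> / (2 * K))" using K by (intro est) simp
    also have "\<dots> = \<bar>?X\<bar> / 2" using K by simp
    finally have "\<bar>?X\<bar> \<le> \<bar>?X\<bar> / 2" .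
    moreover have "\<not> y \<le> y / 2" if "y > 0" for y :: real using that by linarith
    ultimately show False using \<open>\<bar>?X\<bar> > 0\<close> by blast
  qed
  then show ?thesis by linarith
qed

section \<open>The fibrewise square root of the diffusion matrix\<close>

subsection \<open>Square roots of positive definite matrices\<close>

lemma norm_matrix_vector_le: "norm (M *v y) \<le> norm M * norm y" for M :: "real^'n^'m"
proof -
  have "(norm (M *v y))\<^sup>2 = (\<Sum>i\<in>UNIV. ((M $ i) \<bullet> y)\<^sup>2)"
    unfolding power2_norm_eq_inner by (simp add: inner_vec_def matrix_vector_mult_def power2_eq_square)
  also have "\<dots> \<le> (\<Sum>i\<in>UNIV. (norm (M $ i))\<^sup>2 * (norm y)\<^sup>2)"
    using Cauchy_Schwarz_ineq[of "M $ i" y for i] by (intro sum_mono) (simp add: power2_norm_eq_inner)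
  also have "\<dots> = (norm M)\<^sup>2 * (norm y)\<^sup>2"
    unfolding sum_distrib_right[symmetric] by (simp add: power2_norm_eq_inner inner_vec_def)
  finally have "(norm (M *v y))\<^sup>2 \<le> (norm M * norm y)\<^sup>2" by (simp add: power_mult_distrib)
  then show ?thesis by (rule power2_le_imp_le) simp
qed

lemma symmetric_inner: "transpose M = M \<Longrightarrow> (M *v x) \<bullet> y = x \<bullet> (M *v y)" for M :: "real^'n^'n"
proof -
  assume "transpose M = M"
  then have "M *v x = x v* M" using transpose_matrix_vector[of M x] by simp
  then show ?thesis by (simp add: dot_lmul_matrix)
qed

text \<open>If z = B y were nonzero, moving from the zero y of the quadratic form in direction -z
  would lower the form to first order and make it negative.\<close>

lemma psd_kernel:
  fixes B :: "real^'n^'n"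
  assumes sym: "transpose B = B" and pos: "\<And>y. 0 \<le> y \<bullet> (B *v y)" and y: "y \<bullet> (B *v y) = 0"
  shows "B *v y = 0"
proof (rule ccontr)
  define z where "z = B *v y"
  assume "B *v y \<noteq> 0"
  then have n: "z \<bullet> z > 0" by (simp add: z_def)
  define K where "K = z \<bullet> (B *v z)"
  have K: "0 \<le> K" unfolding K_def by (rule pos)
  \<comment> \<open>Small enough that the second-order term s K stays below z . z; the 1 in the
    denominator covers K = 0.\<close>
  define s where "s = (z \<bullet> z) / (K + 1)"
  have s: "s > 0" using n K by (simp add: s_def)
  have "0 \<le> (y - s *\<^sub>R z) \<bullet> (B *v (y - s *\<^sub>R z))" by (rule pos)
  also have "\<dots> = s * (s * K - 2 * (z \<bullet> z))"
    using y symmetric_inner[OF sym, of y z]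
    by (simp add: matrix_vector_mult_diff_distrib matrix_vector_mult_scaleR inner_diff_left inner_diff_right K_def z_def inner_commute algebra_simps)
  finally have "2 * (z \<bullet> z) \<le> s * K" using s by (simp add: zero_le_mult_iff)
  also have "\<dots> \<le> z \<bullet> z" using n K by (simp add: s_def divide_le_eq mult_left_mono)
  finally show False using n by simp
qed

text \<open>For \<open>D = B - C\<close> one has \<open>B D + D C = B\<^sup>2 - C\<^sup>2 = 0\<close>; multiplying by \<open>D\<close> and taking traces gives
  \<open>tr (D B D) + tr (D C D) = 0\<close>, where both terms are nonnegative.\<close>

lemma psd_sqrt_unique:
  fixes B C :: "real^'n^'n"
  assumes B: "transpose B = B" "\<And>y. 0 \<le> y \<bullet> (B *v y)" and C: "transpose C = C" "\<And>y. 0 \<le> y \<bullet> (C *v y)"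
    and eq: "B ** B = C ** C"
  shows "B = C"
proof -
  define D where "D = B - C"
  have symD: "transpose D = D" using B(1) C(1) by (simp add: D_def transpose_def vec_eq_iff)
  have tr: "trace (D ** (E ** D)) = (\<Sum>i\<in>UNIV. (D *v axis i 1) \<bullet> (E *v (D *v axis i 1)))" for E
  proof -
    have "trace N = (\<Sum>i\<in>UNIV. axis i 1 \<bullet> (N *v axis i 1))" for N :: "real^'n^'n"
      by (simp add: trace_def inner_axis' matrix_vector_mul_component inner_axis)
    then show ?thesis
      by (simp add: matrix_vector_mul_assoc[symmetric] symmetric_inner[OF symD])
  qed
  have "B ** D + D ** C = 0"
    by (simp add: matrix_eq matrix_vector_mult_add_rdistrib matrix_vector_mul_assoc[symmetric] D_def matrix_vector_mult_diff_rdistrib matrix_vector_mult_diff_distrib)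
      (simp add: matrix_vector_mul_assoc eq)
  then have "D ** (B ** D) + D ** (D ** C) = 0"
    by (simp add: matrix_add_ldistrib[symmetric])
  then have "trace (D ** (B ** D)) + trace (D ** (D ** C)) = 0"
    by (metis trace_add trace_0 mat_0)
  moreover have "trace (D ** (D ** C)) = trace (D ** (C ** D))"
    by (subst trace_mul_sym) (simp add: matrix_mul_assoc)
  ultimately have "(\<Sum>i\<in>UNIV. (D *v axis i 1) \<bullet> (B *v (D *v axis i 1)) + (D *v axis i 1) \<bullet> (C *v (D *v axis i 1))) = 0"
    by (simp add: tr sum.distrib)
  then have "(D *v axis i 1) \<bullet> (B *v (D *v axis i 1)) + (D *v axis i 1) \<bullet> (C *v (D *v axis i 1)) = 0" for i
    by (subst (asm) sum_nonneg_eq_0_iff) (auto intro: add_nonneg_nonneg B(2) C(2))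
  then have "(D *v axis i 1) \<bullet> (B *v (D *v axis i 1)) = 0" "(D *v axis i 1) \<bullet> (C *v (D *v axis i 1)) = 0" for i
    using B(2)[of "D *v axis i 1"] C(2)[of "D *v axis i 1"] by (smt (verit))+
  then have "B *v (D *v axis i 1) = 0" "C *v (D *v axis i 1) = 0" for i
    using psd_kernel[OF B] psd_kernel[OF C] by blast+
  then have "D *v (D *v axis i 1) = 0" for i
    by (simp add: D_def matrix_vector_mult_diff_rdistrib)
  then have "(D *v axis i 1) \<bullet> (D *v axis i 1) = 0" for i
    by (simp add: symmetric_inner[OF symD])
  then have "D *v axis i 1 = 0" for i by simp
  then have "D = 0"
    by (simp add: vec_eq_iff matrix_vector_mul_component inner_axis)
  then show ?thesis by (simp add: D_def)
qed

lemma mat_sqrt_eqI: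
  assumes "transpose B = B" "\<And>y. 0 \<le> y \<bullet> (B *v y)" "B ** B = M"
  shows "mat_sqrt M = B"
  unfolding mat_sqrt_def
proof (rule the_equality)
  show "C = B" if "transpose C = C \<and> (\<forall>y. 0 \<le> y \<bullet> (C *v y)) \<and> C ** C = M" for C
    by (rule psd_sqrt_unique) (use that assms in auto)
qed (use assms in auto)

text \<open>For \<open>R = I - t M\<close> with \<open>\<parallel>R\<parallel> = \<rho> < 1\<close>, the map \<open>Y \<mapsto> (R + Y\<^sup>2)/2\<close> is a contraction on the symmetric
  operators of norm at most \<open>1 - sqrt (1 - \<rho>)\<close>; its fixed point satisfies \<open>(I - Y)\<^sup>2 = t M\<close>.\<close>

lemma sqrt_fixed_point:
  fixes R :: "'a::euclidean_space \<Rightarrow>\<^sub>L 'a"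
  assumes \<rho>: "norm R < 1" and sym: "\<And>x y. blinfun_apply R x \<bullet> y = x \<bullet> blinfun_apply R y"
  obtains Y where "norm Y < 1" "\<And>x y. blinfun_apply Y x \<bullet> y = x \<bullet> blinfun_apply Y y" "2 *\<^sub>R Y = R + (Y o\<^sub>L Y)"
proof -
  \<comment> \<open>The smaller root of y^2 - 2 y + norm R = 0. The equation makes the ball of
    radius y invariant, and y < 1 serves as contraction constant as well.\<close>
  define y where "y = 1 - sqrt (1 - norm R)"
  have y: "0 \<le> y" "y < 1" "(norm R + y * y) / 2 = y"
  proof -
    show "0 \<le> y" "y < 1" using \<rho> by (auto simp: y_def)
    define s where "s = sqrt (1 - norm R)"
    have "s * s = 1 - norm R" using \<rho> by (simp add: s_def)
    then have R: "norm R = 1 - s * s" by simp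
    have ys: "y = 1 - s" by (simp add: y_def s_def)
    show "(norm R + y * y) / 2 = y" unfolding R ys by (simp add: field_simps)
  qed
  define S where "S = {Y :: 'a \<Rightarrow>\<^sub>L 'a. norm Y \<le> y \<and> (\<forall>x z. blinfun_apply Y x \<bullet> z = x \<bullet> blinfun_apply Y z)}"
  define f where "f Y = (1/2) *\<^sub>R (R + (Y o\<^sub>L Y))" for Y :: "'a \<Rightarrow>\<^sub>L 'a"
  have "S = {Y. norm Y \<le> y} \<inter> (\<Inter>x. \<Inter>z. {Y. blinfun_apply Y x \<bullet> z = x \<bullet> blinfun_apply Y z})"
    by (auto simp: S_def)
  moreover have "closed \<dots>"
    by (intro closed_Int closed_INT ballI closed_Collect_le closed_Collect_eq continuous_intros)
  ultimately have "complete S" by (simp add: complete_eq_closed)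
  moreover have "S \<noteq> {}"
    using y(1) by (auto simp: S_def intro!: exI[of _ 0])
  moreover have "f ` S \<subseteq> S"
  proof clarify
    fix Y assume Y: "Y \<in> S"
    have nY: "norm Y \<le> y" and symY: "\<And>x z. blinfun_apply Y x \<bullet> z = x \<bullet> blinfun_apply Y z"
      using Y unfolding S_def by blast+
    have "norm (f Y) \<le> (norm R + norm (Y o\<^sub>L Y)) / 2"
      unfolding f_def using norm_triangle_ineq[of R "Y o\<^sub>L Y"] by simp
    also have "norm (Y o\<^sub>L Y) \<le> norm Y * norm Y" by (rule norm_blinfun_compose)
    also have "\<dots> \<le> y * y" using nY y(1) by (intro mult_mono) auto
    finally have 1: "norm (f Y) \<le> y" using y(3) by simp
    have 2: "blinfun_apply (f Y) x \<bullet> z = x \<bullet> blinfun_apply (f Y) z" for x z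
      by (simp add: sym symY f_def blinfun.add_left blinfun.scaleR_left inner_add_left inner_add_right)
    show "f Y \<in> S" using 1 2 unfolding S_def by blast
  qed
  moreover have "dist (f Y) (f Z) \<le> y * dist Y Z" if "Y \<in> S" "Z \<in> S" for Y Z
  proof -
    have n: "norm Y \<le> y" "norm Z \<le> y" using that unfolding S_def by blast+
    have "f Y - f Z = (1/2) *\<^sub>R ((Y o\<^sub>L (Y - Z)) + ((Y - Z) o\<^sub>L Z))"
      by (rule blinfun_eqI) (simp add: f_def blinfun.add_left blinfun.diff_left blinfun.diff_right blinfun.scaleR_left scaleR_diff_right scaleR_add_right)
    then have "norm (f Y - f Z) \<le> (norm (Y o\<^sub>L (Y - Z)) + norm ((Y - Z) o\<^sub>L Z)) / 2"
      using norm_triangle_ineq[of "Y o\<^sub>L (Y - Z)" "(Y - Z) o\<^sub>L Z"] by simp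
    also have "\<dots> \<le> (y * norm (Y - Z) + norm (Y - Z) * y) / 2"
      using n y(1) by (intro divide_right_mono add_mono order_trans[OF norm_blinfun_compose] mult_mono) auto
    finally show ?thesis by (simp add: dist_norm)
  qed
  ultimately have "\<exists>!Y. Y \<in> S \<and> f Y = Y"
    using y by (intro Banach_fix[of S y f]) auto
  then obtain Y where Y: "Y \<in> S" "f Y = Y" by blast
  show ?thesis
  proof (rule that[of Y])
    have "norm Y \<le> y" using Y(1) unfolding S_def by blast
    then show "norm Y < 1" using y(2) by simp
    have "2 *\<^sub>R f Y = R + (Y o\<^sub>L Y)" by (simp add: f_def)
    then show "2 *\<^sub>R Y = R + (Y o\<^sub>L Y)" using Y(2) by simp
    show "blinfun_apply Y x \<bullet> z = x \<bullet> blinfun_apply Y z" for x z using Y(1) unfolding S_def by blast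
  qed
qed

text \<open>The root is B = (I - Y) / sqrt t, with Y the fixed point for R = I - t M: then B B = (I
  - 2 Y + Y Y) / t = (I - R) / t = M, and norm Y < 1 makes B positive definite, hence
  invertible.\<close>

lemma mat_sqrt_properties:
  fixes M :: "real^'n^'n"
  assumes sym: "transpose M = M" and \<alpha>: "\<alpha> > 0" and coer: "\<And>y. \<alpha> * (norm y)\<^sup>2 \<le> y \<bullet> (M *v y)"
  shows "transpose (mat_sqrt M) = mat_sqrt M" "mat_sqrt M ** mat_sqrt M = M" "invertible (mat_sqrt M)"
proof -
  \<comment> \<open>An upper bound for the operator norm of M; adding \<alpha> makes K positive and
    at least \<alpha>.\<close>
  define K where "K = norm M + \<alpha>"
  have K: "K > 0" "\<alpha> \<le> K" using \<alpha> by (auto simp: K_def add_nonneg_pos)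
  have MK: "norm (M *v y) \<le> K * norm y" for y
    by (rule order_trans[OF norm_matrix_vector_le], rule mult_right_mono) (use \<alpha> in \<open>simp_all add: K_def\<close>)
  \<comment> \<open>The minimiser of 1 - 2 t \<alpha> + t^2 K^2, which bounds the squared norm of I
    - t M; the minimum is \<open>q\<close>.\<close>
  define t where "t = \<alpha> / K\<^sup>2"
  have t: "t > 0" using \<alpha> K by (simp add: t_def)
  define q where "q = 1 - \<alpha>\<^sup>2 / K\<^sup>2"
  have q: "0 \<le> q" "q < 1" using \<alpha> K by (auto simp: q_def power_mono divide_le_eq)
  define bl where "bl N = Blinfun (\<lambda>x. N *v x)" for N :: "real^'n^'n"
  have bl [simp]: "blinfun_apply (bl N) x = N *v x" for N x
    unfolding bl_def by (subst bounded_linear_Blinfun_apply) (auto intro: matrix_vector_mul_bounded_linear)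
  define R where "R = bl (mat 1 - t *\<^sub>R M)"
  have Rx: "blinfun_apply R x = x - t *\<^sub>R (M *v x)" for x
    by (simp add: R_def matrix_vector_mult_diff_rdistrib scaleR_matrix_vector_assoc)
  have "norm (blinfun_apply R x) \<le> sqrt q * norm x" for x
  proof (rule power2_le_imp_le)
    have "(norm (x - t *\<^sub>R (M *v x)))\<^sup>2 = (norm x)\<^sup>2 - 2 * t * (x \<bullet> (M *v x)) + t\<^sup>2 * (norm (M *v x))\<^sup>2"
      by (simp add: power2_norm_eq_inner inner_diff_left inner_diff_right inner_commute power2_eq_square[of t] algebra_simps)
    also have "\<dots> \<le> (norm x)\<^sup>2 - 2 * t * (\<alpha> * (norm x)\<^sup>2) + t\<^sup>2 * (K * norm x)\<^sup>2"
      using t MK[of x] coer[of x] by (intro add_mono diff_mono mult_left_mono power_mono) auto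
    also have "\<dots> = q * (norm x)\<^sup>2"
      using K by (simp add: t_def q_def power_mult_distrib power2_eq_square field_simps)
    finally show "(norm (blinfun_apply R x))\<^sup>2 \<le> (sqrt q * norm x)\<^sup>2"
      using q by (simp add: Rx power_mult_distrib)
  qed (use q in simp)
  then have "norm R \<le> sqrt q" by (intro norm_blinfun_bound) (use q in auto)
  also have "\<dots> < 1" using q by simp
  finally have nR: "norm R < 1" .
  have symR: "blinfun_apply R x \<bullet> y = x \<bullet> blinfun_apply R y" for x y
    by (simp add: Rx inner_diff_left inner_diff_right symmetric_inner[OF sym])
  obtain Y where Y: "norm Y < 1" "\<And>x y. blinfun_apply Y x \<bullet> y = x \<bullet> blinfun_apply Y y" "2 *\<^sub>R Y = R + (Y o\<^sub>L Y)"
    using sqrt_fixed_point[OF nR symR] by blast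
  define B where "B = (1 / sqrt t) *\<^sub>R (mat 1 - matrix (blinfun_apply Y))"
  have MY: "matrix (blinfun_apply Y) *v x = blinfun_apply Y x" for x
    using fun_cong[OF matrix_vector_mul(3)[OF blinfun.bounded_linear_right[of Y]], of x] by simp
  have Bx: "B *v x = (1 / sqrt t) *\<^sub>R (x - blinfun_apply Y x)" for x
    by (simp add: B_def MY matrix_vector_mult_diff_rdistrib scaleR_matrix_vector_assoc[symmetric])
  have symB: "transpose B = B"
  proof -
    have "(transpose B *v x) \<bullet> y = (B *v x) \<bullet> y" for x y
    proof -
      have "(transpose B *v x) \<bullet> y = x \<bullet> (B *v y)"
        by (simp add: transpose_matrix_vector dot_lmul_matrix)
      also have "\<dots> = (B *v x) \<bullet> y" using Y(2) by (simp add: Bx inner_diff_left inner_diff_right)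
      finally show ?thesis .
    qed
    then show ?thesis by (metis matrix_eq vector_eq_rdot)
  qed
  have posB: "0 < y \<bullet> (B *v y)" if "y \<noteq> 0" for y
  proof -
    have "y \<bullet> blinfun_apply Y y \<le> norm y * (norm Y * norm y)"
      by (rule order_trans[OF norm_cauchy_schwarz]) (intro mult_left_mono norm_blinfun norm_ge_zero)
    also have "\<dots> < norm y * (1 * norm y)"
      using Y(1) that by (intro mult_strict_left_mono mult_strict_right_mono) auto
    finally have "0 < y \<bullet> (y - blinfun_apply Y y)"
      by (simp add: inner_diff_right power2_norm_eq_inner[symmetric] power2_eq_square)
    then show ?thesis using t by (simp add: Bx)
  qed
  have BB: "B ** B = M"
  proof -
    have "(B ** B) *v x = M *v x" for x
    proof -
      have "(B ** B) *v x = B *v (B *v x)" by (simp add: matrix_vector_mul_assoc)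
      also have "\<dots> = (1 / sqrt t) *\<^sub>R ((1 / sqrt t) *\<^sub>R ((x - blinfun_apply Y x) - (blinfun_apply Y x - blinfun_apply Y (blinfun_apply Y x))))"
        by (simp only: Bx blinfun.diff_right blinfun.scaleR_right scaleR_diff_right)
      also have "\<dots> = (1 / t) *\<^sub>R (x - 2 *\<^sub>R blinfun_apply Y x + blinfun_apply Y (blinfun_apply Y x))"
      proof -
        have "(x - blinfun_apply Y x) - (blinfun_apply Y x - blinfun_apply Y (blinfun_apply Y x)) = x - 2 *\<^sub>R blinfun_apply Y x + blinfun_apply Y (blinfun_apply Y x)"
          by (simp add: scaleR_2)
        moreover have "1 / sqrt t * (1 / sqrt t) = 1 / t" using t by simp
        ultimately show ?thesis by (simp only: scaleR_scaleR)
      qed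
      also have "2 *\<^sub>R blinfun_apply Y x = blinfun_apply R x + blinfun_apply Y (blinfun_apply Y x)"
        using arg_cong[OF Y(3), of "\<lambda>Z. blinfun_apply Z x"] by (simp add: blinfun.add_left blinfun.scaleR_left)
      finally show ?thesis using t by (simp add: Rx)
    qed
    then show ?thesis by (simp add: matrix_eq)
  qed
  have "0 \<le> y \<bullet> (B *v y)" for y using posB[of y] by (cases "y = 0") auto
  then have eq: "mat_sqrt M = B" by (rule mat_sqrt_eqI[OF symB _ BB])
  show "transpose (mat_sqrt M) = mat_sqrt M" "mat_sqrt M ** mat_sqrt M = M" using symB BB eq by auto
  have "B *v x = 0 \<Longrightarrow> x = 0" for x using posB[of x] by force
  then show "invertible (mat_sqrt M)"
    unfolding eq by (simp add: invertible_left_inverse matrix_left_invertible_ker)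
qed

lemma mat_sqrt_mult_inverse:
  fixes M :: "real^'n^'n"
  assumes sym: "transpose M = M" and \<alpha>: "\<alpha> > 0" and coer: "\<And>y. \<alpha> * (norm y)\<^sup>2 \<le> y \<bullet> (M *v y)"
  shows "mat_sqrt M *v (matrix_inv (mat_sqrt M) *v y) = y"
proof -
  have "\<exists>N. mat_sqrt M ** N = mat 1 \<and> N ** mat_sqrt M = mat 1"
    using mat_sqrt_properties(3)[OF sym \<alpha> coer] by (simp add: invertible_def)
  then have "mat_sqrt M ** matrix_inv (mat_sqrt M) = mat 1 \<and> matrix_inv (mat_sqrt M) ** mat_sqrt M = mat 1"
    unfolding matrix_inv_def by (rule someI_ex)
  then show ?thesis by (simp add: matrix_vector_mul_assoc)
qed

lemma power2_norm_mat_sqrt: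
  fixes M :: "real^'n^'n"
  assumes sym: "transpose M = M" and \<alpha>: "\<alpha> > 0" and coer: "\<And>y. \<alpha> * (norm y)\<^sup>2 \<le> y \<bullet> (M *v y)"
  shows "(norm (mat_sqrt M *v y))\<^sup>2 = y \<bullet> (M *v y)"
  using symmetric_inner[OF mat_sqrt_properties(1)[OF sym \<alpha> coer], of y "mat_sqrt M *v y"]
    mat_sqrt_properties(2)[OF sym \<alpha> coer]
  by (simp add: power2_norm_eq_inner matrix_vector_mul_assoc)

subsection \<open>Measurability of the square root and of the inverse\<close>

text \<open>A partial function with closed graph is Borel measurable: preimages of compact sets are
  projections of closed sets along compact ones. This covers \<open>THE\<close> and \<open>SOME\<close>, which have a constant
  value where the defining property is unsatisfiable.\<close>

lemma borel_measurable_closed_relation: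
  fixes f :: "'a::euclidean_space \<Rightarrow> 'b::euclidean_space"
  assumes cl: "closed {(y, x). R x y}" and f: "\<And>x y. R x y \<Longrightarrow> f x = y"
    and k: "\<And>x. (\<nexists>y. R x y) \<Longrightarrow> f x = k"
  shows "f \<in> borel_measurable borel"
proof -
  define D where "D C = (\<Union>n::nat. {x. \<exists>y. y \<in> C \<inter> cball 0 (real n) \<and> (y, x) \<in> {(y, x). R x y}})" for C
  have D: "D C \<in> sets borel" if "closed C" for C
    unfolding D_def
    by (intro sets.countable_UN image_subsetI borel_closed closed_compact_projection cl closed_Int_compact that compact_cball)
  have D_iff: "x \<in> D C \<longleftrightarrow> (\<exists>y\<in>C. R x y)" for x C
    using real_arch_simple[of "norm y" for y] by (force simp: D_def)
  have "f -` C \<inter> space borel \<in> sets borel" if C: "closed C" for C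
  proof -
    have "f x \<in> C \<longleftrightarrow> x \<in> D C \<or> (k \<in> C \<and> x \<notin> D UNIV)" for x
      unfolding D_iff using f[of x] k[of x] by (cases "\<exists>y. R x y") auto
    then have "f -` C = D C \<union> (if k \<in> C then - D UNIV else {})" by auto
    then show ?thesis
      using D[OF C] D[OF closed_UNIV] by (simp add: Compl_eq_Diff_UNIV)
  qed
  then have "f \<in> measurable borel (sigma UNIV (Collect closed))"
    by (intro measurable_measure_of) auto
  then show ?thesis by (simp flip: borel_eq_closed)
qed

lemma borel_measurable_mat_sqrt: "(mat_sqrt :: real^'n^'n \<Rightarrow> real^'n^'n) \<in> borel_measurable borel"
proof (rule borel_measurable_closed_relation)
  let ?R = "\<lambda>M B :: real^'n^'n. transpose B = B \<and> (\<forall>y. 0 \<le> y \<bullet> (B *v y)) \<and> B ** B = M"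
  have "{(B, M). ?R M B} = {z. transpose (fst z) = fst z} \<inter> (\<Inter>y. {z. 0 \<le> y \<bullet> (fst z *v y)}) \<inter> {z. fst z ** fst z = snd z}"
    by auto
  moreover have "closed \<dots>"
    unfolding transpose_def matrix_vector_mult_def matrix_matrix_mult_def
    by (intro closed_Int closed_INT ballI closed_Collect_le closed_Collect_eq continuous_intros)
  ultimately show "closed {(B, M). ?R M B}" by metis
  show "mat_sqrt M = B" if "?R M B" for M B using that by (intro mat_sqrt_eqI) auto
  show "mat_sqrt M = (THE B. False)" if "\<nexists>B. ?R M B" for M
    using that unfolding mat_sqrt_def by (intro arg_cong[where f = The]) blast
qed

lemma borel_measurable_matrix_inv: "(matrix_inv :: real^'n^'n \<Rightarrow> real^'n^'n) \<in> borel_measurable borel"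
proof (rule borel_measurable_closed_relation)
  let ?R = "\<lambda>M N :: real^'n^'n. M ** N = mat 1 \<and> N ** M = mat 1"
  have "{(N, M). ?R M N} = {z. snd z ** fst z = mat 1} \<inter> {z. fst z ** snd z = mat 1}"
    by auto
  moreover have "closed \<dots>"
    unfolding matrix_matrix_mult_def
    by (intro closed_Int closed_Collect_eq continuous_intros)
  ultimately show "closed {(N, M). ?R M N}" by metis
  show "matrix_inv M = N" if N: "?R M N" for M N
  proof -
    have "?R M (matrix_inv M)" unfolding matrix_inv_def by (rule someI_ex) (use N in blast)
    then have "matrix_inv M = matrix_inv M ** (M ** N)" using N by simp
    also have "\<dots> = N" using \<open>?R M (matrix_inv M)\<close> by (simp add: matrix_mul_assoc)
    finally show ?thesis .
  qed
  show "matrix_inv M = (SOME N. False)" if "\<nexists>N. ?R M N" for M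
    using that unfolding matrix_inv_def by (intro arg_cong[where f = Eps]) blast
qed

lemma borel_measurable_matrix_vector_mult:
  fixes M :: "'a \<Rightarrow> real^'n^'n"
  assumes "M \<in> borel_measurable N" "f \<in> borel_measurable N"
  shows "(\<lambda>z. M z *v f z) \<in> borel_measurable N"
proof (rule borel_measurable_continuous_Pair[OF assms])
  show "continuous_on UNIV (\<lambda>x :: (real^'n^'n) \<times> (real^'n). fst x *v snd x)"
    unfolding matrix_vector_mult_def by (intro continuous_intros)
qed

section \<open>Projection onto a convex set in a finite-dimensional inner product space\<close>

subsection \<open>Variational inequalities in finite dimensions\<close>

text \<open>The type of triples carries no norm, and the form is bilinear and definite only on the
  discrete space. Hence everything is phrased relative to a carrier \<open>P\<close> and the form
  \<open>a\<close> itself.\<close>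

locale finite_dim_form =
  fixes P :: "'v::real_vector set" and a :: "'v \<Rightarrow> 'v \<Rightarrow> real"
  assumes subspace: "subspace P"
    and finite_dim: "\<exists>B. finite B \<and> span B = P"
    and add: "x \<in> P \<Longrightarrow> y \<in> P \<Longrightarrow> z \<in> P \<Longrightarrow> a (x + y) z = a x z + a y z"
    and scale: "x \<in> P \<Longrightarrow> z \<in> P \<Longrightarrow> a (r *\<^sub>R x) z = r * a x z"
    and sym: "x \<in> P \<Longrightarrow> y \<in> P \<Longrightarrow> a x y = a y x"
    and pos: "x \<in> P \<Longrightarrow> x \<noteq> 0 \<Longrightarrow> 0 < a x x"
begin

lemma mem_add: "x \<in> P \<Longrightarrow> y \<in> P \<Longrightarrow> x + y \<in> P"
  and mem_scale: "x \<in> P \<Longrightarrow> r *\<^sub>R x \<in> P"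
  and mem_diff: "x \<in> P \<Longrightarrow> y \<in> P \<Longrightarrow> x - y \<in> P"
  and mem_zero: "0 \<in> P"
  using subspace by (auto intro: subspace_add subspace_scale subspace_diff subspace_0)

lemma mem_sum: "(\<And>i. i \<in> I \<Longrightarrow> x i \<in> P) \<Longrightarrow> (\<Sum>i\<in>I. x i) \<in> P"
  by (rule subspace_sum[OF subspace])

lemma add_right: "x \<in> P \<Longrightarrow> y \<in> P \<Longrightarrow> z \<in> P \<Longrightarrow> a z (x + y) = a z x + a z y"
  using add[of x y z] sym mem_add by metis

lemma scale_right: "x \<in> P \<Longrightarrow> z \<in> P \<Longrightarrow> a z (r *\<^sub>R x) = r * a z x"
  using scale[of x z r] sym mem_scale by metis

lemma diff: "x \<in> P \<Longrightarrow> y \<in> P \<Longrightarrow> z \<in> P \<Longrightarrow> a (x - y) z = a x z - a y z"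
  using add[of x "-1 *\<^sub>R y" z] scale[of y z "-1"] mem_scale[of y "-1"] by simp

lemma diff_right: "x \<in> P \<Longrightarrow> y \<in> P \<Longrightarrow> z \<in> P \<Longrightarrow> a z (x - y) = a z x - a z y"
  using diff[of x y z] sym mem_diff by metis

lemma zero: "z \<in> P \<Longrightarrow> a 0 z = 0"
  using scale[of 0 z 0] mem_zero by simp

lemma nonneg: "x \<in> P \<Longrightarrow> 0 \<le> a x x"
  using pos[of x] zero[of 0] mem_zero by (cases "x = 0") auto

lemma sum_left: "finite I \<Longrightarrow> (\<And>i. i \<in> I \<Longrightarrow> x i \<in> P) \<Longrightarrow> z \<in> P \<Longrightarrow> a (\<Sum>i\<in>I. x i) z = (\<Sum>i\<in>I. a (x i) z)"
  by (induction I rule: finite_induct) (auto simp: zero add mem_sum)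

text \<open>Gram-Schmidt over a finite spanning set. A vector whose component orthogonal to the
  previous ones vanishes is dropped, so no independent set has to be extracted beforehand.\<close>

lemma orthonormal_basis:
  obtains E where "finite E" "E \<subseteq> P" "span E = P" "\<And>x y. x \<in> E \<Longrightarrow> y \<in> E \<Longrightarrow> a x y = (if x = y then 1 else 0)"
proof -
  obtain B where B: "finite B" "span B = P" using finite_dim by blast
  have "B \<subseteq> P" using B(2) span_superset by blast
  with B(1) have "\<exists>E. finite E \<and> E \<subseteq> P \<and> span E = span B \<and> (\<forall>x\<in>E. \<forall>y\<in>E. a x y = (if x = y then 1 else 0))"
  proof (induction B rule: finite_induct)
    case empty
    show ?case by (intro exI[of _ "{}"]) simp
  next
    case (insert b B)
    have "\<exists>E. finite E \<and> E \<subseteq> P \<and> span E = span B \<and> (\<forall>x\<in>E. \<forall>y\<in>E. a x y = (if x = y then 1 else 0))"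
      by (rule insert.IH) (use insert.prems in simp)
    then obtain E where E': "finite E" "E \<subseteq> P" "span E = span B" "\<forall>x\<in>E. \<forall>y\<in>E. a x y = (if x = y then 1 else 0)"
      by (elim exE conjE)
    have E: "finite E" "E \<subseteq> P" "span E = span B" "\<And>x y. x \<in> E \<Longrightarrow> y \<in> E \<Longrightarrow> a x y = (if x = y then 1 else 0)"
      by (use E' in simp_all)
    have bP: "b \<in> P" using insert.prems by simp
    define p where "p = (\<Sum>e\<in>E. a b e *\<^sub>R e)"
    define r where "r = b - p"
    have pE: "p \<in> span E" unfolding p_def by (intro span_sum span_scale span_base)
    have pP: "p \<in> P" unfolding p_def using E(2) by (intro mem_sum mem_scale) auto
    have rP: "r \<in> P" unfolding r_def by (rule mem_diff[OF bP pP])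
    have orth: "a r e = 0" if e: "e \<in> E" for e
    proof -
      have "a p e = (\<Sum>x\<in>E. a b x * a x e)"
        unfolding p_def using E(1,2) e by (subst sum_left) (auto intro!: sum.cong mem_scale scale)
      also have "\<dots> = (\<Sum>x\<in>E. if x = e then a b e else 0)"
        using E(4) e by (intro sum.cong) auto
      also have "\<dots> = a b e" using E(1) e by simp
      finally show ?thesis
        unfolding r_def using diff[OF bP pP, of e] E(2) e by auto
    qed
    show ?case
    proof (cases "r = 0")
      case True
      then have "b \<in> span B" using pE E(3) by (simp add: r_def)
      then have "span (insert b B) = span B" by (rule span_redundant)
      then show ?thesis using E by (intro exI[of _ E]) auto
    next
      case False
      define e where "e = (1 / sqrt (a r r)) *\<^sub>R r"
      have ar: "a r r > 0" using pos[OF rP False] .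
      have eP: "e \<in> P" unfolding e_def by (rule mem_scale[OF rP])
      have ee: "a e e = 1"
      proof -
        have "a e e = (1 / sqrt (a r r)) * ((1 / sqrt (a r r)) * a r r)"
          unfolding e_def by (simp only: scale[OF rP mem_scale[OF rP]] scale_right[OF rP rP])
        then show ?thesis using ar by (simp add: field_simps)
      qed
      have eo: "a e x = 0" "a x e = 0" if "x \<in> E" for x
      proof -
        have xP: "x \<in> P" using that E(2) by auto
        show "a e x = 0" unfolding e_def by (simp add: scale[OF rP xP] orth[OF that])
        then show "a x e = 0" using sym[OF xP eP] by simp
      qed
      have "span (insert e E) = span (insert b B)"
      proof (rule span_eq[THEN iffD2], intro conjI)
        have bB: "b \<in> span (insert b B)" by (rule span_base) simp
        have pB: "p \<in> span (insert b B)"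
          using pE E(3) span_mono[of B "insert b B"] by auto
        have "e \<in> span (insert b B)"
          unfolding e_def r_def by (intro span_scale span_diff bB pB)
        moreover have "E \<subseteq> span (insert b B)"
          using E(3) span_superset[of E] span_mono[of B "insert b B"] by auto
        ultimately show "insert e E \<subseteq> span (insert b B)" by simp
        have eE: "e \<in> span (insert e E)" by (rule span_base) simp
        have pE': "p \<in> span (insert e E)" using pE span_mono[of E "insert e E"] by auto
        have "b = sqrt (a r r) *\<^sub>R e + p" using ar by (simp add: e_def r_def)
        then have "b \<in> span (insert e E)" by (metis span_add span_scale eE pE')
        moreover have "B \<subseteq> span (insert e E)"
          using E(3) span_superset[of B] span_mono[of E "insert e E"] by auto
        ultimately show "insert b B \<subseteq> span (insert e E)" by simp
      qed
      moreover have "e \<notin> E" using ee eo(1)[of e] by auto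
      ultimately show ?thesis
        using E(1,2,4) eP ee eo by (intro exI[of _ "insert e E"]) auto
    qed
  qed
  then show ?thesis using that B(2) by blast
qed

lemma Cauchy_schwarz:
  assumes "x \<in> P" "y \<in> P"
  shows "\<bar>a x y\<bar> \<le> sqrt (a x x) * sqrt (a y y)"
proof (cases "y = 0")
  case True
  then show ?thesis using zero[of x] sym[of x 0] assms mem_zero by (simp add: zero)
next
  case False
  have ay: "a y y > 0" by (rule pos[OF assms(2) False])
  let ?t = "a x y / a y y"
  have m: "?t *\<^sub>R y \<in> P" "x - ?t *\<^sub>R y \<in> P" using assms by (auto intro: mem_scale mem_diff)
  have "0 \<le> a (x - ?t *\<^sub>R y) (x - ?t *\<^sub>R y)" by (rule nonneg[OF m(2)])
  also have "\<dots> = a x x - 2 * ?t * a x y + ?t * ?t * a y y"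
    using assms m by (simp add: diff diff_right scale scale_right sym[of y x])
  also have "\<dots> = a x x - (a x y)\<^sup>2 / a y y"
    using ay by (simp add: power2_eq_square field_simps)
  finally have "(a x y)\<^sup>2 \<le> a x x * a y y" using ay by (simp add: field_simps)
  then have "sqrt ((a x y)\<^sup>2) \<le> sqrt (a x x * a y y)" by (rule real_sqrt_le_mono)
  then show ?thesis by (simp add: real_sqrt_mult)
qed

text \<open>Cauchy sequences converge coordinatewise in an orthonormal basis, hence in every
  seminorm on \<open>P\<close> at once. The conclusion quantifies over \<open>N\<close> because
  closedness of the convex set is expressed in another norm than that of \<open>a\<close>.\<close>

lemma complete:
  assumes s: "\<And>n::nat. s n \<in> P" and C: "\<And>\<epsilon>. \<epsilon> > 0 \<Longrightarrow> \<exists>N. \<forall>m\<ge>N. \<forall>n\<ge>N. a (s m - s n) (s m - s n) < \<epsilon>"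
  obtains u where "u \<in> P" "(\<lambda>n. a (s n - u) (s n - u)) \<longlonglongrightarrow> 0"
    "\<And>N. (\<And>x. x \<in> P \<Longrightarrow> 0 \<le> N x) \<Longrightarrow> (\<And>x y. x \<in> P \<Longrightarrow> y \<in> P \<Longrightarrow> N (x + y) \<le> N x + N y) \<Longrightarrow>
      (\<And>x r. x \<in> P \<Longrightarrow> N (r *\<^sub>R x) = \<bar>r\<bar> * N x) \<Longrightarrow> (\<lambda>n. N (s n - u)) \<longlonglongrightarrow> (0::real)"
proof -
  obtain E where E: "finite E" "E \<subseteq> P" "span E = P" "\<And>x y. x \<in> E \<Longrightarrow> y \<in> E \<Longrightarrow> a x y = (if x = y then 1 else 0)"
    using orthonormal_basis by blast
  have coord: "a (\<Sum>e\<in>E. c e *\<^sub>R e) x = c x" if "x \<in> E" for c x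
  proof -
    have "a (\<Sum>e\<in>E. c e *\<^sub>R e) x = (\<Sum>e\<in>E. c e * a e x)"
      using E(1,2) that by (subst sum_left) (auto intro!: sum.cong mem_scale scale)
    also have "\<dots> = (\<Sum>e\<in>E. if e = x then c x else 0)"
      using E(4) that by (intro sum.cong) auto
    finally show ?thesis using E(1) that by simp
  qed
  have rep: "x = (\<Sum>e\<in>E. a x e *\<^sub>R e)" if "x \<in> P" for x
  proof -
    have "x \<in> span E" using that E(3) by simp
    then obtain c where c: "x = (\<Sum>e\<in>E. c e *\<^sub>R e)"
      using span_finite[OF E(1)] by auto
    have "(\<Sum>e\<in>E. c e *\<^sub>R e) = (\<Sum>e\<in>E. a x e *\<^sub>R e)"
      by (intro sum.cong refl) (simp add: c coord)
    then show ?thesis using c by simp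
  qed
  have aee: "a x x = (\<Sum>e\<in>E. (a x e)\<^sup>2)" if "x \<in> P" for x
  proof -
    have "a x x = a (\<Sum>e\<in>E. a x e *\<^sub>R e) x" using rep[OF that] by simp
    also have "\<dots> = (\<Sum>e\<in>E. a x e * a e x)"
      using E(1,2) that by (subst sum_left) (auto intro!: sum.cong mem_scale scale)
    also have "\<dots> = (\<Sum>e\<in>E. (a x e)\<^sup>2)"
      using E(2) that by (intro sum.cong refl) (simp add: power2_eq_square sym subset_iff)
    finally show ?thesis .
  qed
  have "convergent (\<lambda>n. a (s n) e)" if e: "e \<in> E" for e
  proof -
    have eP: "e \<in> P" using e E(2) by auto
    have "Cauchy (\<lambda>n. a (s n) e)"
      unfolding Cauchy_def dist_real_def
    proof (intro allI impI)
      fix \<epsilon> :: real assume "\<epsilon> > 0"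
      then obtain N where N: "\<forall>m\<ge>N. \<forall>n\<ge>N. a (s m - s n) (s m - s n) < \<epsilon>\<^sup>2" using C[of "\<epsilon>\<^sup>2"] by auto
      have "\<bar>a (s m) e - a (s n) e\<bar> < \<epsilon>" if "m \<ge> N" "n \<ge> N" for m n
      proof -
        have mP: "s m - s n \<in> P" by (intro mem_diff s)
        have "(a (s m - s n) e)\<^sup>2 \<le> a (s m - s n) (s m - s n)"
          unfolding aee[OF mP] using E(1) e by (intro member_le_sum) auto
        also have "\<dots> < \<epsilon>\<^sup>2" using N that by blast
        finally have "\<bar>a (s m - s n) e\<bar> < \<epsilon>"
          using \<open>\<epsilon> > 0\<close> power2_less_imp_less[of "\<bar>a (s m - s n) e\<bar>" \<epsilon>] by simp
        then show ?thesis using diff[OF s s eP] by simp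
      qed
      then show "\<exists>M. \<forall>m\<ge>M. \<forall>n\<ge>M. \<bar>a (s m) e - a (s n) e\<bar> < \<epsilon>" by blast
    qed
    then show ?thesis by (simp add: Cauchy_convergent_iff)
  qed
  then obtain c where c: "\<And>e. e \<in> E \<Longrightarrow> (\<lambda>n. a (s n) e) \<longlonglongrightarrow> c e"
    unfolding convergent_def by metis
  define u where "u = (\<Sum>e\<in>E. c e *\<^sub>R e)"
  have uP: "u \<in> P" unfolding u_def using E(2) by (intro mem_sum mem_scale) auto
  have dc: "(\<lambda>n. a (s n - u) e) \<longlonglongrightarrow> 0" if e: "e \<in> E" for e
  proof -
    have eP: "e \<in> P" using e E(2) by auto
    have "a (s n - u) e = a (s n) e - c e" for n
      using diff[OF s uP eP] coord[OF e, of c] by (simp add: u_def)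
    then show ?thesis using c[OF e] by (simp add: LIM_zero)
  qed
  show ?thesis
  proof (rule that[OF uP])
    have "(\<lambda>n. \<Sum>e\<in>E. (a (s n - u) e)\<^sup>2) \<longlonglongrightarrow> (\<Sum>e\<in>E. 0\<^sup>2)"
      by (intro tendsto_sum tendsto_power dc)
    then show "(\<lambda>n. a (s n - u) (s n - u)) \<longlonglongrightarrow> 0"
      by (simp add: aee[OF mem_diff[OF s uP]])
    fix N :: "'v \<Rightarrow> real"
    assume N: "\<And>x. x \<in> P \<Longrightarrow> 0 \<le> N x" "\<And>x y. x \<in> P \<Longrightarrow> y \<in> P \<Longrightarrow> N (x + y) \<le> N x + N y"
      "\<And>x r. x \<in> P \<Longrightarrow> N (r *\<^sub>R x) = \<bar>r\<bar> * N x"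
    have N0: "N 0 = 0" using N(3)[OF mem_zero, of 0] by simp
    have Ns: "N (\<Sum>e\<in>F. d e *\<^sub>R e) \<le> (\<Sum>e\<in>F. \<bar>d e\<bar> * N e)" if "finite F" "F \<subseteq> P" for F d
      using that
    proof (induction F rule: finite_induct)
      case (insert x F)
      have "N (d x *\<^sub>R x + (\<Sum>e\<in>F. d e *\<^sub>R e)) \<le> N (d x *\<^sub>R x) + N (\<Sum>e\<in>F. d e *\<^sub>R e)"
        using insert.prems by (intro N(2) mem_scale mem_sum) auto
      then show ?case using insert N(3)[of x "d x"] by simp
    qed (simp add: N0)
    show "(\<lambda>n. N (s n - u)) \<longlonglongrightarrow> 0"
    proof (rule tendsto_sandwich[OF _ _ tendsto_const])
      show "\<forall>\<^sub>F n in sequentially. 0 \<le> N (s n - u)"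
        by (intro always_eventually allI N(1) mem_diff s uP)
      show "\<forall>\<^sub>F n in sequentially. N (s n - u) \<le> (\<Sum>e\<in>E. \<bar>a (s n - u) e\<bar> * N e)"
      proof (intro always_eventually allI)
        fix n
        show "N (s n - u) \<le> (\<Sum>e\<in>E. \<bar>a (s n - u) e\<bar> * N e)"
          using Ns[OF E(1,2), of "\<lambda>e. a (s n - u) e"] rep[OF mem_diff[OF s uP], of n] by simp
      qed
      have "(\<lambda>n. \<Sum>e\<in>E. \<bar>a (s n - u) e\<bar> * N e) \<longlonglongrightarrow> (\<Sum>e\<in>E. \<bar>0\<bar> * N e)"
        by (intro tendsto_sum tendsto_mult tendsto_const tendsto_rabs dc)
      then show "(\<lambda>n. \<Sum>e\<in>E. \<bar>a (s n - u) e\<bar> * N e) \<longlonglongrightarrow> 0" by simp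
    qed
  qed
qed

text \<open>The representer has the values of \<open>F\<close> on an orthonormal basis as its
  coordinates.\<close>

lemma Riesz:
  assumes add: "\<And>x y. x \<in> P \<Longrightarrow> y \<in> P \<Longrightarrow> F (x + y) = F x + F y" and scale: "\<And>x r. x \<in> P \<Longrightarrow> F (r *\<^sub>R x) = r * F x"
  obtains \<rho> where "\<rho> \<in> P" "\<And>x. x \<in> P \<Longrightarrow> F x = a \<rho> x"
proof -
  obtain E where E: "finite E" "E \<subseteq> P" "span E = P" "\<And>x y. x \<in> E \<Longrightarrow> y \<in> E \<Longrightarrow> a x y = (if x = y then 1 else 0)"
    using orthonormal_basis by blast
  define \<rho> where "\<rho> = (\<Sum>e\<in>E. F e *\<^sub>R e)"
  have \<rho>P: "\<rho> \<in> P" unfolding \<rho>_def using E(2) by (intro mem_sum mem_scale) auto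
  have F0: "F 0 = 0" using scale[OF mem_zero, of 0] by simp
  have base: "F e = a \<rho> e" if "e \<in> E" for e
  proof -
    have "a \<rho> e = (\<Sum>x\<in>E. F x * a x e)"
      unfolding \<rho>_def using E(1,2) that by (subst sum_left) (auto intro!: sum.cong mem_scale finite_dim_form.scale[OF finite_dim_form_axioms])
    also have "\<dots> = (\<Sum>x\<in>E. if x = e then F e else 0)"
      using E(4) that by (intro sum.cong) auto
    finally show ?thesis using E(1) that by simp
  qed
  show ?thesis
  proof (rule that[OF \<rho>P])
    fix x assume "x \<in> P"
    then have "x \<in> span E" using E(3) by simp
    then have "x \<in> P \<and> F x = a \<rho> x"
    proof (induction rule: span_induct_alt)
      case base
      show ?case using F0 zero[OF \<rho>P] sym[OF \<rho>P mem_zero] mem_zero by simp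
    next
      case (step c x y)
      have xP: "x \<in> P" using step E(2) by auto
      then show ?case
        using step mem_scale[OF xP, of c] add[of "c *\<^sub>R x" y] scale[of x c] base[of x] add_right[of "c *\<^sub>R x" y \<rho>] scale_right[of x \<rho> c] \<rho>P
        by (auto intro: mem_add mem_scale)
    qed
    then show "F x = a \<rho> x" by simp
  qed
qed

text \<open>By the Riesz representation the inequality characterises the \<open>a\<close>-projection of the
  representer onto \<open>K\<close>; a minimising sequence is Cauchy by the parallelogram law.\<close>

theorem variational_inequality:
  assumes K: "K \<subseteq> P" "K \<noteq> {}" "convex K"
    and N: "\<And>x. x \<in> P \<Longrightarrow> 0 \<le> N x" "\<And>x y. x \<in> P \<Longrightarrow> y \<in> P \<Longrightarrow> N (x + y) \<le> N x + N y"
      "\<And>x r. x \<in> P \<Longrightarrow> N (r *\<^sub>R x) = \<bar>r\<bar> * N x"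
    and closed: "\<And>s u. (\<And>n::nat. s n \<in> K) \<Longrightarrow> u \<in> P \<Longrightarrow> (\<lambda>n. N (s n - u)) \<longlonglongrightarrow> (0::real) \<Longrightarrow> u \<in> K"
    and F: "\<And>x y. x \<in> P \<Longrightarrow> y \<in> P \<Longrightarrow> F (x + y) = F x + F y" "\<And>x r. x \<in> P \<Longrightarrow> F (r *\<^sub>R x) = r * F x"
  shows "\<exists>!u. u \<in> K \<and> (\<forall>v\<in>K. F (v - u) \<le> a u (v - u))"
proof -
  obtain \<rho> where \<rho>: "\<rho> \<in> P" "\<And>x. x \<in> P \<Longrightarrow> F x = a \<rho> x" using Riesz[of F] F by blast
  have KP: "x \<in> P" if "x \<in> K" for x using that K(1) by auto
  let ?J = "\<lambda>x. a (x - \<rho>) (x - \<rho>)"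
  have J0: "0 \<le> ?J x" if "x \<in> K" for x by (rule nonneg[OF mem_diff[OF KP[OF that] \<rho>(1)]])
  define m where "m = Inf (?J ` K)"
  have bdd: "bdd_below (?J ` K)" using J0 by (intro bdd_belowI2[of _ 0]) auto
  have mle: "m \<le> ?J x" if "x \<in> K" for x unfolding m_def using bdd that by (intro cInf_lower) auto
  have "\<exists>x\<in>K. ?J x < m + inverse (real (Suc n))" for n
  proof -
    have "Inf (?J ` K) < m + inverse (real (Suc n))" unfolding m_def by simp
    then show ?thesis using cInf_less_iff[of "?J ` K"] K(2) bdd by auto
  qed
  then obtain s where s: "\<And>n. s n \<in> K" "\<And>n. ?J (s n) < m + inverse (real (Suc n))" by metis
  \<comment> \<open>The parallelogram law about \<rho>, together with \<open>m \<le> ?J\<close> at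
    the midpoint, which convexity keeps in \<open>K\<close>.\<close>
  have par: "a (x - y) (x - y) \<le> 2 * ?J x + 2 * ?J y - 4 * m" if xy: "x \<in> K" "y \<in> K" for x y
  proof -
    have "(1/2) *\<^sub>R x + (1/2) *\<^sub>R y \<in> K" using K(3) xy by (auto intro: convexD)
    then have "m \<le> ?J ((1/2) *\<^sub>R x + (1/2) *\<^sub>R y)" by (rule mle)
    moreover have "(1/2) *\<^sub>R x + (1/2) *\<^sub>R y - \<rho> = (1/2) *\<^sub>R ((x - \<rho>) + (y - \<rho>))"
    proof -
      have "\<rho> = (1/2) *\<^sub>R \<rho> + (1/2) *\<^sub>R \<rho>" by (simp flip: scaleR_add_left)
      then show ?thesis by (simp add: algebra_simps)
    qed
    ultimately have m4: "m \<le> a ((1/2) *\<^sub>R ((x - \<rho>) + (y - \<rho>))) ((1/2) *\<^sub>R ((x - \<rho>) + (y - \<rho>)))" by simp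
    define X Y where "X = x - \<rho>" and "Y = y - \<rho>"
    have XY: "X \<in> P" "Y \<in> P" using KP xy \<rho>(1) by (auto simp: X_def Y_def intro: mem_diff)
    have "4 * m \<le> a (X + Y) (X + Y)"
      using m4 XY unfolding X_def[symmetric] Y_def[symmetric]
      by (simp add: scale[OF mem_add[OF XY] mem_scale[OF mem_add[OF XY]]] scale_right[OF mem_add[OF XY] mem_add[OF XY]])
    moreover have "a (X + Y) (X + Y) = a X X + 2 * a X Y + a Y Y"
      using XY by (simp add: add add_right mem_add sym[of Y X])
    moreover have "a (X - Y) (X - Y) = a X X - 2 * a X Y + a Y Y"
      using XY by (simp add: diff diff_right mem_diff sym[of Y X])
    moreover have "x - y = X - Y" by (simp add: X_def Y_def)
    ultimately show ?thesis by (simp add: X_def[symmetric] Y_def[symmetric])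
  qed
  have C: "\<exists>N. \<forall>k\<ge>N. \<forall>n\<ge>N. a (s k - s n) (s k - s n) < \<epsilon>" if \<epsilon>: "\<epsilon> > 0" for \<epsilon>
  proof -
    obtain N where N: "inverse (real (Suc N)) < \<epsilon> / 4" using reals_Archimedean[of "\<epsilon> / 4"] \<epsilon> by auto
    have "a (s k - s n) (s k - s n) < \<epsilon>" if "k \<ge> N" "n \<ge> N" for k n
    proof -
      have "inverse (real (Suc k)) \<le> inverse (real (Suc N))" "inverse (real (Suc n)) \<le> inverse (real (Suc N))"
        using that by (auto intro: le_imp_inverse_le)
      then show ?thesis using par[OF s(1) s(1), of k n] s(2)[of k] s(2)[of n] N by linarith
    qed
    then show ?thesis by blast
  qed
  have "\<exists>u\<in>P. (\<lambda>n. a (s n - u) (s n - u)) \<longlonglongrightarrow> 0 \<and> (\<lambda>n. N (s n - u)) \<longlonglongrightarrow> 0"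
  proof (rule complete[of s, OF KP[OF s(1)] C])
    fix u assume u: "u \<in> P" "(\<lambda>n. a (s n - u) (s n - u)) \<longlonglongrightarrow> 0"
      and H: "\<And>N. (\<And>x. x \<in> P \<Longrightarrow> 0 \<le> N x) \<Longrightarrow> (\<And>x y. x \<in> P \<Longrightarrow> y \<in> P \<Longrightarrow> N (x + y) \<le> N x + N y) \<Longrightarrow>
      (\<And>x r. x \<in> P \<Longrightarrow> N (r *\<^sub>R x) = \<bar>r\<bar> * N x) \<Longrightarrow> (\<lambda>n. N (s n - u)) \<longlonglongrightarrow> (0::real)"
    have "(\<lambda>n. N (s n - u)) \<longlonglongrightarrow> 0" by (rule H[OF N])
    then show ?thesis using u by blast
  qed
  then obtain u where u: "u \<in> P" "(\<lambda>n. a (s n - u) (s n - u)) \<longlonglongrightarrow> 0" "(\<lambda>n. N (s n - u)) \<longlonglongrightarrow> 0"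
    by blast
  have uK: "u \<in> K" by (rule closed[OF s(1) u(1,3)])
  have Ju: "?J u \<le> m"
  proof -
    \<comment> \<open>The triangle inequality for the norm of \<open>a\<close>; it lets the limit of
      the minimising sequence inherit the value m.\<close>
    have 1: "sqrt (?J u) \<le> sqrt (?J (s n)) + sqrt (a (s n - u) (s n - u))" for n
    proof (rule power2_le_imp_le)
      define X Y where "X = s n - \<rho>" and "Y = s n - u"
      have XY: "X \<in> P" "Y \<in> P" using KP[OF s(1)] \<rho>(1) u(1) by (auto simp: X_def Y_def intro: mem_diff)
      have "u - \<rho> = X - Y" by (simp add: X_def Y_def)
      then have "?J u = a X X - 2 * a X Y + a Y Y"
        using XY by (simp add: diff diff_right mem_diff sym[of Y X])
      also have "\<dots> \<le> a X X + 2 * (sqrt (a X X) * sqrt (a Y Y)) + a Y Y"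
        using Cauchy_schwarz[OF XY] by linarith
      also have "\<dots> = (sqrt (a X X) + sqrt (a Y Y))\<^sup>2"
        using nonneg[OF XY(1)] nonneg[OF XY(2)] by (simp add: power2_sum)
      finally show "(sqrt (?J u))\<^sup>2 \<le> (sqrt (?J (s n)) + sqrt (a (s n - u) (s n - u)))\<^sup>2"
        using J0[OF uK] by (simp add: X_def Y_def)
    qed (use J0[OF s(1)] nonneg[OF mem_diff[OF KP[OF s(1)] u(1)]] in simp)
    have 2: "(\<lambda>n. sqrt (m + inverse (real (Suc n))) + sqrt (a (s n - u) (s n - u))) \<longlonglongrightarrow> sqrt (m + 0) + sqrt 0"
      by (intro tendsto_intros u(2) LIMSEQ_inverse_real_of_nat)
    have "sqrt (?J u) \<le> sqrt (m + inverse (real (Suc n))) + sqrt (a (s n - u) (s n - u))" for n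
    proof -
      have "sqrt (?J (s n)) \<le> sqrt (m + inverse (real (Suc n)))"
        using s(2)[of n] by (intro real_sqrt_le_mono) simp
      then show ?thesis using 1[of n] by linarith
    qed
    then have "sqrt (?J u) \<le> sqrt (m + 0) + sqrt 0"
      by (intro LIMSEQ_le_const[OF 2]) blast
    then show ?thesis by simp
  qed
  have ui: "F (v - u) \<le> a u (v - u)" if v: "v \<in> K" for v
  proof -
    let ?d = "v - u"
    have dP: "?d \<in> P" by (rule mem_diff[OF KP[OF v] u(1)])
    have uP: "u - \<rho> \<in> P" by (rule mem_diff[OF u(1) \<rho>(1)])
    \<comment> \<open>Minimality along the segment from u to v, divided by t; the first-order term
      survives as t tends to zero.\<close>
    have q: "0 \<le> 2 * a (u - \<rho>) ?d + t * a ?d ?d" if t: "0 < t" "t \<le> 1" for t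
    proof -
      have "(1 - t) *\<^sub>R u + t *\<^sub>R v \<in> K" using K(3) uK v t by (auto intro: convexD)
      then have "?J u \<le> ?J ((1 - t) *\<^sub>R u + t *\<^sub>R v)" using Ju mle by fastforce
      moreover have "(1 - t) *\<^sub>R u + t *\<^sub>R v - \<rho> = (u - \<rho>) + t *\<^sub>R ?d"
        by (simp add: algebra_simps)
      ultimately have "?J u \<le> a ((u - \<rho>) + t *\<^sub>R ?d) ((u - \<rho>) + t *\<^sub>R ?d)" by simp
      also have "\<dots> = ?J u + 2 * t * a (u - \<rho>) ?d + t * t * a ?d ?d"
      proof -
        define X Y where "X = u - \<rho>" and "Y = t *\<^sub>R ?d"
        have XY: "X \<in> P" "Y \<in> P" using uP mem_scale[OF dP] by (auto simp: X_def Y_def)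
        have "a (X + Y) (X + Y) = a X X + 2 * a X Y + a Y Y"
          using XY by (simp add: add add_right mem_add sym[of Y X])
        moreover have "a X Y = t * a X ?d" "a Y Y = t * (t * a ?d ?d)"
          unfolding Y_def using XY(1) dP by (simp_all only: scale[OF dP mem_scale[OF dP]] scale_right[OF dP dP] scale_right[OF dP XY(1)])
        ultimately show ?thesis unfolding X_def[symmetric] Y_def[symmetric] by simp
      qed
      finally have "0 \<le> t * (2 * a (u - \<rho>) ?d + t * a ?d ?d)" by (simp add: algebra_simps)
      then show ?thesis using t(1) by (simp add: zero_le_mult_iff)
    qed
    have "0 \<le> 2 * a (u - \<rho>) ?d"
    proof (rule field_le_epsilon)
      fix e :: real assume e: "0 < e"
      \<comment> \<open>At most 1 to stay on the segment, and small enough that t times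
        \<open>a ?d ?d\<close> is at most e.\<close>
      define t where "t = min 1 (e / (a ?d ?d + 1))"
      have ad: "0 \<le> a ?d ?d" by (rule nonneg[OF dP])
      have t: "0 < t" "t \<le> 1" using e ad by (auto simp: t_def)
      have "t * a ?d ?d \<le> (e / (a ?d ?d + 1)) * a ?d ?d" using ad by (intro mult_right_mono) (auto simp: t_def)
      also have "\<dots> \<le> e" using e ad by (simp add: field_simps)
      finally show "0 \<le> 2 * a (u - \<rho>) ?d + e" using q[OF t] by linarith
    qed
    then have "a \<rho> ?d \<le> a u ?d" using diff[OF u(1) \<rho>(1) dP] by simp
    then show ?thesis using \<rho>(2)[OF dP] by simp
  qed
  show ?thesis
  proof (rule ex1I[of _ u], intro conjI uK ballI ui)
    \<comment> \<open>Each of two solutions is tested with the other one; adding the inequalities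
      gives a (w - u) (w - u) \<le> 0.\<close>
    fix w assume w: "w \<in> K \<and> (\<forall>v\<in>K. F (v - w) \<le> a w (v - w))"
    have wP: "w \<in> P" using w KP by blast
    have d: "w - u \<in> P" by (rule mem_diff[OF wP u(1)])
    have "F (u - w) \<le> a w (u - w)" using w uK by blast
    moreover have "u - w = (-1) *\<^sub>R (w - u)" by simp
    ultimately have "(-1) * F (w - u) \<le> (-1) * a w (w - u)"
      by (simp only: F(2)[OF d] scale_right[OF d wP])
    moreover have "F (w - u) \<le> a u (w - u)" using ui w by blast
    ultimately have "a (w - u) (w - u) \<le> 0"
      using diff[OF wP u(1) d] by simp
    then show "w = u" using pos[OF d] by force
  qed
qed

end

section \<open>The least-squares form on triples and the discrete problem\<close>

subsection \<open>The space of triples\<close>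

text \<open>\<open>U_data T \<Omega> v \<tau> m w\<close> says that \<open>(v, \<tau>, m)\<close> with \<open>m\<close> in \<open>L\<^sup>2(Q)\<close> is an element of \<open>U\<close> and
  that \<open>w = div\<^sub>t\<^sub>,\<^sub>x(v, \<tau>) - m\<close>.\<close>

definition U_data ::
  "real \<Rightarrow> (real^'n) set \<Rightarrow> ('n st, real) L2 \<Rightarrow> ('n st, real^'n) L2 \<Rightarrow> ('n st, real) L2 \<Rightarrow> ('n st, real) L2 \<Rightarrow> bool"
  where "U_data T \<Omega> v \<tau> m w \<longleftrightarrow> v \<in> V_space T \<Omega> \<and> \<tau> \<in> L2_on (Qcyl T \<Omega>) \<and>
    m \<in> L2_on (Qcyl T \<Omega>) \<and> w \<in> L2_on (Qcyl T \<Omega>) \<and> weak_eq {0<..<T} \<Omega> v \<tau> (w + m)"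

lemma weak_eq_add: "weak_eq I \<Omega> u \<sigma> f \<Longrightarrow> weak_eq I \<Omega> v \<tau> g \<Longrightarrow> weak_eq I \<Omega> (u + v) (\<sigma> + \<tau>) (f + g)"
  by (force simp: weak_eq_def inner_add_left)

lemma weak_eq_scaleR: "weak_eq I \<Omega> u \<sigma> f \<Longrightarrow> weak_eq I \<Omega> (r *\<^sub>R u) (r *\<^sub>R \<sigma>) (r *\<^sub>R f)"
  by (simp add: weak_eq_def flip: distrib_left)

text \<open>Includes the endpoints, which is what makes the initial and final traces independent of
  the choice in \<open>time_trace\<close> and therefore linear.\<close>

lemma continuous_on_AE_eq:
  fixes w w' :: "real \<Rightarrow> 'a::real_normed_vector"
  assumes w: "continuous_on {0..T} w" "continuous_on {0..T} w'"
    and eq: "AE t in lborel. t \<in> {0<..<T} \<longrightarrow> w t = w' t" and t: "t \<in> {0..T}" and T: "0 < T"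
  shows "w t = w' t"
proof (rule ccontr)
  assume ne: "w t \<noteq> w' t"
  have c: "continuous_on {0..T} (\<lambda>t. norm (w t - w' t))" by (intro continuous_intros w)
  have p: "norm (w t - w' t) > 0" using ne by simp
  obtain d where d: "d > 0" "\<And>s. s \<in> {0..T} \<Longrightarrow> dist s t < d \<Longrightarrow> dist (norm (w s - w' s)) (norm (w t - w' t)) < norm (w t - w' t)"
    using continuous_on_iff[THEN iffD1, OF c, rule_format, OF t p] by blast
  have "max 0 (t - d) < min T (t + d)" using t d(1) T by auto
  then obtain s where s: "max 0 (t - d) < s" "s < min T (t + d)" "s \<in> {0<..<T} \<longrightarrow> w s = w' s"
    using AE_interval_ex[OF eq] by blast
  then have "w s = w' s" "s \<in> {0..T}" "dist s t < d" by (auto simp: dist_real_def)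
  then show False using d(2)[of s] by (simp add: dist_real_def)
qed

text \<open>Flux and function determine the source; this underlies both the description operator in
  \<open>div_minus\<close> and the recovery of the density of \<lambda>.\<close>

lemma weak_eq_unique:
  fixes \<Omega> :: "(real^'n) set"
  assumes \<Omega>: "open \<Omega>" and f: "f \<in> L2_on (Qcyl T \<Omega>)" "f' \<in> L2_on (Qcyl T \<Omega>)"
    and W: "weak_eq {0<..<T} \<Omega> u \<sigma> f" "weak_eq {0<..<T} \<Omega> u \<sigma> f'"
  shows "f = f'"
proof -
  have "f - f' = 0"
  proof (rule fundamental_lemma_L2[OF open_Qcyl[OF \<Omega>]])
    show "f - f' \<in> L2_on (Qcyl T \<Omega>)" by (rule subspace_diff[OF subspace_L2_on[OF sets_Qcyl[OF \<Omega>]] f])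
    show "(f - f') \<bullet> abs_L2 \<phi> = 0" if "\<phi> \<in> test_functions (Qcyl T \<Omega>)" for \<phi>
    proof -
      have "u \<bullet> abs_L2 (dt \<phi>) + \<sigma> \<bullet> abs_L2 (dx \<phi>) + f \<bullet> abs_L2 \<phi> = 0" "u \<bullet> abs_L2 (dt \<phi>) + \<sigma> \<bullet> abs_L2 (dx \<phi>) + f' \<bullet> abs_L2 \<phi> = 0"
        using W that unfolding weak_eq_def Qcyl_def by blast+
      then show ?thesis by (simp add: inner_diff_left)
    qed
  qed
  then show ?thesis by simp
qed

context
  fixes \<Omega> :: "(real^'n) set" and T :: real
  assumes \<Omega>: "open \<Omega>" and T: "0 < T"
begin

lemma L2_embed_test: "\<phi> \<in> test_functions (Qcyl T \<Omega>) \<Longrightarrow> L2_embed T \<Omega> m (L2_of (Qcyl T \<Omega>) \<phi>) = m \<bullet> abs_L2 \<phi>"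
  using H10_valued_test[of \<phi> "{0<..<T}" \<Omega>] V_space_iff[OF \<Omega>]
  by (auto simp: L2_of_test_function L2_embed_def Qcyl_def)

text \<open>Test functions on the cylinder belong to V, so a density is determined by the functional
  that it represents, and \<open>L2_density\<close> recovers it.\<close>

lemma L2_embed_inj:
  assumes m: "m \<in> L2_on (Qcyl T \<Omega>)" "m' \<in> L2_on (Qcyl T \<Omega>)" and eq: "L2_embed T \<Omega> m = L2_embed T \<Omega> m'"
  shows "m = m'"
proof -
  have "m - m' = 0"
  proof (rule fundamental_lemma_L2[OF open_Qcyl[OF \<Omega>]])
    show "m - m' \<in> L2_on (Qcyl T \<Omega>)" by (rule subspace_diff[OF subspace_L2_on[OF sets_Qcyl[OF \<Omega>]] m])
    show "(m - m') \<bullet> abs_L2 \<phi> = 0" if "\<phi> \<in> test_functions (Qcyl T \<Omega>)" for \<phi>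
      using fun_cong[OF eq, of "L2_of (Qcyl T \<Omega>) \<phi>"] by (simp add: L2_embed_test[OF that] inner_diff_left)
  qed
  then show ?thesis by simp
qed

lemma L2_density_embed: "m \<in> L2_on (Qcyl T \<Omega>) \<Longrightarrow> L2_density T \<Omega> (L2_embed T \<Omega> m) = m"
  unfolding L2_density_def by (rule the_equality) (auto intro: L2_embed_inj)

lemma L2_embed_add: "L2_embed T \<Omega> (m + m') = L2_embed T \<Omega> m + L2_embed T \<Omega> m'"
  by (rule ext) (simp add: L2_embed_def inner_add_left)

lemma L2_embed_scaleR: "L2_embed T \<Omega> (r *\<^sub>R m) = r *\<^sub>R L2_embed T \<Omega> m"
  by (rule ext) (simp add: L2_embed_def scaleR_fun_def)

text \<open>Moves the functional to the right-hand side: its density joins the source, and the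
  triple satisfies an evolution equation with data in L2.\<close>

lemma is_div_minus_iff:
  "is_div_minus T \<Omega> (v, \<tau>, L2_embed T \<Omega> m) w \<longleftrightarrow> w \<in> L2_on (Qcyl T \<Omega>) \<and> weak_eq {0<..<T} \<Omega> v \<tau> (w + m)"
proof -
  have "div_tx v \<tau> \<phi> - L2_embed T \<Omega> m (L2_of (Qcyl T \<Omega>) \<phi>) = (LINT z|lborel. rep_L2 w z * \<phi> z) \<longleftrightarrow>
    v \<bullet> abs_L2 (dt \<phi>) + \<tau> \<bullet> abs_L2 (dx \<phi>) + (w + m) \<bullet> abs_L2 \<phi> = 0" if \<phi>: "\<phi> \<in> test_functions (Qcyl T \<Omega>)" for \<phi>
  proof -
    note sq = test_functions_square_integrable[OF \<phi>] dt_square_integrable[OF \<phi>] dx_square_integrable[OF \<phi>]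
    have "w \<bullet> abs_L2 \<phi> = (LINT z|lborel. rep_L2 w z * \<phi> z)"
      using inner_abs_L2[OF square_integrable_rep sq(1), of w] by simp
    moreover have "(LINT z|lborel. rep_L2 v z * dt \<phi> z + rep_L2 \<tau> z \<bullet> dx \<phi> z) = v \<bullet> abs_L2 (dt \<phi>) + \<tau> \<bullet> abs_L2 (dx \<phi>)"
      using inner_abs_L2[OF square_integrable_rep sq(2), of v] inner_abs_L2[OF square_integrable_rep sq(3), of \<tau>]
        Bochner_Integration.integral_add[OF square_integrable_inner[OF square_integrable_rep sq(2), of v] square_integrable_inner[OF square_integrable_rep sq(3), of \<tau>]]
      by simp
    ultimately show ?thesis
      unfolding div_tx_def L2_embed_test[OF \<phi>] by (auto simp: inner_add_left)
  qed
  then show ?thesis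
    by (auto simp: is_div_minus_def weak_eq_def Qcyl_def)
qed

lemma div_minus_eqI:
  assumes "U_data T \<Omega> v \<tau> m w"
  shows "div_minus T \<Omega> (v, \<tau>, L2_embed T \<Omega> m) = w"
  unfolding div_minus_def is_div_minus_iff
proof (rule the_equality)
  show "w \<in> L2_on (Qcyl T \<Omega>) \<and> weak_eq {0<..<T} \<Omega> v \<tau> (w + m)" using assms by (simp add: U_data_def)
  fix w' assume w': "w' \<in> L2_on (Qcyl T \<Omega>) \<and> weak_eq {0<..<T} \<Omega> v \<tau> (w' + m)"
  have "w' + m = w + m"
    by (rule weak_eq_unique[OF \<Omega>]) (use w' assms in \<open>auto simp: U_data_def intro: subspace_add[OF subspace_L2_on[OF sets_Qcyl[OF \<Omega>]]]\<close>)
  then show "w' = w" by simp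
qed

text \<open>\<open>Linf_triples\<close> supplies a density for the third component; from here on
  triples are handled through the four L2 classes v, \<tau>, m and w.\<close>

lemma U_data_ex:
  assumes "x \<in> U_space T \<Omega> \<inter> Linf_triples T \<Omega>"
  obtains v \<tau> m w where "x = (v, \<tau>, L2_embed T \<Omega> m)" "U_data T \<Omega> v \<tau> m w"
proof -
  obtain v \<tau> m where x: "x = (v, \<tau>, L2_embed T \<Omega> m)" "m \<in> L2_on (Qcyl T \<Omega>)" "v \<in> V_space T \<Omega>" "\<tau> \<in> L2_on (Qcyl T \<Omega>)"
    and "\<exists>w. is_div_minus T \<Omega> (v, \<tau>, L2_embed T \<Omega> m) w"
    using assms by (auto simp: U_space_def Linf_triples_def)
  then obtain w where "is_div_minus T \<Omega> (v, \<tau>, L2_embed T \<Omega> m) w" by blast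
  with x show ?thesis using that[of v \<tau> m w] by (simp add: is_div_minus_iff U_data_def)
qed

lemma U_data_add: "U_data T \<Omega> v \<tau> m w \<Longrightarrow> U_data T \<Omega> v' \<tau>' m' w' \<Longrightarrow> U_data T \<Omega> (v + v') (\<tau> + \<tau>') (m + m') (w + w')"
  using weak_eq_add[of "{0<..<T}" \<Omega> v \<tau> "w + m" v' \<tau>' "w' + m'"] subspace_add[OF subspace_L2_on[OF sets_Qcyl[OF \<Omega>]]]
    subspace_add[OF subspace_L2_on[OF sets_Qcyl[OF \<Omega>]]]
  by (auto simp: U_data_def V_space_add[OF \<Omega>] algebra_simps)

lemma U_data_scaleR: "U_data T \<Omega> v \<tau> m w \<Longrightarrow> U_data T \<Omega> (r *\<^sub>R v) (r *\<^sub>R \<tau>) (r *\<^sub>R m) (r *\<^sub>R w)"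
  using weak_eq_scaleR[of "{0<..<T}" \<Omega> v \<tau> "w + m" r] subspace_scale[OF subspace_L2_on[OF sets_Qcyl[OF \<Omega>]]]
    subspace_scale[OF subspace_L2_on[OF sets_Qcyl[OF \<Omega>]]]
  by (auto simp: U_data_def V_space_scaleR[OF \<Omega>] scaleR_add_right)

text \<open>The weak equation contained in \<open>U_data\<close> provides a continuous
  representative, so the choice operator in \<open>time_trace\<close> selects an actual one.\<close>

lemma time_trace_rep:
  assumes "U_data T \<Omega> v \<tau> m w"
  shows "continuous_on {0..T} (time_trace T v)" "AE t in lborel. t \<in> {0<..<T} \<longrightarrow> sec v t = time_trace T v t"
proof -
  let ?P = "\<lambda>w. continuous_on {0..T} w \<and> (AE t in lborel. t \<in> {0<..<T} \<longrightarrow> (AE x in lborel. rep_L2 v (t, x) = rep_L2 (w t) x))"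
  have iff: "(AE t in lborel. t \<in> {0<..<T} \<longrightarrow> (AE x in lborel. rep_L2 v (t, x) = rep_L2 (w t) x)) \<longleftrightarrow>
    (AE t in lborel. t \<in> {0<..<T} \<longrightarrow> sec v t = w t)" for w :: "real \<Rightarrow> (real^'n, real) L2"
  proof -
    have "AE t in lborel. (AE x in lborel. rep_L2 v (t, x) = rep_L2 (w t) x) \<longleftrightarrow> sec v t = w t"
      using rep_sec[of v]
    proof eventually_elim
      case (elim t)
      have "(AE x in lborel. rep_L2 v (t, x) = rep_L2 (w t) x) \<longleftrightarrow> (AE x in lborel. rep_L2 (sec v t) x = rep_L2 (w t) x)"
        using elim by (intro AE_cong_simp[OF refl] iffI) (auto elim: eventually_elim2)
      then show ?case by (simp add: L2_eq_iff)
    qed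
    then show ?thesis
      by (intro iffI) (auto elim: eventually_elim2)
  qed
  obtain G where "H10_valued {0<..<T} \<Omega> v G" using assms V_space_iff[OF \<Omega>] by (auto simp: U_data_def)
  then obtain u where "continuous_on {0..T} u" "AE t in lborel. t \<in> {0<..<T} \<longrightarrow> sec v t = u t"
    using continuous_representative[OF _ _ T] assms unfolding U_data_def by blast
  then have "?P u" using iff by blast
  then have "?P (time_trace T v)" unfolding time_trace_def by (rule someI[of ?P])
  then show "continuous_on {0..T} (time_trace T v)" "AE t in lborel. t \<in> {0<..<T} \<longrightarrow> sec v t = time_trace T v t"
    using iff by auto
qed

lemma time_trace_add:
  assumes x: "U_data T \<Omega> v \<tau> m w" and y: "U_data T \<Omega> v' \<tau>' m' w'" and t: "t \<in> {0..T}"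
  shows "time_trace T (v + v') t = time_trace T v t + time_trace T v' t"
proof (rule continuous_on_AE_eq[OF _ _ _ t T])
  note z = U_data_add[OF x y]
  show "continuous_on {0..T} (time_trace T (v + v'))" "continuous_on {0..T} (\<lambda>t. time_trace T v t + time_trace T v' t)"
    by (intro continuous_intros time_trace_rep(1)[OF x] time_trace_rep(1)[OF y] time_trace_rep(1)[OF z])+
  show "AE t in lborel. t \<in> {0<..<T} \<longrightarrow> time_trace T (v + v') t = time_trace T v t + time_trace T v' t"
    using time_trace_rep(2)[OF x] time_trace_rep(2)[OF y] time_trace_rep(2)[OF z] sec_add[of v v']
    by eventually_elim auto
qed

lemma time_trace_scaleR:
  assumes x: "U_data T \<Omega> v \<tau> m w" and t: "t \<in> {0..T}"
  shows "time_trace T (r *\<^sub>R v) t = r *\<^sub>R time_trace T v t"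
proof (rule continuous_on_AE_eq[OF _ _ _ t T])
  note z = U_data_scaleR[OF x, of r]
  show "continuous_on {0..T} (time_trace T (r *\<^sub>R v))" "continuous_on {0..T} (\<lambda>t. r *\<^sub>R time_trace T v t)"
    by (intro continuous_intros time_trace_rep(1)[OF x] time_trace_rep(1)[OF z])+
  show "AE t in lborel. t \<in> {0<..<T} \<longrightarrow> time_trace T (r *\<^sub>R v) t = r *\<^sub>R time_trace T v t"
    using time_trace_rep(2)[OF x] time_trace_rep(2)[OF z] sec_scaleR[of r v]
    by eventually_elim auto
qed

lemma energy_identity_U:
  assumes "U_data T \<Omega> v \<tau> m w"
  shows "(norm (time_trace T v T))\<^sup>2 - (norm (time_trace T v 0))\<^sup>2 = 2 * (\<tau> \<bullet> xgrad T \<Omega> v + (w + m) \<bullet> v)"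
  by (rule energy_identity[OF _ _ T time_trace_rep[OF assms]])
    (use assms V_space_xgrad[OF \<Omega>] in \<open>auto simp: U_data_def\<close>)

text \<open>The admissible constants form a closed set, as each v imposes a closed condition. It is
  bounded below by 0 and contains 2 R, so its infimum is attained and is the least element.\<close>

lemma friedrichs_const:
  assumes "bounded \<Omega>"
  shows "0 \<le> friedrichs_const T \<Omega>"
    "v \<in> V_space T \<Omega> \<Longrightarrow> norm v \<le> friedrichs_const T \<Omega> * norm (xgrad T \<Omega> v)"
proof -
  let ?P = "\<lambda>C. 0 \<le> C \<and> (\<forall>v\<in>V_space T \<Omega>. norm v \<le> C * norm (xgrad T \<Omega> v))"
  obtain R where R: "0 < R" "\<And>x. x \<in> \<Omega> \<Longrightarrow> norm x \<le> R"
    using assms by (auto simp: bounded_pos)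
  have R': "?P (2 * R)"
    using closure_test_graph_Poincare[OF H10_valued_in_closure[OF V_space_xgrad[OF \<Omega>] T] R(2)] R(1) by auto
  have "Collect ?P = {0..} \<inter> (\<Inter>v\<in>V_space T \<Omega>. {C. norm v \<le> C * norm (xgrad T \<Omega> v)})" by auto
  moreover have "closed \<dots>"
    by (intro closed_Int closed_INT ballI closed_Collect_le continuous_intros closed_atLeast)
  ultimately have cl: "closed (Collect ?P)" by simp
  have bdd: "bdd_below (Collect ?P)" by (intro bdd_belowI[of _ 0]) auto
  have Inf: "?P (Inf (Collect ?P))"
    using closed_contains_Inf[OF _ bdd cl] R' by blast
  have "friedrichs_const T \<Omega> = Inf (Collect ?P)"
    unfolding friedrichs_const_def
    by (rule Least_equality[where P = ?P, OF Inf]) (auto intro: cInf_lower bdd)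
  then show "0 \<le> friedrichs_const T \<Omega>"
    "v \<in> V_space T \<Omega> \<Longrightarrow> norm v \<le> friedrichs_const T \<Omega> * norm (xgrad T \<Omega> v)"
    using Inf by auto
qed

text \<open>On a subspace of such triples, \<open>U_norm\<close> is the norm of a linear image.\<close>

lemma U_norm_eq:
  assumes "U_data T \<Omega> v \<tau> m w"
  shows "U_norm T \<Omega> (v, \<tau>, L2_embed T \<Omega> m) = norm (xgrad T \<Omega> v, time_trace T v 0, time_trace T v T, \<tau>, w)"
  by (simp add: U_norm_def div_minus_eqI[OF assms] norm_Pair add.assoc)

lemma U_norm_triangle:
  assumes x: "x \<in> U_space T \<Omega> \<inter> Linf_triples T \<Omega>" and y: "y \<in> U_space T \<Omega> \<inter> Linf_triples T \<Omega>"
  shows "U_norm T \<Omega> (x + y) \<le> U_norm T \<Omega> x + U_norm T \<Omega> y"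
proof -
  obtain v \<tau> m w where X: "x = (v, \<tau>, L2_embed T \<Omega> m)" "U_data T \<Omega> v \<tau> m w" by (rule U_data_ex[OF x])
  obtain v' \<tau>' m' w' where Y: "y = (v', \<tau>', L2_embed T \<Omega> m')" "U_data T \<Omega> v' \<tau>' m' w'" by (rule U_data_ex[OF y])
  have t: "0 \<in> {0..T}" "T \<in> {0..T}" using T by auto
  have v: "v \<in> V_space T \<Omega>" "v' \<in> V_space T \<Omega>" using X Y by (auto simp: U_data_def)
  have "x + y = (v + v', \<tau> + \<tau>', L2_embed T \<Omega> (m + m'))" by (simp add: X Y L2_embed_add)
  then show ?thesis
    using norm_triangle_ineq[of "(xgrad T \<Omega> v, time_trace T v 0, time_trace T v T, \<tau>, w)" "(xgrad T \<Omega> v', time_trace T v' 0, time_trace T v' T, \<tau>', w')"]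
    by (simp add: U_norm_eq[OF U_data_add[OF X(2) Y(2)]] U_norm_eq[OF X(2)] U_norm_eq[OF Y(2)] X(1) Y(1)
        time_trace_add[OF X(2) Y(2) t(1)] time_trace_add[OF X(2) Y(2) t(2)] xgrad_add[OF \<Omega> v])
qed

lemma U_norm_scaleR:
  assumes x: "x \<in> U_space T \<Omega> \<inter> Linf_triples T \<Omega>"
  shows "U_norm T \<Omega> (r *\<^sub>R x) = \<bar>r\<bar> * U_norm T \<Omega> x"
proof -
  obtain v \<tau> m w where X: "x = (v, \<tau>, L2_embed T \<Omega> m)" "U_data T \<Omega> v \<tau> m w" by (rule U_data_ex[OF x])
  have t: "0 \<in> {0..T}" "T \<in> {0..T}" using T by auto
  have v: "v \<in> V_space T \<Omega>" using X by (auto simp: U_data_def)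
  have "r *\<^sub>R x = (r *\<^sub>R v, r *\<^sub>R \<tau>, L2_embed T \<Omega> (r *\<^sub>R m))" by (simp add: X L2_embed_scaleR)
  then show ?thesis
    using norm_scaleR[of r "(xgrad T \<Omega> v, time_trace T v 0, time_trace T v T, \<tau>, w)"]
    by (simp add: U_norm_eq[OF U_data_scaleR[OF X(2)]] U_norm_eq[OF X(2)] X(1) time_trace_scaleR[OF X(2) t(1)] time_trace_scaleR[OF X(2) t(2)] xgrad_scaleR[OF \<Omega> v])
qed

end

subsection \<open>The residuals and the forms\<close>

text \<open>The integrands are controlled on \<open>Q\<close> only. As the indicator is idempotent
  it can be given to both factors, which then represent L2 classes.\<close>

lemma set_integral_inner_L2:
  fixes p r :: "'a::euclidean_space \<Rightarrow> 'b::euclidean_space"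
  assumes p: "(\<lambda>z. indicator Q z *\<^sub>R p z) \<in> borel_measurable borel" "AE z in lborel. indicator Q z *\<^sub>R p z = rep_L2 P z"
    and r: "(\<lambda>z. indicator Q z *\<^sub>R r z) \<in> borel_measurable borel" "AE z in lborel. indicator Q z *\<^sub>R r z = rep_L2 R z"
  shows "(LINT z:Q|lborel. p z \<bullet> r z) = P \<bullet> R"
proof -
  have "(LINT z:Q|lborel. p z \<bullet> r z) = (LINT z|lborel. (indicator Q z *\<^sub>R p z) \<bullet> (indicator Q z *\<^sub>R r z))"
    unfolding set_lebesgue_integral_def by (intro Bochner_Integration.integral_cong refl) (simp add: indicator_def)
  also have "\<dots> = (LINT z|lborel. rep_L2 P z \<bullet> rep_L2 R z)"
  proof (rule integral_cong_AE)
    show "(\<lambda>z. (indicator Q z *\<^sub>R p z) \<bullet> (indicator Q z *\<^sub>R r z)) \<in> borel_measurable lborel"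
      using borel_measurable_inner[OF p(1) r(1)] by simp
    show "AE z in lborel. (indicator Q z *\<^sub>R p z) \<bullet> (indicator Q z *\<^sub>R r z) = rep_L2 P z \<bullet> rep_L2 R z"
      using p(2) r(2) by eventually_elim simp
  qed measurable
  finally show ?thesis by (simp add: inner_L2_rep)
qed

lemma L2_on_rep_indicator:
  assumes "u \<in> L2_on S"
  shows "AE x in lborel. indicator S x *\<^sub>R rep_L2 u x = rep_L2 u x"
  using assms unfolding L2_on_def by (auto simp: indicator_def elim!: eventually_mono)

text \<open>\<open>A\<close> is measurable only after extension by zero off \<open>Q\<close>, so
  \<open>H\<close> is composed with that extension; under the outer indicator the two versions
  agree.\<close>

lemma matrix_multiplier:
  fixes A :: "'a::euclidean_space \<Rightarrow> real^'n^'n" and H :: "real^'n^'n \<Rightarrow> real^'n^'n"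
  assumes A: "(\<lambda>z. indicator Q z *\<^sub>R A z) \<in> borel_measurable borel" and H: "H \<in> borel_measurable borel"
    and Q [measurable]: "Q \<in> sets borel" and C: "AE z in lborel. z \<in> Q \<longrightarrow> (\<forall>y. norm (H (A z) *v y) \<le> C * norm y)"
  shows "multiplier Q (\<lambda>z y. H (A z) *v y) C"
  unfolding multiplier_def
proof (intro conjI allI ballI)
  fix f :: "'a \<Rightarrow> real^'n" assume f: "f \<in> borel_measurable borel"
  have [measurable]: "(\<lambda>z. H (indicator Q z *\<^sub>R A z) *v f z) \<in> borel_measurable borel"
    by (rule borel_measurable_matrix_vector_mult[OF measurable_compose[OF A H] f])
  have "(\<lambda>z. indicator Q z *\<^sub>R (H (A z) *v f z)) = (\<lambda>z. indicator Q z *\<^sub>R (H (indicator Q z *\<^sub>R A z) *v f z))"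
    by (auto simp: indicator_def)
  also have "\<dots> \<in> borel_measurable borel" by measurable
  finally show "(\<lambda>z. indicator Q z *\<^sub>R (H (A z) *v f z)) \<in> borel_measurable borel" .
qed (use C in auto)

text \<open>With the coefficients acting as bounded operators, \<open>residual_L2\<close> and
  \<open>flux_L2\<close> are linear in the data. The pointwise residuals in the forms agree with
  them almost everywhere on the cylinder.\<close>

definition residual_L2 where
  "residual_L2 T \<Omega> b c v w = w + mul_op (Qcyl T \<Omega>) (\<lambda>z y. b z \<bullet> y) (xgrad T \<Omega> v) + mul_op (Qcyl T \<Omega>) (\<lambda>z y :: real. c z * y) v"

definition flux_L2 where
  "flux_L2 T \<Omega> A v \<tau> = mul_op (Qcyl T \<Omega>) (\<lambda>z y. matrix_inv (mat_sqrt (A z)) *v y) \<tau>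
    + mul_op (Qcyl T \<Omega>) (\<lambda>z y. mat_sqrt (A z) *v y) (xgrad T \<Omega> v)"

context
  fixes \<Omega> :: "(real^'n) set" and T \<alpha> \<Lambda> :: real
    and A :: "'n st \<Rightarrow> real^'n^'n" and b :: "'n st \<Rightarrow> real^'n" and c :: "'n st \<Rightarrow> real"
  assumes \<Omega>: "open \<Omega>" "bounded \<Omega>" and T: "0 < T" and \<alpha>: "0 < \<alpha>"
    and A_Linf: "Linf_on (Qcyl T \<Omega>) A"
    and A_sym: "AE z in lborel. z \<in> Qcyl T \<Omega> \<longrightarrow> transpose (A z) = A z"
    and A_coercive: "AE z in lborel. z \<in> Qcyl T \<Omega> \<longrightarrow> (\<forall>y. y \<bullet> (A z *v y) \<ge> \<alpha> * (norm y)\<^sup>2)"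
    and b_Linf: "Linf_on (Qcyl T \<Omega>) b"
    and c_Linf: "Linf_on (Qcyl T \<Omega>) c"
begin

lemma AE_mat_sqrt:
  "AE z in lborel. z \<in> Qcyl T \<Omega> \<longrightarrow> transpose (mat_sqrt (A z)) = mat_sqrt (A z) \<and>
    (\<forall>y. mat_sqrt (A z) *v (matrix_inv (mat_sqrt (A z)) *v y) = y) \<and>
    (\<forall>y. (norm (mat_sqrt (A z) *v y))\<^sup>2 = y \<bullet> (A z *v y)) \<and> (\<forall>y. \<alpha> * (norm y)\<^sup>2 \<le> y \<bullet> (A z *v y))"
  using A_sym A_coercive
proof eventually_elim
  case (elim z)
  then show ?case
    using mat_sqrt_properties(1)[OF _ \<alpha>, of "A z"] mat_sqrt_mult_inverse[OF _ \<alpha>, of "A z"] power2_norm_mat_sqrt[OF _ \<alpha>, of "A z"]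
    by blast
qed

text \<open>The squared norm of A^(1/2) y is y . A y, which a bound K for A makes at most K
  |y|^2.\<close>

lemma mat_sqrt_multiplier:
  obtains C where "0 \<le> C" "multiplier (Qcyl T \<Omega>) (\<lambda>z y. mat_sqrt (A z) *v y) C"
proof -
  obtain K where K: "0 \<le> K" "AE z in lborel. z \<in> Qcyl T \<Omega> \<longrightarrow> norm (A z) \<le> K"
    using Linf_onE[OF A_Linf] by blast
  have m: "(\<lambda>z. indicator (Qcyl T \<Omega>) z *\<^sub>R A z) \<in> borel_measurable borel"
    using A_Linf by (simp add: Linf_on_def set_borel_measurable_def)
  have "AE z in lborel. z \<in> Qcyl T \<Omega> \<longrightarrow> (\<forall>y. norm (mat_sqrt (A z) *v y) \<le> sqrt K * norm y)"
    using AE_mat_sqrt K(2)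
  proof eventually_elim
    case (elim z)
    show ?case
    proof (intro impI allI)
      fix y assume z: "z \<in> Qcyl T \<Omega>"
      have "(norm (mat_sqrt (A z) *v y))\<^sup>2 = y \<bullet> (A z *v y)" using elim z by blast
      also have "\<dots> \<le> norm y * norm (A z *v y)" by (rule norm_cauchy_schwarz)
      also have "\<dots> \<le> norm y * (K * norm y)"
        using elim(2) z by (intro mult_left_mono order_trans[OF norm_matrix_vector_le] mult_right_mono) auto
      also have "\<dots> = (sqrt K * norm y)\<^sup>2"
        using K(1) by (simp add: power_mult_distrib power2_eq_square)
      finally show "norm (mat_sqrt (A z) *v y) \<le> sqrt K * norm y"
        by (rule power2_le_imp_le) (use K(1) in simp)
    qed
  qed
  from matrix_multiplier[OF m borel_measurable_mat_sqrt sets_Qcyl[OF \<Omega>(1)] this]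
  show ?thesis using K(1) that[of "sqrt K"] by simp
qed

text \<open>For x = A^(-1/2) y, coercivity gives \<alpha> |x|^2 \<le> x . A x = |y|^2.\<close>

lemma mat_sqrt_inverse_multiplier:
  obtains C where "0 \<le> C" "multiplier (Qcyl T \<Omega>) (\<lambda>z y. matrix_inv (mat_sqrt (A z)) *v y) C"
proof -
  have m: "(\<lambda>z. indicator (Qcyl T \<Omega>) z *\<^sub>R A z) \<in> borel_measurable borel"
    using A_Linf by (simp add: Linf_on_def set_borel_measurable_def)
  have "AE z in lborel. z \<in> Qcyl T \<Omega> \<longrightarrow> (\<forall>y. norm (matrix_inv (mat_sqrt (A z)) *v y) \<le> 1 / sqrt \<alpha> * norm y)"
    using AE_mat_sqrt
  proof eventually_elim
    case (elim z)
    show ?case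
    proof (intro impI allI)
      fix y assume z: "z \<in> Qcyl T \<Omega>"
      let ?x = "matrix_inv (mat_sqrt (A z)) *v y"
      have B: "mat_sqrt (A z) *v ?x = y" "(norm (mat_sqrt (A z) *v ?x))\<^sup>2 = ?x \<bullet> (A z *v ?x)" "\<alpha> * (norm ?x)\<^sup>2 \<le> ?x \<bullet> (A z *v ?x)"
        using elim z by blast+
      have "(norm ?x)\<^sup>2 \<le> (1 / sqrt \<alpha> * norm y)\<^sup>2"
        using B(2,3) \<alpha> unfolding B(1) by (simp add: power_mult_distrib power_divide field_simps)
      then show "norm ?x \<le> 1 / sqrt \<alpha> * norm y"
        by (rule power2_le_imp_le) (use \<alpha> in simp)
    qed
  qed
  from matrix_multiplier[OF m measurable_compose[OF borel_measurable_mat_sqrt borel_measurable_matrix_inv] sets_Qcyl[OF \<Omega>(1)] this]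
  show ?thesis using \<alpha> that[of "1 / sqrt \<alpha>"] by simp
qed

lemma residual_L2_add:
  assumes "v \<in> V_space T \<Omega>" "v' \<in> V_space T \<Omega>"
  shows "residual_L2 T \<Omega> b c (v + v') (w + w') = residual_L2 T \<Omega> b c v w + residual_L2 T \<Omega> b c v' w'"
proof -
  obtain Cb Cc where "0 \<le> Cb" "multiplier (Qcyl T \<Omega>) (\<lambda>z y. b z \<bullet> y) Cb" "0 \<le> Cc" "multiplier (Qcyl T \<Omega>) (\<lambda>z y. c z * y) Cc"
    using Linf_on_multiplier_inner[OF b_Linf] Linf_on_multiplier_mult[OF c_Linf] by metis
  then show ?thesis by (simp add: residual_L2_def xgrad_add[OF \<Omega>(1) assms] mul_op_add)
qed

lemma residual_L2_scaleR:
  assumes "v \<in> V_space T \<Omega>"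
  shows "residual_L2 T \<Omega> b c (r *\<^sub>R v) (r *\<^sub>R w) = r *\<^sub>R residual_L2 T \<Omega> b c v w"
proof -
  obtain Cb Cc where "0 \<le> Cb" "multiplier (Qcyl T \<Omega>) (\<lambda>z y. b z \<bullet> y) Cb" "0 \<le> Cc" "multiplier (Qcyl T \<Omega>) (\<lambda>z y. c z * y) Cc"
    using Linf_on_multiplier_inner[OF b_Linf] Linf_on_multiplier_mult[OF c_Linf] by metis
  then show ?thesis by (simp add: residual_L2_def xgrad_scaleR[OF \<Omega>(1) assms] mul_op_scaleR scaleR_add_right)
qed

lemma flux_L2_add:
  assumes "v \<in> V_space T \<Omega>" "v' \<in> V_space T \<Omega>"
  shows "flux_L2 T \<Omega> A (v + v') (\<tau> + \<tau>') = flux_L2 T \<Omega> A v \<tau> + flux_L2 T \<Omega> A v' \<tau>'"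
proof -
  obtain C C' where "0 \<le> C" "multiplier (Qcyl T \<Omega>) (\<lambda>z y. mat_sqrt (A z) *v y) C"
    "0 \<le> C'" "multiplier (Qcyl T \<Omega>) (\<lambda>z y. matrix_inv (mat_sqrt (A z)) *v y) C'"
    using mat_sqrt_multiplier mat_sqrt_inverse_multiplier by metis
  then show ?thesis by (simp add: flux_L2_def xgrad_add[OF \<Omega>(1) assms] mul_op_add)
qed

lemma flux_L2_scaleR:
  assumes "v \<in> V_space T \<Omega>"
  shows "flux_L2 T \<Omega> A (r *\<^sub>R v) (r *\<^sub>R \<tau>) = r *\<^sub>R flux_L2 T \<Omega> A v \<tau>"
proof -
  obtain C C' where "0 \<le> C" "multiplier (Qcyl T \<Omega>) (\<lambda>z y. mat_sqrt (A z) *v y) C"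
    "0 \<le> C'" "multiplier (Qcyl T \<Omega>) (\<lambda>z y. matrix_inv (mat_sqrt (A z)) *v y) C'"
    using mat_sqrt_multiplier mat_sqrt_inverse_multiplier by metis
  then show ?thesis by (simp add: flux_L2_def xgrad_scaleR[OF \<Omega>(1) assms] mul_op_scaleR scaleR_add_right)
qed

lemma first_order_residual_rep:
  assumes U: "U_data T \<Omega> v \<tau> m w"
  shows "(\<lambda>z. indicator (Qcyl T \<Omega>) z *\<^sub>R first_order_residual T \<Omega> b c (v, \<tau>, L2_embed T \<Omega> m) z) \<in> borel_measurable borel"
    "AE z in lborel. indicator (Qcyl T \<Omega>) z *\<^sub>R first_order_residual T \<Omega> b c (v, \<tau>, L2_embed T \<Omega> m) z = rep_L2 (residual_L2 T \<Omega> b c v w) z"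
proof -
  let ?Q = "Qcyl T \<Omega>"
  obtain Cb Cc where b: "0 \<le> Cb" "multiplier ?Q (\<lambda>z y. b z \<bullet> y) Cb" and c: "0 \<le> Cc" "multiplier ?Q (\<lambda>z y. c z * y) Cc"
    using Linf_on_multiplier_inner[OF b_Linf] Linf_on_multiplier_mult[OF c_Linf] by metis
  have Q [measurable]: "?Q \<in> sets borel" by (rule sets_Qcyl[OF \<Omega>(1)])
  let ?B = "mul_op ?Q (\<lambda>z y. b z \<bullet> y) (xgrad T \<Omega> v)" and ?C = "mul_op ?Q (\<lambda>z y :: real. c z * y) v"
  have eq: "indicator ?Q z *\<^sub>R first_order_residual T \<Omega> b c (v, \<tau>, L2_embed T \<Omega> m) z =
    indicator ?Q z *\<^sub>R rep_L2 w z + indicator ?Q z *\<^sub>R (b z \<bullet> rep_L2 (xgrad T \<Omega> v) z) + indicator ?Q z *\<^sub>R (c z * rep_L2 v z)" for z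
    by (simp add: first_order_residual_def div_minus_eqI[OF \<Omega>(1) T U] distrib_left)
  have 1: "(\<lambda>z. indicator ?Q z *\<^sub>R (b z \<bullet> rep_L2 (xgrad T \<Omega> v) z)) \<in> borel_measurable borel"
    "(\<lambda>z. indicator ?Q z *\<^sub>R (c z * rep_L2 v z)) \<in> borel_measurable borel"
    using b(2) c(2) measurable_rep_L2 unfolding multiplier_def by blast+
  have 2: "(\<lambda>z. indicator ?Q z *\<^sub>R rep_L2 w z) \<in> borel_measurable borel" by measurable
  show "(\<lambda>z. indicator ?Q z *\<^sub>R first_order_residual T \<Omega> b c (v, \<tau>, L2_embed T \<Omega> m) z) \<in> borel_measurable borel"
    unfolding eq by (intro borel_measurable_add 1 2)
  have "w \<in> L2_on ?Q" using U by (simp add: U_data_def)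
  from L2_on_rep_indicator[OF this]
  show "AE z in lborel. indicator ?Q z *\<^sub>R first_order_residual T \<Omega> b c (v, \<tau>, L2_embed T \<Omega> m) z = rep_L2 (residual_L2 T \<Omega> b c v w) z"
    using rep_mul_op[OF b(2,1), of "xgrad T \<Omega> v"] rep_mul_op[OF c(2,1), of v] rep_L2_add[of w ?B] rep_L2_add[of "w + ?B" ?C]
    unfolding eq residual_L2_def by eventually_elim simp
qed

lemma flux_residual_rep:
  shows "(\<lambda>z. indicator (Qcyl T \<Omega>) z *\<^sub>R flux_residual T \<Omega> A (v, \<tau>, \<mu>) z) \<in> borel_measurable borel"
    "AE z in lborel. indicator (Qcyl T \<Omega>) z *\<^sub>R flux_residual T \<Omega> A (v, \<tau>, \<mu>) z = rep_L2 (flux_L2 T \<Omega> A v \<tau>) z"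
proof -
  let ?Q = "Qcyl T \<Omega>"
  obtain C C' where B: "0 \<le> C" "multiplier ?Q (\<lambda>z y. mat_sqrt (A z) *v y) C"
    and I: "0 \<le> C'" "multiplier ?Q (\<lambda>z y. matrix_inv (mat_sqrt (A z)) *v y) C'"
    using mat_sqrt_multiplier mat_sqrt_inverse_multiplier by metis
  let ?B = "mul_op ?Q (\<lambda>z y. mat_sqrt (A z) *v y) (xgrad T \<Omega> v)" and ?I = "mul_op ?Q (\<lambda>z y. matrix_inv (mat_sqrt (A z)) *v y) \<tau>"
  have eq: "indicator ?Q z *\<^sub>R flux_residual T \<Omega> A (v, \<tau>, \<mu>) z =
    indicator ?Q z *\<^sub>R (matrix_inv (mat_sqrt (A z)) *v rep_L2 \<tau> z) + indicator ?Q z *\<^sub>R (mat_sqrt (A z) *v rep_L2 (xgrad T \<Omega> v) z)" for z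
    by (simp add: flux_residual_def scaleR_add_right)
  have 1: "(\<lambda>z. indicator ?Q z *\<^sub>R (matrix_inv (mat_sqrt (A z)) *v rep_L2 \<tau> z)) \<in> borel_measurable borel"
    "(\<lambda>z. indicator ?Q z *\<^sub>R (mat_sqrt (A z) *v rep_L2 (xgrad T \<Omega> v) z)) \<in> borel_measurable borel"
    using B(2) I(2) measurable_rep_L2 unfolding multiplier_def by blast+
  show "(\<lambda>z. indicator ?Q z *\<^sub>R flux_residual T \<Omega> A (v, \<tau>, \<mu>) z) \<in> borel_measurable borel"
    unfolding eq by (intro borel_measurable_add 1)
  show "AE z in lborel. indicator ?Q z *\<^sub>R flux_residual T \<Omega> A (v, \<tau>, \<mu>) z = rep_L2 (flux_L2 T \<Omega> A v \<tau>) z"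
    using rep_mul_op[OF B(2,1), of "xgrad T \<Omega> v"] rep_mul_op[OF I(2,1), of \<tau>] rep_L2_add[of ?I ?B]
    unfolding eq flux_L2_def by eventually_elim simp
qed

lemma a_form_eq:
  assumes x: "U_data T \<Omega> v \<tau> m w" and y: "U_data T \<Omega> v' \<tau>' m' w'"
  shows "a_form T \<Omega> A b c \<alpha> \<Lambda> (v, \<tau>, L2_embed T \<Omega> m) (v', \<tau>', L2_embed T \<Omega> m') =
    \<Lambda> / \<alpha> * (residual_L2 T \<Omega> b c v w \<bullet> residual_L2 T \<Omega> b c v' w') + flux_L2 T \<Omega> A v \<tau> \<bullet> flux_L2 T \<Omega> A v' \<tau>'
    + time_trace T v 0 \<bullet> time_trace T v' 0 + 1/2 * (m \<bullet> v') + 1/2 * (m' \<bullet> v)"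
  using set_integral_inner_L2[OF first_order_residual_rep[OF x] first_order_residual_rep[OF y]]
    set_integral_inner_L2[OF flux_residual_rep flux_residual_rep, of v \<tau> "L2_embed T \<Omega> m" v' \<tau>' "L2_embed T \<Omega> m'"] x y
  by (simp add: a_form_def L2_embed_def U_data_def)

text \<open>The obstacle is continuous on a compact set and hence bounded, so its term becomes an L2
  product with the density \<open>m\<close>; this exhibits \<open>F\<close> as a sum of L2 products
  with linear data.\<close>

lemma F_form_eq:
  assumes x: "U_data T \<Omega> v \<tau> m w" and f: "f \<in> L2_on (Qcyl T \<Omega>)" and g: "continuous_on (closure (Qcyl T \<Omega>)) g"
  shows "F_form T \<Omega> b c \<alpha> \<Lambda> f u\<^sub>0 g (v, \<tau>, L2_embed T \<Omega> m) =
    \<Lambda> / \<alpha> * (f \<bullet> residual_L2 T \<Omega> b c v w) + u\<^sub>0 \<bullet> time_trace T v 0 + 1/2 * (L2_of (Qcyl T \<Omega>) g \<bullet> m)"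
proof -
  let ?Q = "Qcyl T \<Omega>"
  have Q [measurable]: "?Q \<in> sets borel" by (rule sets_Qcyl[OF \<Omega>(1)])
  have bQ: "bounded ?Q" unfolding Qcyl_def by (intro bounded_Times \<Omega>(2)) simp
  have m: "m \<in> L2_on ?Q" using x by (simp add: U_data_def)
  have rm: "(\<lambda>z. indicator ?Q z *\<^sub>R rep_L2 u z) \<in> borel_measurable borel" for u :: "('n st, real) L2" by measurable
  have "(\<lambda>z. indicator ?Q z *\<^sub>R g z) \<in> borel_measurable borel"
    by (rule borel_measurable_continuous_on_indicator[OF Q continuous_on_subset[OF g closure_subset]])
  moreover have "bounded (g ` closure ?Q)"
    by (intro compact_imp_bounded compact_continuous_image g) (use bQ in simp)
  then obtain K where K: "\<And>z. z \<in> closure ?Q \<Longrightarrow> norm (g z) \<le> K" by (auto simp: bounded_iff)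
  have "square_integrable (indicator ?Q :: 'n st \<Rightarrow> real)"
  proof -
    have "emeasure lborel ?Q < \<infinity>" by (rule emeasure_bounded_finite[OF bQ])
    then have "integrable lborel (indicator ?Q :: 'n st \<Rightarrow> real)" by (simp add: integrable_indicator_iff)
    moreover have "(\<lambda>z. (norm (indicator ?Q z :: real))\<^sup>2) = indicator ?Q" by (auto simp: indicator_def)
    ultimately show ?thesis by (simp add: square_integrable_def)
  qed
  ultimately have sq: "square_integrable (\<lambda>z. indicator ?Q z *\<^sub>R g z)"
    by (rule_tac square_integrable_AE_cong[where C=K]) (use K closure_subset[of ?Q] in \<open>auto simp: indicator_def intro!: AE_I2\<close>)
  have rg: "AE z in lborel. indicator ?Q z *\<^sub>R g z = rep_L2 (L2_of ?Q g) z"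
    using rep_abs_L2[OF sq] sq by (auto simp: L2_of_def elim: eventually_mono)
  have "(LINT z:?Q|lborel. g z * rep_L2 (L2_density T \<Omega> (L2_embed T \<Omega> m)) z) = L2_of ?Q g \<bullet> m"
    using set_integral_inner_L2[OF square_integrable_measurable[OF sq] rg rm L2_on_rep_indicator[OF m]]
    by (simp add: L2_density_embed[OF \<Omega>(1) T m])
  moreover have "(LINT z:?Q|lborel. rep_L2 f z * first_order_residual T \<Omega> b c (v, \<tau>, L2_embed T \<Omega> m) z) = f \<bullet> residual_L2 T \<Omega> b c v w"
    using set_integral_inner_L2[OF rm L2_on_rep_indicator[OF f] first_order_residual_rep[OF x]] by simp
  ultimately show ?thesis by (simp add: F_form_def)
qed

text \<open>By symmetry the two roots cancel. This turns the term \<tau> . grad v of the energy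
  identity into quantities of the flux residual.\<close>

lemma flux_inner_gradient:
  fixes G \<tau> :: "('n st, real^'n) L2"
  assumes "\<tau> \<in> L2_on (Qcyl T \<Omega>)"
  shows "mul_op (Qcyl T \<Omega>) (\<lambda>z y. matrix_inv (mat_sqrt (A z)) *v y) \<tau> \<bullet> mul_op (Qcyl T \<Omega>) (\<lambda>z y. mat_sqrt (A z) *v y) G = \<tau> \<bullet> G"
proof -
  let ?Q = "Qcyl T \<Omega>"
  obtain C C' where B: "0 \<le> C" "multiplier ?Q (\<lambda>z y. mat_sqrt (A z) *v y) C"
    and I: "0 \<le> C'" "multiplier ?Q (\<lambda>z y. matrix_inv (mat_sqrt (A z)) *v y) C'"
    using mat_sqrt_multiplier mat_sqrt_inverse_multiplier by metis
  show ?thesis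
    unfolding inner_L2_rep
  proof (rule integral_cong_AE)
    show "AE z in lborel. rep_L2 (mul_op ?Q (\<lambda>z y. matrix_inv (mat_sqrt (A z)) *v y) \<tau>) z \<bullet> rep_L2 (mul_op ?Q (\<lambda>z y. mat_sqrt (A z) *v y) G) z
      = rep_L2 \<tau> z \<bullet> rep_L2 G z"
      using rep_mul_op[OF B(2,1), of G] rep_mul_op[OF I(2,1), of \<tau>] AE_mat_sqrt assms[unfolded L2_on_def mem_Collect_eq]
    proof eventually_elim
      case (elim z)
      then show ?case
        using symmetric_inner[of "mat_sqrt (A z)" "matrix_inv (mat_sqrt (A z)) *v rep_L2 \<tau> z" "rep_L2 G z"]
        by (cases "z \<in> ?Q") auto
    qed
  qed measurable
qed

lemma norm_sqrt_gradient:
  fixes G :: "('n st, real^'n) L2"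
  assumes G: "G \<in> L2_on (Qcyl T \<Omega>)"
  shows "\<alpha> * (norm G)\<^sup>2 \<le> (norm (mul_op (Qcyl T \<Omega>) (\<lambda>z y. mat_sqrt (A z) *v y) G))\<^sup>2"
proof -
  let ?Q = "Qcyl T \<Omega>"
  obtain C where B: "0 \<le> C" "multiplier ?Q (\<lambda>z y. mat_sqrt (A z) *v y) C"
    using mat_sqrt_multiplier by metis
  have i: "integrable lborel (\<lambda>z. (norm (rep_L2 u z))\<^sup>2)" for u :: "('n st, real^'n) L2"
    using square_integrable_rep[of u] by (simp add: square_integrable_def)
  have "(LINT z|lborel. \<alpha> * (norm (rep_L2 G z))\<^sup>2) \<le> (LINT z|lborel. (norm (rep_L2 (mul_op ?Q (\<lambda>z y. mat_sqrt (A z) *v y) G) z))\<^sup>2)"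
  proof (rule integral_mono_AE)
    show "AE z in lborel. \<alpha> * (norm (rep_L2 G z))\<^sup>2 \<le> (norm (rep_L2 (mul_op ?Q (\<lambda>z y. mat_sqrt (A z) *v y) G) z))\<^sup>2"
      using rep_mul_op[OF B(2,1), of G] AE_mat_sqrt G[unfolded L2_on_def mem_Collect_eq]
      by eventually_elim (auto simp: indicator_def)
  qed (use i in auto)
  then show ?thesis by (simp add: power2_norm_L2)
qed

text \<open>Integrating \<open>\<langle>\<lambda>, u\<rangle>\<close> by parts in time turns it into boundary terms and \<open>- (\<sigma>, \<nabla>u) - (div(u, \<sigma>) - \<lambda>, u)\<close>;
  the drift contributes \<open>(q u, u) \<ge> 0\<close>, and the residual is absorbed by the Friedrichs inequality.\<close>

lemma a_form_coercive:
  assumes x: "U_data T \<Omega> v \<tau> m w" and q_Linf: "Linf_on (Qcyl T \<Omega>) q" and q_eq: "is_half_div_plus T \<Omega> b c q"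
    and q_nonneg: "AE z in lborel. z \<in> Qcyl T \<Omega> \<longrightarrow> q z \<ge> 0" and \<Lambda>: "(friedrichs_const T \<Omega>)\<^sup>2 \<le> \<Lambda>"
  defines "\<rho> \<equiv> residual_L2 T \<Omega> b c v w" and "P \<equiv> flux_L2 T \<Omega> A v \<tau>"
    and "N \<equiv> mul_op (Qcyl T \<Omega>) (\<lambda>z y. mat_sqrt (A z) *v y) (xgrad T \<Omega> v)"
  shows "\<Lambda> / (2 * \<alpha>) * (norm \<rho>)\<^sup>2 + \<alpha> / 4 * (norm (xgrad T \<Omega> v))\<^sup>2 + (norm (P - (1/2) *\<^sub>R N))\<^sup>2
    \<le> a_form T \<Omega> A b c \<alpha> \<Lambda> (v, \<tau>, L2_embed T \<Omega> m) (v, \<tau>, L2_embed T \<Omega> m)"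
proof -
  let ?Q = "Qcyl T \<Omega>" and ?G = "xgrad T \<Omega> v" and ?cF = "friedrichs_const T \<Omega>"
  have v: "v \<in> V_space T \<Omega>" and \<tau>: "\<tau> \<in> L2_on ?Q" using x by (auto simp: U_data_def)
  obtain Cb Cc Cq where b: "0 \<le> Cb" "multiplier ?Q (\<lambda>z y. b z \<bullet> y) Cb" and c: "0 \<le> Cc" "multiplier ?Q (\<lambda>z y. c z * y) Cc"
    and q: "0 \<le> Cq" "multiplier ?Q (\<lambda>z y. q z * y) Cq"
    using Linf_on_multiplier_inner[OF b_Linf] Linf_on_multiplier_mult[OF c_Linf] Linf_on_multiplier_mult[OF q_Linf] by metis
  have cl: "(v, ?G) \<in> closure (test_graph ?Q)"
    using H10_valued_in_closure[OF V_space_xgrad[OF \<Omega>(1) v] T] by (simp add: Qcyl_def)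
  have qv: "0 \<le> mul_op ?Q (\<lambda>z y. q z * y) v \<bullet> v"
    unfolding inner_mul_op[OF q(2,1)]
    by (rule integral_nonneg_AE) (use q_nonneg in \<open>eventually_elim, auto simp: indicator_def mult.assoc\<close>)
  have wv: "w \<bullet> v = \<rho> \<bullet> v - mul_op ?Q (\<lambda>z y. q z * y) v \<bullet> v"
    unfolding half_div_plus_identity[OF b c q q_eq cl] by (simp add: \<rho>_def residual_L2_def inner_add_left)
  have PN: "P \<bullet> N = \<tau> \<bullet> ?G + (norm N)\<^sup>2"
    unfolding P_def flux_L2_def N_def by (simp add: inner_add_left flux_inner_gradient[OF \<tau>] power2_norm_eq_inner)
  have NG: "\<alpha> * (norm ?G)\<^sup>2 \<le> (norm N)\<^sup>2"
    unfolding N_def by (rule norm_sqrt_gradient[OF V_space_L2_on(2)[OF \<Omega>(1) v]])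
  have energy: "(norm (time_trace T v T))\<^sup>2 - (norm (time_trace T v 0))\<^sup>2 = 2 * (\<tau> \<bullet> ?G + (w \<bullet> v + m \<bullet> v))"
    using energy_identity_U[OF \<Omega>(1) T x] by (simp add: inner_add_left)
  have sq: "(norm (P - (1/2) *\<^sub>R N))\<^sup>2 = (norm P)\<^sup>2 - P \<bullet> N + (norm N)\<^sup>2 / 4"
    by (simp add: power2_norm_eq_inner inner_diff_left inner_diff_right inner_commute)
  have "\<rho> \<bullet> v \<le> norm \<rho> * norm v" by (rule norm_cauchy_schwarz)
  also have "\<dots> \<le> norm \<rho> * (?cF * norm ?G)"
    by (intro mult_left_mono friedrichs_const(2)[OF \<Omega>(1) T \<Omega>(2) v]) simp
  also have "\<dots> \<le> ?cF\<^sup>2 / (2 * \<alpha>) * (norm \<rho>)\<^sup>2 + \<alpha> / 2 * (norm ?G)\<^sup>2"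
  proof -
    \<comment> \<open>Young's inequality weighted so that half of the residual term of the form and
      \<alpha>/2 of the gradient term are consumed.\<close>
    have "0 \<le> (?cF * norm \<rho> - \<alpha> * norm ?G)\<^sup>2 / (2 * \<alpha>)" using \<alpha> by simp
    also have "\<dots> = ?cF\<^sup>2 / (2 * \<alpha>) * (norm \<rho>)\<^sup>2 + \<alpha> / 2 * (norm ?G)\<^sup>2 - norm \<rho> * (?cF * norm ?G)"
      using \<alpha> by (simp add: power2_diff power_mult_distrib power2_eq_square field_simps)
    finally show ?thesis by simp
  qed
  also have "\<dots> \<le> \<Lambda> / (2 * \<alpha>) * (norm \<rho>)\<^sup>2 + \<alpha> / 2 * (norm ?G)\<^sup>2"
    using \<Lambda> \<alpha> by (intro add_right_mono mult_right_mono divide_right_mono) auto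
  finally have \<rho>v: "\<rho> \<bullet> v \<le> \<Lambda> / (2 * \<alpha>) * (norm \<rho>)\<^sup>2 + \<alpha> / 2 * (norm ?G)\<^sup>2" .
  have "a_form T \<Omega> A b c \<alpha> \<Lambda> (v, \<tau>, L2_embed T \<Omega> m) (v, \<tau>, L2_embed T \<Omega> m) =
    2 * (\<Lambda> / (2 * \<alpha>) * (norm \<rho>)\<^sup>2) + (norm P)\<^sup>2 + (norm (time_trace T v 0))\<^sup>2 + m \<bullet> v"
    unfolding a_form_eq[OF x x] \<rho>_def P_def by (simp add: power2_norm_eq_inner)
  \<comment> \<open>Substituting the energy identity for m . v leaves half of both squared traces,
    the nonnegative q-term, the completed square and (3/4)|N|^2, which is at least (3/4) \<alpha>
    |grad v|^2. Subtracting the \<alpha>/2 of Young's inequality leaves \<alpha>/4.\<close>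
  then show ?thesis
    using energy wv qv PN NG sq \<rho>v zero_le_power2[of "norm (time_trace T v T)"] zero_le_power2[of "norm (time_trace T v 0)"]
    by argo
qed

text \<open>If the form vanished, coercivity would give grad v = 0, so v = 0 by Friedrichs. The flux
  residual then reduces to A^(-1/2) \<tau>, so \<tau> = 0; the first-order residual reduces to w,
  and the weak equation with v, \<tau> and w all zero forces m = 0.\<close>

lemma a_form_positive:
  assumes x: "U_data T \<Omega> v \<tau> m w" and q_Linf: "Linf_on (Qcyl T \<Omega>) q" and q_eq: "is_half_div_plus T \<Omega> b c q"
    and q_nonneg: "AE z in lborel. z \<in> Qcyl T \<Omega> \<longrightarrow> q z \<ge> 0" and \<Lambda>: "(friedrichs_const T \<Omega>)\<^sup>2 \<le> \<Lambda>"
    and ne: "(v, \<tau>, L2_embed T \<Omega> m) \<noteq> 0"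
  shows "0 < a_form T \<Omega> A b c \<alpha> \<Lambda> (v, \<tau>, L2_embed T \<Omega> m) (v, \<tau>, L2_embed T \<Omega> m)"
proof (rule ccontr)
  let ?Q = "Qcyl T \<Omega>" and ?G = "xgrad T \<Omega> v" and ?\<rho> = "residual_L2 T \<Omega> b c v w"
  let ?N = "mul_op ?Q (\<lambda>z y. mat_sqrt (A z) *v y) ?G" and ?I = "mul_op ?Q (\<lambda>z y. matrix_inv (mat_sqrt (A z)) *v y) \<tau>"
  assume neg: "\<not> 0 < a_form T \<Omega> A b c \<alpha> \<Lambda> (v, \<tau>, L2_embed T \<Omega> m) (v, \<tau>, L2_embed T \<Omega> m)"
  have v: "v \<in> V_space T \<Omega>" and \<tau>: "\<tau> \<in> L2_on ?Q" and m: "m \<in> L2_on ?Q" and w: "w \<in> L2_on ?Q" using x by (auto simp: U_data_def)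
  have \<Lambda>0: "0 \<le> \<Lambda>" using \<Lambda> zero_le_power2[of "friedrichs_const T \<Omega>"] by linarith
  obtain Cb Cc where b: "0 \<le> Cb" "multiplier ?Q (\<lambda>z y. b z \<bullet> y) Cb" and c: "0 \<le> Cc" "multiplier ?Q (\<lambda>z y. c z * y) Cc"
    using Linf_on_multiplier_inner[OF b_Linf] Linf_on_multiplier_mult[OF c_Linf] by metis
  obtain C C' where B: "0 \<le> C" "multiplier ?Q (\<lambda>z y. mat_sqrt (A z) *v y) C"
    and I: "0 \<le> C'" "multiplier ?Q (\<lambda>z y. matrix_inv (mat_sqrt (A z)) *v y) C'"
    using mat_sqrt_multiplier mat_sqrt_inverse_multiplier by metis
  have "0 \<le> \<Lambda> / (2 * \<alpha>) * (norm ?\<rho>)\<^sup>2" "0 \<le> \<alpha> / 4 * (norm ?G)\<^sup>2" "0 \<le> (norm (flux_L2 T \<Omega> A v \<tau> - (1/2) *\<^sub>R ?N))\<^sup>2"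
    using \<Lambda>0 \<alpha> by auto
  then have "\<Lambda> / (2 * \<alpha>) * (norm ?\<rho>)\<^sup>2 = 0" "\<alpha> / 4 * (norm ?G)\<^sup>2 = 0" "(norm (flux_L2 T \<Omega> A v \<tau> - (1/2) *\<^sub>R ?N))\<^sup>2 = 0"
    using a_form_coercive[OF x q_Linf q_eq q_nonneg \<Lambda>] neg by linarith+
  then have \<rho>: "\<Lambda> = 0 \<or> ?\<rho> = 0" and G: "?G = 0" and P: "flux_L2 T \<Omega> A v \<tau> = (1/2) *\<^sub>R ?N" using \<alpha> by auto
  have v0: "v = 0" using friedrichs_const(2)[OF \<Omega>(1) T \<Omega>(2) v] G by simp
  have mul0: "mul_op S F 0 = 0" if "0 \<le> K" "multiplier S F K" for S F K
    using mul_op_scaleR[OF that(2,1), of 0 0] by simp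
  have "?I = 0" using P by (simp add: flux_L2_def G mul0[OF B])
  have "\<tau> = 0"
  proof (rule L2_eqI)
    show "AE z in lborel. rep_L2 \<tau> z = rep_L2 0 z"
      using rep_mul_op[OF I(2,1), of \<tau>] AE_mat_sqrt \<tau>[unfolded L2_on_def mem_Collect_eq] rep_L2_zero[where ?'a="'n st" and ?'b="real^'n"]
      unfolding \<open>?I = 0\<close>
    proof eventually_elim
      case (elim z)
      show ?case
      proof (cases "z \<in> ?Q")
        case True
        then have "matrix_inv (mat_sqrt (A z)) *v rep_L2 \<tau> z = 0" using elim(1,4) by simp
        then have "rep_L2 \<tau> z = mat_sqrt (A z) *v 0" using elim(2) True by metis
        then show ?thesis using elim(4) by simp
      qed (use elim in simp)
    qed
  qed
  moreover have "L2_embed T \<Omega> m = 0"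
  \<comment> \<open>For \<Lambda> = 0 the form does not see the residual. But then the Friedrichs
    constant is zero, V contains only 0, and every functional on it vanishes.\<close>
  proof (cases "\<Lambda> = 0")
    case True
    then have "friedrichs_const T \<Omega> = 0" using \<Lambda> by simp
    then have "m \<bullet> u = 0" if "u \<in> V_space T \<Omega>" for u using friedrichs_const(2)[OF \<Omega>(1) T \<Omega>(2) that] by simp
    then show ?thesis by (simp add: L2_embed_def fun_eq_iff)
  next
    case False
    have "?\<rho> = w" unfolding residual_L2_def G by (simp add: v0 mul0[OF b] mul0[OF c])
    then have "w = 0" using False \<rho> by simp
    then have "weak_eq {0<..<T} \<Omega> 0 0 m" using x by (simp add: U_data_def v0 \<open>\<tau> = 0\<close>)
    moreover have "weak_eq {0<..<T} \<Omega> 0 0 0" by (simp add: weak_eq_def)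
    ultimately have "m = 0"
      using weak_eq_unique[OF \<Omega>(1) m] subspace_0[OF subspace_L2_on[OF sets_Qcyl[OF \<Omega>(1)]]] by blast
    then show ?thesis by (simp add: L2_embed_def fun_eq_iff)
  qed
  ultimately show False using ne v0 by (simp add: zero_prod_def)
qed

end

theorem theorem6:
  fixes \<Omega> :: "(real^'n) set"
    and T \<alpha> \<Lambda> :: real
    and A :: "'n st \<Rightarrow> real^'n^'n"
    and b :: "'n st \<Rightarrow> real^'n"
    and c q g :: "'n st \<Rightarrow> real"
    and f :: "('n st, real) L2"
    and u\<^sub>0 :: "(real^'n, real) L2"
    and UP KP :: "'n triple set"
  assumes dim: "CARD('n) \<in> {1, 2, 3}"
    and domain: "bounded_lipschitz_domain \<Omega>"
    and T: "T > 0"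
    and A_Linf: "Linf_on (Qcyl T \<Omega>) A"
    and A_sym: "AE z in lborel. z \<in> Qcyl T \<Omega> \<longrightarrow> transpose (A z) = A z"
    and \<alpha>: "\<alpha> > 0"
    and A_coercive:
      "AE z in lborel. z \<in> Qcyl T \<Omega> \<longrightarrow> (\<forall>y. y \<bullet> (A z *v y) \<ge> \<alpha> * (norm y)\<^sup>2)"
    and b_Linf: "Linf_on (Qcyl T \<Omega>) b"
    and c_Linf: "Linf_on (Qcyl T \<Omega>) c"
    and q_Linf: "Linf_on (Qcyl T \<Omega>) q"
    and q_eq: "is_half_div_plus T \<Omega> b c q"
    and q_nonneg: "AE z in lborel. z \<in> Qcyl T \<Omega> \<longrightarrow> q z \<ge> 0"
    and \<Lambda>: "\<Lambda> \<ge> (friedrichs_const T \<Omega>)\<^sup>2"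
    and UP_subspace: "subspace UP"
    and UP_finite_dim: "\<exists>B. finite B \<and> span B = UP"
    and UP_subset: "UP \<subseteq> U_space T \<Omega> \<inter> Linf_triples T \<Omega>"
    and KP_subset: "KP \<subseteq> UP"
    and KP_nonempty: "KP \<noteq> {}"
    and KP_closed: "U_closed T \<Omega> KP"
    and KP_convex: "convex KP"
    and f: "f \<in> L2_on (Qcyl T \<Omega>)"
    and u\<^sub>0: "u\<^sub>0 \<in> L2_on \<Omega>"
    and g_cont: "continuous_on (closure (Qcyl T \<Omega>)) g"
    and g_W: "L2_of (Qcyl T \<Omega>) g \<in> W_tilde T \<Omega>"
    and g_boundary: "\<forall>t\<in>{0<..<T}. \<forall>x\<in>frontier \<Omega>. g (t, x) \<le> 0"
    and g_initial: "AE x in lborel. x \<in> \<Omega> \<longrightarrow> g (0, x) \<le> rep_L2 u\<^sub>0 x"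
    and g_decomp: "\<exists>\<psi>p\<in>V_dual T \<Omega>. \<exists>\<psi>m\<in>V_dual T \<Omega>.
      V_dual_nonneg T \<Omega> \<psi>p \<and> V_dual_nonneg T \<Omega> \<psi>m \<and>
      obstacle_residual T \<Omega> A b c f (L2_of (Qcyl T \<Omega>) g) = \<psi>p - \<psi>m"
  shows "\<exists>!u. u \<in> KP \<and>
    (\<forall>v\<in>KP. a_form T \<Omega> A b c \<alpha> \<Lambda> u (v - u) \<ge> F_form T \<Omega> b c \<alpha> \<Lambda> f u\<^sub>0 g (v - u))"
proof -
  let ?P = "U_space T \<Omega> \<inter> Linf_triples T \<Omega>" and ?a = "a_form T \<Omega> A b c \<alpha> \<Lambda>" and ?F = "F_form T \<Omega> b c \<alpha> \<Lambda> f u\<^sub>0 g"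
  have \<Omega>: "open \<Omega>" "bounded \<Omega>" using domain by (auto simp: bounded_lipschitz_domain_def)
  note coeffs = \<Omega> T \<alpha> A_Linf A_sym A_coercive b_Linf c_Linf
  note a_eq = a_form_eq[OF coeffs, where \<Lambda> = \<Lambda>]
  note F_eq = F_form_eq[OF coeffs _ f g_cont, where \<Lambda> = \<Lambda> and u\<^sub>0 = u\<^sub>0]
  have t0: "0 \<in> {0..T}" using T by simp
  \<comment> \<open>Linearity is proved on all bounded triples in U, where the data are available,
    and is then inherited by \<open>UP\<close>.\<close>
  have form_add: "?a (x + y) z = ?a x z + ?a y z" "?F (x + y) = ?F x + ?F y" if xyz: "x \<in> ?P" "y \<in> ?P" "z \<in> ?P" for x y z
  proof -
    obtain v \<tau> m w where X: "x = (v, \<tau>, L2_embed T \<Omega> m)" "U_data T \<Omega> v \<tau> m w" by (rule U_data_ex[OF \<Omega>(1) T xyz(1)])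
    obtain v' \<tau>' m' w' where Y: "y = (v', \<tau>', L2_embed T \<Omega> m')" "U_data T \<Omega> v' \<tau>' m' w'" by (rule U_data_ex[OF \<Omega>(1) T xyz(2)])
    obtain v'' \<tau>'' m'' w'' where Z: "z = (v'', \<tau>'', L2_embed T \<Omega> m'')" "U_data T \<Omega> v'' \<tau>'' m'' w''" by (rule U_data_ex[OF \<Omega>(1) T xyz(3)])
    have v: "v \<in> V_space T \<Omega>" "v' \<in> V_space T \<Omega>" using X Y by (auto simp: U_data_def)
    have XY: "x + y = (v + v', \<tau> + \<tau>', L2_embed T \<Omega> (m + m'))" by (simp add: X Y L2_embed_add[OF \<Omega>(1) T])
    note lin = residual_L2_add[OF coeffs v] flux_L2_add[OF coeffs v] time_trace_add[OF \<Omega>(1) T X(2) Y(2) t0]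
    show "?a (x + y) z = ?a x z + ?a y z"
      unfolding XY unfolding X Y Z a_eq[OF X(2) Z(2)] a_eq[OF Y(2) Z(2)] a_eq[OF U_data_add[OF \<Omega>(1) T X(2) Y(2)] Z(2)] lin
      by (simp add: inner_add_left inner_add_right algebra_simps)
    show "?F (x + y) = ?F x + ?F y"
      unfolding XY unfolding X Y F_eq[OF X(2)] F_eq[OF Y(2)] F_eq[OF U_data_add[OF \<Omega>(1) T X(2) Y(2)]] lin
      by (simp add: inner_add_left inner_add_right algebra_simps)
  qed
  have form_scale: "?a (r *\<^sub>R x) z = r * ?a x z" "?F (r *\<^sub>R x) = r * ?F x" if xz: "x \<in> ?P" "z \<in> ?P" for x z r
  proof -
    obtain v \<tau> m w where X: "x = (v, \<tau>, L2_embed T \<Omega> m)" "U_data T \<Omega> v \<tau> m w" by (rule U_data_ex[OF \<Omega>(1) T xz(1)])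
    obtain v'' \<tau>'' m'' w'' where Z: "z = (v'', \<tau>'', L2_embed T \<Omega> m'')" "U_data T \<Omega> v'' \<tau>'' m'' w''" by (rule U_data_ex[OF \<Omega>(1) T xz(2)])
    have v: "v \<in> V_space T \<Omega>" using X by (auto simp: U_data_def)
    have RX: "r *\<^sub>R x = (r *\<^sub>R v, r *\<^sub>R \<tau>, L2_embed T \<Omega> (r *\<^sub>R m))" by (simp add: X L2_embed_scaleR[OF \<Omega>(1) T])
    note lin = residual_L2_scaleR[OF coeffs v] flux_L2_scaleR[OF coeffs v] time_trace_scaleR[OF \<Omega>(1) T X(2) t0]
    show "?a (r *\<^sub>R x) z = r * ?a x z"
      unfolding RX unfolding X Z a_eq[OF X(2) Z(2)] a_eq[OF U_data_scaleR[OF \<Omega>(1) T X(2)] Z(2)] lin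
      by (simp add: algebra_simps)
    show "?F (r *\<^sub>R x) = r * ?F x"
      unfolding RX unfolding X F_eq[OF X(2)] F_eq[OF U_data_scaleR[OF \<Omega>(1) T X(2)]] lin
      by (simp add: algebra_simps)
  qed
  interpret finite_dim_form UP ?a
  proof
    fix x y z r assume x: "x \<in> UP"
    show "?a (x + y) z = ?a x z + ?a y z" if "y \<in> UP" "z \<in> UP" using form_add(1) x that UP_subset by blast
    show "?a (r *\<^sub>R x) z = r * ?a x z" if "z \<in> UP" using form_scale(1) x that UP_subset by blast
    obtain v \<tau> m w where X: "x = (v, \<tau>, L2_embed T \<Omega> m)" "U_data T \<Omega> v \<tau> m w"
      using U_data_ex[OF \<Omega>(1) T] x UP_subset by blast
    show "0 < ?a x x" if "x \<noteq> 0"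
      using a_form_positive[OF coeffs X(2) q_Linf q_eq q_nonneg \<Lambda>] that by (simp add: X(1))
    show "?a x y = ?a y x" if y: "y \<in> UP"
    proof -
      obtain v' \<tau>' m' w' where Y: "y = (v', \<tau>', L2_embed T \<Omega> m')" "U_data T \<Omega> v' \<tau>' m' w'"
        using U_data_ex[OF \<Omega>(1) T] y UP_subset by blast
      show ?thesis unfolding X Y a_eq[OF X(2) Y(2)] a_eq[OF Y(2) X(2)] by (simp add: inner_commute)
    qed
  qed (use UP_subspace UP_finite_dim in auto)
  show ?thesis
  \<comment> \<open>The seminorm \<open>N\<close> is instantiated by the norm of U, so that
    closedness of \<open>KP\<close> enters exactly in the norm in which it is assumed.\<close>
  proof (rule variational_inequality[OF KP_subset KP_nonempty KP_convex, where N = "U_norm T \<Omega>"])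
    show "0 \<le> U_norm T \<Omega> x" for x by (cases x) (simp add: U_norm_def)
    show "U_norm T \<Omega> (x + y) \<le> U_norm T \<Omega> x + U_norm T \<Omega> y" if "x \<in> UP" "y \<in> UP" for x y
      using U_norm_triangle[OF \<Omega>(1) T] that UP_subset by blast
    show "U_norm T \<Omega> (r *\<^sub>R x) = \<bar>r\<bar> * U_norm T \<Omega> x" if "x \<in> UP" for x r
      using U_norm_scaleR[OF \<Omega>(1) T] that UP_subset by blast
    show "u \<in> KP" if "\<And>n. s n \<in> KP" "u \<in> UP" "(\<lambda>n. U_norm T \<Omega> (s n - u)) \<longlonglongrightarrow> 0" for s u
      using KP_closed that UP_subset unfolding U_closed_def by blast
    show "?F (x + y) = ?F x + ?F y" if "x \<in> UP" "y \<in> UP" for x y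
      using form_add(2) that UP_subset by blast
    show "?F (r *\<^sub>R x) = r * ?F x" if "x \<in> UP" for x r
      using form_scale(2) that UP_subset by blast
  qed
qed

end
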